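(* There exist two 1-parameter families of minimal pentagons of type SS and CS, respectively.
   Context: A minimal pentagon is a simply connected minimal surface patch in $\mathbb{R}^3$ whose boundary consists of five arcs, called edges, which meet at five points, called vertices. Let $\Pi$ be a minimal pentagon in a box $[0,1]\times[0,1]\times[0,h]$ (with $h>0$) where two edges are diagonals of the top and bottom faces of the box, respectively, and the remaining three edges lie in the vertical faces of the box. Moreover, all vertices of the pentagon lie on box edges or are box vertices. It is further assumed that, along the pentagon edges that lie in the vertical faces of the box, the normal vector of the surface also lies in the plane of these faces, making these planes symmetry planes. A minimal pentagon $\Pi$ satisfying these conditions is said to be of type SS if the two horizontal segments (the diagonals of the top and bottom faces) are parallel, and of type CS if they are orthogonal. *)

theory Defs
  imports "HOL-Analysis.Analysis"
begin

text \<open>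
  Parametrized surfaces are maps \<open>X :: complex \<Rightarrow> real^3\<close>; the parameter is
  \<open>u + \<i> v\<close>, so the directions \<open>1\<close> and \<open>\<i>\<close> give the two partial derivatives.
\<close>

definition partial_deriv :: "complex \<Rightarrow> (complex \<Rightarrow> real^3) \<Rightarrow> complex \<Rightarrow> real^3" where
  "partial_deriv d X z = frechet_derivative X (at z) d"

definition C1_surface_on :: "complex set \<Rightarrow> (complex \<Rightarrow> real^3) \<Rightarrow> bool" where
  "C1_surface_on U X \<longleftrightarrow>
     (\<forall>z\<in>U. X differentiable (at z)) \<and>
     continuous_on U (partial_deriv 1 X) \<and> continuous_on U (partial_deriv \<i> X)"

definition C2_surface_on :: "complex set \<Rightarrow> (complex \<Rightarrow> real^3) \<Rightarrow> bool" where
  "C2_surface_on U X \<longleftrightarrow>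
     C1_surface_on U X \<and> C1_surface_on U (partial_deriv 1 X) \<and> C1_surface_on U (partial_deriv \<i> X)"

definition regular_at :: "(complex \<Rightarrow> real^3) \<Rightarrow> complex \<Rightarrow> bool" where
  "regular_at X z \<longleftrightarrow> cross3 (partial_deriv 1 X z) (partial_deriv \<i> X z) \<noteq> 0"

definition unit_normal :: "(complex \<Rightarrow> real^3) \<Rightarrow> complex \<Rightarrow> real^3" where
  "unit_normal X z = sgn (cross3 (partial_deriv 1 X z) (partial_deriv \<i> X z))"

text \<open>Half the trace of the shape operator, in terms of the coefficients of the first
  (\<open>E, F, G\<close>) and second (\<open>L, M, N\<close>) fundamental forms.\<close>

definition mean_curvature :: "(complex \<Rightarrow> real^3) \<Rightarrow> complex \<Rightarrow> real" where
  "mean_curvature X z =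
     (let Xu = partial_deriv 1 X z; Xv = partial_deriv \<i> X z; n = unit_normal X z;
          E = Xu \<bullet> Xu; F = Xu \<bullet> Xv; G = Xv \<bullet> Xv;
          L = partial_deriv 1 (partial_deriv 1 X) z \<bullet> n;
          M = partial_deriv \<i> (partial_deriv 1 X) z \<bullet> n;
          N = partial_deriv \<i> (partial_deriv \<i> X) z \<bullet> n
      in (E * N - 2 * F * M + G * L) / (2 * (E * G - F\<^sup>2)))"

text \<open>
  The parameter domain is the closed unit disk with five points \<open>cis (\<theta> k)\<close>, \<open>k < 5\<close>, marked
  on its boundary in cyclic order; \<open>\<theta> 5\<close> is \<open>\<theta> 0\<close> after one full turn.  Edge \<open>k\<close> runs from
  \<open>cis (\<theta> k)\<close> to \<open>cis (\<theta> (Suc k))\<close>.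
\<close>

definition five_marks :: "(nat \<Rightarrow> real) \<Rightarrow> bool" where
  "five_marks \<theta> \<longleftrightarrow> (\<forall>k<5. \<theta> k < \<theta> (Suc k)) \<and> \<theta> 5 = \<theta> 0 + 2 * pi"

definition marks :: "(nat \<Rightarrow> real) \<Rightarrow> complex set" where
  "marks \<theta> = (\<lambda>k. cis (\<theta> k)) ` {..<5}"

definition edge_arc :: "(nat \<Rightarrow> real) \<Rightarrow> nat \<Rightarrow> complex set" where
  "edge_arc \<theta> k = cis ` {\<theta> k..\<theta> (Suc k)}"

text \<open>
  A minimal pentagon is an immersed disk of vanishing mean curvature, regular up to and
  including the open boundary edges (hence the neighbourhood \<open>U\<close>, on which \<open>X\<close> is a \<open>C\<^sup>2\<close>
  extension) and continuous at the vertices.  Regularity cannot be asked at a vertex, where the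
  boundary of the surface has a corner while the boundary of the disk has none.  Only the values
  of \<open>X\<close> on the closed disk belong to the surface.  Injectivity on the circle says that the edges
  are arcs which meet only at the vertices.
\<close>

definition minimal_pentagon :: "(complex \<Rightarrow> real^3) \<Rightarrow> (nat \<Rightarrow> real) \<Rightarrow> bool" where
  "minimal_pentagon X \<theta> \<longleftrightarrow>
     five_marks \<theta> \<and>
     continuous_on (cball 0 1) X \<and>
     inj_on X (sphere 0 1) \<and>
     (\<exists>U. open U \<and> cball 0 1 - marks \<theta> \<subseteq> U \<and> C2_surface_on U X) \<and>
     (\<forall>z \<in> cball 0 1 - marks \<theta>. regular_at X z \<and> mean_curvature X z = 0)"

definition box_corner :: "real \<Rightarrow> real^3" where
  "box_corner h = vector [1, 1, h]"

definition unit_base_box :: "real \<Rightarrow> (real^3) set" where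
  "unit_base_box h = cbox 0 (box_corner h)"

text \<open>The union of the twelve closed edges, box vertices included: at least two coordinates
  are extremal.\<close>

definition box_edge_points :: "real \<Rightarrow> (real^3) set" where
  "box_edge_points h =
     {p \<in> unit_base_box h.
        \<exists>i j. i \<noteq> j \<and> p $ i \<in> {0, box_corner h $ i} \<and> p $ j \<in> {0, box_corner h $ j}}"

text \<open>The vertical faces are \<open>vertical_face h i c\<close> with \<open>i \<in> {1, 2}\<close> and \<open>c \<in> {0, 1}\<close>.\<close>

definition vertical_face :: "real \<Rightarrow> 3 \<Rightarrow> real \<Rightarrow> (real^3) set" where
  "vertical_face h i c = {p \<in> unit_base_box h. p $ i = c}"

text \<open>\<open>p\<close> and \<open>q\<close> are the end points of a diagonal of the unit square at height \<open>z\<close>.\<close>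

definition diagonal_ends :: "real \<Rightarrow> real^3 \<Rightarrow> real^3 \<Rightarrow> bool" where
  "diagonal_ends z p q \<longleftrightarrow>
     p $ 3 = z \<and> q $ 3 = z \<and>
     p $ 1 \<in> {0, 1} \<and> p $ 2 \<in> {0, 1} \<and> q $ 1 = 1 - p $ 1 \<and> q $ 2 = 1 - p $ 2"

text \<open>The last conjunct says that the surface normal along an edge in a vertical face lies in
  the plane of that face, i.e. is perpendicular to the axis normal to the face.\<close>

definition pentagon_in_box ::
  "real \<Rightarrow> (complex \<Rightarrow> real^3) \<Rightarrow> (nat \<Rightarrow> real) \<Rightarrow>
   real^3 \<Rightarrow> real^3 \<Rightarrow> real^3 \<Rightarrow> real^3 \<Rightarrow> bool" where
  "pentagon_in_box h X \<theta> p q p' q' \<longleftrightarrow>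
     h > 0 \<and> minimal_pentagon X \<theta> \<and>
     X ` cball 0 1 \<subseteq> unit_base_box h \<and>
     X ` marks \<theta> \<subseteq> box_edge_points h \<and>
     diagonal_ends h p q \<and> diagonal_ends 0 p' q' \<and>
     (\<exists>m<5. \<exists>n<5. m \<noteq> n \<and>
        X ` edge_arc \<theta> m = closed_segment p q \<and>
        X ` edge_arc \<theta> n = closed_segment p' q' \<and>
        (\<forall>k<5. k \<noteq> m \<and> k \<noteq> n \<longrightarrow>
           (\<exists>i\<in>{1, 2}. \<exists>c\<in>{0, 1}.
              X ` edge_arc \<theta> k \<subseteq> vertical_face h i c \<and>
              (\<forall>z \<in> edge_arc \<theta> k - marks \<theta>. unit_normal X z \<bullet> axis i 1 = 0))))"

definition pentagon_SS :: "real \<Rightarrow> (complex \<Rightarrow> real^3) \<Rightarrow> (nat \<Rightarrow> real) \<Rightarrow> bool" where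
  "pentagon_SS h X \<theta> \<longleftrightarrow>
     (\<exists>p q p' q'. pentagon_in_box h X \<theta> p q p' q' \<and> (\<exists>r. q - p = r *\<^sub>R (q' - p')))"

definition pentagon_CS :: "real \<Rightarrow> (complex \<Rightarrow> real^3) \<Rightarrow> (nat \<Rightarrow> real) \<Rightarrow> bool" where
  "pentagon_CS h X \<theta> \<longleftrightarrow>
     (\<exists>p q p' q'. pentagon_in_box h X \<theta> p q p' q' \<and> orthogonal (q - p) (q' - p'))"

text \<open>
  A one-parameter family: the box height, the marked points and the surface depend continuously
  on a parameter ranging over a nonempty open interval, and different parameters give different
  surfaces (as subsets of space).  Since the box is normalized, only finitely many rigid motions
  carry it to itself, so such a family is not produced by moving a single surface around.
\<close>

definition one_parameter_family ::
  "(real \<Rightarrow> (complex \<Rightarrow> real^3) \<Rightarrow> (nat \<Rightarrow> real) \<Rightarrow> bool) \<Rightarrow> bool" where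
  "one_parameter_family P \<longleftrightarrow>
     (\<exists>(I :: real set) h X \<theta>.
        is_interval I \<and> open I \<and> I \<noteq> {} \<and>
        (\<forall>t\<in>I. P (h t) (X t) (\<theta> t)) \<and>
        continuous_on I h \<and>
        (\<forall>k<5. continuous_on I (\<lambda>t. \<theta> t k)) \<and>
        continuous_on (I \<times> cball 0 1) (\<lambda>(t, z). X t z) \<and>
        inj_on (\<lambda>t. X t ` cball 0 1) I)"

end

theory Submission
  imports Defs "HOL-Complex_Analysis.Complex_Analysis"
begin

text \<open>
  The surfaces are given by a Weierstrass representation on the unit disk with five marked points.  Take three
  holomorphic forms \<open>f dz\<close>, \<open>f' dz\<close> and \<open>g dz\<close> that are products of real powers of the distances \<open>1 - z / a\<close> to the marks
  \<open>a\<close>, of Schwarz--Christoffel type, with exponents chosen such that \<open>f f' = g\<^sup>2\<close>.  For \<open>\<rho>, \<kappa> > 0\<close> the curve with differential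
  \<open>(\<kappa> / 2 (f' / \<rho> - \<rho> f), \<i> \<kappa> / 2 (f' / \<rho> + \<rho> f), \<kappa> g) dz\<close> is null, so its real part is a conformally
  parametrized minimal surface (\<open>weierstrass_data\<close>).  Along each arc of the circle between two marks a Schwarz--Christoffel form has
  constant phase (\<open>sc_fun_on_arc\<close>).  The exponents are such that three of the arcs stay in vertical planes
  which they meet orthogonally, and the two others run along horizontal diagonals (\<open>phases\<close>).

  Whether the pentagon fits into the box is then a question about the side lengths of the Euclidean
  polygons onto which the primitives map the circle.  After a Moebius normalization there are two
  parameters \<open>- 1 < p < q < 1\<close> for the marks, and after choosing \<open>\<rho>\<close> and \<open>\<kappa>\<close> one equation remains, which cuts out a curve.
  For parallel diagonals it can be solved for \<open>p\<close> when \<open>q\<close> is given (\<open>ss_solution\<close>), for orthogonal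
  ones for \<open>q\<close> when \<open>p > 1 / 2\<close> is given (\<open>cs_solution\<close>).  In both cases the defining function changes sign, because it is
  dominated by colliding marks or has a symmetry at the ends, and it changes sign only once, by Chebyshev's
  inequality: the quotient \<open>f / f'\<close> is increasing along the first edge, and a mark enters \<open>f\<close> and \<open>f'\<close> with the
  different exponents \<open>- 3 / 4\<close> and \<open>- 1 / 4\<close> (\<open>shift_first_moment\<close>).  Roots of this kind depend continuously on the parameter
  (\<open>sign_change_root_continuous\<close>).

  The coordinates of the surface are harmonic.  On the arcs where a coordinate is not known it
  satisfies a Neumann condition, so the maximum principle (\<open>mixed_boundary_max\<close>) keeps the surface in the box and off the walls
  except along the prescribed edges; as the edges are monotone, the boundary is embedded (\<open>boundary_embedded\<close>).

  Different parameters give different surfaces because the parameters can be read off from the surface.  The wall \<open>x\<^sub>1 = 1\<close>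
  meets it, above the bottom, in the first edge only (\<open>front_wall\<close>).  The heights of the two ends of this edge and
  the limits of \<open>(1 - x\<^sub>2)\<^sup>2\<close> over the height difference there determine the two height
  lengths up to one normalization (\<open>congruent_data\<close>).  If they agree for two pairs of parameters, then
  two quadratic polynomials agree at a point of \<open>(0, 1)\<close> and at a point of \<open>(- 1, 0)\<close> (\<open>congruent_crossings\<close>), and this
  contradicts the values of these polynomials at \<open>0\<close> and \<open>1\<close> (\<open>cs_distinct\<close>, \<open>ss_not_congruent\<close>).
\<close>

section \<open>Schwarz--Christoffel integrands on the disk\<close>

text \<open>The product of the powers \<open>(1 - z / cis (\<theta> k)) ^ e k\<close>, written with principal logarithms so that it is
  single valued off the radial slits starting at the marks.  The constants \<open>\<i>\<close>, \<open>\<i> \<theta> k / 2\<close> and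
  \<open>\<nu> k > 0\<close> normalize its phase on the first arc and its size.\<close>

definition sc_fun :: "(nat \<Rightarrow> real) \<Rightarrow> (nat \<Rightarrow> real) \<Rightarrow> (nat \<Rightarrow> real) \<Rightarrow> complex \<Rightarrow> complex" where
  "sc_fun \<nu> \<theta> e z = \<i> * exp (\<Sum>k<5. of_real (e k) *
     (Ln (1 - z * cis (- \<theta> k)) + \<i> * of_real (\<theta> k / 2) + of_real (ln (\<nu> k))))"

definition slit_plane :: "(nat \<Rightarrow> real) \<Rightarrow> complex set" where
  "slit_plane \<theta> = {z. \<forall>k<5. 1 - z * cis (- \<theta> k) \<notin> \<real>\<^sub>\<le>\<^sub>0}"

text \<open>The primitive vanishing at \<open>0\<close>, integrated along the radius so that it makes sense at the marks too.\<close>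

definition sc_prim :: "(nat \<Rightarrow> real) \<Rightarrow> (nat \<Rightarrow> real) \<Rightarrow> (nat \<Rightarrow> real) \<Rightarrow> complex \<Rightarrow> complex" where
  "sc_prim \<nu> \<theta> e z = z * integral {0<..<1} (\<lambda>s. sc_fun \<nu> \<theta> e (of_real s * z))"

lemma open_slit_plane: "open (slit_plane \<theta>)"
proof -
  have "slit_plane \<theta> = (\<Inter>k<5. (\<lambda>z. 1 - z * cis (- \<theta> k)) -` (- \<real>\<^sub>\<le>\<^sub>0))"
    by (auto simp: slit_plane_def)
  moreover have "open ((\<lambda>z. 1 - z * cis (- \<theta> k)) -` (- \<real>\<^sub>\<le>\<^sub>0))" for k
    by (intro open_vimage continuous_intros) (auto simp: open_Compl)
  ultimately show ?thesis by auto
qed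

lemma slit_plane_scale:
  assumes "z \<in> slit_plane \<theta>" "0 \<le> s" "s \<le> 1"
  shows "of_real s * z \<in> slit_plane \<theta>"
  unfolding slit_plane_def
proof (clarify)
  fix k :: nat assume k: "k < 5" and neg: "1 - of_real s * z * cis (- \<theta> k) \<in> \<real>\<^sub>\<le>\<^sub>0"
  define w where "w = z * cis (- \<theta> k)"
  have nw: "1 - w \<notin> \<real>\<^sub>\<le>\<^sub>0" using assms(1) k by (auto simp: slit_plane_def w_def)
  have "1 - of_real s * w \<in> \<real>\<^sub>\<le>\<^sub>0" using neg by (simp add: w_def mult.assoc)
  then have "s * Im w = 0" "1 \<le> s * Re w" by (auto simp: complex_nonpos_Reals_iff)
  moreover have "s > 0" using calculation(2) assms(2) by (cases "s = 0") auto
  ultimately have "Im w = 0" "1 \<le> Re w"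
    using assms(3) by (auto simp: ) (smt (verit) mult_left_le_one_le mult_nonneg_nonneg mult_nonneg_nonpos)
  then show False using nw by (auto simp: complex_nonpos_Reals_iff)
qed

lemma zero_in_slit_plane: "0 \<in> slit_plane \<theta>"
  by (auto simp: slit_plane_def complex_nonpos_Reals_iff)

lemma starlike_slit_plane: "starlike (slit_plane \<theta>)"
  unfolding starlike_def
proof (intro bexI[of _ 0] ballI subsetI)
  fix x y assume "x \<in> slit_plane \<theta>" "y \<in> closed_segment 0 x"
  then show "y \<in> slit_plane \<theta>"
    using slit_plane_scale by (auto simp: closed_segment_def scaleR_conv_of_real)
qed (rule zero_in_slit_plane)

lemma connected_slit_plane: "connected (slit_plane \<theta>)"
  by (rule starlike_imp_connected[OF starlike_slit_plane])

lemma cball_minus_marks_subset_slit_plane: "cball 0 1 - marks \<theta> \<subseteq> slit_plane \<theta>"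
proof
  fix z :: complex assume z: "z \<in> cball 0 1 - marks \<theta>"
  show "z \<in> slit_plane \<theta>"
    unfolding slit_plane_def
  proof (clarify)
    fix k :: nat assume k: "k < 5" and neg: "1 - z * cis (- \<theta> k) \<in> \<real>\<^sub>\<le>\<^sub>0"
    define w where "w = z * cis (- \<theta> k)"
    have "norm w \<le> 1" using z by (simp add: w_def norm_mult)
    moreover have "Im w = 0" "1 \<le> Re w" using neg by (auto simp: complex_nonpos_Reals_iff w_def)
    ultimately have "w = 1"
      by (smt (verit) complex_Re_le_cmod complex_eq_iff one_complex.simps)
    then have "z = cis (\<theta> k)"
      by (auto simp: w_def) (metis cis_cnj cis_inverse cis_neq_zero inverse_unique mult.commute inverse_inverse_eq)
    then show False using z k by (auto simp: marks_def)
  qed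
qed

lemma ball_subset_slit_plane: "ball 0 1 \<subseteq> slit_plane \<theta>"
proof -
  have "z \<notin> marks \<theta>" if "norm z < 1" for z using that by (auto simp: marks_def)
  then show ?thesis using cball_minus_marks_subset_slit_plane[of \<theta>] by force
qed

lemma sc_fun_holomorphic: "sc_fun \<nu> \<theta> e holomorphic_on slit_plane \<theta>"
  unfolding sc_fun_def [abs_def]
  by (intro holomorphic_intros) (auto simp: slit_plane_def)

lemma sc_fun_nonzero: "sc_fun \<nu> \<theta> e z \<noteq> 0"
  by (simp add: sc_fun_def)

text \<open>The exponents add up, and so do all constants except \<open>\<i>\<close>: this is what makes three integrands
  with \<open>e + e' = 2 d\<close> the data of a null curve.\<close>

lemma sc_fun_mult:
  assumes "\<And>k. k < 5 \<Longrightarrow> e k + e' k = 2 * d k"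
  shows "sc_fun \<nu> \<theta> e z * sc_fun \<nu> \<theta> e' z = (sc_fun \<nu> \<theta> d z)\<^sup>2"
proof -
  let ?L = "\<lambda>k. Ln (1 - z * cis (- \<theta> k)) + \<i> * of_real (\<theta> k / 2) + of_real (ln (\<nu> k))"
  have "(\<Sum>k<5. of_real (e k) * ?L k) + (\<Sum>k<5. of_real (e' k) * ?L k)
      = (\<Sum>k<5. of_real (d k) * ?L k) + (\<Sum>k<5. of_real (d k) * ?L k)"
    unfolding sum.distrib[symmetric]
  proof (rule sum.cong)
    fix k :: nat assume "k \<in> {..<5}"
    then have "complex_of_real (e k) + of_real (e' k) = of_real (d k) + of_real (d k)"
      using assms[of k] by (simp flip: of_real_add)
    then show "of_real (e k) * ?L k + of_real (e' k) * ?L k = of_real (d k) * ?L k + of_real (d k) * ?L k"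
      by (metis distrib_right)
  qed auto
  then have "exp (\<Sum>k<5. of_real (e k) * ?L k) * exp (\<Sum>k<5. of_real (e' k) * ?L k)
      = exp (\<Sum>k<5. of_real (d k) * ?L k) * exp (\<Sum>k<5. of_real (d k) * ?L k)"
    by (simp flip: exp_add)
  then show ?thesis
    unfolding sc_fun_def power2_eq_square by (simp add: mult_ac)
qed

lemma norm_sc_fun:
  assumes "\<And>k. k < 5 \<Longrightarrow> z \<noteq> cis (\<theta> k)" "\<And>k. k < 5 \<Longrightarrow> \<nu> k > 0"
  shows "norm (sc_fun \<nu> \<theta> e z) = (\<Prod>k<5. (\<nu> k * norm (1 - z * cis (- \<theta> k))) powr e k)"
proof -
  have nz: "1 - z * cis (- \<theta> k) \<noteq> 0" if "k < 5" for k
    using assms(1)[OF that]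
    by (auto simp: ) (metis cis_cnj cis_inverse cis_neq_zero inverse_unique mult.commute inverse_inverse_eq)
  have "norm (sc_fun \<nu> \<theta> e z)
     = exp (\<Sum>k<5. e k * (ln (norm (1 - z * cis (- \<theta> k))) + ln (\<nu> k)))"
    unfolding sc_fun_def norm_mult norm_exp_eq_Re using nz by (auto simp: intro!: sum.cong)
  also have "\<dots> = (\<Prod>k<5. (\<nu> k * norm (1 - z * cis (- \<theta> k))) powr e k)"
    unfolding exp_sum[OF finite_lessThan]
  proof (rule prod.cong)
    fix k :: nat assume "k \<in> {..<5}"
    then have "\<nu> k > 0" "norm (1 - z * cis (- \<theta> k)) > 0" using nz assms by auto
    then show "exp (e k * (ln (norm (1 - z * cis (- \<theta> k))) + ln (\<nu> k)))
        = (\<nu> k * norm (1 - z * cis (- \<theta> k))) powr e k"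
      by (subst powr_def) (auto simp: ln_mult add.commute)
  qed auto
  finally show ?thesis .
qed

lemma norm_one_minus_mult_cis: "norm (1 - z * cis (- t)) = norm (cis t - z)"
proof -
  have "cis t * (1 - z * cis (- t)) = cis t - z" by (simp add: algebra_simps cis_mult)
  then show ?thesis by (metis norm_cis norm_mult mult_1)
qed

text \<open>The distances \<open>w k\<close> to two different marks cannot both be small, so at most one factor is large, and that one is at most
  \<open>(1 - s) powr b\<close>.\<close>

lemma sc_product_bound:
  fixes w e :: "nat \<Rightarrow> real"
  assumes s: "0 < s" "s < 1" and b: "b \<le> 0" and e: "\<And>k. k < 5 \<Longrightarrow> b \<le> e k"
    and w1: "\<And>k. k < 5 \<Longrightarrow> 1 - s \<le> w k" and w2: "\<And>k. k < 5 \<Longrightarrow> w k \<le> 2"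
    and d: "0 < \<delta>" "\<delta> \<le> 2" and sep: "\<And>j k. j < 5 \<Longrightarrow> k < 5 \<Longrightarrow> j \<noteq> k \<Longrightarrow> \<delta> \<le> w j + w k"
  shows "(\<Prod>k<5. w k powr e k) \<le> (\<Prod>k<5. exp (\<bar>e k\<bar> * (ln 2 + \<bar>ln (\<delta> / 2)\<bar>))) * (1 - s) powr b"
proof -
  define M where "M k = exp (\<bar>e k\<bar> * (ln 2 + \<bar>ln (\<delta> / 2)\<bar>))" for k
  have M1: "M k \<ge> 1" for k unfolding M_def by auto
  have far: "w k powr e k \<le> M k" if "k < 5" "\<delta> / 2 \<le> w k" for k
  proof -
    have "w k > 0" using w1[OF that(1)] s by auto
    moreover have "\<bar>ln (w k)\<bar> \<le> ln 2 + \<bar>ln (\<delta> / 2)\<bar>"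
    proof -
      have "ln (w k) \<le> ln 2" using w2[OF that(1)] \<open>w k > 0\<close> by simp
      moreover have "ln (\<delta> / 2) \<le> ln (w k)" using that d by (subst ln_le_cancel_iff) auto
      moreover have "ln (2::real) > 0" by simp
      ultimately show ?thesis by linarith
    qed
    then have "e k * ln (w k) \<le> \<bar>e k\<bar> * (ln 2 + \<bar>ln (\<delta> / 2)\<bar>)"
    proof -
      assume *: "\<bar>ln (w k)\<bar> \<le> ln 2 + \<bar>ln (\<delta> / 2)\<bar>"
      have "e k * ln (w k) \<le> \<bar>e k\<bar> * \<bar>ln (w k)\<bar>" by (metis abs_ge_self abs_mult)
      also have "\<dots> \<le> \<bar>e k\<bar> * (ln 2 + \<bar>ln (\<delta> / 2)\<bar>)" using * by (intro mult_left_mono) auto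
      finally show ?thesis .
    qed
    ultimately show ?thesis by (simp add: powr_def M_def)
  qed
  have near: "w k powr e k \<le> (1 - s) powr b" if "k < 5" "w k < \<delta> / 2" for k
  proof -
    have "w k > 0" "w k \<le> 1" using w1[OF that(1)] s that d by auto
    then have "w k powr e k \<le> w k powr b" using e[OF that(1)] by (simp add: powr_mono')
    also have "\<dots> \<le> (1 - s) powr b" using w1[OF that(1)] s b by (intro powr_mono2') auto
    finally show ?thesis .
  qed
  have one: "(1 - s) powr b \<ge> 1" 
    using powr_mono'[of b 0 "1 - s"] s b by simp
  show ?thesis
  proof (cases "\<exists>k<5. w k < \<delta> / 2")
    case True
    then obtain k where k: "k < 5" "w k < \<delta> / 2" by auto
    have others: "\<delta> / 2 \<le> w j" if "j < 5" "j \<noteq> k" for j using sep[of j k] that k by auto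
    have "(\<Prod>j<5. w j powr e j) = w k powr e k * (\<Prod>j\<in>{..<5} - {k}. w j powr e j)"
      using k by (subst prod.remove[of _ k]) auto
    also have "\<dots> \<le> (1 - s) powr b * (\<Prod>j\<in>{..<5} - {k}. M j)"
      using near[OF k] far others by (intro mult_mono prod_mono prod_nonneg) auto
    also have "\<dots> \<le> (1 - s) powr b * (M k * (\<Prod>j\<in>{..<5} - {k}. M j))"
    proof (rule mult_left_mono)
      have "0 \<le> (\<Prod>j\<in>{..<5} - {k}. M j)" by (intro prod_nonneg) (auto simp: M_def)
      from mult_right_mono[OF M1[of k] this]
      show "(\<Prod>j\<in>{..<5} - {k}. M j) \<le> M k * (\<Prod>j\<in>{..<5} - {k}. M j)" by simp
    qed simp
    also have "\<dots> = (\<Prod>j<5. M j) * (1 - s) powr b"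
      using k by (subst (2) prod.remove[of _ k]) auto
    finally show ?thesis by (simp add: M_def)
  next
    case False
    then have "w j powr e j \<le> M j" if "j < 5" for j using far[OF that] that by (meson not_less)
    then have "(\<Prod>j<5. w j powr e j) \<le> (\<Prod>j<5. M j)" by (intro prod_mono) auto
    also have "\<dots> \<le> (\<Prod>j<5. M j) * (1 - s) powr b"
      using mult_left_mono[OF one, of "\<Prod>j<5. M j"] by (simp add: M_def prod_nonneg)
    finally show ?thesis by (simp add: M_def)
  qed
qed

lemma positive_sequence_bounded_below:
  fixes x :: "nat \<Rightarrow> real"
  assumes "x \<longlonglongrightarrow> l" "l > 0" "\<And>n. x n > 0"
  obtains \<delta> where "\<delta> > 0" "\<And>n. \<delta> \<le> x n"
proof -
  have "eventually (\<lambda>n. x n > l / 2) sequentially"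
    using assms by (intro order_tendstoD) auto
  then obtain N where N: "\<And>n. n \<ge> N \<Longrightarrow> x n > l / 2" by (auto simp: eventually_sequentially)
  define \<delta> where "\<delta> = Min (insert (l / 2) (x ` {..<N}))"
  have "\<delta> > 0" unfolding \<delta>_def using assms by (subst Min_gr_iff) auto
  moreover have "\<delta> \<le> x n" for n
  proof (cases "n < N")
    case True then show ?thesis unfolding \<delta>_def by (intro Min_le) auto
  next
    case False
    have "\<delta> \<le> l / 2" unfolding \<delta>_def by (intro Min_le) auto
    then show ?thesis using N[of n] False by auto
  qed
  ultimately show ?thesis using that by blast
qed

lemma one_minus_powr_integrable:
  assumes "(b::real) > -1"
  shows "(\<lambda>s. (1 - s) powr b) integrable_on {0<..<1}"
proof -
  define c where "c = b + 1"
  have c: "c > 0" "b = c - 1" using assms by (auto simp: c_def)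
  have "((\<lambda>s. (1 - s) powr b) has_integral - ((1 - 1) powr c / c) - - ((1 - 0) powr c / c)) {0..1::real}"
  proof (rule fundamental_theorem_of_calculus_interior)
    show "continuous_on {0..1} (\<lambda>s. - ((1 - s) powr c / c))"
      using c by (intro continuous_intros continuous_on_powr') auto
    show "((\<lambda>s. - ((1 - s) powr c / c)) has_vector_derivative (1 - x) powr b) (at x)"
      if "x \<in> {0<..<1}" for x
      using that c unfolding has_real_derivative_iff_has_vector_derivative[symmetric]
      by (auto intro!: derivative_eq_intros)
  qed auto
  then show ?thesis
    by (simp add: integrable_on_open_interval_real has_integral_integrable)
qed

lemma sc_fun_radial_continuous:
  assumes "z \<in> slit_plane \<theta>"
  shows "continuous_on {0..1} (\<lambda>s. sc_fun \<nu> \<theta> e (of_real s * z))"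
proof -
  have "continuous_on (slit_plane \<theta>) (sc_fun \<nu> \<theta> e)"
    by (rule holomorphic_on_imp_continuous_on[OF sc_fun_holomorphic])
  then show ?thesis
    by (rule continuous_on_compose2) (use slit_plane_scale[OF assms] in \<open>auto intro!: continuous_intros\<close>)
qed

lemma sc_prim_dominated:
  fixes \<Theta> :: "nat \<Rightarrow> nat \<Rightarrow> real"
  assumes "b > -1" "b \<le> 0" "\<And>k. k < 5 \<Longrightarrow> b \<le> e k"
    and \<Theta>: "\<And>k. k < 5 \<Longrightarrow> (\<lambda>n. \<Theta> n k) \<longlonglongrightarrow> \<theta> k"
    and N: "\<And>k. k < 5 \<Longrightarrow> (\<lambda>n. N n k) \<longlonglongrightarrow> \<nu> k" "\<And>k. k < 5 \<Longrightarrow> \<nu> k > 0" "\<And>n k. k < 5 \<Longrightarrow> N n k > 0"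
    and Z: "Z \<longlonglongrightarrow> z" "\<And>n. norm (Z n) \<le> 1"
    and d: "\<And>j k. j < 5 \<Longrightarrow> k < 5 \<Longrightarrow> j \<noteq> k \<Longrightarrow> cis (\<theta> j) \<noteq> cis (\<theta> k)"
      "\<And>n j k. j < 5 \<Longrightarrow> k < 5 \<Longrightarrow> j \<noteq> k \<Longrightarrow> cis (\<Theta> n j) \<noteq> cis (\<Theta> n k)"
    and int: "\<And>n. (\<lambda>s. sc_fun (N n) (\<Theta> n) e (of_real s * Z n)) integrable_on {0<..<1}"
  shows "(\<lambda>s. sc_fun \<nu> \<theta> e (of_real s * z)) integrable_on {0<..<1}"
    "(\<lambda>n. sc_prim (N n) (\<Theta> n) e (Z n)) \<longlonglongrightarrow> sc_prim \<nu> \<theta> e z"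
proof -
  have z1: "norm z \<le> 1" by (rule Lim_norm_ubound[OF _ Z(1)]) (use Z(2) in auto)
  have cisc: "(\<lambda>n. cis (\<Theta> n k)) \<longlonglongrightarrow> cis (\<theta> k)" if "k < 5" for k
    using isCont_tendsto_compose[of "\<theta> k" cis] \<Theta>[OF that] by (auto simp: cis_conv_exp intro!: continuous_intros tendsto_intros)
  have cisc': "(\<lambda>n. cis (- \<Theta> n k)) \<longlonglongrightarrow> cis (- \<theta> k)" if "k < 5" for k
    using \<Theta>[OF that] by (auto simp: cis_conv_exp intro!: tendsto_intros)
  \<comment> \<open>a separation of the marks that is uniform along the sequence\<close>
  have "\<exists>\<delta>>0. \<forall>n. \<delta> \<le> dist (cis (\<Theta> n j)) (cis (\<Theta> n k))" if "j < 5" "k < 5" "j \<noteq> k" for j k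
    by (rule positive_sequence_bounded_below[of "\<lambda>n. dist (cis (\<Theta> n j)) (cis (\<Theta> n k))" "dist (cis (\<theta> j)) (cis (\<theta> k))"])
       (use that d cisc in \<open>auto intro!: tendsto_dist\<close>)
  then obtain \<Delta> where \<Delta>: "\<And>j k. j < 5 \<Longrightarrow> k < 5 \<Longrightarrow> j \<noteq> k \<Longrightarrow> \<Delta> j k > 0 \<and> (\<forall>n. \<Delta> j k \<le> dist (cis (\<Theta> n j)) (cis (\<Theta> n k)))"
    by metis
  define P where "P = {(j, k). j < (5::nat) \<and> k < (5::nat) \<and> j \<noteq> k}"
  have "P \<subseteq> {..<5} \<times> {..<5}" by (auto simp: P_def)
  then have finP: "finite P" by (rule finite_subset) auto
  define \<delta> where "\<delta> = Min (insert 2 ((\<lambda>(j, k). \<Delta> j k) ` P))"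
  have \<delta>: "\<delta> > 0" "\<delta> \<le> 2" using finP \<Delta> by (auto simp: \<delta>_def P_def)
  have sep: "\<delta> \<le> dist (cis (\<Theta> n j)) (cis (\<Theta> n k))" if "j < 5" "k < 5" "j \<noteq> k" for n j k
  proof -
    have "\<delta> \<le> \<Delta> j k" unfolding \<delta>_def using finP that by (intro Min_le) (auto simp: P_def image_iff)
    then show ?thesis using \<Delta>[OF that] order_trans by blast
  qed
  define M where "M = (\<Prod>k<5. exp (\<bar>e k\<bar> * (ln 2 + \<bar>ln (\<delta> / 2)\<bar>)))"
  have "(\<lambda>n. \<Prod>k<5. N n k powr e k) \<longlonglongrightarrow> (\<Prod>k<5. \<nu> k powr e k)"
    using N(2) by (intro tendsto_prod tendsto_powr N(1) tendsto_const) force+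
  then have "Bseq (\<lambda>n. \<Prod>k<5. N n k powr e k)" by (intro convergent_imp_Bseq) (auto simp: convergent_def)
  then obtain K where K: "\<And>n. norm (\<Prod>k<5. N n k powr e k) \<le> K" by (auto simp: Bseq_def)
  have bound: "norm (sc_fun (N n) (\<Theta> n) e (of_real s * Z n)) \<le> K * (M * (1 - s) powr b)"
    if s: "s \<in> {0<..<1}" for n s
  proof -
    have sz: "norm (of_real s * Z n) \<le> s"
      using Z(2)[of n] s by (simp add: norm_mult mult_le_cancel_left1)
    define w where "w k = norm (1 - of_real s * Z n * cis (- \<Theta> n k))" for k
    have w_eq: "w k = dist (cis (\<Theta> n k)) (of_real s * Z n)" for k
      unfolding w_def norm_one_minus_mult_cis dist_norm ..
    have w1: "1 - s \<le> w k" and w2: "w k \<le> 2" for k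
    proof -
      have "norm (of_real s * Z n * cis (- \<Theta> n k)) \<le> s" using sz by (simp add: norm_mult)
      then show "1 - s \<le> w k" "w k \<le> 2"
        using norm_triangle_ineq2[of 1 "of_real s * Z n * cis (- \<Theta> n k)"]
          norm_triangle_ineq4[of 1 "of_real s * Z n * cis (- \<Theta> n k)"] s
        unfolding w_def norm_one by auto
    qed
    have sepw: "\<delta> \<le> w j + w k" if "j < 5" "k < 5" "j \<noteq> k" for j k
      using sep[OF that, of n] dist_triangle2[of "cis (\<Theta> n j)" "cis (\<Theta> n k)" "of_real s * Z n"]
      by (simp add: w_eq)
    have ne: "of_real s * Z n \<noteq> cis (\<Theta> n k)" for k
    proof
      assume "of_real s * Z n = cis (\<Theta> n k)"
      then have "norm (of_real s * Z n) = 1" by simp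
      then show False using sz s by auto
    qed
    have "norm (sc_fun (N n) (\<Theta> n) e (of_real s * Z n)) = (\<Prod>k<5. (N n k * w k) powr e k)"
      unfolding w_def by (rule norm_sc_fun) (use ne N(3) in auto)
    also have "\<dots> = (\<Prod>k<5. N n k powr e k) * (\<Prod>k<5. w k powr e k)"
    proof -
      have "(N n k * w k) powr e k = N n k powr e k * w k powr e k" if "k < 5" for k
        by (rule powr_mult)
      then show ?thesis by (simp add: prod.distrib)
    qed
    also have "\<dots> \<le> K * (M * (1 - s) powr b)"
    proof (rule mult_mono)
      show "(\<Prod>k<5. N n k powr e k) \<le> K" using K[of n] by (auto simp: abs_le_iff)
      then show "0 \<le> K" using prod_nonneg[of "{..<5}" "\<lambda>k. N n k powr e k"] by (smt (verit) powr_ge_zero)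
      show "(\<Prod>k<5. w k powr e k) \<le> M * (1 - s) powr b"
        unfolding M_def by (rule sc_product_bound) (use s assms(2,3) w1 w2 \<delta> sepw in auto)
    qed (auto intro: prod_nonneg)
    finally show ?thesis .
  qed
  have conv: "(\<lambda>n. sc_fun (N n) (\<Theta> n) e (of_real s * Z n)) \<longlonglongrightarrow> sc_fun \<nu> \<theta> e (of_real s * z)"
    if s: "s \<in> {0<..<1}" for s
  proof -
    have "norm (of_real s * z) < 1" using z1 s by (simp add: norm_mult) (metis mult_left_le_one_le mult_le_cancel_left1 norm_ge_zero order_le_less_trans mult.commute less_eq_real_def)
    then have "of_real s * z \<in> slit_plane \<theta>" using ball_subset_slit_plane[of \<theta>] by (meson mem_ball_0 subsetD)
    then have "1 - of_real s * z * cis (- \<theta> k) \<notin> \<real>\<^sub>\<le>\<^sub>0" if "k < 5" for k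
      using that by (auto simp: slit_plane_def)
    then show ?thesis
      unfolding sc_fun_def
      by (intro tendsto_intros Z(1) cisc' N(1) \<Theta>) (use N(2) in \<open>force+\<close>)
  qed
  have h: "(\<lambda>s. K * (M * (1 - s) powr b)) integrable_on {0<..<1}"
    using one_minus_powr_integrable[OF assms(1)] by (intro integrable_on_mult_right)
  show "(\<lambda>s. sc_fun \<nu> \<theta> e (of_real s * z)) integrable_on {0<..<1}"
    by (rule dominated_convergence(1)[OF int h bound conv])
  show "(\<lambda>n. sc_prim (N n) (\<Theta> n) e (Z n)) \<longlonglongrightarrow> sc_prim \<nu> \<theta> e z"
    unfolding sc_prim_def
    by (intro tendsto_mult Z(1) dominated_convergence(2)[OF int h bound conv])
qed

lemma sc_prim_integrable:
  assumes "b > -1" "b \<le> 0" "\<And>k. k < 5 \<Longrightarrow> b \<le> e k" "\<And>k. k < 5 \<Longrightarrow> \<nu> k > 0"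
    and d: "\<And>j k. j < 5 \<Longrightarrow> k < 5 \<Longrightarrow> j \<noteq> k \<Longrightarrow> cis (\<theta> j) \<noteq> cis (\<theta> k)"
    and z: "norm z \<le> 1"
  shows "(\<lambda>s. sc_fun \<nu> \<theta> e (of_real s * z)) integrable_on {0<..<1}"
proof (rule sc_prim_dominated(1)[where N = "\<lambda>_. \<nu>" and \<Theta> = "\<lambda>_. \<theta>"])
  let ?Z = "\<lambda>n. of_real (1 - 1 / real (n + 2)) * z"
  have "(\<lambda>n. 1 - 1 / real (n + 2)) \<longlonglongrightarrow> 1 - 0"
    by (intro tendsto_diff tendsto_const LIMSEQ_ignore_initial_segment[OF lim_1_over_n])
  then have "?Z \<longlonglongrightarrow> of_real 1 * z" by (intro tendsto_intros) simp
  then show "?Z \<longlonglongrightarrow> z" by simp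
  have Zn: "norm (?Z n) < 1" for n
  proof -
    have "norm (?Z n) = (1 - 1 / real (n + 2)) * norm z" by (simp add: norm_mult del: of_real_diff)
    also have "\<dots> \<le> (1 - 1 / real (n + 2)) * 1" using z by (intro mult_left_mono) auto
    also have "\<dots> < 1" by simp
    finally show ?thesis .
  qed
  show "norm (?Z n) \<le> 1" for n using Zn[of n] by simp
  have "?Z n \<in> slit_plane \<theta>" for n using ball_subset_slit_plane[of \<theta>] Zn[of n] by (meson mem_ball_0 subsetD)
  then show "(\<lambda>s. sc_fun \<nu> \<theta> e (of_real s * ?Z n)) integrable_on {0<..<1}" for n
    by (subst integrable_on_open_interval_real) (intro integrable_continuous_real sc_fun_radial_continuous)
qed (use assms in auto)

text \<open>The integrands are dominated by one multiple of \<open>(1 - s) powr b\<close> along the sequence, since the limiting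
  marks stay apart.  This gives continuity of the primitive up to the marks and in all parameters at once.\<close>

lemma sc_prim_tendsto:
  fixes \<Theta> :: "nat \<Rightarrow> nat \<Rightarrow> real"
  assumes "b > -1" "b \<le> 0" "\<And>k. k < 5 \<Longrightarrow> b \<le> e k"
    and "\<And>k. k < 5 \<Longrightarrow> (\<lambda>n. \<Theta> n k) \<longlonglongrightarrow> \<theta> k"
    and "\<And>k. k < 5 \<Longrightarrow> (\<lambda>n. N n k) \<longlonglongrightarrow> \<nu> k" "\<And>k. k < 5 \<Longrightarrow> \<nu> k > 0" "\<And>n k. k < 5 \<Longrightarrow> N n k > 0"
    and "Z \<longlonglongrightarrow> z" "\<And>n. norm (Z n) \<le> 1"
    and "\<And>j k. j < 5 \<Longrightarrow> k < 5 \<Longrightarrow> j \<noteq> k \<Longrightarrow> cis (\<theta> j) \<noteq> cis (\<theta> k)"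
      "\<And>n j k. j < 5 \<Longrightarrow> k < 5 \<Longrightarrow> j \<noteq> k \<Longrightarrow> cis (\<Theta> n j) \<noteq> cis (\<Theta> n k)"
  shows "(\<lambda>n. sc_prim (N n) (\<Theta> n) e (Z n)) \<longlonglongrightarrow> sc_prim \<nu> \<theta> e z"
  by (rule sc_prim_dominated(2)) (use assms in \<open>auto intro!: sc_prim_integrable\<close>)

text \<open>The slit domain is starlike about \<open>0\<close>, so some holomorphic primitive exists there, and the radial
  integral is the one that vanishes at \<open>0\<close>.\<close>

lemma sc_prim_derivative:
  assumes "z \<in> slit_plane \<theta>"
  shows "(sc_prim \<nu> \<theta> e has_field_derivative sc_fun \<nu> \<theta> e z) (at z)"
proof -
  let ?f = "sc_fun \<nu> \<theta> e"
  obtain g where g: "\<And>w. w \<in> slit_plane \<theta> \<Longrightarrow> (g has_field_derivative ?f w) (at w)"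
  proof -
    have "\<exists>g. \<forall>w\<in>slit_plane \<theta>. (g has_field_derivative ?f w) (at w)"
    proof (rule holomorphic_starlike_primitive[OF _ starlike_slit_plane open_slit_plane, of _ _ "{}"])
      show "continuous_on (slit_plane \<theta>) ?f" by (rule holomorphic_on_imp_continuous_on[OF sc_fun_holomorphic])
      show "?f field_differentiable at x" if "x \<in> slit_plane \<theta> - {}" for x
        using that open_slit_plane[of \<theta>] sc_fun_holomorphic[of \<nu> \<theta> e] holomorphic_on_imp_differentiable_at by blast
    qed auto
    then show ?thesis using that by auto
  qed
  have P: "sc_prim \<nu> \<theta> e w = g w - g 0" if w: "w \<in> slit_plane \<theta>" for w
  proof -
    have "((\<lambda>s. ?f (of_real s * w) * w) has_integral g (of_real 1 * w) - g (of_real 0 * w)) {0..1}"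
    proof (rule fundamental_theorem_of_calculus)
      fix s :: real assume s: "s \<in> {0..1}"
      have "((\<lambda>s. g (s * w)) has_field_derivative ?f (of_real s * w) * (1 * w)) (at (of_real s))"
        by (rule DERIV_chain2[OF g]) (use s slit_plane_scale[OF w, of s] in \<open>auto intro!: derivative_eq_intros\<close>)
      then have "((\<lambda>s. g (of_real s * w)) has_vector_derivative ?f (of_real s * w) * w) (at s)"
        using has_vector_derivative_real_field by fastforce
      then show "((\<lambda>s. g (of_real s * w)) has_vector_derivative ?f (of_real s * w) * w) (at s within {0..1})"
        by (rule has_vector_derivative_at_within)
    qed auto
    then have "integral {0..1} (\<lambda>s. ?f (of_real s * w) * w) = g (of_real 1 * w) - g (of_real 0 * w)" by (rule integral_unique)
    then show ?thesis
      by (simp add: sc_prim_def integral_open_interval_real mult.commute)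
  qed
  have "((\<lambda>w. g w - g 0) has_field_derivative ?f z) (at z)"
    using g[OF assms] by (auto intro!: derivative_eq_intros)
  then show ?thesis
    by (rule DERIV_cong_ev[THEN iffD1, rotated -1])
       (use P open_slit_plane assms in \<open>auto simp: eventually_nhds intro!: exI[of _ "slit_plane \<theta>"]\<close>)
qed

lemma one_minus_cis_polar:
  assumes "0 < t" "t < 2 * pi"
  shows "exp (of_real (ln (2 * sin (t / 2))) + \<i> * of_real (t / 2 - pi / 2)) = 1 - cis t"
proof -
  have s: "sin (t / 2) > 0" using assms by (intro sin_gt_zero) auto
  have "1 - cos t = 2 * (sin (t / 2))\<^sup>2" "sin t = 2 * sin (t / 2) * cos (t / 2)"
    using cos_double_sin[of "t / 2"] sin_double[of "t / 2"] by auto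
  then have "1 - cis t = of_real (2 * sin (t / 2)) * cis (t / 2 - pi / 2)"
    by (simp add: complex_eq_iff cos_diff sin_diff power2_eq_square)
  moreover have "exp (of_real (ln (2 * sin (t / 2)))) = complex_of_real (2 * sin (t / 2))"
    using s by (simp add: exp_of_real)
  ultimately show ?thesis by (simp add: exp_add cis_conv_exp)
qed

lemma Ln_one_minus_cis:
  assumes "0 < t" "t < 2 * pi"
  shows "Ln (1 - cis t) = of_real (ln (2 * sin (t / 2))) + \<i> * of_real (t / 2 - pi / 2)"
  by (rule Ln_unique[OF one_minus_cis_polar[OF assms]]) (use assms in auto)

lemma Ln_one_minus_cis_uminus:
  assumes "0 < t" "t < 2 * pi"
  shows "Ln (1 - cis (- t)) = of_real (ln (2 * sin (t / 2))) - \<i> * of_real (t / 2 - pi / 2)"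
proof (rule Ln_unique)
  have "exp (of_real (ln (2 * sin (t / 2))) - \<i> * of_real (t / 2 - pi / 2))
      = cnj (exp (of_real (ln (2 * sin (t / 2))) + \<i> * of_real (t / 2 - pi / 2)))"
    unfolding exp_cnj by (rule arg_cong[of _ _ exp]) (simp add: complex_eq_iff)
  also have "\<dots> = 1 - cis (- t)"
    unfolding one_minus_cis_polar[OF assms] by (simp add: cis_cnj)
  finally show "exp (of_real (ln (2 * sin (t / 2))) - \<i> * of_real (t / 2 - pi / 2)) = 1 - cis (- t)" .
qed (use assms in auto)

text \<open>The modulus of \<open>sc_fun\<close> at \<open>cis t\<close>, since \<open>2 \<bar>sin ((t - \<theta> k) / 2)\<bar>\<close> is the chord from \<open>cis t\<close> to the mark.\<close>

definition arc_weight :: "(nat \<Rightarrow> real) \<Rightarrow> (nat \<Rightarrow> real) \<Rightarrow> (nat \<Rightarrow> real) \<Rightarrow> real \<Rightarrow> real" where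
  "arc_weight \<nu> \<theta> e t = (\<Prod>k<5. (2 * \<nu> k * \<bar>sin ((t - \<theta> k) / 2)\<bar>) powr e k)"

lemma five_marks_mono:
  assumes "five_marks \<theta>" "i < j" "j \<le> 5"
  shows "\<theta> i < \<theta> j"
  using assms(2,3)
proof (induction j)
  case (Suc j)
  have "\<theta> j < \<theta> (Suc j)" using assms(1) Suc.prems by (auto simp: five_marks_def)
  then show ?case using Suc by (cases "i = j") auto
qed auto

lemma five_marks_mono_le:
  assumes "five_marks \<theta>" "i \<le> j" "j \<le> 5"
  shows "\<theta> i \<le> \<theta> j"
  using five_marks_mono[OF assms(1), of i j] assms(2,3) by (cases "i = j") auto

lemma five_marks_gap:
  assumes fm: "five_marks \<theta>" and j: "j < 5" and k: "k < 5" and t: "\<theta> j < t" "t < \<theta> (Suc j)"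
  shows "k \<le> j \<Longrightarrow> 0 < t - \<theta> k \<and> t - \<theta> k < 2 * pi"
    and "j < k \<Longrightarrow> 0 < \<theta> k - t \<and> \<theta> k - t < 2 * pi"
proof -
  have *: "\<theta> 5 = \<theta> 0 + 2 * pi" using fm by (simp add: five_marks_def)
  have **: "\<theta> 0 \<le> \<theta> k" "\<theta> (Suc j) \<le> \<theta> 5" "\<theta> 0 \<le> \<theta> j" "\<theta> k < \<theta> 5"
    using five_marks_mono_le[OF fm] five_marks_mono[OF fm] j k by auto
  show "0 < t - \<theta> k \<and> t - \<theta> k < 2 * pi" if "k \<le> j"
    using five_marks_mono_le[OF fm that] * ** t j by linarith
  show "0 < \<theta> k - t \<and> \<theta> k - t < 2 * pi" if "j < k"
    using five_marks_mono_le[OF fm, of "Suc j" k] that * ** t k by linarith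
qed

lemma sin_half_gap_nonzero:
  assumes "five_marks \<theta>" "j < 5" "k < 5" "\<theta> j < t" "t < \<theta> (Suc j)"
  shows "sin ((t - \<theta> k) / 2) \<noteq> 0"
proof (cases "k \<le> j")
  case True
  then have "sin ((t - \<theta> k) / 2) > 0" using five_marks_gap(1)[OF assms] by (intro sin_gt_zero) auto
  then show ?thesis by simp
next
  case False
  then have "sin ((\<theta> k - t) / 2) > 0" using five_marks_gap(2)[OF assms] by (intro sin_gt_zero) auto
  moreover have "sin ((t - \<theta> k) / 2) = - sin ((\<theta> k - t) / 2)"
    by (metis minus_diff_eq minus_divide_left sin_minus)
  ultimately show ?thesis by simp
qed

lemma five_marks_distinct:
  assumes "five_marks \<theta>" "j < 5" "k < 5" "j \<noteq> k"
  shows "cis (\<theta> j) \<noteq> cis (\<theta> k)"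
proof -
  have *: "cis (\<theta> j) \<noteq> cis (\<theta> k)" if "j < k" "k < 5" for j k
  proof
    assume "cis (\<theta> j) = cis (\<theta> k)"
    then have "cis (\<theta> k - \<theta> j) = 1" by (simp add: cis_divide[symmetric])
    then have "cos (\<theta> k - \<theta> j) = 1" by (metis cis.sel(1) one_complex.sel(1))
    moreover have "0 < \<theta> k - \<theta> j" "\<theta> k - \<theta> j < 2 * pi"
      using five_marks_mono[OF assms(1) that(1)] that five_marks_mono[OF assms(1), of k 5]
        five_marks_mono[OF assms(1), of 0 j] assms(1)
      by (cases "j = 0"; auto simp: five_marks_def)+
    ultimately have "sin ((\<theta> k - \<theta> j) / 2) > 0" "cos (\<theta> k - \<theta> j) = 1" by (auto intro!: sin_gt_zero)
    moreover have "\<theta> k - \<theta> j = 2 * ((\<theta> k - \<theta> j) / 2)" by simp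
    ultimately have "1 = 1 - 2 * (sin ((\<theta> k - \<theta> j) / 2))\<^sup>2" by (metis cos_double_sin)
    then show False using \<open>sin ((\<theta> k - \<theta> j) / 2) > 0\<close> by simp
  qed
  show ?thesis using *[of j k] *[of k j] assms by (metis nat_neq_iff)
qed

text \<open>On the circle the factor \<open>1 - z / cis (\<theta> k)\<close> has argument \<open>(t - \<theta> k) / 2 - \<pi> / 2\<close> after the mark and
  \<open>(t - \<theta> k) / 2 + \<pi> / 2\<close> before it;
  exponents of sum \<open>- 2\<close> cancel the dependence on \<open>t\<close> against the factor \<open>\<i> z\<close>, so the tangential
  component has a constant direction on each arc, which turns at a mark by \<open>\<pi>\<close> times the exponent.\<close>

lemma sc_fun_on_arc:
  assumes fm: "five_marks \<theta>" and nu: "\<And>k. k < 5 \<Longrightarrow> \<nu> k > 0" and e: "(\<Sum>k<5. e k) = - 2"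
    and j: "j < 5" and t: "\<theta> j < t" "t < \<theta> (Suc j)"
  shows "\<i> * cis t * sc_fun \<nu> \<theta> e (cis t) = of_real (arc_weight \<nu> \<theta> e t) * cis (- (pi * (\<Sum>k\<le>j. e k)))"
proof -
  define sg :: "nat \<Rightarrow> real" where "sg k = (if k \<le> j then 1 else - 1)" for k
  note before = five_marks_gap(1)[OF fm j _ t] and after = five_marks_gap(2)[OF fm j _ t]
  note sin0 = sin_half_gap_nonzero[OF fm j _ t]
  have factor: "Ln (1 - cis t * cis (- \<theta> k)) + \<i> * of_real (\<theta> k / 2) + of_real (ln (\<nu> k))
      = of_real (ln (2 * \<nu> k * \<bar>sin ((t - \<theta> k) / 2)\<bar>)) + \<i> * of_real (t / 2 - sg k * pi / 2)" if k: "k < 5" for k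
  proof (cases "k \<le> j")
    case True
    have s: "sin ((t - \<theta> k) / 2) > 0" using before[OF k True] by (intro sin_gt_zero) auto
    have "Ln (1 - cis t * cis (- \<theta> k)) = of_real (ln (2 * sin ((t - \<theta> k) / 2))) + \<i> * of_real ((t - \<theta> k) / 2 - pi / 2)"
      using Ln_one_minus_cis[of "t - \<theta> k"] before[OF k True] by (simp add: cis_mult)
    moreover have "ln (2 * \<nu> k * \<bar>sin ((t - \<theta> k) / 2)\<bar>) = ln (2 * sin ((t - \<theta> k) / 2)) + ln (\<nu> k)"
      using s nu[OF k] by (simp add: ln_mult)
    ultimately show ?thesis using True by (simp add: sg_def complex_eq_iff field_simps)
  next
    case False
    then have jk: "j < k" by simp
    have s: "sin ((\<theta> k - t) / 2) > 0" using after[OF k jk] by (intro sin_gt_zero) auto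
    have "sin ((t - \<theta> k) / 2) = - sin ((\<theta> k - t) / 2)"
      by (metis minus_diff_eq minus_divide_left sin_minus)
    then have abs: "\<bar>sin ((t - \<theta> k) / 2)\<bar> = sin ((\<theta> k - t) / 2)" using s by simp
    have "Ln (1 - cis t * cis (- \<theta> k)) = of_real (ln (2 * sin ((\<theta> k - t) / 2))) - \<i> * of_real ((\<theta> k - t) / 2 - pi / 2)"
      using Ln_one_minus_cis_uminus[of "\<theta> k - t"] after[OF k jk] by (simp add: cis_mult)
    moreover have "ln (2 * \<nu> k * \<bar>sin ((t - \<theta> k) / 2)\<bar>) = ln (2 * sin ((\<theta> k - t) / 2)) + ln (\<nu> k)"
      using s nu[OF k] unfolding abs by (simp add: ln_mult)
    ultimately show ?thesis using False by (simp add: sg_def complex_eq_iff field_simps)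
  qed
  define A where "A = (\<Sum>k<5. e k * ln (2 * \<nu> k * \<bar>sin ((t - \<theta> k) / 2)\<bar>))"
  have A: "exp A = arc_weight \<nu> \<theta> e t"
    unfolding A_def arc_weight_def exp_sum[OF finite_lessThan]
    by (rule prod.cong) (use nu sin0 in \<open>auto simp: powr_def mult.commute less_imp_neq[THEN not_sym]\<close>)
  define S where "S = (\<Sum>k\<le>j. e k)"
  have sum_sg: "(\<Sum>k<5. e k * sg k) = 2 * S + 2"
  proof -
    have "(\<Sum>k<5. e k * sg k) = (\<Sum>k<5. 2 * (if k \<le> j then e k else 0) - e k)"
      by (rule sum.cong) (auto simp: sg_def)
    also have "\<dots> = 2 * (\<Sum>k<5. if k \<le> j then e k else 0) + 2"
      using e by (simp add: sum_subtractf sum_distrib_left)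
    also have "(\<Sum>k<5. if k \<le> j then e k else 0) = S"
      unfolding S_def using j by (subst sum.inter_filter[symmetric]) (auto intro!: sum.cong)
    finally show ?thesis .
  qed
  have "(\<Sum>k<5. of_real (e k) * (Ln (1 - cis t * cis (- \<theta> k)) + \<i> * of_real (\<theta> k / 2) + of_real (ln (\<nu> k))))
     = (\<Sum>k<5. of_real (e k * ln (2 * \<nu> k * \<bar>sin ((t - \<theta> k) / 2)\<bar>)) + \<i> * of_real (e k * (t / 2) - e k * sg k * (pi / 2)))"
  proof (rule sum.cong)
    fix k :: nat assume k: "k \<in> {..<5}"
    show "of_real (e k) * (Ln (1 - cis t * cis (- \<theta> k)) + \<i> * of_real (\<theta> k / 2) + of_real (ln (\<nu> k)))
      = of_real (e k * ln (2 * \<nu> k * \<bar>sin ((t - \<theta> k) / 2)\<bar>)) + \<i> * of_real (e k * (t / 2) - e k * sg k * (pi / 2))"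
      unfolding factor[OF k[unfolded lessThan_iff]] by (simp add: algebra_simps)
  qed simp
  also have "\<dots> = of_real A + \<i> * of_real ((\<Sum>k<5. e k) * (t / 2) - (\<Sum>k<5. e k * sg k) * (pi / 2))"
  proof -
    have "(\<Sum>k<5. e k * (t / 2) - e k * sg k * (pi / 2)) = (\<Sum>k<5. e k) * (t / 2) - (\<Sum>k<5. e k * sg k) * (pi / 2)"
      by (simp only: sum_subtractf sum_distrib_right)
    then show ?thesis
      unfolding A_def by (simp only: sum.distrib of_real_sum[symmetric] sum_distrib_left[symmetric])
  qed
  also have "\<dots> = of_real A + \<i> * of_real (- t - pi * S - pi)"
    unfolding e sum_sg by (simp add: algebra_simps)
  finally have "sc_fun \<nu> \<theta> e (cis t) = \<i> * (of_real (exp A) * cis (- t - pi * S - pi))"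
    unfolding sc_fun_def by (simp add: exp_add cis_conv_exp exp_of_real)
  then have "\<i> * cis t * sc_fun \<nu> \<theta> e (cis t) = - (of_real (exp A) * (cis t * cis (- t - pi * S - pi)))"
  proof -
    have "\<i> * a * (\<i> * (b * c)) = - (b * (a * c))" for a b c :: complex
      by (simp add: mult_ac)
    then show ?thesis by (simp only: \<open>sc_fun \<nu> \<theta> e (cis t) = _\<close>)
  qed
  also have "cis t * cis (- t - pi * S - pi) = - cis (- (pi * S))"
    by (simp add: cis_mult complex_eq_iff)
  finally show ?thesis by (simp add: A S_def)
qed

lemma arc_weight_pos:
  assumes fm: "five_marks \<theta>" and nu: "\<And>k. k < 5 \<Longrightarrow> \<nu> k > 0"
    and j: "j < 5" and t: "\<theta> j < t" "t < \<theta> (Suc j)"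
  shows "arc_weight \<nu> \<theta> e t > 0"
  unfolding arc_weight_def using nu sin_half_gap_nonzero[OF fm j _ t]
  by (intro prod_pos) (auto simp: less_imp_neq[THEN not_sym])

definition arc_phase :: "(nat \<Rightarrow> real) \<Rightarrow> nat \<Rightarrow> complex" where
  "arc_phase e j = cis (- (pi * (\<Sum>k\<le>j. e k)))"

lemma arc_phase_nonzero: "arc_phase e j \<noteq> 0"
  by (simp add: arc_phase_def)

definition arc_length :: "(nat \<Rightarrow> real) \<Rightarrow> (nat \<Rightarrow> real) \<Rightarrow> (nat \<Rightarrow> real) \<Rightarrow> nat \<Rightarrow> real" where
  "arc_length \<nu> \<theta> e j = integral {\<theta> j..\<theta> (Suc j)} (arc_weight \<nu> \<theta> e)"

locale sc_data =
  fixes \<nu> \<theta> e :: "nat \<Rightarrow> real"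
  assumes fm: "five_marks \<theta>" and nu: "\<And>k. k < 5 \<Longrightarrow> \<nu> k > 0"
    and e_gt: "\<And>k. k < 5 \<Longrightarrow> e k \<ge> - 3 / 4" and e_sum: "(\<Sum>k<5. e k) = - 2"
begin

lemma sc_prim_continuous_on: "continuous_on (cball 0 1) (sc_prim \<nu> \<theta> e)"
  unfolding continuous_on_sequentially
proof clarify
  fix Z z assume "\<forall>n. Z n \<in> cball (0::complex) 1" "z \<in> cball (0::complex) 1" "Z \<longlonglongrightarrow> z"
  then have "(\<lambda>n. sc_prim \<nu> \<theta> e (Z n)) \<longlonglongrightarrow> sc_prim \<nu> \<theta> e z"
    by (intro sc_prim_tendsto[where b = "- 3 / 4"]) (use e_gt nu five_marks_distinct[OF fm] in auto)
  then show "(sc_prim \<nu> \<theta> e \<circ> Z) \<longlonglongrightarrow> sc_prim \<nu> \<theta> e z" by (simp add: o_def)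
qed

lemma cis_arc_not_mark:
  assumes j: "j < 5" and t: "\<theta> j < t" "t < \<theta> (Suc j)"
  shows "cis t \<notin> marks \<theta>"
proof
  assume "cis t \<in> marks \<theta>"
  then obtain k where k: "k < 5" "cis t = cis (\<theta> k)" by (auto simp: marks_def)
  have "cis (t - \<theta> k) = 1" using k by (simp flip: cis_divide)
  then have "cos (t - \<theta> k) = 1" by (metis cis.sel(1) one_complex.sel(1))
  moreover have "t - \<theta> k = 2 * ((t - \<theta> k) / 2)" by simp
  ultimately have "1 = 1 - 2 * (sin ((t - \<theta> k) / 2))\<^sup>2" by (metis cos_double_sin)
  then have s: "sin ((t - \<theta> k) / 2) = 0" by simp
  have "arc_weight \<nu> \<theta> (\<lambda>_. 1) t > 0" by (rule arc_weight_pos[OF fm nu j t])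
  moreover have "arc_weight \<nu> \<theta> (\<lambda>_. 1) t = 0"
    unfolding arc_weight_def using k s by (intro prod_zero) auto
  ultimately show False by simp
qed

lemma cis_arc_in_slit_plane:
  assumes "j < 5" "\<theta> j < t" "t < \<theta> (Suc j)"
  shows "cis t \<in> slit_plane \<theta>"
  using cis_arc_not_mark[OF assms] cball_minus_marks_subset_slit_plane by force

lemma sc_fun_on_arc': 
  assumes j: "j < 5" and t: "\<theta> j < t" "t < \<theta> (Suc j)"
  shows "\<i> * cis t * sc_fun \<nu> \<theta> e (cis t) = of_real (arc_weight \<nu> \<theta> e t) * arc_phase e j"
  using sc_fun_on_arc[OF fm nu e_sum j t] by (simp add: arc_phase_def)

lemma sc_prim_on_arc:
  assumes j: "j < 5" and t: "\<theta> j \<le> a" "a \<le> b" "b \<le> \<theta> (Suc j)"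
  shows "arc_weight \<nu> \<theta> e integrable_on {a..b}"
    "sc_prim \<nu> \<theta> e (cis b) - sc_prim \<nu> \<theta> e (cis a) = of_real (integral {a..b} (arc_weight \<nu> \<theta> e)) * arc_phase e j"
proof -
  have "((\<lambda>t. of_real (arc_weight \<nu> \<theta> e t) * arc_phase e j) has_integral
      (sc_prim \<nu> \<theta> e (cis b) - sc_prim \<nu> \<theta> e (cis a))) {a..b}"
  proof (rule fundamental_theorem_of_calculus_interior)
    show "continuous_on {a..b} (\<lambda>t. sc_prim \<nu> \<theta> e (cis t))"
      by (rule continuous_on_compose2[OF sc_prim_continuous_on]) (auto intro!: continuous_intros simp: cis_conv_exp)
    fix x assume x: "x \<in> {a<..<b}"
    then have x': "\<theta> j < x" "x < \<theta> (Suc j)" using t by auto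
    have "((\<lambda>z. sc_prim \<nu> \<theta> e (exp (\<i> * z))) has_field_derivative sc_fun \<nu> \<theta> e (cis x) * (\<i> * cis x)) (at (of_real x))"
      using sc_prim_derivative[OF cis_arc_in_slit_plane[OF j x']]
      by (intro DERIV_chain2[of "sc_prim \<nu> \<theta> e"]) (auto intro!: derivative_eq_intros simp: cis_conv_exp)
    then have "((\<lambda>t. sc_prim \<nu> \<theta> e (cis t)) has_vector_derivative sc_fun \<nu> \<theta> e (cis x) * (\<i> * cis x)) (at x)"
      using has_vector_derivative_real_field by (fastforce simp: cis_conv_exp)
    moreover have "sc_fun \<nu> \<theta> e (cis x) * (\<i> * cis x) = of_real (arc_weight \<nu> \<theta> e x) * arc_phase e j"
      using sc_fun_on_arc'[OF j x'] by (simp add: mult_ac)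
    ultimately show "((\<lambda>t. sc_prim \<nu> \<theta> e (cis t)) has_vector_derivative of_real (arc_weight \<nu> \<theta> e x) * arc_phase e j) (at x)"
      by simp
  qed (use t in auto)
  from has_integral_mult_left[OF this, of "inverse (arc_phase e j)"]
  have I: "((\<lambda>t. complex_of_real (arc_weight \<nu> \<theta> e t)) has_integral
      (sc_prim \<nu> \<theta> e (cis b) - sc_prim \<nu> \<theta> e (cis a)) / arc_phase e j) {a..b}"
    by (simp add: divide_inverse mult.assoc arc_phase_nonzero)
  from has_integral_Re[OF this] show int: "arc_weight \<nu> \<theta> e integrable_on {a..b}"
    by (auto simp: integrable_on_def)
  have "((\<lambda>t. complex_of_real (arc_weight \<nu> \<theta> e t)) has_integral of_real (integral {a..b} (arc_weight \<nu> \<theta> e))) {a..b}"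
    by (intro has_integral_of_real integrable_integral int)
  from has_integral_unique[OF I this]
  show "sc_prim \<nu> \<theta> e (cis b) - sc_prim \<nu> \<theta> e (cis a) = of_real (integral {a..b} (arc_weight \<nu> \<theta> e)) * arc_phase e j"
    by (simp add: field_simps arc_phase_def)
qed

lemma sc_prim_edge:
  assumes "j < 5"
  shows "sc_prim \<nu> \<theta> e (cis (\<theta> (Suc j))) - sc_prim \<nu> \<theta> e (cis (\<theta> j)) = of_real (arc_length \<nu> \<theta> e j) * arc_phase e j"
  unfolding arc_length_def using fm assms by (intro sc_prim_on_arc(2)) (auto simp: five_marks_def)

text \<open>The image of the circle is a closed Euclidean polygon with these sides.\<close>

lemma arc_length_closed: "(\<Sum>j<5. of_real (arc_length \<nu> \<theta> e j) * arc_phase e j) = 0"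
proof -
  have "(\<Sum>j<5. of_real (arc_length \<nu> \<theta> e j) * arc_phase e j)
      = (\<Sum>j<5. sc_prim \<nu> \<theta> e (cis (\<theta> (Suc j))) - sc_prim \<nu> \<theta> e (cis (\<theta> j)))"
    by (rule sum.cong) (simp_all add: sc_prim_edge)
  also have "\<dots> = sc_prim \<nu> \<theta> e (cis (\<theta> 5)) - sc_prim \<nu> \<theta> e (cis (\<theta> 0))"
    by (rule sum_lessThan_telescope[of "\<lambda>j. sc_prim \<nu> \<theta> e (cis (\<theta> j))" 5])
  also have "cis (\<theta> 5) = cis (\<theta> 0)" using fm by (simp add: five_marks_def flip: cis_mult)
  finally show ?thesis by simp
qed

end

section \<open>Weierstrass data and free boundary arcs\<close>

definition re_vec :: "(3 \<Rightarrow> complex \<Rightarrow> complex) \<Rightarrow> complex \<Rightarrow> real^3" where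
  "re_vec F z = (\<chi> i. Re (F i z))"

lemma re_vec_nth [simp]: "re_vec F z $ i = Re (F i z)"
  by (simp add: re_vec_def)

lemma re_vec_has_derivative:
  assumes "\<And>i. (F i has_field_derivative \<Phi> i) (at z)"
  shows "(re_vec F has_derivative (\<lambda>d. \<chi> i. Re (\<Phi> i * d))) (at z)"
proof -
  have "((\<lambda>z. Re (F i z)) has_derivative (\<lambda>d. Re (\<Phi> i * d))) (at z)" for i
    using assms[of i] unfolding has_field_derivative_def by (rule has_derivative_Re)
  then show ?thesis
    by (subst has_derivative_componentwise_within) (auto simp: Basis_vec_def inner_axis)
qed

lemma partial_deriv_re_vec:
  assumes "open U" "z \<in> U" "\<And>w. w \<in> U \<Longrightarrow> X w = re_vec F w"
    and "\<And>i. (F i has_field_derivative \<Phi> i z) (at z)"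
  shows "X differentiable (at z)" "partial_deriv d X z = re_vec (\<lambda>i w. \<Phi> i w * d) z"
proof -
  have "(X has_derivative (\<lambda>d. \<chi> i. Re (\<Phi> i z * d))) (at z)"
    by (rule has_derivative_transform_within_open[OF re_vec_has_derivative[of F "\<lambda>i. \<Phi> i z" z] assms(1,2)])
       (use assms(3,4) in auto)
  then show "X differentiable (at z)" "partial_deriv d X z = re_vec (\<lambda>i w. \<Phi> i w * d) z"
    unfolding partial_deriv_def
    by (auto simp: differentiable_def frechet_derivative_at[symmetric] re_vec_def)
qed

text \<open>The Weierstrass representation: the real part of a null holomorphic curve is a conformally
  parametrized minimal surface.\<close>

locale weierstrass_data =
  fixes U :: "complex set" and F \<Phi> :: "3 \<Rightarrow> complex \<Rightarrow> complex"
  assumes open_U: "open U"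
    and deriv_F: "\<And>i z. z \<in> U \<Longrightarrow> (F i has_field_derivative \<Phi> i z) (at z)"
    and null: "\<And>z. z \<in> U \<Longrightarrow> (\<Phi> 1 z)\<^sup>2 + (\<Phi> 2 z)\<^sup>2 + (\<Phi> 3 z)\<^sup>2 = 0"
    and regular: "\<And>z. z \<in> U \<Longrightarrow> \<Phi> 3 z \<noteq> 0"
begin

lemma holomorphic_F: "F i holomorphic_on U"
  using deriv_F open_U by (auto simp: holomorphic_on_open)

lemma holomorphic_Phi: "\<Phi> i holomorphic_on U"
proof -
  have "deriv (F i) holomorphic_on U" by (intro holomorphic_deriv holomorphic_F open_U)
  moreover have "deriv (F i) z = \<Phi> i z" if "z \<in> U" for z using deriv_F[OF that] by (rule DERIV_imp_deriv)
  ultimately show ?thesis by (simp cong: holomorphic_cong)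
qed

lemma deriv_Phi: "z \<in> U \<Longrightarrow> (\<Phi> i has_field_derivative deriv (\<Phi> i) z) (at z)"
  using holomorphic_Phi open_U by (rule holomorphic_derivI)

lemma partial: "z \<in> U \<Longrightarrow> partial_deriv d (re_vec F) z = re_vec (\<lambda>i w. \<Phi> i w * d) z"
  by (rule partial_deriv_re_vec(2)[OF open_U]) (auto intro: deriv_F)

lemma partial_partial:
  assumes "z \<in> U"
  shows "partial_deriv d (re_vec F) differentiable (at z)"
    "partial_deriv d' (partial_deriv d (re_vec F)) z = re_vec (\<lambda>i w. deriv (\<Phi> i) w * d * d') z"
proof -
  have *: "((\<lambda>w. \<Phi> i w * d) has_field_derivative deriv (\<Phi> i) z * d) (at z)" for i
    using deriv_Phi[OF assms] by (auto intro!: derivative_eq_intros)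
  show "partial_deriv d (re_vec F) differentiable (at z)"
    by (rule partial_deriv_re_vec(1)[where F = "\<lambda>i w. \<Phi> i w * d" and \<Phi> = "\<lambda>i w. deriv (\<Phi> i) w * d"])
       (use open_U assms partial * in auto)
  show "partial_deriv d' (partial_deriv d (re_vec F)) z = re_vec (\<lambda>i w. deriv (\<Phi> i) w * d * d') z"
    by (rule partial_deriv_re_vec(2)[where F = "\<lambda>i w. \<Phi> i w * d" and \<Phi> = "\<lambda>i w. deriv (\<Phi> i) w * d"])
       (use open_U assms partial * in auto)
qed

lemma continuous_re_vec:
  assumes "\<And>i. G i holomorphic_on U"
  shows "continuous_on U (re_vec G)"
  unfolding re_vec_def [abs_def]
  by (intro continuous_on_vec_lambda continuous_intros holomorphic_on_imp_continuous_on assms)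

lemma C2_surface: "C2_surface_on U (re_vec F)"
proof -
  have c1: "continuous_on U (partial_deriv d (re_vec F))" for d
  proof -
    have "continuous_on U (re_vec (\<lambda>i w. \<Phi> i w * d))"
      by (intro continuous_re_vec holomorphic_intros holomorphic_Phi)
    then show ?thesis by (rule continuous_on_eq) (simp add: partial)
  qed
  have c2: "continuous_on U (partial_deriv d' (partial_deriv d (re_vec F)))" for d d'
  proof -
    have "continuous_on U (re_vec (\<lambda>i w. deriv (\<Phi> i) w * d * d'))"
      by (intro continuous_re_vec holomorphic_intros holomorphic_deriv holomorphic_Phi open_U)
    then show ?thesis by (rule continuous_on_eq) (simp add: partial_partial)
  qed
  have "re_vec F differentiable (at z)" if "z \<in> U" for z
    by (rule partial_deriv_re_vec(1)[where F = F and \<Phi> = \<Phi> and U = U]) (use open_U that deriv_F in auto)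
  then show ?thesis
    unfolding C2_surface_on_def C1_surface_on_def using partial_partial(1) c1 c2 by auto
qed

lemma conformal:
  assumes "z \<in> U"
  shows "partial_deriv 1 (re_vec F) z \<bullet> partial_deriv 1 (re_vec F) z
       = partial_deriv \<i> (re_vec F) z \<bullet> partial_deriv \<i> (re_vec F) z"
    "partial_deriv 1 (re_vec F) z \<bullet> partial_deriv \<i> (re_vec F) z = 0"
    "partial_deriv 1 (re_vec F) z \<bullet> partial_deriv 1 (re_vec F) z > 0"
proof -
  have sum: "x \<bullet> y = x $ 1 * y $ 1 + x $ 2 * y $ 2 + x $ 3 * y $ 3" for x y :: "real^3"
    by (simp add: inner_vec_def sum_3)
  have re: "(Re (\<Phi> 1 z))\<^sup>2 + (Re (\<Phi> 2 z))\<^sup>2 + (Re (\<Phi> 3 z))\<^sup>2 = (Im (\<Phi> 1 z))\<^sup>2 + (Im (\<Phi> 2 z))\<^sup>2 + (Im (\<Phi> 3 z))\<^sup>2"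
    using arg_cong[OF null[OF assms], of Re] by (simp add: power2_eq_square)
  have im: "Re (\<Phi> 1 z) * Im (\<Phi> 1 z) + Re (\<Phi> 2 z) * Im (\<Phi> 2 z) + Re (\<Phi> 3 z) * Im (\<Phi> 3 z) = 0"
    using arg_cong[OF null[OF assms], of Im] by (simp add: power2_eq_square algebra_simps)
  show 1: "partial_deriv 1 (re_vec F) z \<bullet> partial_deriv 1 (re_vec F) z
       = partial_deriv \<i> (re_vec F) z \<bullet> partial_deriv \<i> (re_vec F) z"
    using re by (simp add: partial[OF assms] sum power2_eq_square)
  show "partial_deriv 1 (re_vec F) z \<bullet> partial_deriv \<i> (re_vec F) z = 0"
    using im by (simp add: partial[OF assms] sum)
  show "partial_deriv 1 (re_vec F) z \<bullet> partial_deriv 1 (re_vec F) z > 0"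
  proof (rule ccontr)
    assume "\<not> ?thesis"
    then have "partial_deriv 1 (re_vec F) z = 0" by simp
    then have "partial_deriv \<i> (re_vec F) z = 0" using 1 by simp
    with \<open>partial_deriv 1 (re_vec F) z = 0\<close> have "Re (\<Phi> 3 z) = 0" "Im (\<Phi> 3 z) = 0"
      by (auto simp: partial[OF assms] vec_eq_iff)
    then show False using regular[OF assms] by (simp add: complex_eq_iff)
  qed
qed

lemma regular_at:
  assumes "z \<in> U"
  shows "regular_at (re_vec F) z"
  using norm_cross_dot[of "partial_deriv 1 (re_vec F) z" "partial_deriv \<i> (re_vec F) z"] conformal[OF assms]
  by (auto simp: regular_at_def power_mult_distrib power2_norm_eq_inner)

lemma mean_curvature_zero:
  assumes "z \<in> U"
  shows "mean_curvature (re_vec F) z = 0"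
proof -
  have "partial_deriv \<i> (partial_deriv \<i> (re_vec F)) z = - partial_deriv 1 (partial_deriv 1 (re_vec F)) z"
    by (simp add: partial_partial[OF assms] vec_eq_iff)
  then show ?thesis
    using conformal[OF assms] by (simp add: mean_curvature_def Let_def)
qed

lemma normal_orthogonal:
  assumes "z \<in> U"
  shows "unit_normal (re_vec F) z \<bullet> re_vec (\<lambda>i w. \<Phi> i w * d) z = 0"
proof -
  have "re_vec (\<lambda>i w. \<Phi> i w * d) z = Re d *\<^sub>R partial_deriv 1 (re_vec F) z + Im d *\<^sub>R partial_deriv \<i> (re_vec F) z"
    by (simp add: partial[OF assms] vec_eq_iff algebra_simps)
  then show ?thesis
    by (simp add: unit_normal_def sgn_div_norm inner_add_right dot_cross_self inner_commute)
qed

end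

text \<open>A harmonic function with vanishing normal derivative along an arc has no maximum there:
  reflected in the arc it would have an interior maximum.\<close>

lemma neumann_arc_max_constant:
  fixes g :: "complex \<Rightarrow> complex"
  assumes U: "open U" "connected U" and g: "g holomorphic_on U"
    and d: "\<delta> > 0" "\<And>t. \<bar>t - t0\<bar> < \<delta> \<Longrightarrow> cis t \<in> U \<and> Im (g (cis t)) = Im (g (cis t0))"
    and max: "\<And>z. z \<in> U \<Longrightarrow> norm z \<le> 1 \<Longrightarrow> Re (g z) \<le> Re (g (cis t0))"
  shows "g constant_on U"
proof -
  let ?e = "\<lambda>w. cis t0 * exp (\<i> * w)"
  have e_real: "?e (of_real t) = cis (t0 + t)" for t by (simp add: cis_conv_exp exp_add distrib_left)
  have "open (?e -` U)" by (intro open_vimage U(1) continuous_intros)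
  moreover have "0 \<in> ?e -` U" using d(2)[of t0] d(1) by simp
  ultimately obtain r0 where r0': "r0 > 0" "ball 0 r0 \<subseteq> ?e -` U" by (meson openE)
  then have r0: "r0 > 0" "\<And>w. norm w < r0 \<Longrightarrow> ?e w \<in> U" by (auto simp: subset_iff)
  define r where "r = min r0 \<delta>"
  define B where "B = ball (0::complex) r"
  have r: "r > 0" and B: "open B" "connected B" "0 \<in> B" using r0 d by (auto simp: r_def B_def)
  have eU: "?e w \<in> U" if "w \<in> B" for w using r0 that by (auto simp: B_def r_def)
  \<comment> \<open>in the coordinate \<open>w\<close> the arc is the real axis; \<open>H\<close> is real there, hence symmetric by reflection\<close>
  define H where "H w = g (?e w) - \<i> * of_real (Im (g (cis t0)))" for w
  have eh: "?e holomorphic_on B" by (intro holomorphic_intros)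
  have holH: "H holomorphic_on B"
    unfolding H_def [abs_def]
    by (intro holomorphic_intros holomorphic_on_compose_gen[OF eh g, unfolded o_def]) (use eU in auto)
  have cnjB: "cnj w \<in> B" if "w \<in> B" for w using that by (simp add: B_def)
  have holH': "(\<lambda>w. cnj (H (cnj w))) holomorphic_on B"
  proof -
    have "cnj ` B = B" using cnjB by force
    then have "(cnj \<circ> H \<circ> cnj) holomorphic_on B"
      using holH B by (intro holomorphic_on_compose_cnj_cnj) auto
    then show ?thesis by (simp add: o_def)
  qed
  have real: "cnj (H (of_real t)) = H (of_real t)" if "\<bar>t\<bar> < r" for t
    using d(2)[of "t0 + t"] that by (simp add: H_def e_real complex_eq_iff r_def)
  have sym: "H w - cnj (H (cnj w)) = 0" if "w \<in> B" for w
  proof (rule analytic_continuation[of "\<lambda>w. H w - cnj (H (cnj w))" B "of_real ` {-r<..<r}" 0 w])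
    show "(\<lambda>w. H w - cnj (H (cnj w))) holomorphic_on B" by (intro holomorphic_intros holH holH')
    show "of_real ` {-r<..<r} \<subseteq> B" by (auto simp: B_def)
    show "0 islimpt complex_of_real ` {-r<..<r}"
    proof (rule islimpt_approachable[THEN iffD2], clarify)
      fix \<epsilon> :: real assume "\<epsilon> > 0"
      define m where "m = min r \<epsilon> / 2"
      have *: "m \<in> {-r<..<r}" "0 < m" "m < \<epsilon>" using r \<open>\<epsilon> > 0\<close> by (auto simp: m_def)
      show "\<exists>x'\<in>complex_of_real ` {-r<..<r}. x' \<noteq> 0 \<and> dist x' 0 < \<epsilon>"
        by (rule bexI[OF _ imageI[OF *(1)]]) (use *(2,3) in \<open>simp add: dist_norm norm_of_real\<close>)
    qed
    show "H z - cnj (H (cnj z)) = 0" if "z \<in> of_real ` {-r<..<r}" for z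
      using that real by auto
  qed (use B that in auto)
  \<comment> \<open>the half plane \<open>Im w \<ge> 0\<close> corresponds to the disk, and reflection covers the other half\<close>
  have Hmax: "Re (H w) \<le> Re (H 0)" if w: "w \<in> B" for w
  proof -
    have up: "Re (H w) \<le> Re (H 0)" if "w \<in> B" "Im w \<ge> 0" for w
      using max[OF eU[OF that(1)]] that(2) by (simp add: H_def norm_mult)
    show ?thesis
    proof (cases "Im w \<ge> 0")
      case False
      then have "Re (H (cnj w)) \<le> Re (H 0)" using up[of "cnj w"] cnjB[OF w] by simp
      then show ?thesis using sym[OF w] by (simp add: complex_eq_iff)
    qed (use up w in auto)
  qed
  have "(\<lambda>w. exp (H w)) constant_on B"
    by (rule maximum_modulus_principle[of _ B B 0]) (use holH B Hmax in \<open>auto intro!: holomorphic_intros\<close>)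
  then obtain c where c: "\<And>w. w \<in> B \<Longrightarrow> exp (H w) = c" by (auto simp: constant_on_def)
  have dg: "deriv g (?e w) = 0" if w: "w \<in> B" for w
  proof -
    have "(g has_field_derivative deriv g (?e w)) (at (?e w))" by (rule holomorphic_derivI[OF g U(1) eU[OF w]])
    moreover have "(?e has_field_derivative \<i> * ?e w) (at w)" by (auto intro!: derivative_eq_intros)
    ultimately have "((\<lambda>w. g (?e w)) has_field_derivative deriv g (?e w) * (\<i> * ?e w)) (at w)"
      by (rule DERIV_chain2)
    then have "((\<lambda>w. exp (H w)) has_field_derivative exp (H w) * (deriv g (?e w) * (\<i> * ?e w))) (at w)"
      unfolding H_def by (auto intro!: derivative_eq_intros)
    moreover have "((\<lambda>w. exp (H w)) has_field_derivative 0) (at w)"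
    proof -
      have "((\<lambda>w. c) has_field_derivative 0) (at w)" by simp
      then show ?thesis
        by (rule DERIV_cong_ev[THEN iffD1, rotated -1]) (use c B w in \<open>auto simp: eventually_nhds intro!: exI[of _ B]\<close>)
    qed
    ultimately have "exp (H w) * (deriv g (?e w) * (\<i> * ?e w)) = 0" by (rule DERIV_unique)
    then show ?thesis by simp
  qed
  have "deriv g z = 0" if "z \<in> U" for z
  proof (rule analytic_continuation[of "deriv g" U "cis ` {t0-r<..<t0+r}" "cis t0"])
    show "deriv g holomorphic_on U" by (intro holomorphic_deriv g U)
    show "cis ` {t0-r<..<t0+r} \<subseteq> U" using d by (auto simp: r_def)
    show "cis t0 \<in> U" using d by auto
    show "cis t0 islimpt cis ` {t0-r<..<t0+r}"
      unfolding islimpt_sequential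
    proof (intro exI conjI allI)
      define m where "m = min r 1"
      define f where "f n = cis (t0 + m / real (n + 2))" for n
      have m: "m > 0" "m \<le> 1" "m \<le> r" using r by (auto simp: m_def)
      show "f n \<in> cis ` {t0-r<..<t0+r} - {cis t0}" for n
      proof -
        have *: "0 < m / real (n + 2)" "m / real (n + 2) < r" "m / real (n + 2) < 1"
          using m by (auto simp: field_simps) (smt (verit) mult_nonneg_nonneg of_nat_0_le_iff)+
        have "f n \<noteq> cis t0"
        proof
          assume "f n = cis t0"
          then have "cis (m / real (n + 2)) = 1" by (simp add: f_def cis_mult[symmetric])
          then have "sin (m / real (n + 2)) = 0" by (metis cis.sel(2) one_complex.sel(2))
          moreover have "sin (m / real (n + 2)) > 0" using * pi_gt3 by (intro sin_gt_zero) linarith+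
          ultimately show False by simp
        qed
        moreover have "f n \<in> cis ` {t0-r<..<t0+r}" using * by (auto simp: f_def)
        ultimately show ?thesis by auto
      qed
      have "(\<lambda>n. m * (1 / real (n + 2))) \<longlonglongrightarrow> m * 0"
        by (intro tendsto_mult tendsto_const LIMSEQ_ignore_initial_segment[OF lim_1_over_n])
      then have "(\<lambda>n. exp (\<i> * of_real (t0 + m / real (n + 2)))) \<longlonglongrightarrow> exp (\<i> * of_real (t0 + 0))"
        by (intro tendsto_intros) auto
      then show "f \<longlonglongrightarrow> cis t0" by (simp add: f_def [abs_def] cis_conv_exp)
    qed
    show "deriv g z = 0" if z: "z \<in> cis ` {t0-r<..<t0+r}" for z
    proof -
      obtain t where t: "z = cis t" "t0 - r < t" "t < t0 + r" using z by auto
      have "?e (of_real (t - t0)) = z" unfolding e_real t by simp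
      moreover have "of_real (t - t0) \<in> B" using t by (auto simp: B_def simp del: of_real_diff)
      ultimately show ?thesis using dg by metis
    qed
  qed (use U that in auto)
  then have "(g has_field_derivative 0) (at z)" if "z \<in> U" for z
    using holomorphic_derivI[OF g U(1) that] that by simp
  then show ?thesis
    using has_field_derivative_0_imp_constant_on[OF _ U(2)] U(1) by auto
qed

text \<open>A coordinate of the surface is only bounded directly on part of the boundary, namely on \<open>sphere 0 1 - N\<close>.
  On the rest its conjugate is constant, so its normal derivative vanishes and no maximum can
  be attained there.\<close>

lemma mixed_boundary_max:
  fixes g :: "complex \<Rightarrow> complex"
  assumes U: "open U" "connected U" "ball 0 1 \<subseteq> U" and g: "g holomorphic_on U"
    and cont: "continuous_on (cball 0 1) g" and nc: "\<not> g constant_on U"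
    and dirichlet: "\<And>z. z \<in> sphere 0 1 - N \<Longrightarrow> Re (g z) \<le> M"
    and neumann: "\<And>z. z \<in> N \<Longrightarrow> \<exists>t0 \<delta>. z = cis t0 \<and> \<delta> > 0 \<and> (\<forall>t. \<bar>t - t0\<bar> < \<delta> \<longrightarrow> cis t \<in> U \<and> Im (g (cis t)) = Im (g z))"
  shows "\<And>z. z \<in> cball 0 1 \<Longrightarrow> Re (g z) \<le> M"
    and "\<And>z. z \<in> ball 0 1 \<union> N \<Longrightarrow> Re (g z) < M"
proof -
  have excl: False if z: "z \<in> ball 0 1 \<union> N" and mx: "\<And>w. w \<in> cball 0 1 \<Longrightarrow> Re (g w) \<le> Re (g z)" for z
  proof (cases "z \<in> N")
    case True
    obtain t0 where "\<exists>\<delta>. z = cis t0 \<and> \<delta> > 0 \<and> (\<forall>t. \<bar>t - t0\<bar> < \<delta> \<longrightarrow> cis t \<in> U \<and> Im (g (cis t)) = Im (g z))"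
      using neumann[OF True] by (rule exE)
    then obtain \<delta> where
      t: "z = cis t0 \<and> \<delta> > 0 \<and> (\<forall>t. \<bar>t - t0\<bar> < \<delta> \<longrightarrow> cis t \<in> U \<and> Im (g (cis t)) = Im (g z))"
      by (rule exE)
    have t': "z = cis t0" "\<delta> > 0" "\<And>s. \<bar>s - t0\<bar> < \<delta> \<Longrightarrow> cis s \<in> U \<and> Im (g (cis s)) = Im (g z)"
      using t by blast+
    have "g constant_on U"
    proof (rule neumann_arc_max_constant[OF U(1,2) g t'(2)])
      show "cis s \<in> U \<and> Im (g (cis s)) = Im (g (cis t0))" if "\<bar>s - t0\<bar> < \<delta>" for s
        using t'(3)[OF that] unfolding t'(1) .
      show "Re (g w) \<le> Re (g (cis t0))" if "norm w \<le> 1" for w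
        using mx[of w] that unfolding t'(1) by (simp only: mem_cball_0)
    qed
    then show False using nc by contradiction
  next
    case False
    then have zb: "z \<in> ball 0 1" using z by auto
    have "(\<lambda>w. exp (g w)) constant_on ball 0 1"
      by (rule maximum_modulus_principle[of _ "ball 0 1" "ball 0 1" z])
         (use zb mx holomorphic_on_subset[OF g U(3)] in \<open>auto intro!: holomorphic_intros\<close>)
    then obtain c where c: "\<And>w. w \<in> ball 0 1 \<Longrightarrow> exp (g w) = c" by (auto simp: constant_on_def)
    have "exp (g w) = c" if "w \<in> U" for w
    proof -
      have "exp (g w) - c = 0"
        by (rule analytic_continuation[of "\<lambda>w. exp (g w) - c" U "ball 0 1" 0])
           (use c that U g in \<open>auto intro!: holomorphic_intros interior_limit_point simp: interior_open\<close>)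
      then show ?thesis by simp
    qed
    then have ex: "\<And>w. w \<in> U \<Longrightarrow> exp (g w) = c" .
    have "(g has_field_derivative 0) (at w)" if w: "w \<in> U" for w
    proof -
      have 1: "((\<lambda>w. exp (g w)) has_field_derivative exp (g w) * deriv g w) (at w)"
        using holomorphic_derivI[OF g U(1) w] by (auto intro!: derivative_eq_intros)
      have "((\<lambda>w. c) has_field_derivative 0) (at w)" by simp
      then have "((\<lambda>w. exp (g w)) has_field_derivative 0) (at w)"
        by (rule DERIV_cong_ev[THEN iffD1, rotated -1]) (use ex U w in \<open>auto simp: eventually_nhds intro!: exI[of _ U]\<close>)
      from DERIV_unique[OF 1 this] holomorphic_derivI[OF g U(1) w] show ?thesis by simp
    qed
    then have "g constant_on U" using has_field_derivative_0_imp_constant_on[OF _ U(2)] U(1) by auto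
    then show False using nc by contradiction
  qed
  have "compact (cball (0::complex) 1)" by simp
  moreover have "cball (0::complex) 1 \<noteq> {}" by simp
  moreover have "continuous_on (cball 0 1) (\<lambda>z. Re (g z))" by (intro continuous_intros cont)
  ultimately obtain z where z: "z \<in> cball 0 1" "\<And>w. w \<in> cball 0 1 \<Longrightarrow> Re (g w) \<le> Re (g z)"
    by (meson continuous_attains_sup)
  then have "z \<notin> ball 0 1 \<union> N" using excl by blast
  then have "z \<in> sphere 0 1 - N" using z(1) by auto
  then show le: "Re (g w) \<le> M" if "w \<in> cball 0 1" for w
    using dirichlet z(2)[OF that] by fastforce
  show "Re (g w) < M" if w: "w \<in> ball 0 1 \<union> N" for w
  proof (rule ccontr)
    assume "\<not> Re (g w) < M"
    then show False using excl[OF w] le by (meson not_less order_trans)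
  qed
qed

section \<open>Edge integrals\<close>

lemma continuous_dominated_integrable:
  fixes f g :: "real \<Rightarrow> real"
  assumes "continuous_on {a<..<b} f" "g integrable_on {a..b}" "\<And>t. t \<in> {a<..<b} \<Longrightarrow> \<bar>f t\<bar> \<le> g t"
  shows "f integrable_on {a..b}"
proof -
  have "f \<in> borel_measurable (lebesgue_on {a<..<b})"
    by (rule continuous_imp_measurable_on_sets_lebesgue[OF assms(1)]) simp
  moreover have "g integrable_on {a<..<b}" using assms(2) by (simp add: integrable_on_open_interval_real)
  ultimately have "f integrable_on {a<..<b}"
    by (rule measurable_bounded_by_integrable_imp_integrable) (use assms(3) in auto)
  then show ?thesis by (simp add: integrable_on_open_interval_real)
qed

lemma integral_open_cong:
  fixes f g :: "real \<Rightarrow> real"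
  assumes "\<And>t. t \<in> {a<..<b} \<Longrightarrow> f t = g t"
  shows "integral {a..b} f = integral {a..b} g"
proof -
  have "integral {a<..<b} f = integral {a<..<b} g" using assms by (rule integral_cong)
  then show ?thesis by (simp add: integral_open_interval_real)
qed

lemma integral_open_mono:
  fixes f g :: "real \<Rightarrow> real"
  assumes "f integrable_on {a..b}" "g integrable_on {a..b}" "\<And>t. t \<in> {a<..<b} \<Longrightarrow> f t \<le> g t"
  shows "integral {a..b} f \<le> integral {a..b} g"
proof -
  have "integral {a<..<b} f \<le> integral {a<..<b} g"
    by (rule integral_le) (use assms in \<open>auto simp: integrable_on_open_interval_real\<close>)
  then show ?thesis by (simp add: integral_open_interval_real)
qed

lemma integral_ge_subinterval:
  fixes f :: "real \<Rightarrow> real"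
  assumes "f integrable_on {a..b}" "\<And>t. t \<in> {a<..<b} \<Longrightarrow> 0 \<le> f t"
    and "a \<le> c" "c \<le> d" "d \<le> b" "\<And>t. t \<in> {c<..<d} \<Longrightarrow> m \<le> f t"
  shows "m * (d - c) \<le> integral {a..b} f"
proof -
  have sub: "f integrable_on {c..d}" by (rule integrable_on_subinterval[OF assms(1)]) (use assms in auto)
  have "m * (d - c) = integral {c..d} (\<lambda>_. m)" using assms by simp
  also have "\<dots> \<le> integral {c..d} f"
    by (rule integral_open_mono) (use sub assms in auto)
  also have "\<dots> = integral {c<..<d} f" by (simp add: integral_open_interval_real)
  also have "\<dots> \<le> integral {a<..<b} f"
    by (rule integral_subset_le) (use sub assms in \<open>auto simp: integrable_on_open_interval_real\<close>)
  finally show ?thesis by (simp add: integral_open_interval_real)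
qed

lemma integral_pos_open:
  fixes f :: "real \<Rightarrow> real"
  assumes "f integrable_on {a..b}" "continuous_on {a<..<b} f" "\<And>t. t \<in> {a<..<b} \<Longrightarrow> 0 \<le> f t"
    and c: "c \<in> {a<..<b}" "f c > 0"
  shows "0 < integral {a..b} f"
proof -
  have "isCont f c" using assms(2) c by (simp add: continuous_on_eq_continuous_at)
  then have "eventually (\<lambda>t. f t > f c / 2) (at c)"
    using c(2) unfolding isCont_def by (intro order_tendstoD(1)) auto
  then obtain d where d: "d > 0" "\<And>t. t \<noteq> c \<Longrightarrow> dist t c < d \<Longrightarrow> f t > f c / 2"
    by (auto simp: eventually_at)
  define e where "e = min d (b - c)"
  have e: "e > 0" "c + e \<le> b" using d c by (auto simp: e_def)
  have "f c / 2 * (c + e - c) \<le> integral {a..b} f"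
    by (rule integral_ge_subinterval[OF assms(1,3)])
       (use c e d in \<open>auto simp: dist_real_def e_def intro!: less_imp_le\<close>)
  moreover have "f c / 2 * (c + e - c) > 0" using e c by simp
  ultimately show ?thesis by linarith
qed

lemma integral_open_strict_mono:
  fixes f g :: "real \<Rightarrow> real"
  assumes "a < b" "f integrable_on {a..b}" "g integrable_on {a..b}"
    "continuous_on {a<..<b} f" "continuous_on {a<..<b} g" "\<And>t. t \<in> {a<..<b} \<Longrightarrow> f t < g t"
  shows "integral {a..b} f < integral {a..b} g"
proof -
  have "0 < integral {a..b} (\<lambda>t. g t - f t)"
    by (rule integral_pos_open[where c = "(a + b) / 2"])
       (use assms in \<open>auto intro!: integrable_diff continuous_intros simp: less_imp_le\<close>)
  then show ?thesis using assms by (simp add: integral_diff)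
qed

lemma integral_diff_scaled:
  fixes f g :: "real \<Rightarrow> real"
  assumes "f integrable_on S" "g integrable_on S"
  shows "integral S (\<lambda>t. f t - c * g t) = integral S f - c * integral S g"
proof -
  have "integral S (\<lambda>t. f t - c * g t) = integral S f - integral S (\<lambda>t. c * g t)"
    by (rule integral_diff[OF assms(1) integrable_on_mult_right[OF assms(2)]])
  also have "integral S (\<lambda>t. c * g t) = c * integral S g" by (rule integral_mult_right)
  finally show ?thesis .
qed

text \<open>Chebyshev's inequality: the weight \<open>w r\<close> gives an increasing function a larger mean than \<open>w\<close>,
  because the mean \<open>m\<close> of \<open>f\<close> for \<open>w\<close> is attained at some \<open>t0\<close> and \<open>(r - r t0) (f - m)\<close> is nonnegative.\<close>

lemma chebyshev_strict:
  fixes w r f :: "real \<Rightarrow> real"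
  assumes ab: "a < b"
    and int: "w integrable_on {a..b}" "(\<lambda>t. w t * r t) integrable_on {a..b}"
      "(\<lambda>t. w t * f t) integrable_on {a..b}" "(\<lambda>t. w t * r t * f t) integrable_on {a..b}"
    and cont: "continuous_on {a<..<b} w" "continuous_on {a<..<b} r" "continuous_on {a<..<b} f"
    and w: "\<And>t. t \<in> {a<..<b} \<Longrightarrow> w t > 0"
    and mono: "strict_mono_on {a<..<b} r" "strict_mono_on {a<..<b} f"
  shows "integral {a..b} (\<lambda>t. w t * r t) * integral {a..b} (\<lambda>t. w t * f t)
       < integral {a..b} w * integral {a..b} (\<lambda>t. w t * r t * f t)"
proof -
  define W where "W = integral {a..b} w"
  define m where "m = integral {a..b} (\<lambda>t. w t * f t) / W"
  have mid: "(a + b) / 2 \<in> {a<..<b}" using ab by auto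
  have W: "W > 0" unfolding W_def
    by (rule integral_pos_open[OF int(1) cont(1) _ mid]) (use w mid in \<open>auto intro: less_imp_le\<close>)
  have zero: "integral {a..b} (\<lambda>t. w t * f t - m * w t) = 0"
  proof -
    have "integral {a..b} (\<lambda>t. w t * f t - m * w t) = integral {a..b} (\<lambda>t. w t * f t) - m * W"
      unfolding W_def by (rule integral_diff_scaled) (use int in auto)
    then show ?thesis using W by (simp add: m_def)
  qed
  have "\<exists>t0\<in>{a<..<b}. f t0 = m"
  proof (rule ccontr)
    assume no: "\<not> ?thesis"
    have "connected (f ` {a<..<b})" by (rule connected_continuous_image[OF cont(3)]) simp
    then have iv: "is_interval (f ` {a<..<b})" by (simp add: is_interval_connected_1)
    have "(\<forall>t\<in>{a<..<b}. f t < m) \<or> (\<forall>t\<in>{a<..<b}. f t > m)"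
    proof (rule ccontr)
      assume "\<not> ?thesis"
      then obtain s t where "s \<in> {a<..<b}" "t \<in> {a<..<b}" "m \<le> f s" "f t \<le> m"
        by (meson not_less)
      then have "m \<in> f ` {a<..<b}" using iv unfolding is_interval_1 by blast
      then show False using no by auto
    qed
    then show False
    proof
      assume less: "\<forall>t\<in>{a<..<b}. f t < m"
      have "0 < integral {a..b} (\<lambda>t. m * w t - w t * f t)"
      proof (rule integral_pos_open[OF _ _ _ mid])
        show "0 \<le> m * w t - w t * f t" if "t \<in> {a<..<b}" for t
        proof -
          have "f t < m" using less that by blast
          then have "w t * f t < w t * m" using w[OF that] by simp
          then show ?thesis by (simp add: mult.commute)
        qed
        show "0 < m * w ((a + b) / 2) - w ((a + b) / 2) * f ((a + b) / 2)"
          using w[OF mid] less mid mult_strict_left_mono[of "f ((a + b) / 2)" m "w ((a + b) / 2)"]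
          by (metis diff_gt_0_iff_gt mult.commute)
      qed (use int cont in \<open>auto intro!: integrable_diff integrable_on_mult_right continuous_intros\<close>)
      moreover have "integral {a..b} (\<lambda>t. m * w t - w t * f t) = - integral {a..b} (\<lambda>t. w t * f t - m * w t)"
        by (simp flip: integral_neg)
      ultimately show False using zero by simp
    next
      assume less: "\<forall>t\<in>{a<..<b}. f t > m"
      have "0 < integral {a..b} (\<lambda>t. w t * f t - m * w t)"
      proof (rule integral_pos_open[OF _ _ _ mid])
        show "0 \<le> w t * f t - m * w t" if "t \<in> {a<..<b}" for t
        proof -
          have "m < f t" using less that by blast
          then have "w t * m < w t * f t" using w[OF that] by simp
          then show ?thesis by (simp add: mult.commute)
        qed
        show "0 < w ((a + b) / 2) * f ((a + b) / 2) - m * w ((a + b) / 2)"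
          using w[OF mid] less mid mult_strict_left_mono[of m "f ((a + b) / 2)" "w ((a + b) / 2)"]
          by (metis diff_gt_0_iff_gt mult.commute)
      qed (use int cont in \<open>auto intro!: integrable_diff integrable_on_mult_right continuous_intros\<close>)
      then show False using zero by simp
    qed
  qed
  then obtain t0 where t0: "t0 \<in> {a<..<b}" "f t0 = m" by auto
  define R where "R = r t0"
  have pos: "0 < (r t - R) * (f t - m)" if t: "t \<in> {a<..<b}" "t \<noteq> t0" for t
  proof (cases "t < t0")
    case True
    then have "r t < R" "f t < m"
      using mono t t0 by (auto simp: R_def strict_mono_on_def)
    then show ?thesis by (simp add: mult_neg_neg)
  next
    case False
    then have "R < r t" "m < f t"
      using mono t t0 by (auto simp: R_def strict_mono_on_def)
    then show ?thesis by simp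
  qed
  \<comment> \<open>any point other than \<open>t0\<close>, to get a strict inequality\<close>
  define c where "c = (if t0 = (a + b) / 2 then (a + 3 * b) / 4 else (a + b) / 2)"
  have c: "c \<in> {a<..<b}" "c \<noteq> t0" using ab by (auto simp: c_def)
  let ?g = "\<lambda>t. w t * r t * f t - m * (w t * r t) - R * (w t * f t - m * w t)"
  have g: "?g t = w t * ((r t - R) * (f t - m))" for t by (simp add: algebra_simps)
  have "0 < integral {a..b} ?g"
  proof (rule integral_pos_open[OF _ _ _ c(1)])
    show "?g integrable_on {a..b}"
      using int by (intro integrable_diff integrable_on_mult_right) auto
    show "continuous_on {a<..<b} ?g" using cont by (intro continuous_intros)
    show "0 \<le> ?g t" if "t \<in> {a<..<b}" for t
      unfolding g using w[OF that] pos[OF that] t0 by (cases "t = t0") (auto intro: less_imp_le)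
    show "0 < ?g c" unfolding g using w[OF c(1)] pos[OF c] by simp
  qed
  also have "integral {a..b} ?g = integral {a..b} (\<lambda>t. w t * r t * f t - m * (w t * r t)) - R * integral {a..b} (\<lambda>t. w t * f t - m * w t)"
    by (rule integral_diff_scaled) (use int in \<open>auto intro!: integrable_diff integrable_on_mult_right\<close>)
  also have "\<dots> = integral {a..b} (\<lambda>t. w t * r t * f t) - m * integral {a..b} (\<lambda>t. w t * r t)"
    unfolding zero by (simp add: integral_diff_scaled[OF int(4,2)])
  finally have "m * integral {a..b} (\<lambda>t. w t * r t) < integral {a..b} (\<lambda>t. w t * r t * f t)" by simp
  then have "W * (m * integral {a..b} (\<lambda>t. w t * r t)) < W * integral {a..b} (\<lambda>t. w t * r t * f t)"
    using W by simp
  moreover have "W * m = integral {a..b} (\<lambda>t. w t * f t)" using W by (simp add: m_def)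
  moreover have "W * (m * X) = X * (W * m)" for X by (simp only: mult_ac)
  ultimately show ?thesis unfolding W_def by metis
qed

text \<open>Up to a positive constant and sign this is the chord from \<open>cis t\<close> to the mark whose half angle has
  cotangent \<open>x\<close>.  In the variable \<open>tan (t / 2)\<close> it is linear, up to the factor \<open>cos (t / 2)\<close>.\<close>

definition lin :: "real \<Rightarrow> real \<Rightarrow> real" where
  "lin x t = cos (t / 2) - x * sin (t / 2)"

lemma lin_continuous [continuous_intros]: "continuous_on S (lin x)"
  unfolding lin_def [abs_def] by (rule continuous_intros | simp)+

lemma half_angle_bounds:
  assumes "0 < t" "t < pi / 2"
  shows "0 < sin (t / 2)" "sin (t / 2) < cos (t / 2)" "1 / 2 < cos (t / 2)" "cos (t / 2) \<le> 1" "sin (t / 2) \<le> 1"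
proof -
  show s: "0 < sin (t / 2)" using assms by (intro sin_gt_zero) auto
  have "sin (t / 2) < sin (pi / 4)" using assms by (intro sin_monotone_2pi) auto
  moreover have "cos (pi / 4) < cos (t / 2)" using assms by (intro cos_monotone_0_pi) auto
  ultimately show "sin (t / 2) < cos (t / 2)" by (simp add: sin_45 cos_45)
  have "cos (pi / 3) < cos (t / 2)" using assms by (intro cos_monotone_0_pi) auto
  then show "1 / 2 < cos (t / 2)" by (simp add: cos_60)
qed auto

lemma lin_lower:
  assumes "0 < t" "t < pi / 2" "x \<le> y" "0 \<le> y" "y \<le> 1"
  shows "(1 - y) / 2 \<le> lin x t" "lin 1 t > 0" "x < 1 \<Longrightarrow> lin x t > 0"
proof -
  note h = half_angle_bounds[OF assms(1,2)]
  have *: "(1 - y) * cos (t / 2) \<le> cos (t / 2) - y * sin (t / 2)"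
    using mult_left_mono[OF less_imp_le[OF h(2)] assms(4)] by (simp add: algebra_simps)
  also have "\<dots> \<le> lin x t" unfolding lin_def using assms(3) h by (simp add: mult_right_mono)
  finally have **: "(1 - y) * cos (t / 2) \<le> lin x t" .
  have "(1 - y) * (1 / 2) \<le> (1 - y) * cos (t / 2)" using h assms by (intro mult_left_mono) auto
  with ** show "(1 - y) / 2 \<le> lin x t" by simp
  show "lin 1 t > 0" using h by (simp add: lin_def)
  show "lin x t > 0" if "x < 1"
  proof -
    have "x * sin (t / 2) \<le> 1 * sin (t / 2)" using that h by (intro mult_right_mono) auto
    then show ?thesis using h unfolding lin_def by linarith
  qed
qed

lemma lin_pos: "0 < t \<Longrightarrow> t < pi / 2 \<Longrightarrow> x \<le> 1 \<Longrightarrow> lin x t > 0"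
  using lin_lower(2)[of t 0 0] lin_lower(3)[of t x 1] by (cases "x = 1") (simp_all del: lin_def)

lemma lin_upper: "\<bar>lin x t\<bar> \<le> 1 + \<bar>x\<bar>"
proof -
  have "\<bar>lin x t\<bar> \<le> \<bar>cos (t / 2)\<bar> + \<bar>x * sin (t / 2)\<bar>" unfolding lin_def by (rule abs_triangle_ineq4)
  also have "\<bar>x * sin (t / 2)\<bar> \<le> \<bar>x\<bar> * 1" unfolding abs_mult by (intro mult_left_mono) auto
  finally show ?thesis using abs_cos_le_one[of "t / 2"] by linarith
qed

lemma powr_bounded:
  fixes v c :: real
  assumes "0 < m" "m \<le> v" "v \<le> M"
  shows "v powr c \<le> exp (\<bar>c\<bar> * (\<bar>ln m\<bar> + \<bar>ln M\<bar>))"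
proof -
  have "ln m \<le> ln v" "ln v \<le> ln M" using assms by auto
  then have "\<bar>ln v\<bar> \<le> \<bar>ln m\<bar> + \<bar>ln M\<bar>" by linarith
  then have "\<bar>c\<bar> * \<bar>ln v\<bar> \<le> \<bar>c\<bar> * (\<bar>ln m\<bar> + \<bar>ln M\<bar>)" by (intro mult_left_mono) auto
  moreover have "c * ln v \<le> \<bar>c\<bar> * \<bar>ln v\<bar>" by (metis abs_ge_self abs_mult)
  ultimately show ?thesis using assms by (simp add: powr_def)
qed

text \<open>The speed along the arc \<open>0 < t < \<pi> / 2\<close> of a primitive with marks at \<open>t = 0\<close> and at the half angles of
  cotangent \<open>1\<close>, \<open>- 1\<close>, \<open>x\<close> and \<open>y\<close>.  Only the factors \<open>sin (t / 2)\<close> and \<open>lin 1 t\<close> vanish at an end.\<close>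

definition wt :: "real \<Rightarrow> real \<Rightarrow> real \<Rightarrow> real \<Rightarrow> real \<Rightarrow> real \<Rightarrow> real \<Rightarrow> real \<Rightarrow> real" where
  "wt a b b' c d x y t = sin (t / 2) powr a * lin 1 t powr b * lin (- 1) t powr b' * lin x t powr c * lin y t powr d"

lemma wt_pos:
  assumes "0 < t" "t < pi / 2" "x < 1" "y < 1"
  shows "wt a b b' c d x y t > 0"
proof -
  have "sin (t / 2) > 0" by (rule half_angle_bounds[OF assms(1,2)])
  moreover have "lin 1 t > 0" "lin (- 1) t > 0" "lin x t > 0" "lin y t > 0"
    using assms(3,4) by (simp_all add: lin_pos[OF assms(1,2)])
  ultimately show ?thesis by (simp add: wt_def)
qed

lemma wt_continuous:
  assumes "x < 1" "y < 1"
  shows "continuous_on {0<..<pi / 2} (wt a b b' c d x y)"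
proof -
  have nz: "\<forall>t\<in>{0<..<pi / 2}. lin z t \<noteq> 0" if "z \<le> 1" for z
  proof
    fix t :: real assume "t \<in> {0<..<pi / 2}"
    then show "lin z t \<noteq> 0" using lin_pos[of t z] that by simp
  qed
  have "\<forall>t\<in>{0<..<pi / 2}. sin (t / 2) \<noteq> 0"
  proof
    fix t :: real assume "t \<in> {0<..<pi / 2}"
    then show "sin (t / 2) \<noteq> 0" using half_angle_bounds(1)[of t] by simp
  qed
  moreover have "continuous_on {0<..<pi / 2} (\<lambda>t::real. sin (t / 2))" by (rule continuous_intros | simp)+
  ultimately show ?thesis
    unfolding wt_def [abs_def]
    by (intro continuous_on_mult continuous_on_powr lin_continuous continuous_on_const nz) (use assms in simp_all)
qed

lemma lin_one_eq: "lin 1 t = sqrt 2 * sin ((pi / 2 - t) / 2)"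
proof -
  have "sin ((pi / 2 - t) / 2) = sin (pi / 4 - t / 2)" by (simp add: diff_divide_distrib)
  also have "\<dots> = sqrt 2 / 2 * (cos (t / 2) - sin (t / 2))"
    unfolding sin_diff sin_45 cos_45 by (simp add: right_diff_distrib)
  finally have "sqrt 2 * sin ((pi / 2 - t) / 2) = (sqrt 2 * (sqrt 2 / 2)) * (cos (t / 2) - sin (t / 2))"
    by (simp only: mult.assoc)
  also have "sqrt 2 * (sqrt 2 / 2) = (1::real)" by simp
  finally show ?thesis by (simp add: lin_def)
qed

lemma sin_lower:
  assumes "0 \<le> x" "x \<le> pi / 4"
  shows "x / 2 \<le> sin x"
proof -
  have "sin 0 - 0 / 2 \<le> sin x - x / 2"
  proof (rule DERIV_nonneg_imp_nondecreasing[OF assms(1)])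
    fix y assume y: "0 \<le> y" "y \<le> x"
    have "cos (pi / 3) \<le> cos y" using y assms by (intro cos_monotone_0_pi_le) auto
    moreover have "((\<lambda>x. sin x - x / 2) has_real_derivative cos y - 1 / 2) (at y)"
      by (auto intro!: derivative_eq_intros)
    ultimately show "\<exists>z. ((\<lambda>x. sin x - x / 2) has_real_derivative z) (at y) \<and> 0 \<le> z"
      by (auto simp: cos_60)
  qed
  then show ?thesis by simp
qed

definition majorant :: "real \<Rightarrow> real" where
  "majorant t = (t / 4) powr (- 3 / 4) + ((pi / 2 - t) / 4) powr (- 3 / 4)"

lemma majorant_integrable: "majorant integrable_on {0..pi / 2}"
proof -
  have "((\<lambda>t. (t / 4) powr (- 3 / 4) + ((pi / 2 - t) / 4) powr (- 3 / 4)) has_integral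
     (16 * ((pi / 2) / 4) powr (1 / 4) - 16 * ((pi / 2 - pi / 2) / 4) powr (1 / 4)) -
     (16 * (0 / 4) powr (1 / 4) - 16 * ((pi / 2 - 0) / 4) powr (1 / 4))) {0..pi / 2}"
  proof (rule fundamental_theorem_of_calculus_interior)
    show "continuous_on {0..pi / 2} (\<lambda>t. 16 * (t / 4) powr (1 / 4) - 16 * ((pi / 2 - t) / 4) powr (1 / 4))"
      by (intro continuous_intros continuous_on_powr') auto
    show "((\<lambda>t. 16 * (t / 4) powr (1 / 4) - 16 * ((pi / 2 - t) / 4) powr (1 / 4)) has_vector_derivative
        (x / 4) powr (- 3 / 4) + ((pi / 2 - x) / 4) powr (- 3 / 4)) (at x)"
      if "x \<in> {0<..<pi / 2}" for x
      using that unfolding has_real_derivative_iff_has_vector_derivative[symmetric]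
      by (auto intro!: derivative_eq_intros)
  qed auto
  then show ?thesis unfolding majorant_def [abs_def] by (rule has_integral_integrable)
qed

text \<open>At each point one of the two singular factors is bounded, as \<open>sin + lin 1 = cos\<close>.\<close>

lemma singular_product_le_majorant:
  assumes t: "0 < t" "t < pi / 2" and ab: "- 3 / 4 \<le> a" "- 3 / 4 \<le> b"
  shows "sin (t / 2) powr a * lin 1 t powr b \<le> 4 * majorant t"
proof -
  define u where "u = sin (t / 2)"
  define v where "v = lin 1 t"
  note h = half_angle_bounds[OF t]
  have u: "0 < u" "u \<le> 1" "t / 4 \<le> u" using h sin_lower[of "t / 2"] t by (auto simp: u_def)
  have v: "0 < v" "v \<le> 1" using h unfolding v_def lin_def by linarith+
  have v4: "(pi / 2 - t) / 4 \<le> v"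
  proof -
    have s: "(pi / 2 - t) / 4 \<le> sin ((pi / 2 - t) / 2)" using sin_lower[of "(pi / 2 - t) / 2"] t by auto
    also have "\<dots> \<le> v" unfolding v_def lin_one_eq using s t by (simp add: mult_le_cancel_right1)
    finally show ?thesis .
  qed
  have uv: "u + v > 1 / 2" using h by (simp add: u_def v_def lin_def)
  have quarter: "x powr (- 3 / 4) \<le> 4" if "1 / 4 \<le> x" for x :: real
  proof -
    have "x powr (- 3 / 4) \<le> (1 / 4) powr (- 3 / 4)" using that by (intro powr_mono2') auto
    also have "\<dots> \<le> (1 / 4) powr (- 1)" by (intro powr_mono') auto
    finally show ?thesis by (simp add: powr_minus_divide)
  qed
  have ua: "u powr a \<le> u powr (- 3 / 4)" and vb: "v powr b \<le> v powr (- 3 / 4)"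
    using u v ab by (auto intro!: powr_mono')
  have ut: "u powr (- 3 / 4) \<le> (t / 4) powr (- 3 / 4)" using u t by (intro powr_mono2') auto
  have vt: "v powr (- 3 / 4) \<le> ((pi / 2 - t) / 4) powr (- 3 / 4)" using v4 t by (intro powr_mono2') auto
  have "u powr a * v powr b \<le> 4 * majorant t"
  proof (cases "v \<ge> 1 / 4")
    case True
    have "u powr a * v powr b \<le> (t / 4) powr (- 3 / 4) * 4"
      by (intro mult_mono order_trans[OF ua ut] order_trans[OF vb quarter[OF True]]) auto
    also have "\<dots> \<le> 4 * majorant t" by (simp add: majorant_def)
    finally show ?thesis .
  next
    case False
    then have "u \<ge> 1 / 4" using uv by simp
    have "u powr a * v powr b \<le> 4 * ((pi / 2 - t) / 4) powr (- 3 / 4)"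
      by (intro mult_mono order_trans[OF ua quarter] order_trans[OF vb vt] \<open>u \<ge> 1 / 4\<close>) auto
    also have "\<dots> \<le> 4 * majorant t" by (simp add: majorant_def)
    finally show ?thesis .
  qed
  then show ?thesis by (simp add: u_def v_def)
qed

lemma wt_le_majorant:
  assumes t: "0 < t" "t < pi / 2" and ab: "- 3 / 4 \<le> a" "- 3 / 4 \<le> b"
    and s: "0 \<le> s" "s < 1" and x: "x \<le> s" "\<bar>x\<bar> \<le> K" and y: "y \<le> s" "\<bar>y\<bar> \<le> K"
  defines "C \<equiv> \<lambda>c. exp (\<bar>c\<bar> * (\<bar>ln ((1 - s) / 2)\<bar> + \<bar>ln (2 + K)\<bar>))"
  shows "wt a b b' c d x y t \<le> 4 * (C b' * C c * C d) * majorant t"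
proof -
  have lb: "(1 - s) / 2 \<le> lin z t" if "z \<le> s" for z using lin_lower(1)[OF t that s(1)] s by simp
  have ub: "lin z t \<le> 2 + K" if "\<bar>z\<bar> \<le> 1 + K" for z using lin_upper[of z t] that by linarith
  have C: "lin z t powr e \<le> C e" if "z \<le> s" "\<bar>z\<bar> \<le> 1 + K" for z e
    unfolding C_def by (rule powr_bounded) (use s lb ub that in auto)
  have K: "K \<ge> 0" using x by simp
  have "wt a b b' c d x y t = (sin (t / 2) powr a * lin 1 t powr b) * (lin (- 1) t powr b' * lin x t powr c * lin y t powr d)"
    by (simp add: wt_def mult_ac)
  also have "\<dots> \<le> (4 * majorant t) * (C b' * C c * C d)"
  proof (rule mult_mono[OF singular_product_le_majorant[OF t ab]])
    show "lin (- 1) t powr b' * lin x t powr c * lin y t powr d \<le> C b' * C c * C d"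
      using s x y K by (intro mult_mono C) (auto simp: C_def)
  qed (auto simp: majorant_def)
  finally show ?thesis by (simp add: mult_ac)
qed

definition J :: "real \<Rightarrow> real \<Rightarrow> real \<Rightarrow> real \<Rightarrow> real \<Rightarrow> real \<Rightarrow> real \<Rightarrow> real" where
  "J a b b' c d x y = integral {0..pi / 2} (wt a b b' c d x y)"

lemma wt_integrable:
  assumes "- 3 / 4 \<le> a" "- 3 / 4 \<le> b" "x < 1" "y < 1"
  shows "wt a b b' c d x y integrable_on {0..pi / 2}"
proof -
  define s where "s = max 0 (max x y)"
  define K where "K = max \<bar>x\<bar> \<bar>y\<bar>"
  define C where "C c = exp (\<bar>c\<bar> * (\<bar>ln ((1 - s) / 2)\<bar> + \<bar>ln (2 + K)\<bar>))" for c
  show ?thesis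
  proof (rule continuous_dominated_integrable[OF wt_continuous[OF assms(3,4)]])
    show "(\<lambda>t. 4 * (C b' * C c * C d) * majorant t) integrable_on {0..pi / 2}"
      using majorant_integrable by (rule integrable_on_mult_right)
    show "\<bar>wt a b b' c d x y t\<bar> \<le> 4 * (C b' * C c * C d) * majorant t" if "t \<in> {0<..<pi / 2}" for t
    proof -
      have "wt a b b' c d x y t > 0" by (rule wt_pos) (use that assms in simp_all)
      moreover have "wt a b b' c d x y t \<le> 4 * (C b' * C c * C d) * majorant t"
        unfolding C_def by (rule wt_le_majorant) (use that assms in \<open>simp_all add: s_def K_def\<close>)
      ultimately show ?thesis by simp
    qed
  qed
qed

lemma J_pos:
  assumes "- 3 / 4 \<le> a" "- 3 / 4 \<le> b" "x < 1" "y < 1"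
  shows "J a b b' c d x y > 0"
  unfolding J_def
proof (rule integral_pos_open[where c = "pi / 4"])
  show "wt a b b' c d x y integrable_on {0..pi / 2}" by (rule wt_integrable[OF assms])
  show "continuous_on {0<..<pi / 2} (wt a b b' c d x y)" by (rule wt_continuous[OF assms(3,4)])
  show "0 \<le> wt a b b' c d x y t" if "t \<in> {0<..<pi / 2}" for t
    by (rule order.strict_implies_order, rule wt_pos) (use that assms in simp_all)
  show "pi / 4 \<in> {0<..<pi / 2}" by simp
  show "0 < wt a b b' c d x y (pi / 4)" by (rule wt_pos) (use assms in simp_all)
qed

text \<open>On a neighbourhood of \<open>(x, y)\<close> the weights share the integrable majorant of \<open>wt_le_majorant\<close>.\<close>

lemma J_continuous:
  assumes ab: "- 3 / 4 \<le> a" "- 3 / 4 \<le> b"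
  shows "continuous_on ({..<1} \<times> {..<1}) (\<lambda>(x, y). J a b b' c d x y)"
  unfolding continuous_on_sequentially
proof (intro allI ballI impI)
  fix u :: "nat \<Rightarrow> real \<times> real" and z :: "real \<times> real"
  assume z: "z \<in> {..<1} \<times> {..<1}" and uz: "(\<forall>n. u n \<in> {..<1} \<times> {..<1}) \<and> u \<longlonglongrightarrow> z"
  define x where "x = fst z"
  define y where "y = snd z"
  have xy: "x \<in> {..<1}" "y \<in> {..<1}" using z by (simp_all add: x_def y_def mem_Times_iff)
  define X where "X n = fst (u n)" for n
  define Y where "Y n = snd (u n)" for n
  have u: "u n \<in> {..<1} \<times> {..<1}" for n using uz by simp
  have lim: "u \<longlonglongrightarrow> z" using uz by simp
  have X: "X \<longlonglongrightarrow> x" "\<And>n. X n < 1" and Y: "Y \<longlonglongrightarrow> y" "\<And>n. Y n < 1"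
    using tendsto_fst[OF lim] tendsto_snd[OF lim] u
    by (simp_all add: X_def [abs_def] Y_def [abs_def] x_def y_def mem_Times_iff)
  have lims: "(\<lambda>n. 1 - X n) \<longlonglongrightarrow> 1 - x" "(\<lambda>n. 1 - Y n) \<longlonglongrightarrow> 1 - y"
    by (rule tendsto_diff[OF tendsto_const], rule X(1)) (rule tendsto_diff[OF tendsto_const], rule Y(1))
  obtain \<delta>1 where \<delta>1: "\<delta>1 > 0" "\<And>n. \<delta>1 \<le> 1 - X n"
    by (rule positive_sequence_bounded_below[OF lims(1)]) (use X(2) xy(1) in simp_all)
  obtain \<delta>2 where \<delta>2: "\<delta>2 > 0" "\<And>n. \<delta>2 \<le> 1 - Y n"
    by (rule positive_sequence_bounded_below[OF lims(2)]) (use Y(2) xy(2) in simp_all)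
  obtain K1 where K1: "\<And>n. norm (X n) \<le> K1"
    using convergent_imp_Bseq[of X] X(1) by (auto simp: convergent_def Bseq_def)
  obtain K2 where K2: "\<And>n. norm (Y n) \<le> K2"
    using convergent_imp_Bseq[of Y] Y(1) by (auto simp: convergent_def Bseq_def)
  define s where "s = max 0 (1 - min \<delta>1 \<delta>2)"
  define K where "K = max K1 K2"
  define C where "C c = exp (\<bar>c\<bar> * (\<bar>ln ((1 - s) / 2)\<bar> + \<bar>ln (2 + K)\<bar>))" for c
  have s: "0 \<le> s" "s < 1" "\<And>n. X n \<le> s" "\<And>n. Y n \<le> s"
  proof -
    show "0 \<le> s" "s < 1" using \<delta>1(1) \<delta>2(1) by (simp_all add: s_def)
    show "X n \<le> s" for n using \<delta>1(2)[of n] unfolding s_def by linarith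
    show "Y n \<le> s" for n using \<delta>2(2)[of n] unfolding s_def by linarith
  qed
  have K: "\<bar>X n\<bar> \<le> K" "\<bar>Y n\<bar> \<le> K" for n using K1[of n] K2[of n] by (auto simp: K_def)
  have "(\<lambda>n. integral {0<..<pi / 2} (wt a b b' c d (X n) (Y n))) \<longlonglongrightarrow> integral {0<..<pi / 2} (wt a b b' c d x y)"
  proof (rule dominated_convergence(2))
    show "wt a b b' c d (X n) (Y n) integrable_on {0<..<pi / 2}" for n
      using wt_integrable[OF ab X(2) Y(2)] by (simp add: integrable_on_open_interval_real)
    show "(\<lambda>t. 4 * (C b' * C c * C d) * majorant t) integrable_on {0<..<pi / 2}"
      using integrable_on_mult_right[OF majorant_integrable] by (simp add: integrable_on_open_interval_real)
    show "norm (wt a b b' c d (X n) (Y n) t) \<le> 4 * (C b' * C c * C d) * majorant t" if "t \<in> {0<..<pi / 2}" for n t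
    proof -
      have "wt a b b' c d (X n) (Y n) t > 0" by (rule wt_pos) (use that X(2) Y(2) in simp_all)
      moreover have "wt a b b' c d (X n) (Y n) t \<le> 4 * (C b' * C c * C d) * majorant t"
        unfolding C_def by (rule wt_le_majorant) (use that ab s K in simp_all)
      ultimately show ?thesis by simp
    qed
    show "(\<lambda>n. wt a b b' c d (X n) (Y n) t) \<longlonglongrightarrow> wt a b b' c d x y t" if "t \<in> {0<..<pi / 2}" for t
    proof -
      have "lin x t > 0" "lin y t > 0" using lin_pos that xy by auto
      then show ?thesis
        unfolding wt_def lin_def by (intro tendsto_intros X Y) auto
    qed
  qed
  then show "((\<lambda>(x, y). J a b b' c d x y) \<circ> u) \<longlonglongrightarrow> (case z of (x, y) \<Rightarrow> J a b b' c d x y)"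
    by (simp add: o_def J_def case_prod_beta X_def Y_def x_def y_def integral_open_interval_real)
qed

section \<open>Monotonicity of the period quotients\<close>

lemma integral_reflect_about:
  fixes f :: "real \<Rightarrow> real"
  shows "integral {c - b..c - a} (\<lambda>t. f (c - t)) = integral {a..b} f"
proof -
  have "integral {- b + c..- a + c} (\<lambda>t. f (c - t)) = integral {- b..- a} ((\<lambda>t. f (c - t)) \<circ> (+) c)"
    by (rule integral_shift_Icc_real[symmetric])
  also have "(\<lambda>t. f (c - t)) \<circ> (+) c = (\<lambda>t. f (- t))" by (simp add: fun_eq_iff)
  also have "integral {- b..- a} (\<lambda>t. f (- t)) = integral {a..b} f" by (rule Henstock_Kurzweil_Integration.integral_reflect_real)
  finally show ?thesis by (simp add: add.commute)
qed

text \<open>All these quotients are fractional linear in \<open>tan (t / 2)\<close>, with positive determinant.\<close>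

lemma lin_ratio_increasing:
  assumes st: "0 < s" "s < t" "t < pi / 2"
  shows "x \<le> 1 \<Longrightarrow> sin (s / 2) / lin x s < sin (t / 2) / lin x t"
    and "x < y \<Longrightarrow> y \<le> 1 \<Longrightarrow> lin x s / lin y s < lin x t / lin y t"
proof -
  have "sin (t / 2 - s / 2) > 0" using st by (intro sin_gt_zero) auto
  then have d: "0 < sin (t / 2) * cos (s / 2) - cos (t / 2) * sin (s / 2)" by (simp add: sin_diff)
  show "sin (s / 2) / lin x s < sin (t / 2) / lin x t" if "x \<le> 1"
  proof -
    have "lin x s > 0" "lin x t > 0" using that st by (auto intro!: lin_pos)
    then have "sin (s / 2) / lin x s < sin (t / 2) / lin x t \<longleftrightarrow> sin (s / 2) * lin x t < sin (t / 2) * lin x s"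
      by (simp add: divide_simps)
    also have "\<dots>" using d by (simp add: lin_def algebra_simps)
    finally show ?thesis .
  qed
  show "lin x s / lin y s < lin x t / lin y t" if "x < y" "y \<le> 1"
  proof -
    have "lin y s > 0" "lin y t > 0" using that st by (auto intro!: lin_pos)
    then have "lin x s / lin y s < lin x t / lin y t \<longleftrightarrow> lin x s * lin y t < lin x t * lin y s"
      by (simp add: divide_simps)
    also have "\<dots> \<longleftrightarrow> 0 < (y - x) * (sin (t / 2) * cos (s / 2) - cos (t / 2) * sin (s / 2))"
      by (simp add: lin_def algebra_simps)
    also have "\<dots>" using d that by simp
    finally show ?thesis .
  qed
qed

lemma lin_quotient_increasing: "x < y \<Longrightarrow> y \<le> 1 \<Longrightarrow> strict_mono_on {0<..<pi / 2} (\<lambda>t. lin x t / lin y t)"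
  by (rule strict_mono_onI) (simp add: lin_ratio_increasing(2))

lemma lin_quotient_gt_one:
  assumes "0 < t" "t < pi / 2" "x < y" "y \<le> 1"
  shows "1 < lin x t / lin y t"
proof -
  have "sin (t / 2) > 0" by (rule half_angle_bounds[OF assms(1,2)])
  then have "lin y t < lin x t" using assms(3) by (simp add: lin_def)
  then show ?thesis using lin_pos[OF assms(1,2,4)] by simp
qed

lemma lin_quotient_continuous:
  assumes "y \<le> 1"
  shows "continuous_on {0<..<pi / 2} (\<lambda>t. lin x t / lin y t)"
proof (rule continuous_on_divide[OF lin_continuous lin_continuous], rule ballI)
  fix t :: real assume "t \<in> {0<..<pi / 2}"
  then show "lin y t \<noteq> 0" using lin_pos[of t y] assms by simp
qed

text \<open>The ratio of the two weights, that is the square of the Gauss map up to a constant, is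
  increasing along the edge.\<close>

definition gauss_ratio :: "real \<Rightarrow> real \<Rightarrow> real \<Rightarrow> real \<Rightarrow> real" where
  "gauss_ratio x1 x2 x3 t = ((sin (t / 2) / lin x1 t) * (sin (t / 2) / lin x2 t) * (lin x3 t / lin 1 t)) powr (1 / 2)"

lemma gauss_ratio_increasing:
  assumes "x1 \<le> 1" "x2 \<le> 1" "x3 < 1"
  shows "strict_mono_on {0<..<pi / 2} (gauss_ratio x1 x2 x3)"
proof (rule strict_mono_onI)
  fix s t :: real assume st: "s \<in> {0<..<pi / 2}" "t \<in> {0<..<pi / 2}" "s < t"
  have s: "0 < s" "s < pi / 2" and t: "0 < t" "t < pi / 2" using st by auto
  have p: "0 < sin (s / 2) / lin x1 s" "0 < sin (s / 2) / lin x2 s" "0 < lin x3 s / lin 1 s"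
    using half_angle_bounds(1)[OF s] lin_pos[OF s] assms by auto
  have "(sin (s / 2) / lin x1 s) * (sin (s / 2) / lin x2 s) * (lin x3 s / lin 1 s)
      < (sin (t / 2) / lin x1 t) * (sin (t / 2) / lin x2 t) * (lin x3 t / lin 1 t)"
    by (rule mult_strict_mono'[OF mult_strict_mono'])
       (use s st(3) t assms in \<open>auto intro!: lin_ratio_increasing mult_nonneg_nonneg less_imp_le[OF p(1)] less_imp_le[OF p(2)] less_imp_le[OF p(3)] simp del: times_divide_eq_right times_divide_eq_left times_divide_times_eq\<close>)
  moreover have "0 \<le> (sin (s / 2) / lin x1 s) * (sin (s / 2) / lin x2 s) * (lin x3 s / lin 1 s)"
    by (intro mult_nonneg_nonneg less_imp_le p)
  ultimately show "gauss_ratio x1 x2 x3 s < gauss_ratio x1 x2 x3 t"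
    unfolding gauss_ratio_def by (intro powr_less_mono2) simp_all
qed

lemma gauss_ratio_continuous:
  assumes "x1 \<le> 1" "x2 \<le> 1" "x3 < 1"
  shows "continuous_on {0<..<pi / 2} (gauss_ratio x1 x2 x3)"
proof -
  have nz: "lin x t \<noteq> 0" if "x \<le> 1" "t \<in> {0<..<pi / 2}" for x t using lin_pos[of t x] that by auto
  have sz: "sin (t / 2) \<noteq> 0" if "t \<in> {0<..<pi / 2}" for t :: real using half_angle_bounds(1)[of t] that by auto
  show ?thesis
    unfolding gauss_ratio_def [abs_def]
    by (intro continuous_on_powr continuous_on_mult continuous_on_divide lin_continuous continuous_on_const
        continuous_on_sin continuous_on_id ballI) (use nz sz assms in \<open>simp_all\<close>)
qed

lemma powr_quarters:
  fixes x :: real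
  assumes "x > 0"
  shows "(x powr (1 / 4)) ^ 2 = x powr (1 / 2)" "(x powr (1 / 4)) ^ 3 = x powr (3 / 4)"
  using assms by (simp_all add: power2_eq_square power3_eq_cube flip: powr_add)

lemma powr_quotient_shift:
  fixes u v d :: real
  assumes "u > 0" "v > 0"
  shows "u powr d * (u / v) powr (- d) = v powr d"
proof -
  have "d * ln u + - d * (ln u - ln v) = d * ln v" by (simp add: algebra_simps)
  then show ?thesis using assms by (simp add: powr_def ln_div flip: exp_add)
qed

text \<open>Moving the mark \<open>y\<close> to \<open>y'\<close> multiplies the speed by a power of one quotient.\<close>

lemma lin_quotient_powr_shift:
  assumes "0 < t" "t < pi / 2" "y < 1" "y' < 1"
  shows "wt a b b' c d x y' t = wt a b b' c d x y t * (lin y t / lin y' t) powr (- d)"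
proof -
  have pos: "lin y t > 0" "lin y' t > 0" using assms by (auto intro!: lin_pos)
  show ?thesis unfolding wt_def using powr_quotient_shift[OF pos, of d] by (simp only: mult.assoc)
qed

text \<open>Shifting one root from \<open>y\<close> to \<open>y' > y\<close> multiplies the second weight by an increasing function
  \<open>\<phi> > 1\<close> and the first, which is larger where \<open>\<phi>\<close> is large, by \<open>\<phi>\<^sup>3\<close>.\<close>

lemma shift_first_moment:
  fixes a b b' c \<alpha> \<beta> \<beta>' \<gamma> x y y' :: real
  defines "w1 \<equiv> wt a b b' c (- 3 / 4) x y" and "w2 \<equiv> wt \<alpha> \<beta> \<beta>' \<gamma> (- 1 / 4) x y"
  defines "\<phi> \<equiv> \<lambda>t. (lin y t / lin y' t) powr (1 / 4)"
  assumes ex: "- 3 / 4 \<le> a" "- 3 / 4 \<le> b" "- 3 / 4 \<le> \<alpha>" "- 3 / 4 \<le> \<beta>"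
    and xy: "x < 1" "y < y'" "y' < 1" and uvz: "u \<le> 1" "v \<le> 1" "z < 1"
    and r: "\<And>t. t \<in> {0<..<pi / 2} \<Longrightarrow> w1 t = w2 t * gauss_ratio u v z t"
  shows "(\<lambda>t. w1 t * \<phi> t) integrable_on {0..pi / 2}"
    and "J a b b' c (- 3 / 4) x y * J \<alpha> \<beta> \<beta>' \<gamma> (- 1 / 4) x y'
       < J \<alpha> \<beta> \<beta>' \<gamma> (- 1 / 4) x y * integral {0..pi / 2} (\<lambda>t. w1 t * \<phi> t)"
    and "integral {0..pi / 2} (\<lambda>t. w1 t * \<phi> t) \<le> J a b b' c (- 3 / 4) x y'"
    and "\<And>t. t \<in> {0<..<pi / 2} \<Longrightarrow> wt a b b' c (- 3 / 4) x y' t = w1 t * \<phi> t ^ 3"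
proof -
  let ?S = "{0<..<pi / 2}"
  have y1: "y < 1" using xy by simp
  have quot: "1 < lin y t / lin y' t" if "t \<in> ?S" for t using lin_quotient_gt_one[of t y y'] that xy by simp
  have phi1: "1 < \<phi> t" if "t \<in> ?S" for t
    unfolding \<phi>_def using powr_less_mono2[of "1 / 4" 1 "lin y t / lin y' t"] quot[OF that] by simp
  have phi_mono: "strict_mono_on ?S \<phi>"
  proof (rule strict_mono_onI)
    fix s t assume st: "s \<in> ?S" "t \<in> ?S" "s < t"
    have "lin y s / lin y' s < lin y t / lin y' t"
      using st xy by (intro lin_ratio_increasing) auto
    then show "\<phi> s < \<phi> t" unfolding \<phi>_def using quot[OF st(1)] by (intro powr_less_mono2) auto
  qed
  have phi_cont: "continuous_on ?S \<phi>"
    unfolding \<phi>_def by (intro continuous_on_powr lin_quotient_continuous continuous_on_const ballI)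
      (use quot xy in fastforce)+
  have w1_int: "w1 integrable_on {0..pi / 2}" and w2_int: "w2 integrable_on {0..pi / 2}"
    unfolding w1_def w2_def using ex xy y1 by (auto intro!: wt_integrable)
  have w1_cont: "continuous_on ?S w1" and w2_cont: "continuous_on ?S w2"
    unfolding w1_def w2_def using xy y1 by (auto intro!: wt_continuous)
  have w1_pos: "w1 t > 0" and w2_pos: "w2 t > 0" if "t \<in> ?S" for t
    unfolding w1_def w2_def using xy y1 that by (auto intro!: wt_pos)
  have cube: "(\<phi> t) ^ 3 = (lin y t / lin y' t) powr (3 / 4)" if "t \<in> ?S" for t
    unfolding \<phi>_def by (rule powr_quarters(2), rule less_trans[OF zero_less_one quot[OF that]])
  show w1': "wt a b b' c (- 3 / 4) x y' t = w1 t * \<phi> t ^ 3" if "t \<in> ?S" for t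
    unfolding cube[OF that] w1_def using lin_quotient_powr_shift[of t y y' a b b' c "- 3 / 4" x] that xy y1 by simp
  have w2': "wt \<alpha> \<beta> \<beta>' \<gamma> (- 1 / 4) x y' t = w2 t * \<phi> t" if "t \<in> ?S" for t
    unfolding w2_def \<phi>_def using lin_quotient_powr_shift[of t y y' \<alpha> \<beta> \<beta>' \<gamma> "- 1 / 4" x] that xy y1 by simp
  have w1'_int: "wt a b b' c (- 3 / 4) x y' integrable_on {0..pi / 2}"
    and w2'_int: "wt \<alpha> \<beta> \<beta>' \<gamma> (- 1 / 4) x y' integrable_on {0..pi / 2}"
    using ex xy by (auto intro!: wt_integrable)
  have phi_le: "\<phi> t \<le> \<phi> t ^ 3" if "t \<in> ?S" for t
    using phi1[OF that] by (intro self_le_power) auto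
  show int: "(\<lambda>t. w1 t * \<phi> t) integrable_on {0..pi / 2}"
  proof (rule continuous_dominated_integrable[OF _ w1'_int])
    show "continuous_on ?S (\<lambda>t. w1 t * \<phi> t)" by (intro continuous_on_mult w1_cont phi_cont)
    show "\<bar>w1 t * \<phi> t\<bar> \<le> wt a b b' c (- 3 / 4) x y' t" if "t \<in> ?S" for t
      unfolding w1'[OF that] using w1_pos[OF that] phi1[OF that] phi_le[OF that] by (simp add: abs_mult)
  qed
  show "integral {0..pi / 2} (\<lambda>t. w1 t * \<phi> t) \<le> J a b b' c (- 3 / 4) x y'"
    unfolding J_def
  proof (rule integral_open_mono[OF int w1'_int])
    show "w1 t * \<phi> t \<le> wt a b b' c (- 3 / 4) x y' t" if "t \<in> ?S" for t
      unfolding w1'[OF that] using w1_pos[OF that] phi_le[OF that] by simp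
  qed
  have W1: "J a b b' c (- 3 / 4) x y = integral {0..pi / 2} (\<lambda>t. w2 t * gauss_ratio u v z t)"
    unfolding J_def w1_def[symmetric] by (rule integral_open_cong) (rule r)
  have W2': "J \<alpha> \<beta> \<beta>' \<gamma> (- 1 / 4) x y' = integral {0..pi / 2} (\<lambda>t. w2 t * \<phi> t)"
    unfolding J_def by (rule integral_open_cong) (rule w2')
  have W1phi: "integral {0..pi / 2} (\<lambda>t. w1 t * \<phi> t) = integral {0..pi / 2} (\<lambda>t. w2 t * gauss_ratio u v z t * \<phi> t)"
    by (rule integral_open_cong) (simp add: r)
  have spike: "f integrable_on {0..pi / 2}" if "g integrable_on {0..pi / 2}" "\<And>t. t \<in> ?S \<Longrightarrow> g t = f t" for f g :: "real \<Rightarrow> real"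
    using that integrable_cong[of ?S g f] by (simp flip: integrable_on_open_interval_real)
  show "J a b b' c (- 3 / 4) x y * J \<alpha> \<beta> \<beta>' \<gamma> (- 1 / 4) x y'
       < J \<alpha> \<beta> \<beta>' \<gamma> (- 1 / 4) x y * integral {0..pi / 2} (\<lambda>t. w1 t * \<phi> t)"
    unfolding W1 W2' W1phi unfolding J_def w2_def[symmetric]
  proof (rule chebyshev_strict)
    show "(\<lambda>t. w2 t * gauss_ratio u v z t) integrable_on {0..pi / 2}" by (rule spike[OF w1_int r])
    show "(\<lambda>t. w2 t * \<phi> t) integrable_on {0..pi / 2}" by (rule spike[OF w2'_int w2'])
    show "(\<lambda>t. w2 t * gauss_ratio u v z t * \<phi> t) integrable_on {0..pi / 2}"
      by (rule spike[OF int]) (simp add: r)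
  qed (use w2_int w2_cont w2_pos phi_cont phi_mono gauss_ratio_continuous gauss_ratio_increasing uvz in simp_all)
qed

lemma wt_swap: "wt a b b' c d x y = wt a b b' d c y x"
  by (simp add: wt_def fun_eq_iff mult_ac)

lemma J_swap: "J a b b' c d x y = J a b b' d c y x"
  unfolding J_def wt_swap[of a b b' c d x y] ..

text \<open>The length of the edge \<open>0\<close> for the two horizontal forms of the family with parallel diagonals.  Reflection
  in the real axis exchanges the edges \<open>0\<close> and \<open>4\<close> and the parameters with their negatives, so the same functions at
  \<open>(- p, - q)\<close> give the edge \<open>4\<close>.\<close>

definition ssB1 where "ssB1 p q = J (1 / 2) (- 3 / 4) (- 3 / 4) (- 1 / 4) (- 3 / 4) q p"
definition ssB2 where "ssB2 p q = J (- 1 / 2) (- 1 / 4) (- 1 / 4) (- 3 / 4) (- 1 / 4) q p"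

lemma ss_gauss_ratio:
  assumes "t \<in> {0<..<pi / 2}" "x < 1" "y < 1"
  shows "wt (1 / 2) (- 3 / 4) (- 3 / 4) (- 1 / 4) (- 3 / 4) x y t
    = wt (- 1 / 2) (- 1 / 4) (- 1 / 4) (- 3 / 4) (- 1 / 4) x y t * gauss_ratio (- 1) y x t"
proof -
  have t: "0 < t" "t < pi / 2" using assms by auto
  have pos: "sin (t / 2) > 0" "lin 1 t > 0" "lin (- 1) t > 0" "lin x t > 0" "lin y t > 0"
    using half_angle_bounds(1)[OF t] lin_pos[OF t] assms by auto
  have e: "v powr a = v powr b * v powr (a - b)" if "v > 0" for v a b :: real using that by (simp flip: powr_add)
  have "gauss_ratio (- 1) y x t = sin (t / 2) powr 1 * lin (- 1) t powr (- 1 / 2) * lin y t powr (- 1 / 2)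
      * lin x t powr (1 / 2) * lin 1 t powr (- 1 / 2)"
  proof -
    have "sin (t / 2) powr 1 = sin (t / 2) powr (1 / 2) * sin (t / 2) powr (1 / 2)" by (simp flip: powr_add)
    then show ?thesis
      using pos unfolding gauss_ratio_def by (simp add: powr_mult powr_divide powr_minus field_simps)
  qed
  then show ?thesis
    unfolding wt_def
    using e[OF pos(1), of "1 / 2" "- 1 / 2"] e[OF pos(2), of "- 3 / 4" "- 1 / 4"] e[OF pos(3), of "- 3 / 4" "- 1 / 4"]
      e[OF pos(4), of "- 1 / 4" "- 3 / 4"] e[OF pos(5), of "- 3 / 4" "- 1 / 4"]
    by (simp add: mult_ac)
qed

text \<open>Multiplying the two weights by \<open>\<phi>\<close> and \<open>\<phi>\<^sup>3\<close> with \<open>\<phi> > 1\<close> increases the first integral by the larger factor,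
  by the inequality of Chebyshev.\<close>

lemma ss_shift:
  assumes "q < 1" "p < p'" "p' < 1"
  shows "ssB1 p q * ssB2 p' q < ssB2 p q * ssB1 p' q"
proof -
  note s = shift_first_moment[where a = "1 / 2" and b = "- 3 / 4" and b' = "- 3 / 4" and c = "- 1 / 4"
          and \<alpha> = "- 1 / 2" and \<beta> = "- 1 / 4" and \<beta>' = "- 1 / 4" and \<gamma> = "- 3 / 4" and x = q and y = p and y' = p'
          and u = "- 1" and v = p and z = q]
  have "ssB2 p q > 0" using assms unfolding ssB2_def by (intro J_pos) auto
  then show ?thesis
    unfolding ssB1_def ssB2_def
    by (intro less_le_trans[OF s(2)] mult_left_mono s(3)) (use assms ss_gauss_ratio in auto)
qed

lemma exponent_exchange:
  fixes u v :: real
  assumes "0 < u" "u < v"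
  shows "u powr (- 1 / 4) * v powr (- 3 / 4) < u powr (- 3 / 4) * v powr (- 1 / 4)"
proof -
  have e: "x powr (- 1 / 4) = x powr (- 3 / 4) * x powr (1 / 2)" if "x > 0" for x :: real
    using that by (simp flip: powr_add)
  have "u powr (1 / 2) < v powr (1 / 2)" using assms by (intro powr_less_mono2) auto
  then have "u powr (- 3 / 4) * v powr (- 3 / 4) * u powr (1 / 2) < u powr (- 3 / 4) * v powr (- 3 / 4) * v powr (1 / 2)"
    using assms by (intro mult_strict_left_mono mult_pos_pos) simp_all
  then show ?thesis using e[of u] e[of v] assms by (simp add: mult_ac)
qed

text \<open>For \<open>p = - q\<close> the factors of exponents \<open>- 1 / 4\<close> and \<open>- 3 / 4\<close> are exchanged by the reflection, and the two
  products compare pointwise.\<close>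

lemma ss_sign_below:
  assumes "0 < q" "q < 1"
  shows "ssB1 (- q) q * ssB2 q (- q) < ssB2 (- q) q * ssB1 q (- q)"
proof -
  have w: "J a b b' (- 1 / 4) (- 3 / 4) q (- q) < J a b b' (- 3 / 4) (- 1 / 4) q (- q)"
    if ab: "- 3 / 4 \<le> a" "- 3 / 4 \<le> b" for a b b'
    unfolding J_def
  proof (rule integral_open_strict_mono)
    show "wt a b b' (- 1 / 4) (- 3 / 4) q (- q) t < wt a b b' (- 3 / 4) (- 1 / 4) q (- q) t"
      if "t \<in> {0<..<pi / 2}" for t
    proof -
      have t: "0 < t" "t < pi / 2" using that by auto
      have s: "sin (t / 2) > 0" by (rule half_angle_bounds[OF t])
      then have l: "0 < lin q t" "lin q t < lin (- q) t" using lin_pos[OF t] assms by (simp_all add: lin_def)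
      have c: "0 < sin (t / 2) powr a * lin 1 t powr b * lin (- 1) t powr b'"
        using s lin_pos[OF t, of 1] lin_pos[OF t, of "- 1"] by simp
      from mult_strict_left_mono[OF exponent_exchange[OF l] c]
      show ?thesis by (simp only: wt_def mult.assoc)
    qed
  qed (use assms ab in \<open>auto intro!: wt_integrable wt_continuous\<close>)
  have "ssB1 (- q) q < ssB1 q (- q)"
    using w[of "1 / 2" "- 3 / 4" "- 3 / 4"] J_swap[of "1 / 2" "- 3 / 4" "- 3 / 4" "- 1 / 4" "- 3 / 4" "- q" q]
    by (simp add: ssB1_def)
  moreover have "ssB2 q (- q) < ssB2 (- q) q"
    using w[of "- 1 / 2" "- 1 / 4" "- 1 / 4"] J_swap[of "- 1 / 2" "- 1 / 4" "- 1 / 4" "- 3 / 4" "- 1 / 4" "- q" q]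
    by (simp add: ssB2_def)
  moreover have "ssB1 (- q) q > 0" "ssB2 q (- q) > 0"
    using assms unfolding ssB1_def ssB2_def by (auto intro!: J_pos)
  ultimately show ?thesis by (simp add: mult.commute mult_strict_mono')
qed

text \<open>For \<open>p = q\<close> the two interior marks merge into a factor of exponent \<open>- 1\<close> in both forms, and passing from
  \<open>- q\<close> to \<open>q\<close> multiplies both weights by the same increasing function; the inequality of Chebyshev applies.\<close>

lemma ss_sign_diagonal:
  assumes "0 < q" "q < 1"
  shows "ssB2 q q * ssB1 (- q) (- q) < ssB1 q q * ssB2 (- q) (- q)"
proof -
  let ?S = "{0<..<pi / 2}"
  let ?w = "wt (- 1 / 2) (- 1 / 4) (- 1 / 4) (- 3 / 4) (- 1 / 4) (- q) (- q)"
  let ?r = "gauss_ratio (- 1) (- q) (- q)"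
  let ?f = "\<lambda>t. lin (- q) t / lin q t"
  have spike: "g integrable_on {0..pi / 2}" if "f integrable_on {0..pi / 2}" "\<And>t. t \<in> ?S \<Longrightarrow> f t = g t" for f g :: "real \<Rightarrow> real"
    using that integrable_cong[of ?S f g] by (simp flip: integrable_on_open_interval_real)
  have int: "wt a b b' c d x y integrable_on {0..pi / 2}" if "- 3 / 4 \<le> a" "- 3 / 4 \<le> b" "x \<in> {q, - q}" "y \<in> {q, - q}" for a b b' c d x y
    using that assms by (intro wt_integrable) auto
  have r: "wt (1 / 2) (- 3 / 4) (- 3 / 4) (- 1 / 4) (- 3 / 4) (- q) (- q) t = ?w t * ?r t" if "t \<in> ?S" for t
    using ss_gauss_ratio[OF that, of "- q" "- q"] assms by simp
  have shift: "wt a b b' c d q q t = wt a b b' c d (- q) (- q) t * ?f t" if "t \<in> ?S" "c + d = - 1" for a b b' c d t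
  proof -
    have "lin q t > 0" "lin (- q) t > 0" using that assms by (auto intro!: lin_pos)
    moreover have "x powr c * x powr d = inverse x" if "x > 0" for x :: real
    proof -
      have "x powr c * x powr d = x powr (- 1)" by (simp only: powr_add[symmetric] \<open>c + d = - 1\<close>)
      then show ?thesis using that by (simp add: powr_minus)
    qed
    ultimately have "lin q t powr c * lin q t powr d = lin (- q) t powr c * lin (- q) t powr d * (lin (- q) t / lin q t)"
      by (simp add: divide_inverse)
    then show ?thesis unfolding wt_def by (simp only: mult.assoc)
  qed
  have f: "wt (- 1 / 2) (- 1 / 4) (- 1 / 4) (- 3 / 4) (- 1 / 4) q q t = ?w t * ?f t" if "t \<in> ?S" for t
    using shift[OF that] by simp
  have rf: "wt (1 / 2) (- 3 / 4) (- 3 / 4) (- 1 / 4) (- 3 / 4) q q t = ?w t * ?r t * ?f t" if "t \<in> ?S" for t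
    using shift[OF that, of "- 1 / 4" "- 3 / 4"] r[OF that] by simp
  have "integral {0..pi / 2} (\<lambda>t. ?w t * ?r t) * integral {0..pi / 2} (\<lambda>t. ?w t * ?f t)
      < integral {0..pi / 2} ?w * integral {0..pi / 2} (\<lambda>t. ?w t * ?r t * ?f t)"
  proof (rule chebyshev_strict)
    show "(\<lambda>t. ?w t * ?r t) integrable_on {0..pi / 2}" by (rule spike[OF int r]) auto
    show "(\<lambda>t. ?w t * ?f t) integrable_on {0..pi / 2}" by (rule spike[OF int f]) auto
    show "(\<lambda>t. ?w t * ?r t * ?f t) integrable_on {0..pi / 2}" by (rule spike[OF int rf]) auto
    show "?w integrable_on {0..pi / 2}" by (rule int) auto
    show "continuous_on ?S ?w" by (rule wt_continuous) (use assms in auto)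
    show "0 < ?w t" if "t \<in> ?S" for t by (rule wt_pos) (use assms that in auto)
  qed (use assms in \<open>simp_all add: gauss_ratio_continuous gauss_ratio_increasing lin_quotient_continuous lin_quotient_increasing\<close>)
  moreover have "ssB1 (- q) (- q) = integral {0..pi / 2} (\<lambda>t. ?w t * ?r t)"
    unfolding ssB1_def J_def by (rule integral_open_cong) (rule r)
  moreover have "ssB2 q q = integral {0..pi / 2} (\<lambda>t. ?w t * ?f t)"
    unfolding ssB2_def J_def by (rule integral_open_cong) (rule f)
  moreover have "ssB1 q q = integral {0..pi / 2} (\<lambda>t. ?w t * ?r t * ?f t)"
    unfolding ssB1_def J_def by (rule integral_open_cong) (rule rf)
  moreover have "ssB2 (- q) (- q) = integral {0..pi / 2} ?w" unfolding ssB2_def J_def by simp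
  ultimately show ?thesis by (simp add: mult.commute)
qed

text \<open>The length of the edge \<open>0\<close> for the two horizontal forms of the family with orthogonal diagonals.\<close>

definition csB1 where "csB1 p q = J (1 / 2) (- 3 / 4) (- 1 / 4) (- 3 / 4) (- 3 / 4) p q"
definition csB2 where "csB2 p q = J (- 1 / 2) (- 1 / 4) (- 3 / 4) (- 1 / 4) (- 1 / 4) p q"

lemma cs_gauss_ratio:
  assumes "t \<in> {0<..<pi / 2}" "x < 1" "y < 1"
  shows "wt (1 / 2) (- 3 / 4) (- 1 / 4) (- 3 / 4) (- 3 / 4) x y t
    = wt (- 1 / 2) (- 1 / 4) (- 3 / 4) (- 1 / 4) (- 1 / 4) x y t * gauss_ratio x y (- 1) t"
proof -
  have t: "0 < t" "t < pi / 2" using assms by auto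
  have pos: "sin (t / 2) > 0" "lin 1 t > 0" "lin (- 1) t > 0" "lin x t > 0" "lin y t > 0"
    using half_angle_bounds(1)[OF t] lin_pos[OF t] assms by auto
  have e: "v powr a = v powr b * v powr (a - b)" if "v > 0" for v a b :: real using that by (simp flip: powr_add)
  have "gauss_ratio x y (- 1) t = sin (t / 2) powr 1 * lin x t powr (- 1 / 2) * lin y t powr (- 1 / 2)
      * lin (- 1) t powr (1 / 2) * lin 1 t powr (- 1 / 2)"
  proof -
    have "sin (t / 2) powr 1 = sin (t / 2) powr (1 / 2) * sin (t / 2) powr (1 / 2)" by (simp flip: powr_add)
    then show ?thesis
      using pos unfolding gauss_ratio_def by (simp add: powr_mult powr_divide powr_minus field_simps)
  qed
  then show ?thesis
    unfolding wt_def
    using e[OF pos(1), of "1 / 2" "- 1 / 2"] e[OF pos(2), of "- 3 / 4" "- 1 / 4"] e[OF pos(3), of "- 1 / 4" "- 3 / 4"]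
      e[OF pos(4), of "- 3 / 4" "- 1 / 4"] e[OF pos(5), of "- 3 / 4" "- 1 / 4"]
    by (simp add: mult_ac)
qed

lemma lin_decreasing:
  assumes "0 < s" "s < t" "t < pi / 2" "0 \<le> x"
  shows "lin x t < lin x s"
proof -
  have "cos (t / 2) < cos (s / 2)" using assms by (intro cos_monotone_0_pi) auto
  moreover have "sin (s / 2) \<le> sin (t / 2)" using assms by (intro sin_monotone_2pi_le) auto
  ultimately show ?thesis using assms(4) mult_left_mono[of "sin (s / 2)" "sin (t / 2)" x] by (simp add: lin_def)
qed

text \<open>The only decreasing factor, \<open>lin (- 1) powr (- 1 / 4)\<close>, is compensated by half of the power of \<open>sin (t / 2)\<close>.\<close>

lemma cs_weight_increasing:
  assumes xy: "0 \<le> x" "x < 1" "0 \<le> y" "y < 1" and st: "0 < s" "s < t" "t < pi / 2"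
  shows "wt (1 / 2) (- 3 / 4) (- 1 / 4) (- 3 / 4) (- 3 / 4) x y s < wt (1 / 2) (- 3 / 4) (- 1 / 4) (- 3 / 4) (- 3 / 4) x y t"
proof -
  have s: "0 < s" "s < pi / 2" and t: "0 < t" "t < pi / 2" using st by auto
  have eq: "wt (1 / 2) (- 3 / 4) (- 1 / 4) (- 3 / 4) (- 3 / 4) x y u
    = sin (u / 2) powr (1 / 4) * (sin (u / 2) / lin (- 1) u) powr (1 / 4) * lin 1 u powr (- 3 / 4) * lin x u powr (- 3 / 4) * lin y u powr (- 3 / 4)"
    if "0 < u" "u < pi / 2" for u
  proof -
    have "sin (u / 2) > 0" "lin (- 1) u > 0" using half_angle_bounds(1)[OF that] lin_pos[OF that] by auto
    then have "sin (u / 2) powr (1 / 4) * (sin (u / 2) / lin (- 1) u) powr (1 / 4)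
        = sin (u / 2) powr (1 / 4 + 1 / 4) * lin (- 1) u powr (- 1 / 4)"
      unfolding powr_add by (simp add: powr_divide powr_minus_divide)
    then show ?thesis unfolding wt_def by (simp add: mult_ac)
  qed
  have lin: "lin z s powr (- 3 / 4) < lin z t powr (- 3 / 4)" if "0 \<le> z" "z \<le> 1" for z
    using lin_decreasing[OF st that(1)] lin_pos[OF t that(2)] by (intro powr_less_mono2_neg) auto
  have "sin (s / 2) < sin (t / 2)" using st by (intro sin_monotone_2pi) auto
  then have "sin (s / 2) powr (1 / 4) < sin (t / 2) powr (1 / 4)"
    using half_angle_bounds(1)[OF s] by (intro powr_less_mono2) auto
  moreover have "(sin (s / 2) / lin (- 1) s) powr (1 / 4) < (sin (t / 2) / lin (- 1) t) powr (1 / 4)"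
    using lin_ratio_increasing(1)[OF st, of "- 1"] half_angle_bounds(1)[OF s] lin_pos[OF s, of "- 1"]
    by (intro powr_less_mono2) auto
  ultimately show ?thesis
    unfolding eq[OF s] eq[OF t] using xy by (intro mult_strict_mono' lin) auto
qed

text \<open>The product of the values of \<open>lin y\<close> at \<open>t\<close> and \<open>\<pi> / 2 - t\<close> is the quadratic \<open>D + c - c y + D y\<^sup>2\<close> with
  \<open>c = sqrt 2 / 2\<close> and \<open>2 D + c \<le> 1\<close>.  Times \<open>1 + y\<close> it is a cubic whose difference quotient is nonpositive
  once \<open>y + y' \<ge> 1\<close>; hence the bound \<open>1 / 2\<close> on the parameter.\<close>

lemma lin_pair_product:
  fixes y y' :: real
  assumes y: "1 / 2 \<le> y" "y < y'" "y' < 1" and t: "0 < t" "t < pi / 2"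
  shows "(1 + y') * (lin y' t * lin y' (pi / 2 - t)) \<le> (1 + y) * (lin y t * lin y (pi / 2 - t))"
proof -
  define c where "c = sqrt 2 / 2"
  define D where "D = sin (t / 2) * sin ((pi / 2 - t) / 2)"
  have half: "(pi / 2 - t) / 2 = pi / 4 - t / 2" by (simp add: diff_divide_distrib)
  have c: "sin (t / 2 + (pi / 4 - t / 2)) = c" "cos (t / 2 + (pi / 4 - t / 2)) = c"
    by (simp_all add: c_def sin_45 cos_45)
  have prod: "lin z t * lin z (pi / 2 - t) = D + c - z * c + z\<^sup>2 * D" for z
  proof -
    have "lin z t * lin z (pi / 2 - t) = cos (t / 2) * cos (pi / 4 - t / 2)
        - z * (sin (t / 2) * cos (pi / 4 - t / 2) + cos (t / 2) * sin (pi / 4 - t / 2)) + z\<^sup>2 * D"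
      unfolding lin_def half D_def by (simp add: algebra_simps power2_eq_square)
    also have "\<dots> = D + c - z * c + z\<^sup>2 * D"
      using c unfolding sin_add cos_add half D_def by simp
    finally show ?thesis .
  qed
  have D0: "0 \<le> D" unfolding D_def using half_angle_bounds(1)[OF t] half_angle_bounds(1)[of "pi / 2 - t"] t by simp
  have "cos (t / 2 - (pi / 4 - t / 2)) \<le> 1" by simp
  then have D1: "2 * D + c \<le> 1" using c(2) unfolding D_def half cos_diff cos_add by simp
  \<comment> \<open>\<open>c > 0.7\<close> and \<open>D \<le> (1 - c) / 2 \<le> 0.15\<close> leave the room needed in the last estimate\<close>
  have c7: "c \<ge> 7 / 10" unfolding c_def using real_le_rsqrt[of "7 / 5" 2] by (simp add: power2_eq_square)
  have S: "1 \<le> y + y'" "y + y' \<le> 2" using y by auto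
  have "D * (1 + (y + y') + (y\<^sup>2 + y * y' + y'\<^sup>2)) \<le> (3 / 20) * (1 + 3 * (y + y'))"
  proof (rule mult_mono)
    have "y * y \<le> y" using y mult_left_mono[of y 1 y] by simp
    moreover have "y * y' \<le> y" using y mult_left_mono[of y' 1 y] by simp
    moreover have "y' * y' \<le> y'" using y mult_left_mono[of y' 1 y'] by simp
    ultimately have "y * y + y * y' + y' * y' \<le> y + y + y'" by (intro add_mono)
    then show "1 + (y + y') + (y\<^sup>2 + y * y' + y'\<^sup>2) \<le> 1 + 3 * (y + y')"
      using y unfolding power2_eq_square distrib_left by simp
  qed (use D1 c7 y in auto)
  also have "\<dots> \<le> (7 / 10) * (y + y')" using S by simp
  also have "\<dots> \<le> c * (y + y')" using c7 y by (intro mult_right_mono) auto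
  finally have "(y' - y) * (D * (1 + (y + y') + (y\<^sup>2 + y * y' + y'\<^sup>2))) \<le> (y' - y) * (c * (y + y'))"
    using y by (intro mult_left_mono) auto
  then show ?thesis unfolding prod by (simp add: algebra_simps power2_eq_square power3_eq_cube)
qed

text \<open>Symmetrizing under \<open>t \<mapsto> \<pi> / 2 - t\<close> and applying the inequality of the means reduces this to the product of
  the two values, which \<open>lin_pair_product\<close> bounds.\<close>

lemma lin_quotient_sqrt_mean:
  assumes y: "1 / 2 \<le> y" "y < y'" "y' < 1"
  shows "((1 + y') / (1 + y)) powr (1 / 4) * (pi / 2) \<le> integral {0..pi / 2} (\<lambda>t. (lin y t / lin y' t) powr (1 / 2))"
    and "(\<lambda>t. (lin y t / lin y' t) powr (1 / 2)) integrable_on {0..pi / 2}"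
proof -
  define g where "g t = (lin y t / lin y' t) powr (1 / 2)" for t
  define k where "k = ((1 + y') / (1 + y)) powr (1 / 4)"
  have k: "k > 0" "k * k = ((1 + y') / (1 + y)) powr (1 / 2)" using y by (simp_all add: k_def flip: powr_add)
  have pos: "lin z t > 0" if "z < 1" "0 \<le> t" "t \<le> pi / 2" for z t
  proof -
    have "0 \<le> sin (t / 2)" using that by (intro sin_ge_zero) auto
    moreover have "sin (t / 2) \<le> sin (pi / 4)" using that by (intro sin_monotone_2pi_le) auto
    moreover have "cos (pi / 4) \<le> cos (t / 2)" using that by (intro cos_monotone_0_pi_le) auto
    moreover have "cos (pi / 4) = sin (pi / 4)" "sin (pi / 4) > 0" by (simp_all add: sin_45 cos_45)
    ultimately have sc: "sin (t / 2) \<le> cos (t / 2)" "0 < cos (t / 2)" "0 \<le> sin (t / 2)" by linarith+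
    have "z * sin (t / 2) < cos (t / 2)"
    proof (cases "z \<le> 0")
      case True then show ?thesis using mult_nonpos_nonneg[OF True sc(3)] sc(2) by linarith
    next
      case False
      then have "z * sin (t / 2) \<le> z * cos (t / 2)" using sc by (intro mult_left_mono) auto
      also have "\<dots> < 1 * cos (t / 2)" using that(1) sc(2) by (intro mult_strict_right_mono) auto
      finally show ?thesis by simp
    qed
    then show ?thesis by (simp add: lin_def)
  qed
  have cont: "continuous_on {0..pi / 2} g"
    unfolding g_def
    by (intro continuous_on_powr continuous_on_divide lin_continuous continuous_on_const ballI)
       (use pos y in \<open>simp_all add: less_imp_neq[THEN not_sym]\<close>)
  then show int: "(\<lambda>t. (lin y t / lin y' t) powr (1 / 2)) integrable_on {0..pi / 2}"
    using integrable_continuous_real unfolding g_def by blast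
  then have int: "g integrable_on {0..pi / 2}" by (simp add: g_def [abs_def])
  have cont': "continuous_on {0..pi / 2} (\<lambda>t. g (pi / 2 - t))"
    by (rule continuous_on_compose2[OF cont]) (auto intro!: continuous_intros)
  have pair: "2 * k \<le> g t + g (pi / 2 - t)" if "t \<in> {0<..<pi / 2}" for t
  proof -
    have t: "0 < t" "t < pi / 2" using that by auto
    have l: "lin y t > 0" "lin y' t > 0" "lin y (pi / 2 - t) > 0" "lin y' (pi / 2 - t) > 0"
      using pos t y by auto
    have "k * k \<le> (lin y t * lin y (pi / 2 - t) / (lin y' t * lin y' (pi / 2 - t))) powr (1 / 2)"
      unfolding k(2) using lin_pair_product[OF y t] l y by (intro powr_mono2) (auto simp: divide_simps mult_ac)
    also have "\<dots> = g t * g (pi / 2 - t)"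
      unfolding g_def using l by (simp flip: powr_mult)
    finally have "k * k \<le> g t * g (pi / 2 - t)" .
    moreover have "0 \<le> (g t - g (pi / 2 - t))\<^sup>2" by simp
    ultimately have "(2 * k)\<^sup>2 \<le> (g t + g (pi / 2 - t))\<^sup>2" by (simp add: power2_eq_square algebra_simps)
    then show ?thesis by (rule power2_le_imp_le) (simp add: g_def)
  qed
  have "integral {0..pi / 2} (\<lambda>t. g (pi / 2 - t)) = integral {0..pi / 2} g"
    using integral_reflect_about[of "pi / 2" "pi / 2" 0 g] by simp
  moreover have "integral {0..pi / 2} (\<lambda>_. 2 * k) \<le> integral {0..pi / 2} (\<lambda>t. g t + g (pi / 2 - t))"
    by (rule integral_open_mono) (use pair int integrable_continuous_real[OF cont'] in \<open>auto intro: integrable_add\<close>)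
  moreover have "integral {0..pi / 2} (\<lambda>t. g t + g (pi / 2 - t)) = integral {0..pi / 2} g + integral {0..pi / 2} (\<lambda>t. g (pi / 2 - t))"
    by (rule integral_add[OF int integrable_continuous_real[OF cont']])
  ultimately show "((1 + y') / (1 + y)) powr (1 / 4) * (pi / 2) \<le> integral {0..pi / 2} (\<lambda>t. (lin y t / lin y' t) powr (1 / 2))"
    by (simp add: g_def [symmetric] k_def [symmetric] mult.commute)
qed

text \<open>The first weight gains the factor \<open>\<phi>\<^sup>3\<close> and the second \<open>\<phi>\<close>.  One application of Chebyshev compares \<open>\<phi>\<close> for the
  two weights; a second one, for the increasing weight \<open>w \<phi>\<close>, extracts the mean of \<open>\<phi>\<^sup>2\<close>, which is at least the
  stated power.  The surplus power is needed because the other edges of the polygon change with \<open>q\<close> as well.\<close>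

lemma cs_shift:
  assumes p: "0 \<le> p" "p < 1" and q: "1 / 2 \<le> q" "q < q'" "q' < 1"
  shows "((1 + q') / (1 + q)) powr (1 / 4) * (csB1 p q * csB2 p q') < csB2 p q * csB1 p q'"
proof -
  let ?S = "{0<..<pi / 2}"
  define k where "k = ((1 + q') / (1 + q)) powr (1 / 4)"
  have k: "k > 0" using q by (simp add: k_def)
  define w where "w = wt (1 / 2) (- 3 / 4) (- 1 / 4) (- 3 / 4) (- 3 / 4) p q"
  define \<phi> where "\<phi> t = (lin q t / lin q' t) powr (1 / 4)" for t
  have r: "wt (1 / 2) (- 3 / 4) (- 1 / 4) (- 3 / 4) (- 3 / 4) p q t
    = wt (- 1 / 2) (- 1 / 4) (- 3 / 4) (- 1 / 4) (- 1 / 4) p q t * gauss_ratio p q (- 1) t" if "t \<in> ?S" for t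
    using cs_gauss_ratio[OF that] p q by simp
  have s1: "(\<lambda>t. w t * \<phi> t) integrable_on {0..pi / 2}"
    and s2: "csB1 p q * csB2 p q' < csB2 p q * integral {0..pi / 2} (\<lambda>t. w t * \<phi> t)"
    and s4: "\<And>t. t \<in> ?S \<Longrightarrow> wt (1 / 2) (- 3 / 4) (- 1 / 4) (- 3 / 4) (- 3 / 4) p q' t = w t * \<phi> t ^ 3"
    unfolding csB1_def csB2_def w_def \<phi>_def
    by (rule shift_first_moment[where a = "1 / 2" and b = "- 3 / 4" and b' = "- 1 / 4" and c = "- 3 / 4"
          and \<alpha> = "- 1 / 2" and \<beta> = "- 1 / 4" and \<beta>' = "- 3 / 4" and \<gamma> = "- 1 / 4" and x = p and y = q and y' = q'
          and u = p and v = q and z = "- 1"]; use p q r in simp)+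
  have quot: "1 < lin q t / lin q' t" if "t \<in> ?S" for t using lin_quotient_gt_one[of t q q'] that q by simp
  have sq: "(lin q t / lin q' t) powr (1 / 2) = \<phi> t ^ 2" if "t \<in> ?S" for t
    unfolding \<phi>_def by (rule powr_quarters(1)[symmetric], rule less_trans[OF zero_less_one quot[OF that]])
  have phi_mono: "\<phi> u < \<phi> v" if "u \<in> ?S" "v \<in> ?S" "u < v" for u v
    unfolding \<phi>_def using lin_ratio_increasing(2)[of u v q q'] that q quot[OF that(1)]
    by (intro powr_less_mono2) auto
  have phi_pos: "\<phi> t > 0" if "t \<in> ?S" for t
    unfolding \<phi>_def powr_gt_zero using less_trans[OF zero_less_one quot[OF that]] by (rule less_imp_neq[THEN not_sym])
  have w_pos: "w t > 0" if "t \<in> ?S" for t unfolding w_def using p q that by (intro wt_pos) auto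
  have phi_cont: "continuous_on ?S \<phi>"
    unfolding \<phi>_def [abs_def] by (intro continuous_on_powr lin_quotient_continuous continuous_on_const ballI)
      (use quot q in fastforce)+
  have w_cont: "continuous_on ?S w" unfolding w_def using p q by (intro wt_continuous) auto
  have w3_int: "wt (1 / 2) (- 3 / 4) (- 1 / 4) (- 3 / 4) (- 3 / 4) p q' integrable_on {0..pi / 2}"
    using p q by (intro wt_integrable) auto
  have spike: "g integrable_on {0..pi / 2}" if "f integrable_on {0..pi / 2}" "\<And>t. t \<in> ?S \<Longrightarrow> f t = g t" for f g :: "real \<Rightarrow> real"
    using that integrable_cong[of ?S f g] by (simp flip: integrable_on_open_interval_real)
  have "integral {0..pi / 2} (\<lambda>t. 1 * (w t * \<phi> t)) * integral {0..pi / 2} (\<lambda>t. 1 * \<phi> t ^ 2)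
      < integral {0..pi / 2} (\<lambda>_. 1) * integral {0..pi / 2} (\<lambda>t. 1 * (w t * \<phi> t) * \<phi> t ^ 2)"
  proof (rule chebyshev_strict)
    show "(\<lambda>t. 1 * \<phi> t ^ 2) integrable_on {0..pi / 2}" by (rule spike[OF lin_quotient_sqrt_mean(2)[OF q]]) (simp add: sq)
    show "(\<lambda>t. 1 * (w t * \<phi> t) * \<phi> t ^ 2) integrable_on {0..pi / 2}"
    proof (rule spike[OF w3_int])
      fix t assume t: "t \<in> ?S"
      show "wt (1 / 2) (- 3 / 4) (- 1 / 4) (- 3 / 4) (- 3 / 4) p q' t = 1 * (w t * \<phi> t) * \<phi> t ^ 2"
        unfolding s4[OF t] by (simp add: power2_eq_square power3_eq_cube)
    qed
    show "strict_mono_on ?S (\<lambda>t. w t * \<phi> t)"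
    proof (rule strict_mono_onI)
      fix u v assume uv: "u \<in> ?S" "v \<in> ?S" "u < v"
      have "w u < w v" unfolding w_def using uv p q by (intro cs_weight_increasing) auto
      then show "w u * \<phi> u < w v * \<phi> v"
        using phi_mono[OF uv] less_imp_le[OF w_pos[OF uv(1)]] less_imp_le[OF phi_pos[OF uv(1)]] by (intro mult_strict_mono') auto
    qed
    show "strict_mono_on ?S (\<lambda>t. \<phi> t ^ 2)"
      using phi_mono phi_pos by (intro strict_mono_onI power_strict_mono) (auto intro: less_imp_le)
  qed (use s1 w_cont phi_cont in \<open>auto intro!: continuous_intros\<close>)
  then have A: "integral {0..pi / 2} (\<lambda>t. w t * \<phi> t) * integral {0..pi / 2} (\<lambda>t. \<phi> t ^ 2) < pi / 2 * csB1 p q'"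
    unfolding csB1_def J_def using integral_open_cong[of 0 "pi / 2", OF s4] by (simp add: power2_eq_square power3_eq_cube mult_ac)
  have B: "k * (pi / 2) \<le> integral {0..pi / 2} (\<lambda>t. \<phi> t ^ 2)"
    using lin_quotient_sqrt_mean(1)[OF q] integral_open_cong[of 0 "pi / 2", OF sq] by (simp add: k_def)
  have "integral {0..pi / 2} (\<lambda>_. 0) \<le> integral {0..pi / 2} (\<lambda>t. w t * \<phi> t)"
    by (rule integral_open_mono[OF integrable_0 s1]) (use w_pos phi_pos in \<open>simp add: less_imp_le\<close>)
  then have "0 \<le> integral {0..pi / 2} (\<lambda>t. w t * \<phi> t)" by simp
  from mult_left_mono[OF B this] A
  have "integral {0..pi / 2} (\<lambda>t. w t * \<phi> t) * (k * (pi / 2)) < pi / 2 * csB1 p q'" by (rule le_less_trans)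
  then have "k * integral {0..pi / 2} (\<lambda>t. w t * \<phi> t) < csB1 p q'" by (simp add: mult_ac)
  moreover have "csB2 p q > 0" unfolding csB2_def using p q by (intro J_pos) auto
  ultimately have "csB2 p q * (k * integral {0..pi / 2} (\<lambda>t. w t * \<phi> t)) < csB2 p q * csB1 p q'" by simp
  moreover have "k * (csB1 p q * csB2 p q') < k * (csB2 p q * integral {0..pi / 2} (\<lambda>t. w t * \<phi> t))" using s2 k by simp
  ultimately show ?thesis unfolding k_def[symmetric] by (simp add: mult_ac)
qed

section \<open>Five marks with two parameters\<close>

lemma less_5_cases: "k < (5::nat) \<longleftrightarrow> k = 0 \<or> k = 1 \<or> k = 2 \<or> k = 3 \<or> k = 4"
  by auto

lemma prod_lessThan_5: "(\<Prod>k<5. f k) = f 0 * f 1 * f 2 * f 3 * f (4::nat)"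
  by (simp add: eval_nat_numeral)

lemma sum_lessThan_5: "(\<Sum>k<5. f k) = f 0 + f 1 + f 2 + f 3 + f (4::nat)"
  by (simp add: eval_nat_numeral)

text \<open>A Moebius transformation moves three of the marks to \<open>1\<close>, \<open>\<i>\<close> and \<open>- \<i>\<close>.  The half angles of the marks \<open>1\<close> to \<open>4\<close> have
  cotangents \<open>1\<close>, \<open>q\<close>, \<open>p\<close> and \<open>- 1\<close>, so the reflection in the real axis acts by \<open>(p, q) \<mapsto> (- q, - p)\<close>.\<close>

definition pmark :: "real \<Rightarrow> real \<Rightarrow> nat \<Rightarrow> real" where
  "pmark p q k = (if k = 0 then 0 else if k = 1 then pi / 2 else if k = 2 then pi - 2 * arctan q
     else if k = 3 then pi - 2 * arctan p else if k = 4 then 3 * pi / 2 else 2 * pi)"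

text \<open>These scales turn the chord to the mark of parameter \<open>x\<close> into \<open>\<bar>lin x t\<bar>\<close> and the chord to \<open>1\<close> into \<open>\<bar>sin (t / 2)\<bar>\<close>.\<close>

definition pscale :: "real \<Rightarrow> real \<Rightarrow> nat \<Rightarrow> real" where
  "pscale p q k = (if k = 0 then 1 / 2 else 1 / (2 * sin (pmark p q k / 2)))"

definition expo :: "real \<Rightarrow> real \<Rightarrow> real \<Rightarrow> real \<Rightarrow> real \<Rightarrow> nat \<Rightarrow> real" where
  "expo a b c d e k = (if k = 0 then a else if k = 1 then b else if k = 2 then c else if k = 3 then d else e)"

lemma pmark_five_marks:
  assumes "- 1 < p" "p < q" "q < 1"
  shows "five_marks (pmark p q)"
proof -
  have "arctan (- 1) < arctan p" "arctan p < arctan q" "arctan q < arctan 1"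
    using assms by (simp_all only: arctan_less_iff)
  then have "- pi / 4 < arctan p" "arctan p < arctan q" "arctan q < pi / 4"
    by (simp_all add: arctan_minus arctan_one)
  then show ?thesis
    unfolding five_marks_def less_5_cases by (auto simp: pmark_def)
qed

lemma half_mark:
  assumes "k = 1 \<and> x = 1 \<or> k = 2 \<and> x = q \<or> k = 3 \<and> x = p \<or> k = 4 \<and> x = - 1"
  shows "sin (pmark p q k / 2) > 0" "cos (pmark p q k / 2) = x * sin (pmark p q k / 2)"
proof -
  have a: "cos (pi / 2 - arctan y) = y * sin (pi / 2 - arctan y)" "sin (pi / 2 - arctan y) > 0" for y
  proof -
    have "sin (arctan y) / cos (arctan y) = y" using tan_arctan[of y] by (simp only: tan_def)
    then have "sin (arctan y) = y * cos (arctan y)" using cos_arctan_not_zero[of y] by (metis nonzero_divide_eq_eq)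
    moreover have "cos (pi / 2 - arctan y) = sin (arctan y)" "sin (pi / 2 - arctan y) = cos (arctan y)"
      by (simp_all only: cos_diff sin_diff) simp_all
    ultimately show "cos (pi / 2 - arctan y) = y * sin (pi / 2 - arctan y)" by simp
    have "cos (arctan y) > 0" using arctan_bounded[of y] by (intro cos_gt_zero_pi) auto
    then show "sin (pi / 2 - arctan y) > 0" by (simp add: sin_diff)
  qed
  have b: "pmark p q k / 2 = pi / 2 - arctan x"
    using assms by (auto simp: pmark_def arctan_one arctan_minus field_simps)
  show "sin (pmark p q k / 2) > 0" "cos (pmark p q k / 2) = x * sin (pmark p q k / 2)"
    unfolding b using a by auto
qed

lemma pscale_pos:
  assumes "k < 5"
  shows "pscale p q k > 0"
proof (cases "k = 0")
  case True
  then show ?thesis by (simp add: pscale_def)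
next
  case False
  then have "k = 1 \<or> k = 2 \<or> k = 3 \<or> k = 4" using assms by linarith
  then have "sin (pmark p q k / 2) > 0"
    by (elim disjE) (rule half_mark(1)[of k 1 q p] half_mark(1)[of k q q p] half_mark(1)[of k p q p] half_mark(1)[of k "- 1" q p], simp)+
  then show ?thesis using False by (simp add: pscale_def)
qed

lemma chord_eq_lin:
  assumes "k = 1 \<and> x = 1 \<or> k = 2 \<and> x = q \<or> k = 3 \<and> x = p \<or> k = 4 \<and> x = - 1"
  shows "2 * pscale p q k * \<bar>sin ((t - pmark p q k) / 2)\<bar> = \<bar>lin x t\<bar>"
proof -
  note h = half_mark[OF assms]
  have "sin ((t - pmark p q k) / 2) = sin (t / 2 - pmark p q k / 2)" by (simp add: diff_divide_distrib)
  also have "\<dots> = - sin (pmark p q k / 2) * lin x t"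
    unfolding sin_diff h(2) by (simp add: lin_def algebra_simps)
  finally have "\<bar>sin ((t - pmark p q k) / 2)\<bar> = sin (pmark p q k / 2) * \<bar>lin x t\<bar>"
    using h(1) by (simp add: abs_mult)
  moreover have "k \<noteq> 0" using assms by auto
  ultimately show ?thesis using h(1) by (simp add: pscale_def)
qed

definition parc :: "(nat \<Rightarrow> real) \<Rightarrow> real \<Rightarrow> real \<Rightarrow> real \<Rightarrow> real" where
  "parc e p q t = \<bar>sin (t / 2)\<bar> powr e 0 * \<bar>lin 1 t\<bar> powr e 1 * \<bar>lin q t\<bar> powr e 2 * \<bar>lin p t\<bar> powr e 3 * \<bar>lin (- 1) t\<bar> powr e 4"

lemma arc_weight_eq: "arc_weight (pscale p q) (pmark p q) e t = parc e p q t"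
proof -
  have "2 * pscale p q 0 * \<bar>sin ((t - pmark p q 0) / 2)\<bar> = \<bar>sin (t / 2)\<bar>"
    by (simp add: pscale_def pmark_def)
  moreover have "2 * pscale p q 1 * \<bar>sin ((t - pmark p q 1) / 2)\<bar> = \<bar>lin 1 t\<bar>" by (rule chord_eq_lin) simp
  moreover have "2 * pscale p q 2 * \<bar>sin ((t - pmark p q 2) / 2)\<bar> = \<bar>lin q t\<bar>" by (rule chord_eq_lin) simp
  moreover have "2 * pscale p q 3 * \<bar>sin ((t - pmark p q 3) / 2)\<bar> = \<bar>lin p t\<bar>" by (rule chord_eq_lin) simp
  moreover have "2 * pscale p q 4 * \<bar>sin ((t - pmark p q 4) / 2)\<bar> = \<bar>lin (- 1) t\<bar>" by (rule chord_eq_lin) simp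
  ultimately show ?thesis by (simp only: arc_weight_def prod_lessThan_5 parc_def)
qed

definition edge_len :: "(nat \<Rightarrow> real) \<Rightarrow> nat \<Rightarrow> real \<Rightarrow> real \<Rightarrow> real" where
  "edge_len e j p q = arc_length (pscale p q) (pmark p q) e j"

lemma edge_len_integral: "edge_len e j p q = integral {pmark p q j..pmark p q (Suc j)} (parc e p q)"
  unfolding edge_len_def arc_length_def by (rule integral_cong) (rule arc_weight_eq)

lemma edge_len_0:
  assumes "p < 1" "q < 1"
  shows "edge_len e 0 p q = J (e 0) (e 1) (e 4) (e 2) (e 3) q p"
proof -
  have eq: "parc e p q t = wt (e 0) (e 1) (e 4) (e 2) (e 3) q p t" if "t \<in> {0<..<pi / 2}" for t
  proof -
    have t: "0 < t" "t < pi / 2" using that by auto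
    have "sin (t / 2) > 0" by (rule half_angle_bounds[OF t])
    moreover have "lin 1 t > 0" "lin q t > 0" "lin p t > 0" "lin (- 1) t > 0" using assms by (simp_all add: lin_pos[OF t])
    ultimately show ?thesis by (simp add: parc_def wt_def)
  qed
  have "edge_len e 0 p q = integral {0..pi / 2} (parc e p q)"
    unfolding edge_len_integral by (simp add: pmark_def)
  also have "\<dots> = J (e 0) (e 1) (e 4) (e 2) (e 3) q p"
    unfolding J_def by (rule integral_open_cong[OF eq])
  finally show ?thesis .
qed

lemma edge_len_4:
  assumes "- 1 < p" "- 1 < q"
  shows "edge_len e 4 p q = J (e 0) (e 4) (e 1) (e 2) (e 3) (- q) (- p)"
proof -
  have sym: "parc e p q (2 * pi - t) = wt (e 0) (e 4) (e 1) (e 2) (e 3) (- q) (- p) t" if "t \<in> {0<..<pi / 2}" for t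
  proof -
    have t: "0 < t" "t < pi / 2" using that by auto
    have half: "(2 * pi - t) / 2 = pi - t / 2" by simp
    have l: "lin x (2 * pi - t) = - lin (- x) t" "sin ((2 * pi - t) / 2) = sin (t / 2)" for x
      unfolding lin_def half by simp_all
    have "sin (t / 2) > 0" by (rule half_angle_bounds[OF t])
    moreover have "lin 1 t > 0" "lin (- q) t > 0" "lin (- p) t > 0" "lin (- 1) t > 0" using assms by (simp_all add: lin_pos[OF t])
    ultimately show ?thesis unfolding parc_def l by (simp add: wt_def)
  qed
  have "edge_len e 4 p q = integral {3 * pi / 2..2 * pi} (parc e p q)"
    unfolding edge_len_integral by (simp add: pmark_def)
  also have "\<dots> = integral {2 * pi - 2 * pi..2 * pi - 3 * pi / 2} (\<lambda>t. parc e p q (2 * pi - t))"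
    by (rule integral_reflect_about[symmetric])
  also have "\<dots> = integral {0..pi / 2} (\<lambda>t. parc e p q (2 * pi - t))" by (simp add: field_simps)
  also have "\<dots> = J (e 0) (e 4) (e 1) (e 2) (e 3) (- q) (- p)"
    unfolding J_def by (rule integral_open_cong[OF sym])
  finally show ?thesis .
qed

definition admissible :: "(nat \<Rightarrow> real) \<Rightarrow> bool" where
  "admissible e \<longleftrightarrow> (\<forall>k<5. - 3 / 4 \<le> e k) \<and> (\<Sum>k<5. e k) = - 2"

definition Params :: "(real \<times> real) set" where
  "Params = {(p, q). - 1 < p \<and> p < q \<and> q < 1}"

lemma sc_data_pmark:
  assumes "admissible e" "(p, q) \<in> Params"
  shows "sc_data (pscale p q) (pmark p q) e"
proof (rule sc_data.intro)
  have "- 1 < p" "p < q" "q < 1" using assms(2) by (simp_all add: Params_def)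
  then show "five_marks (pmark p q)" by (rule pmark_five_marks)
  show "0 < pscale p q k" if "k < 5" for k by (rule pscale_pos[OF that])
  show "- 3 / 4 \<le> e k" if "k < 5" for k using assms(1) that by (simp add: admissible_def)
  show "(\<Sum>k<5. e k) = - 2" using assms(1) by (simp add: admissible_def)
qed

definition pprim :: "(nat \<Rightarrow> real) \<Rightarrow> real \<Rightarrow> real \<Rightarrow> complex \<Rightarrow> complex" where
  "pprim e p q = sc_prim (pscale p q) (pmark p q) e"

lemma pprim_continuous:
  assumes "admissible e"
  shows "continuous_on (Params \<times> cball 0 1) (\<lambda>((p, q), z). pprim e p q z)"
proof (rule continuous_on_sequentially[THEN iffD2], rule allI, rule ballI, rule impI)
  fix u :: "nat \<Rightarrow> (real \<times> real) \<times> complex" and w :: "(real \<times> real) \<times> complex"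
  assume w: "w \<in> Params \<times> cball 0 1" and u: "(\<forall>n. u n \<in> Params \<times> cball 0 1) \<and> u \<longlonglongrightarrow> w"
  define p where "p = fst (fst w)"
  define q where "q = snd (fst w)"
  define z where "z = snd w"
  define P where "P n = fst (fst (u n))" for n
  define Q where "Q n = snd (fst (u n))" for n
  define Z where "Z n = snd (u n)" for n
  have lim: "u \<longlonglongrightarrow> w" by (rule conjunct2[OF u])
  have un: "u n \<in> Params \<times> cball 0 1" for n using conjunct1[OF u] by (rule spec)
  have P: "P \<longlonglongrightarrow> p" and Q: "Q \<longlonglongrightarrow> q" and Z: "Z \<longlonglongrightarrow> z"
    unfolding P_def [abs_def] Q_def [abs_def] Z_def [abs_def] p_def q_def z_def by (intro tendsto_intros lim)+
  have pq: "(p, q) \<in> Params" using w by (simp add: p_def q_def mem_Times_iff)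
  have PQ: "(P n, Q n) \<in> Params" and Zn: "norm (Z n) \<le> 1" for n
    using un[of n] by (simp_all add: P_def Q_def Z_def mem_Times_iff)
  have marks: "(\<lambda>n. pmark (P n) (Q n) k) \<longlonglongrightarrow> pmark p q k" for k
  proof -
    have "(\<lambda>n. pi - 2 * arctan (P n)) \<longlonglongrightarrow> pi - 2 * arctan p" by (intro tendsto_intros P)
    moreover have "(\<lambda>n. pi - 2 * arctan (Q n)) \<longlonglongrightarrow> pi - 2 * arctan q" by (intro tendsto_intros Q)
    ultimately show ?thesis by (simp add: pmark_def)
  qed
  have scale: "(\<lambda>n. pscale (P n) (Q n) k) \<longlonglongrightarrow> pscale p q k" if "k < 5" for k
  proof (cases "k = 0")
    case False
    have "pscale p q k > 0" by (rule pscale_pos[OF that])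
    then have "2 * sin (pmark p q k / 2) \<noteq> 0" using False by (auto simp: pscale_def)
    then have "(\<lambda>n. 1 / (2 * sin (pmark (P n) (Q n) k / 2))) \<longlonglongrightarrow> 1 / (2 * sin (pmark p q k / 2))"
      by (intro tendsto_intros marks) auto
    then show ?thesis using False by (simp add: pscale_def)
  qed (simp add: pscale_def)
  have "(\<lambda>n. pprim e (P n) (Q n) (Z n)) \<longlonglongrightarrow> pprim e p q z"
    unfolding pprim_def
  proof (rule sc_prim_tendsto[where b = "- 3 / 4"])
    show "cis (pmark p q j) \<noteq> cis (pmark p q k)" if "j < 5" "k < 5" "j \<noteq> k" for j k
      using five_marks_distinct[OF pmark_five_marks that] pq by (simp add: Params_def)
    show "cis (pmark (P n) (Q n) j) \<noteq> cis (pmark (P n) (Q n) k)" if "j < 5" "k < 5" "j \<noteq> k" for n j k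
      using five_marks_distinct[OF pmark_five_marks that] PQ[of n] by (simp add: Params_def)
  qed (use assms marks scale pscale_pos Z Zn in \<open>simp_all add: admissible_def\<close>)
  then show "((\<lambda>x. case x of (x, z) \<Rightarrow> (case x of (p, q) \<Rightarrow> \<lambda>z. pprim e p q z) z) \<circ> u) \<longlonglongrightarrow> (case w of (x, z) \<Rightarrow> (case x of (p, q) \<Rightarrow> \<lambda>z. pprim e p q z) z)"
    by (simp add: o_def case_prod_beta P_def Q_def Z_def p_def q_def z_def)
qed

lemma pmark_continuous: "continuous_on S (\<lambda>x. pmark (fst x) (snd x) k)"
proof -
  have "continuous_on S (\<lambda>x. pi - 2 * arctan (fst x))" "continuous_on S (\<lambda>x. pi - 2 * arctan (snd x))"
    by (intro continuous_intros)+
  then show ?thesis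
    by (cases "k = 0"; cases "k = 1"; cases "k = 2"; cases "k = 3"; cases "k = 4"; simp add: pmark_def)
qed

lemma pprim_mark_continuous:
  assumes "admissible e"
  shows "continuous_on Params (\<lambda>x. pprim e (fst x) (snd x) (cis (pmark (fst x) (snd x) k)))"
proof -
  have "continuous_on Params (\<lambda>x. (\<lambda>((p, q), z). pprim e p q z) (x, cis (pmark (fst x) (snd x) k)))"
    by (rule continuous_on_compose2[OF pprim_continuous[OF assms]])
       (auto intro!: continuous_intros pmark_continuous simp: cis_conv_exp)
  then show ?thesis by (simp add: case_prod_beta)
qed

lemma edge_len_continuous:
  assumes "admissible e" "j < 5"
  shows "continuous_on Params (\<lambda>x. edge_len e j (fst x) (snd x))"
proof -
  have "continuous_on Params (\<lambda>x. Re ((pprim e (fst x) (snd x) (cis (pmark (fst x) (snd x) (Suc j)))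
     - pprim e (fst x) (snd x) (cis (pmark (fst x) (snd x) j))) / arc_phase e j))"
    by (intro continuous_intros pprim_mark_continuous assms) (auto simp: arc_phase_nonzero)
  then show ?thesis
  proof (rule continuous_on_eq)
    fix x assume "x \<in> Params"
    then interpret sc_data "pscale (fst x) (snd x)" "pmark (fst x) (snd x)" e
      using assms by (intro sc_data_pmark) auto
    show "Re ((pprim e (fst x) (snd x) (cis (pmark (fst x) (snd x) (Suc j)))
     - pprim e (fst x) (snd x) (cis (pmark (fst x) (snd x) j))) / arc_phase e j) = edge_len e j (fst x) (snd x)"
      unfolding pprim_def sc_prim_edge[OF assms(2)] edge_len_def by (simp add: arc_phase_nonzero)
  qed
qed

lemma edge_len_pos:
  assumes "admissible e" "j < 5" "(p, q) \<in> Params"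
  shows "edge_len e j p q > 0"
proof -
  interpret sc_data "pscale p q" "pmark p q" e using assms by (intro sc_data_pmark) auto
  have lt: "pmark p q j < pmark p q (Suc j)" using five_marks_mono[OF fm, of j "Suc j"] assms(2) by simp
  have wp: "arc_weight (pscale p q) (pmark p q) e t > 0" if "t \<in> {pmark p q j<..<pmark p q (Suc j)}" for t
    by (rule arc_weight_pos[OF fm nu assms(2)]) (use that in simp_all)
  show ?thesis
    unfolding edge_len_def arc_length_def
  proof (rule integral_pos_open[where c = "(pmark p q j + pmark p q (Suc j)) / 2"])
    show "arc_weight (pscale p q) (pmark p q) e integrable_on {pmark p q j..pmark p q (Suc j)}"
      by (rule sc_prim_on_arc(1)[OF assms(2)]) (use lt in simp_all)
    show mid: "(pmark p q j + pmark p q (Suc j)) / 2 \<in> {pmark p q j<..<pmark p q (Suc j)}" using lt by auto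
    show "0 < arc_weight (pscale p q) (pmark p q) e ((pmark p q j + pmark p q (Suc j)) / 2)" by (rule wp[OF mid])
    show "continuous_on {pmark p q j<..<pmark p q (Suc j)} (arc_weight (pscale p q) (pmark p q) e)"
      unfolding arc_weight_def [abs_def]
    proof (intro continuous_on_prod continuous_on_powr continuous_intros ballI)
      fix k t assume "k \<in> {..<5::nat}" "t \<in> {pmark p q j<..<pmark p q (Suc j)}"
      then have "sin ((t - pmark p q k) / 2) \<noteq> 0" "pscale p q k > 0"
        using sin_half_gap_nonzero[OF fm assms(2), of k t] nu[of k] by simp_all
      then show "2 * pscale p q k * \<bar>sin ((t - pmark p q k) / 2)\<bar> \<noteq> 0" by simp
    qed simp_all
    show "0 \<le> arc_weight (pscale p q) (pmark p q) e t" if "t \<in> {pmark p q j<..<pmark p q (Suc j)}" for t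
      by (rule less_imp_le[OF wp[OF that]])
  qed
qed

lemma parc_integrable:
  assumes "admissible e" "j < 5" "(p, q) \<in> Params"
  shows "parc e p q integrable_on {pmark p q j..pmark p q (Suc j)}"
proof -
  interpret sc_data "pscale p q" "pmark p q" e using assms by (intro sc_data_pmark) auto
  have "pmark p q j < pmark p q (Suc j)" using five_marks_mono[OF fm, of j "Suc j"] assms(2) by simp
  then show ?thesis using sc_prim_on_arc(1)[OF assms(2), of "pmark p q j" "pmark p q (Suc j)"]
    by (simp add: arc_weight_eq cong: integrable_cong)
qed

text \<open>The hypothesis \<open>step\<close> says that the function can cross zero only upwards.  The zero is then caught between
  a point of negative and a point of positive value, and both signs persist for nearby parameters.\<close>

section \<open>The period problem\<close>

lemma sign_change_root_continuous:
  fixes D :: "real \<Rightarrow> real \<Rightarrow> real" and lo hi :: "real \<Rightarrow> real"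
  assumes I: "open I" and lohi: "continuous_on I lo" "continuous_on I hi"
    and cont: "continuous_on {x. fst x \<in> I \<and> lo (fst x) < snd x \<and> snd x < hi (fst x)} (\<lambda>x. D (fst x) (snd x))"
    and step: "\<And>x y y'. x \<in> I \<Longrightarrow> lo x < y \<Longrightarrow> y < y' \<Longrightarrow> y' < hi x \<Longrightarrow> 0 \<le> D x y \<Longrightarrow> 0 < D x y'"
    and neg: "\<And>x. x \<in> I \<Longrightarrow> \<exists>y. lo x < y \<and> y < hi x \<and> D x y < 0"
    and pos: "\<And>x. x \<in> I \<Longrightarrow> \<exists>y. lo x < y \<and> y < hi x \<and> 0 < D x y"
  obtains f where "continuous_on I f" "\<And>x. x \<in> I \<Longrightarrow> lo x < f x \<and> f x < hi x \<and> D x (f x) = 0"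
proof -
  let ?W = "{x. fst x \<in> I \<and> lo (fst x) < snd x \<and> snd x < hi (fst x)}"
  have "\<exists>y. lo x < y \<and> y < hi x \<and> D x y = 0" if x: "x \<in> I" for x
  proof -
    obtain a where a: "lo x < a" "a < hi x" "D x a < 0" using neg[OF x] by auto
    obtain b where b: "lo x < b" "b < hi x" "0 < D x b" using pos[OF x] by auto
    have "a < b" using step[OF x b(1) _ a(2)] a b by (cases a b rule: linorder_cases) auto
    have "continuous_on {a..b} (\<lambda>y. D (fst (x, y)) (snd (x, y)))"
    proof (rule continuous_on_compose2[OF cont])
      show "continuous_on {a..b} (Pair x)" by (intro continuous_intros)
      show "Pair x ` {a..b} \<subseteq> {x. fst x \<in> I \<and> lo (fst x) < snd x \<and> snd x < hi (fst x)}" using a b x by auto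
    qed
    then have "continuous_on {a..b} (D x)" by simp
    then obtain y where "a \<le> y" "y \<le> b" "D x y = 0"
      using IVT'[of "D x" a 0 b] \<open>a < b\<close> a b by auto
    then show ?thesis using a b by (intro exI[of _ y]) auto
  qed
  then obtain f where f: "\<And>x. x \<in> I \<Longrightarrow> lo x < f x \<and> f x < hi x \<and> D x (f x) = 0" by metis
  have below: "a < f x" if "x \<in> I" "lo x < a" "a < hi x" "D x a < 0" for x a
    using step[OF that(1), of "f x" a] f[OF that(1)] that by (cases "f x" a rule: linorder_cases) auto
  have above: "f x < b" if "x \<in> I" "lo x < b" "b < hi x" "0 < D x b" for x b
    using step[OF that(1), of b "f x"] f[OF that(1)] that by (cases "f x" b rule: linorder_cases) auto
  have near: "isCont (\<lambda>x. D x a) x0 \<and> eventually (\<lambda>x. x \<in> I \<and> lo x < a \<and> a < hi x) (at x0)"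
    if "x0 \<in> I" "lo x0 < a" "a < hi x0" for x0 a
  proof -
    define A where "A = {x \<in> I. lo x < a} \<inter> {x \<in> I. a < hi x}"
    have "{x \<in> I. lo x < a} = I \<inter> lo -` {..<a}" "{x \<in> I. a < hi x} = I \<inter> hi -` {a<..}" by auto
    then have "open A"
      unfolding A_def using continuous_open_preimage[OF lohi(1) I] continuous_open_preimage[OF lohi(2) I]
      by (simp add: open_Int)
    have "continuous_on A (\<lambda>x. D (fst (x, a)) (snd (x, a)))"
      by (rule continuous_on_compose2[OF cont]) (auto simp: A_def intro!: continuous_intros)
    then have "isCont (\<lambda>x. D x a) x0"
      using \<open>open A\<close> that by (simp add: continuous_on_eq_continuous_at A_def)
    moreover have "eventually (\<lambda>x. x \<in> A) (at x0)"
      by (rule eventually_at_in_open'[OF \<open>open A\<close>]) (use that in \<open>simp add: A_def\<close>)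
    then have "eventually (\<lambda>x. x \<in> I \<and> lo x < a \<and> a < hi x) (at x0)"
      by (rule eventually_mono) (simp add: A_def)
    ultimately show ?thesis by blast
  qed
  have "isCont f x0" if x0: "x0 \<in> I" for x0
    unfolding isCont_def
  proof (rule order_tendstoI)
    fix a assume a: "a < f x0"
    have "max (lo x0) a < f x0" using f[OF x0] a by simp
    then obtain a' where "max (lo x0) a < a'" "a' < f x0" using dense by blast
    then have a': "lo x0 < a'" "a' < hi x0" "a \<le> a'" "a' < f x0" using f[OF x0] by simp_all
    have "D x0 a' < 0"
    proof (rule ccontr)
      assume "\<not> D x0 a' < 0"
      then have "0 < D x0 (f x0)" using step[OF x0 a'(1,4)] f[OF x0] by simp
      then show False using f[OF x0] by simp
    qed
    then have "eventually (\<lambda>x. D x a' < 0) (at x0)"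
      using near[OF x0 a'(1,2)] unfolding isCont_def by (intro order_tendstoD) auto
    moreover have "eventually (\<lambda>x. x \<in> I \<and> lo x < a' \<and> a' < hi x) (at x0)" using near[OF x0 a'(1,2)] by blast
    ultimately show "eventually (\<lambda>x. a < f x) (at x0)"
    proof eventually_elim
      case (elim x)
      then show ?case using below[of x a'] a'(3) by linarith
    qed
  next
    fix a assume a: "f x0 < a"
    have "f x0 < min (hi x0) a" using f[OF x0] a by simp
    then obtain a' where "f x0 < a'" "a' < min (hi x0) a" using dense by blast
    then have a': "lo x0 < a'" "a' < hi x0" "a' \<le> a" "f x0 < a'" using f[OF x0] by simp_all
    have "0 < D x0 a'" using step[OF x0 _ a'(4,2)] f[OF x0] by simp
    then have "eventually (\<lambda>x. 0 < D x a') (at x0)"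
      using near[OF x0 a'(1,2)] unfolding isCont_def by (intro order_tendstoD) auto
    moreover have "eventually (\<lambda>x. x \<in> I \<and> lo x < a' \<and> a' < hi x) (at x0)" using near[OF x0 a'(1,2)] by blast
    ultimately show "eventually (\<lambda>x. f x < a) (at x0)"
    proof eventually_elim
      case (elim x)
      then show ?case using above[of x a'] a'(3) by linarith
    qed
  qed
  then have "continuous_on I f" by (simp add: continuous_at_imp_continuous_on)
  then show ?thesis using that f by blast
qed


text \<open>The exponents of the height form and of the two pairs of horizontal forms.  In each pair the
  exponents average to those of the height form.  At an endpoint of a horizontal diagonal a pair differs by \<open>1 / 2\<close>, which is
  an angle of \<open>\<pi> / 4\<close> between diagonal and wall; at the mark \<open>0\<close> it differs by \<open>1\<close>, where the surface passes
  from one wall to the adjacent one.\<close>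

definition e_height where "e_height = expo 0 (- 1 / 2) (- 1 / 2) (- 1 / 2) (- 1 / 2)"
definition e_ss1 where "e_ss1 = expo (1 / 2) (- 3 / 4) (- 1 / 4) (- 3 / 4) (- 3 / 4)"
definition e_ss2 where "e_ss2 = expo (- 1 / 2) (- 1 / 4) (- 3 / 4) (- 1 / 4) (- 1 / 4)"
definition e_cs1 where "e_cs1 = expo (1 / 2) (- 3 / 4) (- 3 / 4) (- 3 / 4) (- 1 / 4)"
definition e_cs2 where "e_cs2 = expo (- 1 / 2) (- 1 / 4) (- 1 / 4) (- 1 / 4) (- 3 / 4)"

lemma expo_simps [simp]:
  "expo a b c d e 0 = a" "expo a b c d e 1 = b" "expo a b c d e (Suc 0) = b" "expo a b c d e 2 = c" "expo a b c d e 3 = d" "expo a b c d e 4 = e"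
  by (simp_all add: expo_def)

lemma admissible_expo:
  "- 3 / 4 \<le> a \<Longrightarrow> - 3 / 4 \<le> b \<Longrightarrow> - 3 / 4 \<le> c \<Longrightarrow> - 3 / 4 \<le> d \<Longrightarrow> - 3 / 4 \<le> e \<Longrightarrow> a + b + c + d + e = - 2
    \<Longrightarrow> admissible (expo a b c d e)"
  unfolding admissible_def sum_lessThan_5 by (simp add: less_5_cases del: One_nat_def)

lemma admissible_exponents [simp]:
  "admissible e_height" "admissible e_ss1" "admissible e_ss2" "admissible e_cs1" "admissible e_cs2"
  unfolding e_height_def e_ss1_def e_ss2_def e_cs1_def e_cs2_def by (rule admissible_expo; simp)+

lemma ss_edges:
  assumes "- 1 < p" "p < 1" "- 1 < q" "q < 1"
  shows "edge_len e_ss1 0 p q = ssB1 p q" "edge_len e_ss2 0 p q = ssB2 p q"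
    "edge_len e_ss1 4 p q = ssB1 (- p) (- q)" "edge_len e_ss2 4 p q = ssB2 (- p) (- q)"
  using assms by (simp_all add: edge_len_0 edge_len_4 e_ss1_def e_ss2_def ssB1_def ssB2_def)

lemma ssB_pos: "p < 1 \<Longrightarrow> q < 1 \<Longrightarrow> ssB1 p q > 0" "p < 1 \<Longrightarrow> q < 1 \<Longrightarrow> ssB2 p q > 0"
  unfolding ssB1_def ssB2_def by (rule J_pos; simp)+

lemma J_continuous':
  assumes "- 3 / 4 \<le> a" "- 3 / 4 \<le> b" "continuous_on S f" "continuous_on S g" "\<And>x. x \<in> S \<Longrightarrow> f x < 1 \<and> g x < 1"
  shows "continuous_on S (\<lambda>x. J a b b' c d (f x) (g x))"
proof -
  have "continuous_on S (\<lambda>x. case (f x, g x) of (x, y) \<Rightarrow> J a b b' c d x y)"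
    by (rule continuous_on_compose2[OF J_continuous[OF assms(1,2)]])
       (use assms(3-5) in \<open>auto intro!: continuous_intros\<close>)
  then show ?thesis by simp
qed

text \<open>The function whose zero is sought is negative at \<open>p = - q\<close>, positive at \<open>p = q\<close>, and can only cross zero
  upwards, because both edge quotients move in the same direction by \<open>ss_shift\<close>.\<close>

lemma ss_solution:
  obtains P where "continuous_on {0<..<1} P"
    "\<And>q. q \<in> {0<..<1} \<Longrightarrow> (P q, q) \<in> Params"
    "\<And>q. q \<in> {0<..<1} \<Longrightarrow> edge_len e_ss1 0 (P q) q * edge_len e_ss2 4 (P q) q = edge_len e_ss2 0 (P q) q * edge_len e_ss1 4 (P q) q"
proof -
  define D where "D q p = ssB1 p q * ssB2 (- p) (- q) - ssB2 p q * ssB1 (- p) (- q)" for q p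
  have step: "0 < D q p'" if q: "q \<in> {0<..<1}" and p: "- 1 < p" "p < p'" "p' < 1" and D: "0 \<le> D q p" for q p p'
  proof -
    have B: "ssB1 p q * ssB2 p' q < ssB2 p q * ssB1 p' q" using q p by (intro ss_shift) auto
    have C: "ssB1 (- p') (- q) * ssB2 (- p) (- q) < ssB2 (- p') (- q) * ssB1 (- p) (- q)"
      using q p by (intro ss_shift) auto
    have pos: "ssB1 p q > 0" "ssB2 p q > 0" "ssB1 p' q > 0" "ssB2 p' q > 0"
      "ssB1 (- p) (- q) > 0" "ssB2 (- p) (- q) > 0" "ssB1 (- p') (- q) > 0" "ssB2 (- p') (- q) > 0"
      using q p by (simp_all add: ssB_pos)
    have le: "ssB2 p q * ssB1 (- p) (- q) \<le> ssB1 p q * ssB2 (- p) (- q)" using D by (simp add: D_def)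
    have "(ssB2 p' q * ssB1 (- p') (- q)) * (ssB2 p q * ssB1 (- p) (- q))
        \<le> (ssB2 p' q * ssB1 (- p') (- q)) * (ssB1 p q * ssB2 (- p) (- q))"
      using le pos by (intro mult_left_mono) simp_all
    also have "\<dots> = (ssB1 p q * ssB2 p' q) * (ssB1 (- p') (- q) * ssB2 (- p) (- q))" by (simp only: mult_ac)
    also have "\<dots> < (ssB2 p q * ssB1 p' q) * (ssB2 (- p') (- q) * ssB1 (- p) (- q))"
      by (rule mult_strict_mono'[OF B C]) (use pos in simp_all)
    also have "\<dots> = (ssB1 p' q * ssB2 (- p') (- q)) * (ssB2 p q * ssB1 (- p) (- q))" by (simp only: mult_ac)
    finally have "ssB2 p' q * ssB1 (- p') (- q) < ssB1 p' q * ssB2 (- p') (- q)"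
      using pos by (simp add: mult_less_cancel_right_pos)
    then show ?thesis by (simp add: D_def)
  qed
  have below: "D q (- q) < 0" if "q \<in> {0<..<1}" for q
    using ss_sign_below[of q] that by (simp add: D_def)
  have above: "0 < D q q" if "q \<in> {0<..<1}" for q
    using ss_sign_diagonal[of q] that by (simp add: D_def)
  obtain P where P: "continuous_on {0<..<1} P" "\<And>q. q \<in> {0<..<1} \<Longrightarrow> - 1 < P q \<and> P q < 1 \<and> D q (P q) = 0"
  proof (rule sign_change_root_continuous[of "{0<..<1::real}" "\<lambda>_. - 1" "\<lambda>_. 1" D])
    show "continuous_on {x. fst x \<in> {0<..<1} \<and> - 1 < snd x \<and> snd x < 1} (\<lambda>x. D (fst x) (snd x))"
      unfolding D_def ssB1_def ssB2_def
      by (intro continuous_on_diff continuous_on_mult J_continuous' continuous_intros) simp_all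
    show "\<exists>y. - 1 < y \<and> y < 1 \<and> D x y < 0" if "x \<in> {0<..<1}" for x
      using below[OF that] that by (intro exI[of _ "- x"]) simp
    show "\<exists>y. - 1 < y \<and> y < 1 \<and> 0 < D x y" if "x \<in> {0<..<1}" for x
      using above[OF that] that by (intro exI[of _ x]) simp
  qed (use step in \<open>simp_all add: continuous_on_const\<close>)
  have less: "P q < q" if q: "q \<in> {0<..<1}" for q
  proof (rule ccontr)
    assume "\<not> P q < q"
    moreover have "P q \<noteq> q" using above[OF q] P(2)[OF q] by force
    ultimately have "q < P q" by simp
    have "0 < D q (P q)"
      by (rule step[OF q _ \<open>q < P q\<close> _ less_imp_le[OF above[OF q]]]) (use q P(2)[OF q] in simp_all)
    then show False using P(2)[OF q] by simp
  qed
  show ?thesis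
  proof
    show "continuous_on {0<..<1} P" by (rule P(1))
    fix q :: real assume q: "q \<in> {0<..<1}"
    show "(P q, q) \<in> Params" using P(2)[OF q] less[OF q] q by (simp add: Params_def)
    show "edge_len e_ss1 0 (P q) q * edge_len e_ss2 4 (P q) q = edge_len e_ss2 0 (P q) q * edge_len e_ss1 4 (P q) q"
      using P(2)[OF q] q by (simp add: ss_edges D_def)
  qed
qed

text \<open>By the closing relations of the two polygons these are the sums of the edges \<open>2\<close> and \<open>4\<close> minus the edge \<open>0\<close>.
  In this form each of them is controlled by the arcs behind the mark \<open>3\<close> alone.\<close>

definition cs_S1 where "cs_S1 p q = 2 * edge_len e_cs1 4 p q + sqrt 2 * edge_len e_cs1 3 p q"
definition cs_S2 where "cs_S2 p q = 2 * edge_len e_cs2 4 p q - sqrt 2 * edge_len e_cs2 3 p q"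

lemma cis_eighths:
  "x = 0 \<or> x = - 2 \<Longrightarrow> cis (- (pi * x)) = 1" "x = 1 / 2 \<or> x = - 3 / 2 \<Longrightarrow> cis (- (pi * x)) = - \<i>"
  "x = - 1 / 2 \<Longrightarrow> cis (- (pi * x)) = \<i>" "x = - 1 \<Longrightarrow> cis (- (pi * x)) = - 1"
  "x = - 1 / 4 \<Longrightarrow> cis (- (pi * x)) = (1 + \<i>) / sqrt 2" "x = - 3 / 4 \<Longrightarrow> cis (- (pi * x)) = (- 1 + \<i>) / sqrt 2"
  "x = - 5 / 4 \<Longrightarrow> cis (- (pi * x)) = (- 1 - \<i>) / sqrt 2" "x = - 7 / 4 \<Longrightarrow> cis (- (pi * x)) = (1 - \<i>) / sqrt 2"
proof -
  have q: "cis (pi / 4) = (1 + \<i>) / sqrt 2"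
    by (simp add: complex_eq_iff cos_45 sin_45 real_div_sqrt field_simps)
  have i: "cis (pi / 2) = \<i>" "cis pi = - 1" "cis (2 * pi) = 1"
    by (simp_all add: complex_eq_iff)
  have m: "cis (- (pi * x)) = cis a * cis b" if "- (pi * x) = a + b" for a b using that by (simp add: cis_mult)
  have h: "cis (- (pi / 2)) = - \<i>" by (simp add: complex_eq_iff)
  show "cis (- (pi * x)) = 1" if "x = 0 \<or> x = - 2"
    using that i by (auto simp: mult.commute)
  show "cis (- (pi * x)) = - \<i>" if "x = 1 / 2 \<or> x = - 3 / 2"
    using that
  proof
    assume "x = 1 / 2"
    then have "- (pi * x) = - (pi / 2)" by simp
    then show ?thesis by (simp only: h)
  next
    assume "x = - 3 / 2"
    then show ?thesis using m[of pi "pi / 2"] i by simp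
  qed
  show "cis (- (pi * x)) = \<i>" if "x = - 1 / 2" using that i by simp
  show "cis (- (pi * x)) = - 1" if "x = - 1" using that i by simp
  show "cis (- (pi * x)) = (1 + \<i>) / sqrt 2" if "x = - 1 / 4" using that q by simp
  show "cis (- (pi * x)) = (- 1 + \<i>) / sqrt 2" if "x = - 3 / 4"
    using that m[of "pi / 2" "pi / 4"] unfolding q i by (simp add: distrib_left)
  show "cis (- (pi * x)) = (- 1 - \<i>) / sqrt 2" if "x = - 5 / 4"
    using that m[of pi "pi / 4"] unfolding q i by simp
  have "cis (pi + pi / 2) = - \<i>" unfolding cis_mult[symmetric] i by simp
  then show "cis (- (pi * x)) = (1 - \<i>) / sqrt 2" if "x = - 7 / 4"
    using that m[of "pi + pi / 2" "pi / 4"] unfolding q by (simp add: distrib_left)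
qed

lemma sum_atMost_simps: "(\<Sum>k\<le>0. f k) = f 0" "(\<Sum>k\<le>1. f k) = f 0 + f 1" "(\<Sum>k\<le>2. f k) = f 0 + f 1 + f 2"
  "(\<Sum>k\<le>3. f k) = f 0 + f 1 + f 2 + f 3" "(\<Sum>k\<le>4. f k) = f 0 + f 1 + f 2 + f 3 + f (4::nat)"
  by (simp_all add: eval_nat_numeral)

text \<open>The directions of the edges.  Along the edges \<open>0\<close>, \<open>2\<close> and \<open>4\<close> all three forms are real or imaginary, along the
  diagonals \<open>1\<close> and \<open>3\<close> the horizontal ones point into the diagonal directions.\<close>

lemma phases:
  "arc_phase e_height 0 = 1" "arc_phase e_height 1 = \<i>" "arc_phase e_height 2 = - 1" "arc_phase e_height 3 = - \<i>" "arc_phase e_height 4 = 1"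
  "arc_phase e_ss1 0 = - \<i>" "arc_phase e_ss1 1 = (1 + \<i>) / sqrt 2" "arc_phase e_ss1 2 = \<i>" "arc_phase e_ss1 3 = (- 1 - \<i>) / sqrt 2" "arc_phase e_ss1 4 = 1"
  "arc_phase e_ss2 0 = \<i>" "arc_phase e_ss2 1 = (- 1 + \<i>) / sqrt 2" "arc_phase e_ss2 2 = - \<i>" "arc_phase e_ss2 3 = (1 - \<i>) / sqrt 2" "arc_phase e_ss2 4 = 1"
  "arc_phase e_cs1 0 = - \<i>" "arc_phase e_cs1 1 = (1 + \<i>) / sqrt 2" "arc_phase e_cs1 2 = - 1" "arc_phase e_cs1 3 = (1 - \<i>) / sqrt 2" "arc_phase e_cs1 4 = 1"
  "arc_phase e_cs2 0 = \<i>" "arc_phase e_cs2 1 = (- 1 + \<i>) / sqrt 2" "arc_phase e_cs2 2 = - 1" "arc_phase e_cs2 3 = (- 1 - \<i>) / sqrt 2" "arc_phase e_cs2 4 = 1"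
  unfolding arc_phase_def sum_atMost_simps e_height_def e_ss1_def e_ss2_def e_cs1_def e_cs2_def expo_simps
  by (rule cis_eighths; simp)+

lemma edge_closed:
  assumes "admissible e" "(p, q) \<in> Params"
  shows "of_real (edge_len e 0 p q) * arc_phase e 0 + of_real (edge_len e 1 p q) * arc_phase e 1 + of_real (edge_len e 2 p q) * arc_phase e 2
    + of_real (edge_len e 3 p q) * arc_phase e 3 + of_real (edge_len e 4 p q) * arc_phase e 4 = 0"
proof -
  interpret sc_data "pscale p q" "pmark p q" e by (rule sc_data_pmark[OF assms])
  show ?thesis using arc_length_closed unfolding sum_lessThan_5 edge_len_def .
qed

lemma cs_edges:
  assumes "- 1 < p" "p < 1" "- 1 < q" "q < 1"
  shows "edge_len e_cs1 0 p q = csB1 p q" "edge_len e_cs2 0 p q = csB2 p q"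
  using assms unfolding edge_len_0[OF assms(2,4)] csB1_def csB2_def J_swap[of _ _ _ _ _ p q]
  by (simp_all add: e_cs1_def e_cs2_def)

lemma edge_len_conv:
  assumes "(p, q) \<in> Params"
  shows "- 1 < p" "p < q" "q < 1" "p < 1" "- 1 < q"
  using assms by (auto simp: Params_def)

lemma cs_closed:
  assumes "(p, q) \<in> Params"
  shows "edge_len e_cs1 2 p q + edge_len e_cs1 4 p q = cs_S1 p q + edge_len e_cs1 0 p q"
    "edge_len e_cs2 2 p q + edge_len e_cs2 4 p q = cs_S2 p q + edge_len e_cs2 0 p q"
    "cs_S2 p q > 0" "cs_S1 p q > 0"
proof -
  have r: "x / sqrt 2 = sqrt 2 * x / 2" for x :: real by (simp add: real_div_sqrt field_simps)
  note c1 = edge_closed[OF admissible_exponents(4) assms, unfolded phases]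
  note c2 = edge_closed[OF admissible_exponents(5) assms, unfolded phases]
  have re1: "edge_len e_cs1 1 p q / sqrt 2 - edge_len e_cs1 2 p q + edge_len e_cs1 3 p q / sqrt 2 + edge_len e_cs1 4 p q = 0"
    and im1: "- edge_len e_cs1 0 p q + edge_len e_cs1 1 p q / sqrt 2 - edge_len e_cs1 3 p q / sqrt 2 = 0"
    using arg_cong[OF c1, of Re] arg_cong[OF c1, of Im] by simp_all
  have re2: "- (edge_len e_cs2 1 p q / sqrt 2) - edge_len e_cs2 2 p q - edge_len e_cs2 3 p q / sqrt 2 + edge_len e_cs2 4 p q = 0"
    and im2: "edge_len e_cs2 0 p q + edge_len e_cs2 1 p q / sqrt 2 - edge_len e_cs2 3 p q / sqrt 2 = 0"
    using arg_cong[OF c2, of Re] arg_cong[OF c2, of Im] by simp_all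
  show "edge_len e_cs1 2 p q + edge_len e_cs1 4 p q = cs_S1 p q + edge_len e_cs1 0 p q"
    using re1 im1 unfolding cs_S1_def r by simp
  show "edge_len e_cs2 2 p q + edge_len e_cs2 4 p q = cs_S2 p q + edge_len e_cs2 0 p q"
    using re2 im2 unfolding cs_S2_def r by simp
  have pos: "edge_len e j p q > 0" if "admissible e" "j < 5" for e j by (rule edge_len_pos[OF that assms])
  have "cs_S2 p q = 2 * edge_len e_cs2 2 p q + sqrt 2 * edge_len e_cs2 1 p q"
    using re2 im2 unfolding cs_S2_def r by simp
  then show "cs_S2 p q > 0" using pos[of e_cs2 2] pos[of e_cs2 1] by (simp add: add_pos_pos)
  show "cs_S1 p q > 0" unfolding cs_S1_def using pos[of e_cs1 4] pos[of e_cs1 3] by (simp add: add_pos_pos)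
qed

lemma lin_mark:
  assumes "k = 1 \<and> x = 1 \<or> k = 2 \<and> x = q \<or> k = 3 \<and> x = p \<or> k = 4 \<and> x = - 1"
  shows "lin x t = - sin ((t - pmark p q k) / 2) / sin (pmark p q k / 2)"
proof -
  note h = half_mark[OF assms]
  have "sin ((t - pmark p q k) / 2) = sin (t / 2 - pmark p q k / 2)" by (simp add: diff_divide_distrib)
  also have "\<dots> = - sin (pmark p q k / 2) * lin x t"
    unfolding sin_diff h(2) by (simp add: lin_def algebra_simps)
  finally show ?thesis using h(1) by simp
qed

text \<open>Behind the mark \<open>3\<close> the value \<open>lin q t\<close> is negative and decreases with \<open>q\<close>.  Whether it does so faster or slower
  than \<open>1 + q\<close> is decided by the sign of \<open>lin (- 1) t\<close>, which changes at the mark \<open>4\<close>.\<close>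

lemma late_arc_bounds:
  assumes pq: "(p, q) \<in> Params" and q': "q < q'" "q' < 1" and t: "pmark p q 3 < t" "t < 2 * pi"
  shows "0 < \<bar>lin q t\<bar>" "\<bar>lin q t\<bar> \<le> \<bar>lin q' t\<bar>"
    "t \<le> 3 * pi / 2 \<Longrightarrow> (1 + q') / (1 + q) * \<bar>lin q t\<bar> \<le> \<bar>lin q' t\<bar>"
    "3 * pi / 2 \<le> t \<Longrightarrow> \<bar>lin q' t\<bar> \<le> (1 + q') / (1 + q) * \<bar>lin q t\<bar>"
proof -
  note P = edge_len_conv[OF pq]
  have m3: "pmark p q 3 > 0" using five_marks_mono[OF pmark_five_marks[OF P(1-3)], of 0 3] by (simp add: pmark_def)
  have s: "sin (t / 2) > 0" using t m3 by (intro sin_gt_zero) auto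
  have "sin ((t - pmark p q 3) / 2) > 0" using t m3 by (intro sin_gt_zero) auto
  then have lp: "lin p t < 0" using lin_mark[of 3 p q p t] half_mark(1)[of 3 p q p] by simp
  have "0 < (q - p) * sin (t / 2)" "0 < (q' - q) * sin (t / 2)" using P q' s by simp_all
  then have neg: "lin q t < 0" "lin q' t < lin q t" using lp by (simp_all add: lin_def algebra_simps)
  then show "0 < \<bar>lin q t\<bar>" "\<bar>lin q t\<bar> \<le> \<bar>lin q' t\<bar>" by simp_all
  have m4: "pmark p q 4 = 3 * pi / 2" by (simp add: pmark_def)
  have key: "(1 + q) * \<bar>lin q' t\<bar> - (1 + q') * \<bar>lin q t\<bar> = (q' - q) * lin (- 1) t"
    using neg by (simp add: lin_def algebra_simps)
  have q1: "1 + q > 0" using P by simp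
  show "(1 + q') / (1 + q) * \<bar>lin q t\<bar> \<le> \<bar>lin q' t\<bar>" if "t \<le> 3 * pi / 2"
  proof -
    have "sin ((3 * pi / 2 - t) / 2) \<ge> 0" using that t m3 by (intro sin_ge_zero) auto
    moreover have "sin ((t - 3 * pi / 2) / 2) = - sin ((3 * pi / 2 - t) / 2)" by (metis minus_diff_eq minus_divide_left sin_minus)
    ultimately have "lin (- 1) t \<ge> 0" using lin_mark[of 4 "- 1" q p t] half_mark(1)[of 4 "- 1" q p] by (simp add: m4)
    then have "0 \<le> (q' - q) * lin (- 1) t" using q' by simp
    then show ?thesis using key q1 by (simp add: divide_le_eq mult.commute)
  qed
  show "\<bar>lin q' t\<bar> \<le> (1 + q') / (1 + q) * \<bar>lin q t\<bar>" if "3 * pi / 2 \<le> t"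
  proof -
    have "sin ((t - 3 * pi / 2) / 2) \<ge> 0" using that t by (intro sin_ge_zero) auto
    then have "lin (- 1) t \<le> 0" using lin_mark[of 4 "- 1" q p t] half_mark(1)[of 4 "- 1" q p] by (simp add: m4)
    then have "(q' - q) * lin (- 1) t \<le> 0" using q' by (simp add: mult_nonneg_nonpos)
    then show ?thesis using key q1 by (simp add: le_divide_eq mult.commute)
  qed
qed

lemma parc_shift:
  assumes "\<bar>lin q' t\<bar> powr e 2 \<le> c * \<bar>lin q t\<bar> powr e 2"
  shows "parc e p q' t \<le> c * parc e p q t"
proof -
  have *: "parc e p x t = \<bar>lin x t\<bar> powr e 2 * (\<bar>sin (t / 2)\<bar> powr e 0 * \<bar>lin 1 t\<bar> powr e 1 * \<bar>lin p t\<bar> powr e 3 * \<bar>lin (- 1) t\<bar> powr e 4)" for x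
    by (simp add: parc_def mult_ac)
  show ?thesis unfolding * mult.assoc[symmetric] using assms by (intro mult_right_mono) auto
qed

lemma edge_len_shift_le:
  assumes e: "admissible e" and j: "j < 5" and pq: "(p, q) \<in> Params" "(p, q') \<in> Params"
    and m: "pmark p q j = a" "pmark p q' j = a" "pmark p q (Suc j) = b" "pmark p q' (Suc j) = b"
    and le: "\<And>t. a < t \<Longrightarrow> t < b \<Longrightarrow> \<bar>lin q' t\<bar> powr e 2 \<le> c * \<bar>lin q t\<bar> powr e 2"
  shows "edge_len e j p q' \<le> c * edge_len e j p q"
proof -
  have "integral {a..b} (parc e p q') \<le> integral {a..b} (\<lambda>t. c * parc e p q t)"
  proof (rule integral_open_mono)
    show "parc e p q' integrable_on {a..b}" using parc_integrable[OF e j pq(2)] by (simp add: m)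
    show "(\<lambda>t. c * parc e p q t) integrable_on {a..b}"
      using parc_integrable[OF e j pq(1)] by (simp add: m integrable_on_mult_right)
    show "parc e p q' t \<le> c * parc e p q t" if "t \<in> {a<..<b}" for t
      by (rule parc_shift, rule le) (use that in simp_all)
  qed
  then show ?thesis by (simp add: edge_len_integral m)
qed

text \<open>Comparison of the integrands on the two arcs behind the mark \<open>3\<close>.  In \<open>cs_S2\<close> the edges \<open>3\<close> and \<open>4\<close> enter with
  opposite signs; the edge \<open>3\<close> shrinks at least by the factor \<open>k\<close> and the edge \<open>4\<close> at most.\<close>

lemma cs_S_shift:
  assumes pq: "(p, q) \<in> Params" and q': "q < q'" "q' < 1"
  defines "k \<equiv> ((1 + q') / (1 + q)) powr (1 / 4)"
  shows "cs_S1 p q' \<le> cs_S1 p q" "cs_S2 p q \<le> k * cs_S2 p q'" "edge_len e_cs2 4 p q \<le> k * edge_len e_cs2 4 p q'"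
proof -
  note P = edge_len_conv[OF pq]
  have pq': "(p, q') \<in> Params" using P q' by (simp add: Params_def)
  define \<kappa> where "\<kappa> = (1 + q') / (1 + q)"
  have \<kappa>: "\<kappa> > 0" using P q' by (simp add: \<kappa>_def)
  have fmk: "five_marks (pmark p q)" by (rule pmark_five_marks[OF P(1-3)])
  have m3: "pmark p q 3 < 3 * pi / 2" using five_marks_mono[OF fmk, of 3 4] by (simp add: pmark_def)
  have m: "pmark p q 3 = pmark p q 3" "pmark p q' 3 = pmark p q 3" "pmark p q (Suc 3) = 3 * pi / 2" "pmark p q' (Suc 3) = 3 * pi / 2"
    "pmark p q 4 = 3 * pi / 2" "pmark p q' 4 = 3 * pi / 2" "pmark p q (Suc 4) = 2 * pi" "pmark p q' (Suc 4) = 2 * pi"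
    by (simp_all add: pmark_def)
  have mono: "\<bar>lin q' t\<bar> powr (- 3 / 4) \<le> 1 * \<bar>lin q t\<bar> powr (- 3 / 4)" if "pmark p q 3 < t" "t < 2 * pi" for t
    using late_arc_bounds(1,2)[OF pq q' that] by (simp add: powr_mono2')
  have e2: "e_cs1 2 = - 3 / 4" by (simp add: e_cs1_def)
  have "edge_len e_cs1 3 p q' \<le> 1 * edge_len e_cs1 3 p q"
  proof (rule edge_len_shift_le[OF _ _ pq pq' m(1-4)])
    fix t assume t: "pmark p q 3 < t" "t < 3 * pi / 2"
    then have "t < 2 * pi" using pi_gt_zero by linarith
    then show "\<bar>lin q' t\<bar> powr e_cs1 2 \<le> 1 * \<bar>lin q t\<bar> powr e_cs1 2" unfolding e2 by (rule mono[OF t(1)])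
  qed simp_all
  moreover have "edge_len e_cs1 4 p q' \<le> 1 * edge_len e_cs1 4 p q"
  proof (rule edge_len_shift_le[OF _ _ pq pq' m(5-8)])
    fix t assume t: "3 * pi / 2 < t" "t < 2 * pi"
    then have "pmark p q 3 < t" using m3 by linarith
    then show "\<bar>lin q' t\<bar> powr e_cs1 2 \<le> 1 * \<bar>lin q t\<bar> powr e_cs1 2" unfolding e2 by (rule mono[OF _ t(2)])
  qed simp_all
  ultimately show "cs_S1 p q' \<le> cs_S1 p q" unfolding cs_S1_def by (intro add_mono mult_left_mono) simp_all
  have k: "k > 0" "k * \<kappa> powr (- 1 / 4) = 1"
    using \<kappa> by (simp_all add: k_def \<kappa>_def[symmetric] flip: powr_add)
  have "edge_len e_cs2 3 p q' \<le> \<kappa> powr (- 1 / 4) * edge_len e_cs2 3 p q"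
  proof (rule edge_len_shift_le[OF _ _ pq pq' m(1-4)])
    fix t assume t: "pmark p q 3 < t" "t < 3 * pi / 2"
    have t2: "t < 2 * pi" using t pi_gt_zero by linarith
    have "\<bar>lin q' t\<bar> powr (- 1 / 4) \<le> (\<kappa> * \<bar>lin q t\<bar>) powr (- 1 / 4)"
    proof (rule powr_mono2')
      show "0 < \<kappa> * \<bar>lin q t\<bar>" using late_arc_bounds(1)[OF pq q' t(1) t2] \<kappa> by (intro mult_pos_pos) auto
      show "\<kappa> * \<bar>lin q t\<bar> \<le> \<bar>lin q' t\<bar>" unfolding \<kappa>_def using late_arc_bounds(3)[OF pq q' t(1) t2] t by simp
    qed simp
    then show "\<bar>lin q' t\<bar> powr e_cs2 2 \<le> \<kappa> powr (- 1 / 4) * \<bar>lin q t\<bar> powr e_cs2 2"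
      by (simp add: e_cs2_def powr_mult)
  qed simp_all
  then have "k * edge_len e_cs2 3 p q' \<le> k * (\<kappa> powr (- 1 / 4) * edge_len e_cs2 3 p q)"
    using k by (intro mult_left_mono) simp_all
  then have d: "k * edge_len e_cs2 3 p q' \<le> edge_len e_cs2 3 p q" using k(2) by (simp flip: mult.assoc)
  have "edge_len e_cs2 4 p q \<le> k * edge_len e_cs2 4 p q'"
  proof (rule edge_len_shift_le[OF _ _ pq' pq m(6) m(5) m(8) m(7)])
    fix t assume t: "3 * pi / 2 < t" "t < 2 * pi"
    have t3: "pmark p q 3 < t" using t m3 by linarith
    note b = late_arc_bounds(1,2,4)[OF pq q' t3 t(2)]
    have "(\<kappa> * \<bar>lin q t\<bar>) powr (- 1 / 4) \<le> \<bar>lin q' t\<bar> powr (- 1 / 4)"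
      using b t \<kappa> by (intro powr_mono2') (simp_all add: \<kappa>_def)
    then have "k * (\<kappa> powr (- 1 / 4) * \<bar>lin q t\<bar> powr (- 1 / 4)) \<le> k * \<bar>lin q' t\<bar> powr (- 1 / 4)"
      using k by (simp add: powr_mult)
    then show "\<bar>lin q t\<bar> powr e_cs2 2 \<le> k * \<bar>lin q' t\<bar> powr e_cs2 2"
      using k(2) by (simp add: e_cs2_def flip: mult.assoc)
  qed (use k in simp_all)
  then show C: "edge_len e_cs2 4 p q \<le> k * edge_len e_cs2 4 p q'" .
  have "sqrt 2 * (k * edge_len e_cs2 3 p q') \<le> sqrt 2 * edge_len e_cs2 3 p q" using d by simp
  then show "cs_S2 p q \<le> k * cs_S2 p q'" using C unfolding cs_S2_def right_diff_distrib mult.left_commute[of k] by linarith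
qed

definition cs_E where
  "cs_E p q = edge_len e_cs1 0 p q * cs_S2 p q - edge_len e_cs2 0 p q * cs_S1 p q"

lemma csB_pos: "p < 1 \<Longrightarrow> q < 1 \<Longrightarrow> csB1 p q > 0" "p < 1 \<Longrightarrow> q < 1 \<Longrightarrow> csB2 p q > 0"
  unfolding csB1_def csB2_def by (rule J_pos; simp)+

text \<open>As \<open>q\<close> grows, \<open>cs_S1\<close> does not increase and \<open>cs_S2\<close> shrinks at most by the factor \<open>k\<close>, while by \<open>cs_shift\<close> the quotient of the
  two lengths of the edge \<open>0\<close> grows by more than \<open>k\<close>.\<close>

lemma cs_E_step:
  assumes p: "1 / 2 < p" and pq: "p < q" "q < q'" "q' < 1" and E: "0 \<le> cs_E p q"
  shows "0 < cs_E p q'"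
proof -
  have P: "(p, q) \<in> Params" "(p, q') \<in> Params" using p pq by (simp_all add: Params_def)
  define k where "k = ((1 + q') / (1 + q)) powr (1 / 4)"
  have k: "k > 0" using p pq by (simp add: k_def)
  have B: "k * (csB1 p q * csB2 p q') < csB2 p q * csB1 p q'"
    unfolding k_def using p pq by (intro cs_shift) auto
  note S = cs_S_shift[OF P(1) pq(2,3), folded k_def] and S2 = cs_closed(3,4)[OF P(1)] and S2' = cs_closed(3,4)[OF P(2)]
  have pos: "csB1 p q > 0" "csB2 p q > 0" "csB1 p q' > 0" "csB2 p q' > 0" using p pq by (simp_all add: csB_pos)
  have E': "csB2 p q * cs_S1 p q \<le> csB1 p q * cs_S2 p q" using E p pq by (simp add: cs_E_def cs_edges)
  have "csB2 p q * (csB2 p q' * cs_S1 p q') \<le> csB2 p q * (csB2 p q' * cs_S1 p q)"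
    using S(1) pos by (intro mult_left_mono) simp_all
  also have "\<dots> = csB2 p q' * (csB2 p q * cs_S1 p q)" by (simp only: mult_ac)
  also have "\<dots> \<le> csB2 p q' * (csB1 p q * cs_S2 p q)" using E' pos by (intro mult_left_mono) simp_all
  also have "\<dots> \<le> csB2 p q' * (csB1 p q * (k * cs_S2 p q'))" using S(2) pos by (intro mult_left_mono) simp_all
  also have "\<dots> = (k * (csB1 p q * csB2 p q')) * cs_S2 p q'" by (simp only: mult_ac)
  also have "\<dots> < (csB2 p q * csB1 p q') * cs_S2 p q'" using B S2'(1) by (intro mult_strict_right_mono)
  also have "\<dots> = csB2 p q * (csB1 p q' * cs_S2 p q')" by (simp only: mult_ac)
  finally have "csB2 p q' * cs_S1 p q' < csB1 p q' * cs_S2 p q'" using pos by (simp add: mult_less_cancel_left_pos)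
  then show ?thesis using p pq by (simp add: cs_E_def cs_edges)
qed

lemma powr_large:
  fixes K d a :: real
  assumes "d > 0" "a > 0"
  obtains \<delta> where "0 < \<delta>" "\<delta> < d" "K < \<delta> powr (- a)"
proof -
  define \<delta> where "\<delta> = min (d / 2) ((\<bar>K\<bar> + 1) powr (- 1 / a))"
  have "0 < \<delta>" "\<delta> < d" using assms by (auto simp: \<delta>_def min_def)
  moreover have "\<bar>K\<bar> + 1 = ((\<bar>K\<bar> + 1) powr (- 1 / a)) powr (- a)" using assms by (simp add: powr_powr)
  then have "\<bar>K\<bar> + 1 \<le> \<delta> powr (- a)"
    using \<open>0 < \<delta>\<close> assms powr_mono2'[of "- a" \<delta> "(\<bar>K\<bar> + 1) powr (- 1 / a)"] by (simp add: \<delta>_def)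
  ultimately show ?thesis using that by auto
qed

lemma powr_lower:
  fixes x M e :: real
  assumes "0 < x" "x \<le> M" "e \<le> 0"
  shows "M powr e \<le> x powr e"
  using assms by (intro powr_mono2') auto

lemma two_powr_lower: "1 / 2 \<le> (2::real) powr (- 3 / 4)" "1 / 2 \<le> (2::real) powr (- 1 / 4)"
  using powr_mono[of "- 1" "- 3 / 4" "2::real"] powr_mono[of "- 1" "- 1 / 4" "2::real"] by (simp_all add: powr_minus)

lemma three_halves_powr:
  fixes \<delta> :: real
  assumes "0 < \<delta>"
  shows "\<delta> powr (- 3 / 4) * \<delta> powr (- 3 / 4) * \<delta> = \<delta> powr (- 1 / 2)"
proof -
  have "\<delta> powr (- 3 / 4) * \<delta> powr (- 3 / 4) * \<delta> powr 1 = \<delta> powr (- 3 / 4 + - 3 / 4 + 1)" by (simp only: powr_add)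
  also have "\<dots> = \<delta> powr (- 1 / 2)" by (rule arg_cong[of _ _ "\<lambda>e. \<delta> powr e"]) simp
  finally show ?thesis using assms by (simp only: powr_one order.strict_implies_order)
qed

text \<open>As \<open>q \<rightarrow> 1\<close> two marks of exponent \<open>- 3 / 4\<close> collide, so the integrand is of order \<open>\<delta> powr (- 3 / 2)\<close> on an interval
  of length \<open>\<delta>\<close>.\<close>

lemma csB1_blowup:
  assumes p: "0 \<le> p" "p < 1" and d: "0 < \<delta>" "\<delta> \<le> 1 / 2"
  shows "\<delta> powr (- 1 / 2) / 32 \<le> csB1 p (1 - \<delta>)"
proof -
  let ?w = "wt (1 / 2) (- 3 / 4) (- 1 / 4) (- 3 / 4) (- 3 / 4) p (1 - \<delta>)"
  \<comment> \<open>\<open>32\<close> is the product of the bounds \<open>4\<close>, \<open>2\<close>, \<open>2\<close> and \<open>2\<close> for the factors that do not blow up\<close>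
  define m where "m = \<delta> powr (- 3 / 4) * \<delta> powr (- 3 / 4) / 32"
  have "m * (pi / 2 - (pi / 2 - \<delta>)) \<le> integral {0..pi / 2} ?w"
  proof (rule integral_ge_subinterval)
    show "?w integrable_on {0..pi / 2}" using p d by (intro wt_integrable) auto
    show "0 \<le> ?w t" if "t \<in> {0<..<pi / 2}" for t
      by (rule less_imp_le, rule wt_pos) (use that p d in simp_all)
    show "0 \<le> pi / 2 - \<delta>" using d pi_gt3 by simp
    show "m \<le> ?w t" if t: "t \<in> {pi / 2 - \<delta><..<pi / 2}" for t
    proof -
      have t0: "0 < t" "t < pi / 2" "1 \<le> t" "pi / 2 - t \<le> \<delta>" using t d pi_gt3 by auto
      note h = half_angle_bounds[OF t0(1,2)]
      have l: "lin 1 t > 0" "lin (- 1) t > 0" "lin p t > 0" "lin (1 - \<delta>) t > 0" using p d by (simp_all add: lin_pos[OF t0(1,2)])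
      have "1 / 4 \<le> sin (t / 2)" using sin_lower[of "t / 2"] t0 by simp
      also have "sin (t / 2) = sin (t / 2) powr 1" using h by simp
      also have "\<dots> \<le> sin (t / 2) powr (1 / 2)" using h by (intro powr_mono') auto
      finally have s: "1 / 4 \<le> sin (t / 2) powr (1 / 2)" .
      have "sqrt 2 \<le> 2" using sqrt2_less_2 by simp
      moreover have "sin ((pi / 2 - t) / 2) \<le> (pi / 2 - t) / 2" using t0 by (intro sin_x_le_x) auto
      moreover have "0 \<le> sin ((pi / 2 - t) / 2)" using t0 by (intro sin_ge_zero) auto
      ultimately have "lin 1 t \<le> 2 * ((pi / 2 - t) / 2)" unfolding lin_one_eq by (intro mult_mono) auto
      then have l1: "lin 1 t \<le> \<delta>" using t0 by simp
      have "lin (1 - \<delta>) t = lin 1 t + \<delta> * sin (t / 2)" by (simp add: lin_def algebra_simps)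
      also have "\<dots> \<le> \<delta> + \<delta> * 1" using l1 h d by (intro add_mono mult_left_mono) auto
      finally have lq: "lin (1 - \<delta>) t \<le> 2 * \<delta>" by simp
      have lp: "lin p t \<le> 2" "lin (- 1) t \<le> 2" using lin_upper[of p t] lin_upper[of "- 1" t] p by auto
      have e1: "\<delta> powr (- 3 / 4) \<le> lin 1 t powr (- 3 / 4)" by (rule powr_lower) (use l l1 in auto)
      have e2: "1 / 2 \<le> lin (- 1) t powr (- 1 / 4)" by (rule order_trans[OF two_powr_lower(2) powr_lower]) (use l lp in auto)
      have e3: "1 / 2 \<le> lin p t powr (- 3 / 4)" by (rule order_trans[OF two_powr_lower(1) powr_lower]) (use l lp in auto)
      have "1 / 2 * \<delta> powr (- 3 / 4) \<le> (2 * \<delta>) powr (- 3 / 4)" unfolding powr_mult using two_powr_lower(1) by (rule mult_right_mono) simp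
      also have "\<dots> \<le> lin (1 - \<delta>) t powr (- 3 / 4)" by (rule powr_lower) (use l lq in auto)
      finally have e4: "1 / 2 * \<delta> powr (- 3 / 4) \<le> lin (1 - \<delta>) t powr (- 3 / 4)" .
      have "1 / 4 * \<delta> powr (- 3 / 4) * (1 / 2) * (1 / 2) * (1 / 2 * \<delta> powr (- 3 / 4)) \<le> ?w t"
        unfolding wt_def by (intro mult_mono s e1 e2 e3 e4) auto
      then show ?thesis by (simp add: m_def)
    qed
  qed (use d in simp_all)
  moreover have "m * \<delta> = \<delta> powr (- 1 / 2) / 32" unfolding m_def using three_halves_powr[OF d(1)] by simp
  ultimately show ?thesis unfolding csB1_def J_def by simp
qed

text \<open>As \<open>q \<rightarrow> p\<close> the marks \<open>2\<close> and \<open>3\<close>, both of exponent \<open>- 3 / 4\<close>, collide at the beginning of the edge \<open>3\<close>.\<close>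

lemma cs_d2_blowup:
  assumes p: "0 < p" "p < 1" and d: "0 < \<delta>" "\<delta> \<le> 1 / 2" "p + \<delta> < 1"
  shows "\<delta> powr (- 1 / 2) / 32 \<le> edge_len e_cs1 3 p (p + \<delta>)"
proof -
  \<comment> \<open>the same constant as in \<open>csB1_blowup\<close>, for the same reason\<close>
  define m where "m = \<delta> powr (- 3 / 4) * \<delta> powr (- 3 / 4) / 32"
  define \<beta> where "\<beta> = pi - 2 * arctan p"
  have P: "(p, p + \<delta>) \<in> Params" using p d by (simp add: Params_def)
  have fmk: "five_marks (pmark p (p + \<delta>))" by (rule pmark_five_marks) (use p d in auto)
  have "arctan p > 0" using p by simp
  then have \<beta>: "\<beta> < pi" "pi / 2 < \<beta>"
    using five_marks_mono[OF fmk, of 1 3] by (simp_all add: pmark_def \<beta>_def)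
  have m3: "pmark p (p + \<delta>) 3 = \<beta>" "pmark p (p + \<delta>) (Suc 3) = 3 * pi / 2" by (simp_all add: pmark_def \<beta>_def)
  have "m * ((\<beta> + \<delta>) - \<beta>) \<le> integral {\<beta>..3 * pi / 2} (parc e_cs1 p (p + \<delta>))"
  proof (rule integral_ge_subinterval)
    show "parc e_cs1 p (p + \<delta>) integrable_on {\<beta>..3 * pi / 2}"
      using parc_integrable[OF admissible_exponents(4) _ P, of 3, unfolded m3] by simp
    show "0 \<le> parc e_cs1 p (p + \<delta>) t" for t by (simp add: parc_def)
    show le: "\<beta> + \<delta> \<le> 3 * pi / 2" using \<beta> d pi_gt3 by linarith
    show "m \<le> parc e_cs1 p (p + \<delta>) t" if t: "t \<in> {\<beta><..<\<beta> + \<delta>}" for t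
    proof -
      have t0: "pi / 2 < t" "t < 3 * pi / 2" "\<beta> < t" "t - \<beta> \<le> \<delta>" using t \<beta> le by auto
      have t3: "pmark p (p + \<delta>) 3 < t" "t < 2 * pi" using t0 m3 pi_gt_zero by linarith+
      have "sin (pi / 4) \<le> sin (t / 2)"
      proof (cases "t \<le> pi")
        case True then show ?thesis using t0 by (intro sin_monotone_2pi_le) auto
      next
        case False
        then have "sin (pi / 4) \<le> sin (pi - t / 2)" using t0 by (intro sin_monotone_2pi_le) auto
        then show ?thesis by simp
      qed
      moreover have "sqrt 2 / 2 \<ge> (1 / 2 :: real)" by simp
      ultimately have sin: "1 / 2 \<le> sin (t / 2)" unfolding sin_45 by linarith
      then have "1 / 4 \<le> \<bar>sin (t / 2)\<bar> powr 1" by simp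
      also have "\<dots> \<le> \<bar>sin (t / 2)\<bar> powr (1 / 2)" using sin by (intro powr_mono') auto
      finally have s: "1 / 4 \<le> \<bar>sin (t / 2)\<bar> powr (1 / 2)" .
      have lp: "\<bar>lin p t\<bar> \<le> \<delta>"
      proof -
        have h: "sin (\<beta> / 2) > 0" using \<beta> by (intro sin_gt_zero) auto
        have "sin (pi / 4) \<le> sin (\<beta> / 2)" using \<beta> by (intro sin_monotone_2pi_le) auto
        then have h2: "1 / 2 \<le> sin (\<beta> / 2)" using \<open>sqrt 2 / 2 \<ge> (1 / 2 :: real)\<close> unfolding sin_45 by linarith
        have "0 \<le> sin ((t - \<beta>) / 2)" using t0 d pi_gt3 by (intro sin_ge_zero) auto
        moreover have "sin ((t - \<beta>) / 2) \<le> (t - \<beta>) / 2" using t0 by (intro sin_x_le_x) auto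
        moreover have "lin p t = - sin ((t - \<beta>) / 2) / sin (\<beta> / 2)"
          using lin_mark[of 3 p "p + \<delta>" p t] by (simp add: m3)
        ultimately have "\<bar>lin p t\<bar> \<le> ((t - \<beta>) / 2) / sin (\<beta> / 2)"
        proof -
          assume nn: "0 \<le> sin ((t - \<beta>) / 2)" and le: "sin ((t - \<beta>) / 2) \<le> (t - \<beta>) / 2" and eq: "lin p t = - sin ((t - \<beta>) / 2) / sin (\<beta> / 2)"
          have "\<bar>lin p t\<bar> = sin ((t - \<beta>) / 2) / sin (\<beta> / 2)" unfolding eq using nn h by (simp add: abs_divide)
          also have "\<dots> \<le> ((t - \<beta>) / 2) / sin (\<beta> / 2)" by (rule divide_right_mono[OF le]) (use h in simp)
          finally show ?thesis .
        qed
        also have "\<dots> \<le> ((t - \<beta>) / 2) / (1 / 2)" using h2 t0 by (intro divide_left_mono) auto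
        finally show ?thesis using t0 by simp
      qed
      have lp0: "\<bar>lin p t\<bar> > 0"
      proof -
        have "sin ((t - \<beta>) / 2) > 0" using t0 d pi_gt3 by (intro sin_gt_zero) auto
        then show ?thesis using lin_mark[of 3 p "p + \<delta>" p t] half_mark(1)[of 3 p "p + \<delta>" p] by (simp add: m3)
      qed
      have "lin (p + \<delta>) t = lin p t - \<delta> * sin (t / 2)" by (simp add: lin_def algebra_simps)
      then have "\<bar>lin (p + \<delta>) t\<bar> \<le> \<bar>lin p t\<bar> + \<bar>\<delta> * sin (t / 2)\<bar>" by linarith
      also have "\<bar>\<delta> * sin (t / 2)\<bar> \<le> \<delta> * 1" unfolding abs_mult using d by (intro mult_mono) auto
      finally have lq: "\<bar>lin (p + \<delta>) t\<bar> \<le> 2 * \<delta>" using lp by simp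
      have lq0: "\<bar>lin (p + \<delta>) t\<bar> > 0"
        using late_arc_bounds(1)[OF P, of "(p + \<delta> + 1) / 2" t] t3 d by simp
      have l: "\<bar>lin 1 t\<bar> \<le> 2" "\<bar>lin (- 1) t\<bar> \<le> 2" using lin_upper[of 1 t] lin_upper[of "- 1" t] by auto
      have l0: "\<bar>lin 1 t\<bar> > 0" "\<bar>lin (- 1) t\<bar> > 0"
      proof -
        have "sin ((t - pmark p (p + \<delta>) 1) / 2) > 0" by (rule sin_gt_zero) (use t0 in \<open>simp_all add: pmark_def\<close>)
        then have "lin 1 t < 0" using lin_mark[of 1 1 "p + \<delta>" p t] half_mark(1)[of 1 1 "p + \<delta>" p] by (simp add: divide_neg_pos)
        then show "\<bar>lin 1 t\<bar> > 0" by simp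
        have "sin ((pmark p (p + \<delta>) 4 - t) / 2) > 0" by (rule sin_gt_zero) (use t0 in \<open>simp_all add: pmark_def\<close>)
        moreover have "sin ((pmark p (p + \<delta>) 4 - t) / 2) = - sin ((t - pmark p (p + \<delta>) 4) / 2)"
          by (subst sin_minus[symmetric]) (rule arg_cong[where f = sin], simp add: field_simps)
        ultimately have "- sin ((t - pmark p (p + \<delta>) 4) / 2) > 0" by simp
        then have "lin (- 1) t > 0" using lin_mark[of 4 "- 1" "p + \<delta>" p t] half_mark(1)[of 4 "- 1" "p + \<delta>" p]
          by (metis divide_pos_pos)
        then show "\<bar>lin (- 1) t\<bar> > 0" by simp
      qed
      have e1: "\<delta> powr (- 3 / 4) \<le> \<bar>lin p t\<bar> powr (- 3 / 4)" by (rule powr_lower) (use lp0 lp in auto)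
      have e2: "1 / 2 \<le> \<bar>lin (- 1) t\<bar> powr (- 1 / 4)" by (rule order_trans[OF two_powr_lower(2) powr_lower]) (use l l0 in auto)
      have e3: "1 / 2 \<le> \<bar>lin 1 t\<bar> powr (- 3 / 4)" by (rule order_trans[OF two_powr_lower(1) powr_lower]) (use l l0 in auto)
      have "1 / 2 * \<delta> powr (- 3 / 4) \<le> (2 * \<delta>) powr (- 3 / 4)" unfolding powr_mult using two_powr_lower(1) by (rule mult_right_mono) simp
      also have "\<dots> \<le> \<bar>lin (p + \<delta>) t\<bar> powr (- 3 / 4)" by (rule powr_lower) (use lq lq0 in auto)
      finally have e4: "1 / 2 * \<delta> powr (- 3 / 4) \<le> \<bar>lin (p + \<delta>) t\<bar> powr (- 3 / 4)" .
      have "1 / 4 * (1 / 2) * (1 / 2 * \<delta> powr (- 3 / 4)) * \<delta> powr (- 3 / 4) * (1 / 2) \<le>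
        \<bar>sin (t / 2)\<bar> powr (1 / 2) * \<bar>lin 1 t\<bar> powr (- 3 / 4) * \<bar>lin (p + \<delta>) t\<bar> powr (- 3 / 4) * \<bar>lin p t\<bar> powr (- 3 / 4) * \<bar>lin (- 1) t\<bar> powr (- 1 / 4)"
        by (intro mult_mono s e1 e2 e3 e4) auto
      then show ?thesis by (simp add: m_def parc_def e_cs1_def)
    qed
  qed (use d in simp_all)
  moreover have "m * \<delta> = \<delta> powr (- 1 / 2) / 32" unfolding m_def using three_halves_powr[OF d(1)] by simp
  ultimately show ?thesis unfolding edge_len_integral m3 by simp
qed

lemma shift_ratio_le_two:
  fixes q q' :: real
  assumes "0 \<le> q" "q < q'" "q' < 1"
  shows "((1 + q') / (1 + q)) powr (1 / 4) \<le> 2"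
proof -
  define x where "x = (1 + q') / (1 + q)"
  have x: "1 \<le> x" "x \<le> 2" using assms by (simp_all add: x_def divide_simps)
  then have "x powr (1 / 4) \<le> x powr 1" by (intro powr_mono) auto
  then show ?thesis using x unfolding x_def[symmetric] by simp
qed

lemma csB_y_mono:
  assumes "p < 1" "q \<le> q'" "q' < 1"
  shows "csB1 p q \<le> csB1 p q'" "csB2 p q \<le> csB2 p q'"
proof -
  have "J a b b' c d p q \<le> J a b b' c d p q'" if ab: "- 3 / 4 \<le> a" "- 3 / 4 \<le> b" "d \<le> 0" for a b b' c d
    unfolding J_def
  proof (rule integral_open_mono)
    show "wt a b b' c d p q t \<le> wt a b b' c d p q' t" if "t \<in> {0<..<pi / 2}" for t
    proof -
      have t: "0 < t" "t < pi / 2" using that by auto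
      have "lin q' t \<le> lin q t" using assms(2) half_angle_bounds(1)[OF t] by (simp add: lin_def)
      moreover have "lin q' t > 0" by (rule lin_pos[OF t]) (use assms in simp)
      ultimately have "lin q t powr d \<le> lin q' t powr d" using ab by (intro powr_mono2') auto
      then show ?thesis unfolding wt_def by (intro mult_left_mono) auto
    qed
  qed (use assms ab in \<open>auto intro!: wt_integrable\<close>)
  then show "csB1 p q \<le> csB1 p q'" "csB2 p q \<le> csB2 p q'" by (simp_all add: csB1_def csB2_def)
qed

lemma csB2_growth:
  assumes "p < 1" "q < q'" "q' < 1"
  shows "csB2 p q' \<le> ((1 - q') / (1 - q)) powr (- 1 / 4) * csB2 p q"
proof -
  define \<kappa> where "\<kappa> = (1 - q') / (1 - q)"
  have \<kappa>: "\<kappa> > 0" using assms by (simp add: \<kappa>_def)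
  have "integral {0..pi / 2} (wt (- 1 / 2) (- 1 / 4) (- 3 / 4) (- 1 / 4) (- 1 / 4) p q')
    \<le> integral {0..pi / 2} (\<lambda>t. \<kappa> powr (- 1 / 4) * wt (- 1 / 2) (- 1 / 4) (- 3 / 4) (- 1 / 4) (- 1 / 4) p q t)"
  proof (rule integral_open_mono)
    show "wt (- 1 / 2) (- 1 / 4) (- 3 / 4) (- 1 / 4) (- 1 / 4) p q' integrable_on {0..pi / 2}"
      using assms by (intro wt_integrable) auto
    show "(\<lambda>t. \<kappa> powr (- 1 / 4) * wt (- 1 / 2) (- 1 / 4) (- 3 / 4) (- 1 / 4) (- 1 / 4) p q t) integrable_on {0..pi / 2}"
      using assms by (intro integrable_on_mult_right wt_integrable) auto
    fix t assume "t \<in> {0<..<pi / 2}"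
    then have t: "0 < t" "t < pi / 2" by auto
    have "(1 - q) * lin q' t - (1 - q') * lin q t = (q' - q) * (cos (t / 2) - sin (t / 2))" by (simp add: lin_def algebra_simps)
    also have "\<dots> \<ge> 0" using half_angle_bounds(2)[OF t] assms by simp
    finally have "\<kappa> * lin q t \<le> lin q' t" using assms by (simp add: \<kappa>_def divide_le_eq mult.commute)
    moreover have "lin q t > 0" by (rule lin_pos[OF t]) (use assms in simp)
    ultimately have "lin q' t powr (- 1 / 4) \<le> (\<kappa> * lin q t) powr (- 1 / 4)" using \<kappa> by (intro powr_mono2') auto
    then have *: "lin q' t powr (- 1 / 4) \<le> \<kappa> powr (- 1 / 4) * lin q t powr (- 1 / 4)" by (simp add: powr_mult)
    define c where "c = sin (t / 2) powr (- 1 / 2) * lin 1 t powr (- 1 / 4) * lin (- 1) t powr (- 3 / 4) * lin p t powr (- 1 / 4)"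
    have "c * lin q' t powr (- 1 / 4) \<le> c * (\<kappa> powr (- 1 / 4) * lin q t powr (- 1 / 4))"
      using * by (intro mult_left_mono) (simp_all add: c_def)
    then show "wt (- 1 / 2) (- 1 / 4) (- 3 / 4) (- 1 / 4) (- 1 / 4) p q' t \<le> \<kappa> powr (- 1 / 4) * wt (- 1 / 2) (- 1 / 4) (- 3 / 4) (- 1 / 4) (- 1 / 4) p q t"
      unfolding wt_def c_def[symmetric] by (simp add: mult_ac)
  qed
  then show ?thesis by (simp add: csB2_def J_def \<kappa>_def)
qed

text \<open>Near \<open>q = 1\<close> the first edge grows like \<open>\<delta> powr (- 1 / 2)\<close> and the second at most like \<open>\<delta> powr (- 1 / 4)\<close>, while the
  other factors stay bounded.\<close>

lemma cs_E_positive: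
  assumes p: "1 / 2 < p" "p < 1"
  shows "\<exists>q. p < q \<and> q < 1 \<and> 0 < cs_E p q"
proof -
  define r where "r = (1 + p) / 2"
  have r: "p < r" "r < 1" using p by (simp_all add: r_def)
  have R: "(p, r) \<in> Params" using p r by (simp add: Params_def)
  define K where "K = 64 * ((1 - r) powr (1 / 4) * csB2 p r * cs_S1 p r) / cs_S2 p r"
  obtain \<delta> where \<delta>: "0 < \<delta>" "\<delta> < 1 - r" "K < \<delta> powr (- (1 / 4))"
    using powr_large[of "1 - r" "1 / 4" K] r by auto
  define q where "q = 1 - \<delta>"
  have q: "r < q" "q < 1" "p < q" using \<delta> r by (simp_all add: q_def)
  have Q: "(p, q) \<in> Params" using p q by (simp add: Params_def)
  note S = cs_S_shift[OF R q(1,2)]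
  have S2: "cs_S2 p r \<le> 2 * cs_S2 p q"
    by (rule order_trans[OF S(2)], rule mult_right_mono[OF shift_ratio_le_two]) (use cs_closed(3)[OF Q] p r q in simp_all)
  have pos: "cs_S2 p r > 0" "cs_S1 p r > 0" "csB2 p r > 0" "csB2 p q > 0" "cs_S2 p q > 0"
    using cs_closed(3,4)[OF R] cs_closed(3)[OF Q] p r q by (simp_all add: csB_pos)
  have "\<delta> powr (- 1 / 2) / 32 \<le> csB1 p q" unfolding q_def by (rule csB1_blowup) (use p \<delta> r in auto)
  have d: "\<delta> powr (- 1 / 2) = \<delta> powr (- (1 / 4)) * \<delta> powr (- (1 / 4))" by (simp flip: powr_add)
  have "csB2 p q * cs_S1 p q \<le> (((1 - q) / (1 - r)) powr (- 1 / 4) * csB2 p r) * cs_S1 p r"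
    using csB2_growth[OF p(2) q(1,2)] S(1) pos cs_closed(4)[OF Q] by (intro mult_mono) auto
  also have "((1 - q) / (1 - r)) powr (- 1 / 4) = \<delta> powr (- (1 / 4)) * (1 - r) powr (1 / 4)"
  proof -
    have "((1 - q) / (1 - r)) powr (- 1 / 4) = \<delta> powr (- 1 / 4) / (1 - r) powr (- 1 / 4)" by (simp only: q_def powr_divide) simp
    also have "(1 - r) powr (- 1 / 4) = inverse ((1 - r) powr (1 / 4))" by (simp flip: powr_minus)
    finally show ?thesis by (simp add: inverse_eq_divide)
  qed
  also have "\<delta> powr (- (1 / 4)) * (1 - r) powr (1 / 4) * csB2 p r * cs_S1 p r = \<delta> powr (- (1 / 4)) * (K * cs_S2 p r / 64)"
    using pos by (simp add: K_def)
  also have "\<dots> < \<delta> powr (- (1 / 4)) * (\<delta> powr (- (1 / 4)) * cs_S2 p r / 64)"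
    using \<delta> pos by simp
  also have "\<dots> \<le> \<delta> powr (- (1 / 4)) * (\<delta> powr (- (1 / 4)) * (2 * cs_S2 p q) / 64)"
    using S2 by (intro mult_left_mono divide_right_mono) auto
  also have "\<dots> = \<delta> powr (- 1 / 2) / 32 * cs_S2 p q" unfolding d by simp
  also have "\<dots> \<le> csB1 p q * cs_S2 p q" using \<open>\<delta> powr (- 1 / 2) / 32 \<le> csB1 p q\<close> pos by (intro mult_right_mono) auto
  finally have "0 < cs_E p q" using p q by (simp add: cs_E_def cs_edges)
  then show ?thesis using q by blast
qed

text \<open>Near \<open>q = p\<close> the edge \<open>3\<close> of the first form grows without bound and the other lengths involved stay bounded.\<close>

lemma cs_E_negative:
  assumes p: "1 / 2 < p" "p < 1"
  shows "\<exists>q. p < q \<and> q < 1 \<and> cs_E p q < 0"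
proof -
  define r where "r = (1 + p) / 2"
  have r: "p < r" "r < 1" "r - p \<le> 1 / 4" using p by (simp_all add: r_def)
  have R: "(p, r) \<in> Params" using p r by (simp add: Params_def)
  define K where "K = 128 * csB1 p r * edge_len e_cs2 4 p r / csB2 p p"
  obtain \<delta> where \<delta>: "0 < \<delta>" "\<delta> < r - p" "K < \<delta> powr (- (1 / 2))"
    using powr_large[of "r - p" "1 / 2" K] r by auto
  define q where "q = p + \<delta>"
  have q: "p < q" "q < r" "q < 1" using \<delta> r by (simp_all add: q_def)
  have Q: "(p, q) \<in> Params" using p q by (simp add: Params_def)
  have pos: "csB1 p r > 0" "csB2 p p > 0" "csB1 p q > 0" "csB2 p q > 0" "cs_S2 p q > 0" "cs_S1 p q > 0"
    using cs_closed(3,4)[OF Q] p r q by (simp_all add: csB_pos)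
  have L: "edge_len e_cs2 4 p r > 0" "edge_len e_cs2 3 p q > 0" "edge_len e_cs1 3 p q > 0" "edge_len e_cs1 4 p q > 0"
    by (rule edge_len_pos; use R Q in simp)+
  have C: "edge_len e_cs2 4 p q \<le> 2 * edge_len e_cs2 4 p r"
    by (rule order_trans[OF cs_S_shift(3)[OF Q q(2) r(2)]], rule mult_right_mono[OF shift_ratio_le_two]) (use L p q r in simp_all)
  have "cs_S2 p q \<le> 2 * edge_len e_cs2 4 p q" unfolding cs_S2_def using L by simp
  then have S2: "cs_S2 p q \<le> 4 * edge_len e_cs2 4 p r" using C by simp
  have "csB1 p q * cs_S2 p q \<le> csB1 p r * (4 * edge_len e_cs2 4 p r)"
    using csB_y_mono(1)[OF p(2), of q r] q r S2 pos by (intro mult_mono) auto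
  also have "\<dots> = K * csB2 p p / 32" using pos by (simp add: K_def)
  also have "\<dots> < \<delta> powr (- (1 / 2)) * csB2 p p / 32" using \<delta> pos by simp
  also have "\<dots> = csB2 p p * (\<delta> powr (- 1 / 2) / 32)" by simp
  also have "\<dots> \<le> csB2 p q * cs_S1 p q"
  proof (rule mult_mono)
    show "csB2 p p \<le> csB2 p q" using csB_y_mono(2)[OF p(2), of p q] q by simp
    have "\<delta> powr (- 1 / 2) / 32 \<le> edge_len e_cs1 3 p q"
      unfolding q_def by (rule cs_d2_blowup) (use p \<delta> r in auto)
    also have "\<dots> \<le> sqrt 2 * edge_len e_cs1 3 p q" using L by (simp add: mult_le_cancel_right1)
    also have "\<dots> \<le> cs_S1 p q" unfolding cs_S1_def using L by simp
    finally show "\<delta> powr (- 1 / 2) / 32 \<le> cs_S1 p q" .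
  qed (use pos in auto)
  finally have "cs_E p q < 0" using p q by (simp add: cs_E_def cs_edges)
  then show ?thesis using q by blast
qed

lemma cs_solution:
  obtains Q where "continuous_on {1 / 2<..<1} Q"
    "\<And>p. p \<in> {1 / 2<..<1} \<Longrightarrow> (p, Q p) \<in> Params"
    "\<And>p. p \<in> {1 / 2<..<1} \<Longrightarrow> edge_len e_cs1 0 p (Q p) * (edge_len e_cs2 2 p (Q p) + edge_len e_cs2 4 p (Q p))
      = edge_len e_cs2 0 p (Q p) * (edge_len e_cs1 2 p (Q p) + edge_len e_cs1 4 p (Q p))"
proof -
  obtain Q where Q: "continuous_on {1 / 2<..<1} Q"
    "\<And>p. p \<in> {1 / 2<..<1} \<Longrightarrow> p < Q p \<and> Q p < 1 \<and> cs_E p (Q p) = 0"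
  proof (rule sign_change_root_continuous[of "{1 / 2<..<1::real}" "\<lambda>p. p" "\<lambda>_. 1" cs_E])
    show "continuous_on {x. fst x \<in> {1 / 2<..<1} \<and> fst x < snd x \<and> snd x < 1} (\<lambda>x. cs_E (fst x) (snd x))"
    proof (rule continuous_on_subset[of Params])
      show "continuous_on Params (\<lambda>x. cs_E (fst x) (snd x))"
        unfolding cs_E_def cs_S1_def cs_S2_def by (intro continuous_intros edge_len_continuous) simp_all
    qed (auto simp: Params_def)
    show "0 < cs_E p y'" if "p \<in> {1 / 2<..<1}" "p < y" "y < y'" "y' < 1" "0 \<le> cs_E p y" for p y y'
      by (rule cs_E_step[OF _ that(2-5)]) (use that(1) in simp)
    show "\<exists>y. p < y \<and> y < 1 \<and> cs_E p y < 0" if "p \<in> {1 / 2<..<1}" for p using cs_E_negative[of p] that by simp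
    show "\<exists>y. p < y \<and> y < 1 \<and> 0 < cs_E p y" if "p \<in> {1 / 2<..<1}" for p using cs_E_positive[of p] that by simp
  qed (simp_all add: continuous_on_id continuous_on_const)
  show ?thesis
  proof
    show "continuous_on {1 / 2<..<1} Q" by (rule Q(1))
    fix p :: real assume p: "p \<in> {1 / 2<..<1}"
    show P: "(p, Q p) \<in> Params" using Q(2)[OF p] p by (simp add: Params_def)
    show "edge_len e_cs1 0 p (Q p) * (edge_len e_cs2 2 p (Q p) + edge_len e_cs2 4 p (Q p))
      = edge_len e_cs2 0 p (Q p) * (edge_len e_cs1 2 p (Q p) + edge_len e_cs1 4 p (Q p))"
      unfolding cs_closed[OF P] using Q(2)[OF p] by (simp add: cs_E_def algebra_simps)
  qed
qed

section \<open>Pentagons in a box\<close>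

lemma exhaust_3_cases: "(i::3) = 1 \<or> i = 2 \<or> i = 3"
  using exhaust_3 by blast

lemma path_onto_segment:
  fixes \<gamma> :: "real \<Rightarrow> 'a::real_normed_vector"
  assumes "a \<le> b" and f: "continuous_on {a..b} f" "\<And>t. t \<in> {a..b} \<Longrightarrow> 0 \<le> f t \<and> f t \<le> 1"
    and ends: "f a = 0 \<and> f b = 1 \<or> f a = 1 \<and> f b = 0"
    and \<gamma>: "\<And>t. t \<in> {a..b} \<Longrightarrow> \<gamma> t = (1 - f t) *\<^sub>R P + f t *\<^sub>R Q"
  shows "\<gamma> ` {a..b} = closed_segment P Q"
proof
  show "\<gamma> ` {a..b} \<subseteq> closed_segment P Q"
    using f(2) \<gamma> by (fastforce simp: closed_segment_def)
  show "closed_segment P Q \<subseteq> \<gamma> ` {a..b}"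
  proof
    fix x assume "x \<in> closed_segment P Q"
    then obtain u where u: "0 \<le> u" "u \<le> 1" "x = (1 - u) *\<^sub>R P + u *\<^sub>R Q" by (auto simp: closed_segment_def)
    have "\<exists>t. a \<le> t \<and> t \<le> b \<and> f t = u"
      using ends
    proof
      assume "f a = 0 \<and> f b = 1"
      then show ?thesis using IVT'[of f a u b] u f(1) assms(1) by auto
    next
      assume "f a = 1 \<and> f b = 0"
      then show ?thesis using IVT2'[of f b u a] u f(1) assms(1) by auto
    qed
    then obtain t where "t \<in> {a..b}" "f t = u" by auto
    then show "x \<in> \<gamma> ` {a..b}" using \<gamma>[of t] u(3) by (metis image_eqI)
  qed
qed

lemma five_marks_order:
  assumes "five_marks \<theta>"
  shows "\<theta> 0 < \<theta> 1" "\<theta> 1 < \<theta> 2" "\<theta> 2 < \<theta> 3" "\<theta> 3 < \<theta> 4" "\<theta> 4 < \<theta> 5" "\<theta> 5 = \<theta> 0 + 2 * pi"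
proof -
  have "\<theta> k < \<theta> (Suc k)" if "k < 5" for k using assms that by (simp add: five_marks_def)
  moreover have S: "Suc 0 = 1" "Suc 1 = 2" "Suc 2 = 3" "Suc 3 = 4" "Suc 4 = 5" by simp_all
  ultimately show "\<theta> 0 < \<theta> 1" "\<theta> 1 < \<theta> 2" "\<theta> 2 < \<theta> 3" "\<theta> 3 < \<theta> 4" "\<theta> 4 < \<theta> 5" by (metis S numeral_less_iff zero_less_numeral one_less_numeral_iff semiring_norm)+
  show "\<theta> 5 = \<theta> 0 + 2 * pi" using assms by (simp add: five_marks_def)
qed

lemma sphere_arcs:
  assumes "five_marks \<theta>" "z \<in> sphere 0 1"
  obtains j t where "j < 5" "\<theta> j \<le> t" "t < \<theta> (Suc j)" "z = cis t"
proof -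
  note fm = five_marks_order[OF assms(1)]
  obtain s where s: "z = cis s" using assms(2) by (metis cis_Arg dist_0_norm mem_sphere norm_zero zero_neq_one sgn_div_norm div_by_1 inverse_1 scaleR_one)
  define n where "n = \<lfloor>(s - \<theta> 0) / (2 * pi)\<rfloor>"
  define t where "t = s - 2 * pi * n"
  have "of_int n \<le> (s - \<theta> 0) / (2 * pi)" "(s - \<theta> 0) / (2 * pi) < of_int n + 1" unfolding n_def by linarith+
  then have t: "\<theta> 0 \<le> t" "t < \<theta> 5" using fm(6) pi_gt_zero by (simp_all add: t_def field_simps)
  have "cis (2 * pi * n) = 1" by (simp add: cis_multiple_2pi)
  then have z: "z = cis t" unfolding s t_def by (simp flip: cis_divide)
  consider "t < \<theta> 1" | "\<theta> 1 \<le> t" "t < \<theta> 2" | "\<theta> 2 \<le> t" "t < \<theta> 3" | "\<theta> 3 \<le> t" "t < \<theta> 4" | "\<theta> 4 \<le> t" by linarith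
  then show ?thesis
  proof cases
    case 1 then show ?thesis using that[of 0 t] t z by simp
  next
    case 2 then show ?thesis using that[of 1 t] t z by (simp add: numeral_2_eq_2)
  next
    case 3 then show ?thesis using that[of 2 t] t z by (simp add: eval_nat_numeral)
  next
    case 4 then show ?thesis using that[of 3 t] t z by (simp add: eval_nat_numeral)
  next
    case 5 then show ?thesis using that[of 4 t] t z by (simp add: eval_nat_numeral)
  qed
qed

text \<open>The axis orthogonal to the wall that contains the edge \<open>j \<in> {0, 2, 4}\<close>.  Only the wall of the edge \<open>2\<close> depends on the
  type of the pentagon.\<close>

definition wall_axis :: "3 \<Rightarrow> nat \<Rightarrow> 3" where
  "wall_axis i0 j = (if j = 0 then 1 else if j = 4 then 2 else i0)"

text \<open>The behaviour of the null curve on the five arcs and at the five marks that forces its real part to be a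
  pentagon in the box.  The edges \<open>0\<close> and \<open>4\<close> rise in the walls \<open>x\<^sub>1 = 1\<close> and \<open>x\<^sub>2 = 1\<close>, the edge \<open>2\<close> falls in the wall
  \<open>x i0 = 0\<close>, the edge \<open>1\<close> is a diagonal of the top and the edge \<open>3\<close> one of the bottom.  The case \<open>a = 0\<close> has parallel
  diagonals, the case \<open>a = 1\<close> orthogonal ones.\<close>

locale box_pentagon = weierstrass_data "slit_plane \<theta>" F \<Phi>
  for \<theta> :: "nat \<Rightarrow> real" and F \<Phi> :: "3 \<Rightarrow> complex \<Rightarrow> complex" +
  fixes h c a :: real and i0 :: 3 and vel :: "3 \<Rightarrow> real \<Rightarrow> complex"
  assumes velocity: "vel i t = \<i> * cis t * \<Phi> i (cis t)"
    and fm: "five_marks \<theta>"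
    and cont: "continuous_on (cball 0 1) (F i)"
    and kind: "i0 = 1 \<and> a = 0 \<or> i0 = 2 \<and> a = 1"
    and c_pos: "0 < c"
    and walls: "j = 0 \<or> j = 2 \<or> j = 4 \<Longrightarrow> \<theta> j < t \<Longrightarrow> t < \<theta> (Suc j) \<Longrightarrow> Re (vel (wall_axis i0 j) t) = 0"
      "j = 0 \<or> j = 2 \<or> j = 4 \<Longrightarrow> \<theta> j < t \<Longrightarrow> t < \<theta> (Suc j) \<Longrightarrow> i \<noteq> wall_axis i0 j \<Longrightarrow> Im (vel i t) = 0"
    and rise: "j = 0 \<or> j = 4 \<Longrightarrow> \<theta> j < t \<Longrightarrow> t < \<theta> (Suc j) \<Longrightarrow> Re (vel 3 t) > 0"
    and fall: "\<theta> 2 < t \<Longrightarrow> t < \<theta> 3 \<Longrightarrow> Re (vel 3 t) < 0"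
    and level: "j = 1 \<or> j = 3 \<Longrightarrow> \<theta> j < t \<Longrightarrow> t < \<theta> (Suc j) \<Longrightarrow> Re (vel 3 t) = 0"
    and top: "\<theta> 1 < t \<Longrightarrow> t < \<theta> 2 \<Longrightarrow> Re (vel 1 t) = Re (vel 2 t)" "\<theta> 1 < t \<Longrightarrow> t < \<theta> 2 \<Longrightarrow> Re (vel 2 t) < 0"
    and bottom: "\<theta> 3 < t \<Longrightarrow> t < \<theta> 4 \<Longrightarrow> Re (vel 1 t) = (1 - 2 * a) * Re (vel 2 t)" "\<theta> 3 < t \<Longrightarrow> t < \<theta> 4 \<Longrightarrow> Re (vel 2 t) > 0"
    and vertices: "re_vec F (cis (\<theta> 0)) = vector [1, 1, c]" "re_vec F (cis (\<theta> 1)) = vector [1, 1, h]"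
      "re_vec F (cis (\<theta> 2)) = vector [0, 0, h]" "re_vec F (cis (\<theta> 3)) = vector [a, 0, 0]"
      "re_vec F (cis (\<theta> 4)) = vector [1 - a, 1, 0]"
begin

definition coord :: "3 \<Rightarrow> real \<Rightarrow> real" where
  "coord i t = Re (F i (cis t))"

lemma re_vec_coord: "re_vec F (cis t) $ i = coord i t"
  by (simp add: coord_def)

lemmas mark_order = five_marks_order[OF fm]

lemma cis_last: "cis (\<theta> 5) = cis (\<theta> 0)"
  using mark_order(6) by (simp flip: cis_mult)

lemma vertex_coords:
  "coord 1 (\<theta> 0) = 1" "coord 2 (\<theta> 0) = 1" "coord 3 (\<theta> 0) = c"
  "coord 1 (\<theta> 1) = 1" "coord 2 (\<theta> 1) = 1" "coord 3 (\<theta> 1) = h"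
  "coord 1 (\<theta> 2) = 0" "coord 2 (\<theta> 2) = 0" "coord 3 (\<theta> 2) = h"
  "coord 1 (\<theta> 3) = a" "coord 2 (\<theta> 3) = 0" "coord 3 (\<theta> 3) = 0"
  "coord 1 (\<theta> 4) = 1 - a" "coord 2 (\<theta> 4) = 1" "coord 3 (\<theta> 4) = 0"
  "coord 1 (\<theta> 5) = 1" "coord 2 (\<theta> 5) = 1" "coord 3 (\<theta> 5) = c"
proof -
  have c5: "coord i (\<theta> 5) = coord i (\<theta> 0)" for i by (simp add: coord_def cis_last)
  have "coord i (\<theta> 0) = vector [1, 1, c] $ i" "coord i (\<theta> 1) = vector [1, 1, h] $ i" "coord i (\<theta> 2) = vector [0, 0, h] $ i"
     "coord i (\<theta> 3) = vector [a, 0, 0] $ i" "coord i (\<theta> 4) = vector [1 - a, 1, 0] $ i" for i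
    by (simp_all only: re_vec_coord[symmetric] vertices)
  note v = this
  show "coord 1 (\<theta> 0) = 1" "coord 2 (\<theta> 0) = 1" "coord 3 (\<theta> 0) = c"
    "coord 1 (\<theta> 1) = 1" "coord 2 (\<theta> 1) = 1" "coord 3 (\<theta> 1) = h"
    "coord 1 (\<theta> 2) = 0" "coord 2 (\<theta> 2) = 0" "coord 3 (\<theta> 2) = h"
    "coord 1 (\<theta> 3) = a" "coord 2 (\<theta> 3) = 0" "coord 3 (\<theta> 3) = 0"
    "coord 1 (\<theta> 4) = 1 - a" "coord 2 (\<theta> 4) = 1" "coord 3 (\<theta> 4) = 0"
    "coord 1 (\<theta> 5) = 1" "coord 2 (\<theta> 5) = 1" "coord 3 (\<theta> 5) = c"
    unfolding c5 v by (simp_all add: vector_3)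
qed

lemma arc_in_slit_plane:
  assumes "j < 5" "\<theta> j < t" "t < \<theta> (Suc j)"
  shows "cis t \<in> slit_plane \<theta>"
proof -
  interpret sc_data "\<lambda>_. 1" \<theta> "\<lambda>_. - 2 / 5" by unfold_locales (use fm in \<open>simp_all\<close>)
  show ?thesis by (rule cis_arc_in_slit_plane[OF assms])
qed

lemma curve_derivative:
  assumes "j < 5" "\<theta> j < t" "t < \<theta> (Suc j)"
  shows "((\<lambda>t. F i (cis t)) has_vector_derivative vel i t) (at t)"
proof -
  have "((\<lambda>z. F i (exp (\<i> * z))) has_field_derivative \<Phi> i (cis t) * (\<i> * cis t)) (at (of_real t))"
    using deriv_F[OF arc_in_slit_plane[OF assms]]
    by (intro DERIV_chain2[of "F i"]) (auto intro!: derivative_eq_intros simp: cis_conv_exp)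
  then have "((\<lambda>t. F i (cis t)) has_vector_derivative \<Phi> i (cis t) * (\<i> * cis t)) (at t)"
    using has_vector_derivative_real_field by (fastforce simp: cis_conv_exp)
  then show ?thesis by (simp add: velocity mult_ac)
qed

lemma coord_derivative:
  assumes "j < 5" "\<theta> j < t" "t < \<theta> (Suc j)"
  shows "(coord i has_real_derivative Re (vel i t)) (at t)"
    and "((\<lambda>t. Im (F i (cis t))) has_real_derivative Im (vel i t)) (at t)"
  using bounded_linear.has_vector_derivative[OF bounded_linear_Re curve_derivative[OF assms]]
    bounded_linear.has_vector_derivative[OF bounded_linear_Im curve_derivative[OF assms]]
  unfolding coord_def [abs_def] by (simp_all add: has_real_derivative_iff_has_vector_derivative)

lemma coord_continuous: "continuous_on S (coord i)" and Im_continuous: "continuous_on S (\<lambda>t. Im (F i (cis t)))"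
proof -
  have "continuous_on S (\<lambda>t. F i (cis t))"
    by (rule continuous_on_compose2[OF cont]) (auto intro!: continuous_intros simp: cis_conv_exp)
  then show "continuous_on S (coord i)" "continuous_on S (\<lambda>t. Im (F i (cis t)))"
    unfolding coord_def [abs_def] by (simp_all add: continuous_on_Re continuous_on_Im)
qed

lemma coord_increasing:
  assumes "j < 5" "\<And>t. \<theta> j < t \<Longrightarrow> t < \<theta> (Suc j) \<Longrightarrow> Re (vel i t) > 0" "\<theta> j \<le> s" "s < t" "t \<le> \<theta> (Suc j)"
  shows "coord i s < coord i t"
proof (rule DERIV_pos_imp_increasing_open[OF assms(4)])
  fix x assume "s < x" "x < t"
  then have x: "\<theta> j < x" "x < \<theta> (Suc j)" using assms by linarith+
  then show "\<exists>y. (coord i has_real_derivative y) (at x) \<and> 0 < y"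
    using coord_derivative(1)[OF assms(1) x] assms(2)[OF x] by blast
qed (rule coord_continuous)

lemma coord_decreasing:
  assumes "j < 5" "\<And>t. \<theta> j < t \<Longrightarrow> t < \<theta> (Suc j) \<Longrightarrow> Re (vel i t) < 0" "\<theta> j \<le> s" "s < t" "t \<le> \<theta> (Suc j)"
  shows "coord i t < coord i s"
proof (rule DERIV_neg_imp_decreasing_open[OF assms(4)])
  fix x assume "s < x" "x < t"
  then have x: "\<theta> j < x" "x < \<theta> (Suc j)" using assms by linarith+
  then show "\<exists>y. (coord i has_real_derivative y) (at x) \<and> y < 0"
    using coord_derivative(1)[OF assms(1) x] assms(2)[OF x] by blast
qed (rule coord_continuous)

lemma combination_constant:
  assumes "j < 5" "\<And>t. \<theta> j < t \<Longrightarrow> t < \<theta> (Suc j) \<Longrightarrow> Re (vel i t) = k * Re (vel i' t)" "\<theta> j \<le> t" "t \<le> \<theta> (Suc j)"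
  shows "coord i t - k * coord i' t = coord i (\<theta> j) - k * coord i' (\<theta> j)"
proof (cases "\<theta> j = t")
  case False
  show ?thesis
  proof (rule DERIV_isconst_end[of "\<theta> j" t "\<lambda>t. coord i t - k * coord i' t"])
    show "continuous_on {\<theta> j..t} (\<lambda>t. coord i t - k * coord i' t)" by (intro continuous_intros coord_continuous)
    fix x assume "\<theta> j < x" "x < t"
    then have x: "\<theta> j < x" "x < \<theta> (Suc j)" using assms by linarith+
    have "((\<lambda>t. coord i t - k * coord i' t) has_real_derivative Re (vel i x) - k * Re (vel i' x)) (at x)"
      by (intro DERIV_diff DERIV_cmult coord_derivative(1)[OF assms(1) x])
    then show "((\<lambda>t. coord i t - k * coord i' t) has_real_derivative 0) (at x)" using assms(2)[OF x] by simp
  qed (use False assms in simp)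
qed simp

lemma coord_constant:
  assumes "j < 5" "\<And>t. \<theta> j < t \<Longrightarrow> t < \<theta> (Suc j) \<Longrightarrow> Re (vel i t) = 0" "\<theta> j \<le> t" "t \<le> \<theta> (Suc j)"
  shows "coord i t = coord i (\<theta> j)"
  using combination_constant[of j i 0 i t] assms by simp

lemma conjugate_constant:
  assumes "j < 5" "\<And>t. \<theta> j < t \<Longrightarrow> t < \<theta> (Suc j) \<Longrightarrow> Im (vel i t) = 0" "\<theta> j < t" "t < \<theta> (Suc j)"
  shows "Im (F i (cis t)) = Im (F i (cis (\<theta> j)))"
proof (rule DERIV_isconst_end[of "\<theta> j" t "\<lambda>t. Im (F i (cis t))", OF assms(3) Im_continuous])
  fix x assume "\<theta> j < x" "x < t"
  then have x: "\<theta> j < x" "x < \<theta> (Suc j)" using assms by linarith+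
  show "((\<lambda>t. Im (F i (cis t))) has_real_derivative 0) (at x)"
    using coord_derivative(2)[OF assms(1) x, of i] assms(2)[OF x] by simp
qed


subsection \<open>Boundary values\<close>

lemmas vertex_simps = vertex_coords vertex_coords[unfolded One_nat_def]

lemma wall_coord:
  assumes "j = 0 \<or> j = 2 \<or> j = 4" "\<theta> j \<le> t" "t \<le> \<theta> (Suc j)"
  shows "coord (wall_axis i0 j) t = (if j = 2 then 0 else 1)"
proof -
  have "coord (wall_axis i0 j) t = coord (wall_axis i0 j) (\<theta> j)"
    by (rule coord_constant[OF _ walls(1)[OF assms(1)] assms(2,3)]) (use assms(1) in auto)
  also have "\<dots> = (if j = 2 then 0 else 1)"
    using assms(1) kind by (auto simp: wall_axis_def vertex_simps)
  finally show ?thesis .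
qed

lemma wall_B: "\<theta> 0 \<le> t \<Longrightarrow> t \<le> \<theta> 1 \<Longrightarrow> coord 1 t = 1"
  using wall_coord[of 0 t] by (simp add: wall_axis_def)

lemma wall_A: "\<theta> 2 \<le> t \<Longrightarrow> t \<le> \<theta> 3 \<Longrightarrow> coord i0 t = 0"
  using wall_coord[of 2 t] by (simp add: wall_axis_def)

lemma wall_C: "\<theta> 4 \<le> t \<Longrightarrow> t \<le> \<theta> 5 \<Longrightarrow> coord 2 t = 1"
  using wall_coord[of 4 t] by (simp add: wall_axis_def)

lemma top_coords:
  assumes "\<theta> 1 \<le> t" "t \<le> \<theta> 2"
  shows "coord 3 t = h" "coord 1 t = coord 2 t"
proof -
  have S: "\<theta> (Suc 1) = \<theta> 2" by (simp add: numeral_2_eq_2)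
  show "coord 3 t = h"
    using coord_constant[of 1 3 t] level[of 1] assms unfolding S by (simp add: vertex_simps)
  show "coord 1 t = coord 2 t"
    using combination_constant[of 1 1 1 2 t] top(1) assms unfolding S by (simp add: vertex_simps)
qed

lemma bottom_coords:
  assumes "\<theta> 3 \<le> t" "t \<le> \<theta> 4"
  shows "coord 3 t = 0" "coord 1 t = a + (1 - 2 * a) * coord 2 t"
proof -
  show "coord 3 t = 0"
    using coord_constant[of 3 3 t] level[of 3] assms by (simp add: vertex_simps)
  show "coord 1 t = a + (1 - 2 * a) * coord 2 t"
    using combination_constant[of 3 1 "1 - 2 * a" 2 t] bottom(1) assms by (simp add: vertex_simps)
qed

lemma top_decreasing: "\<theta> 1 \<le> s \<Longrightarrow> s < t \<Longrightarrow> t \<le> \<theta> 2 \<Longrightarrow> coord 2 t < coord 2 s"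
  using coord_decreasing[of 1 2 s t] top(2) by (simp add: numeral_2_eq_2)

lemma bottom_increasing: "\<theta> 3 \<le> s \<Longrightarrow> s < t \<Longrightarrow> t \<le> \<theta> 4 \<Longrightarrow> coord 2 s < coord 2 t"
  using coord_increasing[of 3 2 s t] bottom(2) by simp

lemma rise_B: "\<theta> 0 \<le> s \<Longrightarrow> s < t \<Longrightarrow> t \<le> \<theta> 1 \<Longrightarrow> coord 3 s < coord 3 t"
  using coord_increasing[of 0 3 s t] rise[of 0] by simp

lemma fall_A: "\<theta> 2 \<le> s \<Longrightarrow> s < t \<Longrightarrow> t \<le> \<theta> 3 \<Longrightarrow> coord 3 t < coord 3 s"
  using coord_decreasing[of 2 3 s t] fall by simp

lemma rise_C: "\<theta> 4 \<le> s \<Longrightarrow> s < t \<Longrightarrow> t \<le> \<theta> 5 \<Longrightarrow> coord 3 s < coord 3 t"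
  using coord_increasing[of 4 3 s t] rise[of 4] by simp

lemma c_less_h: "c < h"
  using rise_B[of "\<theta> 0" "\<theta> 1"] mark_order by (simp add: vertex_simps)

lemma weak_mono:
  assumes "\<And>s t. A \<le> s \<Longrightarrow> s < t \<Longrightarrow> t \<le> B \<Longrightarrow> f s < (f t :: real)" "A \<le> t" "t \<le> (B::real)"
  shows "f A \<le> f t" "f t \<le> f B"
  using assms(1)[of A t] assms(1)[of t B] assms(2,3) by (cases "A = t"; cases "t = B"; auto)+

lemma weak_antimono:
  assumes "\<And>s t. A \<le> s \<Longrightarrow> s < t \<Longrightarrow> t \<le> B \<Longrightarrow> f t < (f s :: real)" "A \<le> t" "t \<le> (B::real)"
  shows "f B \<le> f t" "f t \<le> f A"
  using assms(1)[of A t] assms(1)[of t B] assms(2,3) by (cases "A = t"; cases "t = B"; auto)+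

lemma top_bounds: "\<theta> 1 \<le> t \<Longrightarrow> t \<le> \<theta> 2 \<Longrightarrow> 0 \<le> coord 2 t \<and> coord 2 t \<le> 1"
  using weak_antimono[of "\<theta> 1" "\<theta> 2" "coord 2" t] top_decreasing by (simp add: vertex_simps)

lemma bottom_bounds: "\<theta> 3 \<le> t \<Longrightarrow> t \<le> \<theta> 4 \<Longrightarrow> 0 \<le> coord 2 t \<and> coord 2 t \<le> 1"
  using weak_mono[of "\<theta> 3" "\<theta> 4" "coord 2" t] bottom_increasing by (simp add: vertex_simps)

lemma height_B: "\<theta> 0 \<le> t \<Longrightarrow> t \<le> \<theta> 1 \<Longrightarrow> c \<le> coord 3 t \<and> coord 3 t \<le> h"
  using weak_mono[of "\<theta> 0" "\<theta> 1" "coord 3" t] rise_B by (simp add: vertex_simps)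

lemma height_A: "\<theta> 2 \<le> t \<Longrightarrow> t \<le> \<theta> 3 \<Longrightarrow> 0 \<le> coord 3 t \<and> coord 3 t \<le> h"
  using weak_antimono[of "\<theta> 2" "\<theta> 3" "coord 3" t] fall_A by (simp add: vertex_simps)

lemma height_C: "\<theta> 4 \<le> t \<Longrightarrow> t \<le> \<theta> 5 \<Longrightarrow> 0 \<le> coord 3 t \<and> coord 3 t \<le> c"
  using weak_mono[of "\<theta> 4" "\<theta> 5" "coord 3" t] rise_C by (simp add: vertex_simps)

lemma arc_cases:
  assumes "j < 5" "\<theta> j \<le> t" "t < \<theta> (Suc j)"
  obtains "j = 0" "\<theta> 0 \<le> t" "t < \<theta> 1" | "j = 1" "\<theta> 1 \<le> t" "t < \<theta> 2" | "j = 2" "\<theta> 2 \<le> t" "t < \<theta> 3"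
    | "j = 3" "\<theta> 3 \<le> t" "t < \<theta> 4" | "j = 4" "\<theta> 4 \<le> t" "t < \<theta> 5"
proof -
  have "j = 0 \<or> j = 1 \<or> j = 2 \<or> j = 3 \<or> j = 4" using assms(1) less_5_cases by blast
  then show thesis
  proof (elim disjE)
    assume "j = 1"
    then show thesis using that(2) assms by (simp add: numeral_2_eq_2)
  qed (use that assms in simp_all)
qed

subsection \<open>The surface stays in the box\<close>

lemma nonconstant: "\<not> F i constant_on slit_plane \<theta>"
proof
  assume "F i constant_on slit_plane \<theta>"
  then obtain y where y: "\<And>z. z \<in> slit_plane \<theta> \<Longrightarrow> F i z = y" by (auto simp: constant_on_def)
  have zero: "\<Phi> i z = 0" if z: "z \<in> slit_plane \<theta>" for z
  proof -
    have "(F i has_field_derivative 0) (at z)"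
      by (rule has_field_derivative_transform_within_open[OF DERIV_const open_U z]) (simp add: y)
    then show ?thesis using deriv_F[OF z] by (metis DERIV_unique)
  qed
  define t where "t = (\<theta> 1 + \<theta> 2) / 2"
  have t: "\<theta> 1 < t" "t < \<theta> 2" using mark_order by (simp_all add: t_def)
  have U: "cis t \<in> slit_plane \<theta>" by (rule arc_in_slit_plane[of 1]) (use t in \<open>simp_all add: numeral_2_eq_2\<close>)
  have "vel i t = 0" using zero[OF U] by (simp add: velocity)
  then have "i = 3" using top[OF t] exhaust_3_cases[of i] by auto
  then show False using regular[OF U] zero[OF U] by simp
qed

text \<open>The open arcs along which coordinate \<open>i\<close> is not prescribed but its conjugate is constant.\<close>

definition free_arcs :: "3 \<Rightarrow> complex set" where
  "free_arcs i = {z. \<exists>j t. (j = 0 \<or> j = 2 \<or> j = 4) \<and> i \<noteq> wall_axis i0 j \<and> \<theta> j < t \<and> t < \<theta> (Suc j) \<and> z = cis t}"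

lemma neumann:
  assumes "z \<in> free_arcs i"
  shows "\<exists>t0 \<delta>. z = cis t0 \<and> \<delta> > 0 \<and> (\<forall>t. \<bar>t - t0\<bar> < \<delta> \<longrightarrow> cis t \<in> slit_plane \<theta> \<and> Im (F i (cis t)) = Im (F i z))"
proof -
  obtain j t0 where j: "j = 0 \<or> j = 2 \<or> j = 4" "i \<noteq> wall_axis i0 j" and t0: "\<theta> j < t0" "t0 < \<theta> (Suc j)" and z: "z = cis t0"
    using assms unfolding free_arcs_def by blast
  have j5: "j < 5" using j(1) by auto
  have C: "Im (F i (cis t)) = Im (F i (cis (\<theta> j)))" if "\<theta> j < t" "t < \<theta> (Suc j)" for t
    by (rule conjugate_constant[OF j5 walls(2)[OF j(1) _ _ j(2)] that])
  define \<delta> where "\<delta> = min (t0 - \<theta> j) (\<theta> (Suc j) - t0)"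
  have "cis t \<in> slit_plane \<theta> \<and> Im (F i (cis t)) = Im (F i z)" if "\<bar>t - t0\<bar> < \<delta>" for t
  proof -
    have t: "\<theta> j < t" "t < \<theta> (Suc j)" using that unfolding \<delta>_def by linarith+
    show ?thesis using arc_in_slit_plane[OF j5 t] C[OF t] C[OF t0] z by simp
  qed
  moreover have "\<delta> > 0" using t0 by (simp add: \<delta>_def)
  ultimately show ?thesis using z by blast
qed

lemma a_01: "a = 0 \<or> a = 1"
  using kind by blast

text \<open>Off the free arcs a horizontal coordinate is either the constant of a wall or monotone along a diagonal.\<close>

lemma fixed_arc_bounds:
  assumes i: "i = 1 \<or> i = 2" and z: "z \<in> sphere 0 1 - free_arcs i"
  shows "0 \<le> Re (F i z)" "Re (F i z) \<le> 1"
proof -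
  have "z \<in> sphere 0 1" using z by blast
  then obtain j t where j: "j < 5" "\<theta> j \<le> t" "t < \<theta> (Suc j)" "z = cis t" by (rule sphere_arcs[OF fm])
  have "0 \<le> coord i t \<and> coord i t \<le> 1"
  proof (cases "j = 0 \<or> j = 2 \<or> j = 4")
    case True
    show ?thesis
    proof (cases "i = wall_axis i0 j")
      case True
      then show ?thesis using wall_coord[OF \<open>j = 0 \<or> j = 2 \<or> j = 4\<close> j(2) less_imp_le[OF j(3)]] by simp
    next
      case False
      have "\<not> \<theta> j < t"
      proof
        assume "\<theta> j < t"
        then have "z \<in> free_arcs i" unfolding free_arcs_def using True False j(3,4) by blast
        then show False using z by blast
      qed
      then have "t = \<theta> j" using j(2) by simp
      then show ?thesis using True i a_01 by (elim disjE) (simp_all add: vertex_simps)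
    qed
  next
    case False
    show ?thesis
    proof (rule arc_cases[OF j(1-3)])
      assume t: "\<theta> 1 \<le> t" "t < \<theta> 2"
      then show ?thesis using i top_bounds[of t] top_coords[of t] by (elim disjE) simp_all
    next
      assume t: "\<theta> 3 \<le> t" "t < \<theta> 4"
      then show ?thesis using i a_01 bottom_bounds[of t] bottom_coords(2)[of t] by (elim disjE) simp_all
    qed (use False in simp_all)
  qed
  then show "0 \<le> Re (F i z)" "Re (F i z) \<le> 1" by (simp_all add: coord_def j(4))
qed

lemma slit_plane_facts: "open (slit_plane \<theta>)" "connected (slit_plane \<theta>)" "ball 0 1 \<subseteq> slit_plane \<theta>"
  by (rule open_slit_plane connected_slit_plane ball_subset_slit_plane)+

lemma horizontal_upper:
  assumes i: "i = 1 \<or> i = 2"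
  shows "z \<in> cball 0 1 \<Longrightarrow> Re (F i z) \<le> 1" "z \<in> ball 0 1 \<union> free_arcs i \<Longrightarrow> Re (F i z) < 1"
  by (rule mixed_boundary_max[OF slit_plane_facts holomorphic_F cont nonconstant fixed_arc_bounds(2)[OF i] neumann]; assumption)+

lemma horizontal_lower:
  assumes i: "i = 1 \<or> i = 2"
  shows "z \<in> cball 0 1 \<Longrightarrow> 0 \<le> Re (F i z)" "z \<in> ball 0 1 \<union> free_arcs i \<Longrightarrow> 0 < Re (F i z)"
proof -
  have hol: "(\<lambda>z. - F i z) holomorphic_on slit_plane \<theta>" by (intro holomorphic_intros holomorphic_F)
  have co: "continuous_on (cball 0 1) (\<lambda>z. - F i z)" by (intro continuous_intros cont)
  have nc: "\<not> (\<lambda>z. - F i z) constant_on slit_plane \<theta>"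
  proof
    assume "(\<lambda>z. - F i z) constant_on slit_plane \<theta>"
    then obtain y where "\<And>z. z \<in> slit_plane \<theta> \<Longrightarrow> - F i z = y" by (auto simp: constant_on_def)
    then have "\<forall>z\<in>slit_plane \<theta>. F i z = - y" by (metis minus_minus)
    then have "F i constant_on slit_plane \<theta>" unfolding constant_on_def by blast
    then show False using nonconstant by blast
  qed
  have d: "Re (- F i z) \<le> 0" if "z \<in> sphere 0 1 - free_arcs i" for z using fixed_arc_bounds(1)[OF i that] by simp
  have n: "\<exists>t0 \<delta>. z = cis t0 \<and> \<delta> > 0 \<and> (\<forall>t. \<bar>t - t0\<bar> < \<delta> \<longrightarrow> cis t \<in> slit_plane \<theta> \<and> Im (- F i (cis t)) = Im (- F i z))"
    if "z \<in> free_arcs i" for z using neumann[OF that] by (simp only: uminus_complex.sel neg_equal_iff_equal)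
  show "0 \<le> Re (F i z)" if "z \<in> cball 0 1"
    using mixed_boundary_max(1)[OF slit_plane_facts hol co nc d n that] by (simp only: uminus_complex.sel neg_le_0_iff_le)
  show "0 < Re (F i z)" if "z \<in> ball 0 1 \<union> free_arcs i"
    using mixed_boundary_max(2)[OF slit_plane_facts hol co nc d n that] by (simp only: uminus_complex.sel neg_less_0_iff_less)
qed

lemma sphere_height:
  assumes "z \<in> sphere 0 1"
  shows "0 \<le> Re (F 3 z)" "Re (F 3 z) \<le> h"
proof -
  obtain j t where j: "j < 5" "\<theta> j \<le> t" "t < \<theta> (Suc j)" "z = cis t" by (rule sphere_arcs[OF fm assms])
  have "0 \<le> coord 3 t \<and> coord 3 t \<le> h"
    by (rule arc_cases[OF j(1-3)])
       (use height_B[of t] height_A[of t] height_C[of t] top_coords(1)[of t] bottom_coords(1)[of t] c_pos c_less_h in simp_all)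
  then show "0 \<le> Re (F 3 z)" "Re (F 3 z) \<le> h" by (simp_all add: coord_def j(4))
qed

lemma vertical_bounds:
  assumes "z \<in> cball 0 1"
  shows "0 \<le> Re (F 3 z)" "Re (F 3 z) \<le> h"
proof -
  have hol: "F 3 holomorphic_on interior (cball 0 1)"
    using holomorphic_on_subset[OF holomorphic_F ball_subset_slit_plane] by simp
  have co: "continuous_on (closure (cball 0 1)) (F 3)" using cont by simp
  have bd: "bounded (cball (0::complex) 1)" by simp
  show "Re (F 3 z) \<le> h"
    by (rule maximum_real_frontier[OF hol co bd _ assms]) (rule sphere_height, simp)
  have "Re (- F 3 z) \<le> 0"
  proof (rule maximum_real_frontier[OF holomorphic_on_minus[OF hol] continuous_on_minus[OF co] bd _ assms])
    show "Re (- F 3 w) \<le> 0" if "w \<in> frontier (cball 0 1)" for w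
      using sphere_height(1)[of w] that by simp
  qed
  then show "0 \<le> Re (F 3 z)" by simp
qed

lemma in_box: "z \<in> cball 0 1 \<Longrightarrow> re_vec F z \<in> unit_base_box h"
  unfolding unit_base_box_def mem_box_cart forall_3
  using horizontal_lower(1)[of 1 z] horizontal_lower(1)[of 2 z] horizontal_upper(1)[of 1 z] horizontal_upper(1)[of 2 z] vertical_bounds[of z]
  by (simp add: box_corner_def vector_3)


subsection \<open>The boundary is embedded\<close>

lemma free_arc_C: "\<theta> 4 < t \<Longrightarrow> t < \<theta> 5 \<Longrightarrow> 0 < coord 1 t \<and> coord 1 t < 1"
proof -
  assume t: "\<theta> 4 < t" "t < \<theta> 5"
  have "cis t \<in> free_arcs 1"
    unfolding free_arcs_def by (rule CollectI, rule exI[of _ 4], rule exI[of _ t]) (use t in \<open>simp add: wall_axis_def\<close>)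
  then show ?thesis unfolding coord_def using horizontal_lower(2)[of 1 "cis t"] horizontal_upper(2)[of 1 "cis t"] by simp
qed

lemma free_arc_B: "\<theta> 0 < t \<Longrightarrow> t < \<theta> 1 \<Longrightarrow> 0 < coord 2 t \<and> coord 2 t < 1"
proof -
  assume t: "\<theta> 0 < t" "t < \<theta> 1"
  have "cis t \<in> free_arcs 2"
    unfolding free_arcs_def by (rule CollectI, rule exI[of _ 0], rule exI[of _ t]) (use t in \<open>simp add: wall_axis_def\<close>)
  then show ?thesis unfolding coord_def using horizontal_lower(2)[of 2 "cis t"] horizontal_upper(2)[of 2 "cis t"] by simp
qed

lemma free_arc_A: "i0 = 2 \<Longrightarrow> \<theta> 2 < t \<Longrightarrow> t < \<theta> 3 \<Longrightarrow> coord 1 t < 1"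
proof -
  assume i0: "i0 = 2" and t: "\<theta> 2 < t" "t < \<theta> 3"
  have "cis t \<in> free_arcs 1"
    unfolding free_arcs_def by (rule CollectI, rule exI[of _ 2], rule exI[of _ t]) (use t i0 in \<open>simp add: wall_axis_def\<close>)
  then show ?thesis unfolding coord_def using horizontal_upper(2)[of 1 "cis t"] by simp
qed

text \<open>Properties of the coordinates that tell the five arcs apart.  Each arc contains its initial mark
  only, which is why some inequalities are strict.  The strict ones on the open wall edges come from the
  maximum principle.\<close>

lemma arc_signature:
  assumes "j < 5" "\<theta> j \<le> t" "t < \<theta> (Suc j)"
  shows "j = 0 \<Longrightarrow> c \<le> coord 3 t \<and> coord 3 t < h \<and> coord 1 t = 1 \<and> 0 < coord 2 t"
    "j = 1 \<Longrightarrow> coord 3 t = h \<and> 0 < coord 2 t"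
    "j = 2 \<Longrightarrow> 0 < coord 3 t \<and> coord i0 t = 0 \<and> (coord 3 t = h \<longrightarrow> coord 2 t = 0)"
    "j = 3 \<Longrightarrow> coord 3 t = 0 \<and> coord 2 t < 1"
    "j = 4 \<Longrightarrow> 0 \<le> coord 3 t \<and> coord 3 t < c \<and> coord 2 t = 1 \<and> (0 < coord 3 t \<longrightarrow> 0 < coord 1 t)"
proof -
  show "c \<le> coord 3 t \<and> coord 3 t < h \<and> coord 1 t = 1 \<and> 0 < coord 2 t" if "j = 0"
  proof -
    have t: "\<theta> 0 \<le> t" "t < \<theta> 1" using assms that by simp_all
    have "coord 3 t < h" using rise_B[of t "\<theta> 1"] t by (simp add: vertex_simps)
    moreover have "0 < coord 2 t" using free_arc_B[of t] t by (cases "t = \<theta> 0") (simp_all add: vertex_simps)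
    ultimately show ?thesis using height_B[of t] wall_B[of t] t by simp
  qed
  show "coord 3 t = h \<and> 0 < coord 2 t" if "j = 1"
  proof -
    have t: "\<theta> 1 \<le> t" "t < \<theta> 2" using assms that by (simp_all add: numeral_2_eq_2)
    show ?thesis using top_decreasing[of t "\<theta> 2"] top_coords(1)[of t] t by (simp add: vertex_simps)
  qed
  show "0 < coord 3 t \<and> coord i0 t = 0 \<and> (coord 3 t = h \<longrightarrow> coord 2 t = 0)" if "j = 2"
  proof -
    have t: "\<theta> 2 \<le> t" "t < \<theta> 3" using assms that by simp_all
    have "0 < coord 3 t" using fall_A[of t "\<theta> 3"] t by (simp add: vertex_simps)
    moreover have "coord 2 t = 0" if h: "coord 3 t = h"
    proof -
      have "\<theta> 2 < t \<Longrightarrow> coord 3 t < h" using fall_A[of "\<theta> 2" t] t by (simp add: vertex_simps)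
      then have "t = \<theta> 2" using t h by force
      then show ?thesis by (simp add: vertex_simps)
    qed
    ultimately show ?thesis using wall_A[of t] t by simp
  qed
  show "coord 3 t = 0 \<and> coord 2 t < 1" if "j = 3"
  proof -
    have t: "\<theta> 3 \<le> t" "t < \<theta> 4" using assms that by simp_all
    show ?thesis using bottom_increasing[of t "\<theta> 4"] bottom_coords(1)[of t] t by (simp add: vertex_simps)
  qed
  show "0 \<le> coord 3 t \<and> coord 3 t < c \<and> coord 2 t = 1 \<and> (0 < coord 3 t \<longrightarrow> 0 < coord 1 t)" if "j = 4"
  proof -
    have t: "\<theta> 4 \<le> t" "t < \<theta> 5" using assms that by simp_all
    have "coord 3 t < c" using rise_C[of t "\<theta> 5"] t by (simp add: vertex_simps)
    moreover have "0 < coord 1 t" if "0 < coord 3 t"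
    proof -
      have "t \<noteq> \<theta> 4" using that by (auto simp: vertex_simps)
      then show ?thesis using free_arc_C[of t] t by simp
    qed
    ultimately show ?thesis using height_C[of t] wall_C[of t] t by simp
  qed
qed

lemma arcs_disjoint:
  assumes "j < 5" "\<theta> j \<le> s" "s < \<theta> (Suc j)" "k < 5" "\<theta> k \<le> t" "t < \<theta> (Suc k)" and eq: "\<And>i. coord i s = coord i t"
  shows "\<not> j < k"
proof
  assume "j < k"
  note S = arc_signature[OF assms(1-3), unfolded eq] and T = arc_signature[OF assms(4-6)]
  note k2 = kind c_pos c_less_h
  consider "j = 0" "k = 1" | "j = 0" "k = 2" | "j = 0" "k = 3" | "j = 0" "k = 4" | "j = 1" "k = 2" | "j = 1" "k = 3" | "j = 1" "k = 4"
    | "j = 2" "k = 3" | "j = 2" "k = 4" | "j = 3" "k = 4"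
  proof -
    have "j = 0 \<and> k = 1 \<or> j = 0 \<and> k = 2 \<or> j = 0 \<and> k = 3 \<or> j = 0 \<and> k = 4 \<or> j = 1 \<and> k = 2 \<or> j = 1 \<and> k = 3
        \<or> j = 1 \<and> k = 4 \<or> j = 2 \<and> k = 3 \<or> j = 2 \<and> k = 4 \<or> j = 3 \<and> k = 4"
      using \<open>j < k\<close> \<open>k < 5\<close> by presburger
    then show thesis using that by blast
  qed
  then show False
  proof cases
    case 1 then show False using S(1) T(2) by simp
  next
    case 2 then show False using S(1) T(3) kind by auto
  next
    case 3 then show False using S(1) T(4) c_pos by simp
  next
    case 4 then show False using S(1) T(5) by simp
  next
    case 5 then show False using S(2) T(3) by simp
  next
    case 6 then show False using S(2) T(4) c_pos c_less_h by simp
  next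
    case 7 then show False using S(2) T(5) c_less_h by simp
  next
    case 8 then show False using S(3) T(4) by simp
  next
    case 9 then show False using S(3) T(5) kind by auto
  next
    case 10 then show False using S(4) T(5) by simp
  qed
qed

lemma arc_injective:
  assumes "j < 5" "\<theta> j \<le> s" "s < t" "t < \<theta> (Suc j)" and eq: "\<And>i. coord i s = coord i t"
  shows False
proof (rule arc_cases[OF assms(1,2) less_trans[OF assms(3,4)]])
  assume "j = 0" "\<theta> 0 \<le> s" then show False using rise_B[of s t] assms by simp
next
  assume "j = 1" "\<theta> 1 \<le> s" then show False using top_decreasing[of s t] assms by (simp add: numeral_2_eq_2)
next
  assume "j = 2" "\<theta> 2 \<le> s" then show False using fall_A[of s t] assms by simp
next
  assume "j = 3" "\<theta> 3 \<le> s" then show False using bottom_increasing[of s t] assms by simp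
next
  assume "j = 4" "\<theta> 4 \<le> s" then show False using rise_C[of s t] assms by simp
qed

lemma boundary_embedded: "inj_on (re_vec F) (sphere 0 1)"
proof (rule inj_onI)
  fix z w assume z: "z \<in> sphere 0 1" and w: "w \<in> sphere 0 1" and eq: "re_vec F z = re_vec F w"
  obtain j s where j: "j < 5" "\<theta> j \<le> s" "s < \<theta> (Suc j)" "z = cis s" by (rule sphere_arcs[OF fm z])
  obtain k t where k: "k < 5" "\<theta> k \<le> t" "t < \<theta> (Suc k)" "w = cis t" by (rule sphere_arcs[OF fm w])
  have E: "coord i s = coord i t" for i using arg_cong[OF eq, of "\<lambda>x. x $ i"] unfolding j(4) k(4) re_vec_coord .
  have "j = k" using arcs_disjoint[OF j(1-3) k(1-3) E] arcs_disjoint[OF k(1-3) j(1-3) E[symmetric]] by simp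
  have "s = t"
  proof (rule linorder_cases[of s t])
    assume "s < t" then show ?thesis using arc_injective[OF j(1,2) _ _ E] k(3) \<open>j = k\<close> by blast
  next
    assume "t < s" then show ?thesis using arc_injective[OF k(1,2) _ _ E[symmetric]] j(3) \<open>j = k\<close> by blast
  qed
  then show "z = w" using j(4) k(4) by simp
qed

subsection \<open>The pentagon\<close>

lemma re_vec_continuous: "continuous_on (cball 0 1) (re_vec F)"
  unfolding re_vec_def [abs_def] by (intro continuous_on_vec_lambda continuous_intros cont)

lemma top_image: "re_vec F ` edge_arc \<theta> 1 = closed_segment (vector [1, 1, h]) (vector [0, 0, h])"
proof -
  have "(\<lambda>t. re_vec F (cis t)) ` {\<theta> 1..\<theta> 2} = closed_segment (vector [1, 1, h]) (vector [0, 0, h])"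
  proof (rule path_onto_segment[where f = "\<lambda>t. 1 - coord 2 t"])
    show "continuous_on {\<theta> 1..\<theta> 2} (\<lambda>t. 1 - coord 2 t)" by (intro continuous_intros coord_continuous)
    show "0 \<le> 1 - coord 2 t \<and> 1 - coord 2 t \<le> 1" if "t \<in> {\<theta> 1..\<theta> 2}" for t using top_bounds[of t] that by simp
    show "1 - coord 2 (\<theta> 1) = 0 \<and> 1 - coord 2 (\<theta> 2) = 1 \<or> 1 - coord 2 (\<theta> 1) = 1 \<and> 1 - coord 2 (\<theta> 2) = 0" by (simp add: vertex_simps)
    show "re_vec F (cis t) = (1 - (1 - coord 2 t)) *\<^sub>R vector [1, 1, h] + (1 - coord 2 t) *\<^sub>R vector [0, 0, h]" if "t \<in> {\<theta> 1..\<theta> 2}" for t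
      using top_coords[of t] that unfolding vec_eq_iff forall_3 re_vec_coord by (simp add: vector_3 algebra_simps)
  qed (use mark_order in simp)
  then show ?thesis by (simp add: edge_arc_def image_image numeral_2_eq_2)
qed

lemma bottom_image: "re_vec F ` edge_arc \<theta> 3 = closed_segment (vector [a, 0, 0]) (vector [1 - a, 1, 0])"
proof -
  have "(\<lambda>t. re_vec F (cis t)) ` {\<theta> 3..\<theta> 4} = closed_segment (vector [a, 0, 0]) (vector [1 - a, 1, 0])"
  proof (rule path_onto_segment[where f = "coord 2"])
    show "0 \<le> coord 2 t \<and> coord 2 t \<le> 1" if "t \<in> {\<theta> 3..\<theta> 4}" for t using bottom_bounds[of t] that by simp
    show "coord 2 (\<theta> 3) = 0 \<and> coord 2 (\<theta> 4) = 1 \<or> coord 2 (\<theta> 3) = 1 \<and> coord 2 (\<theta> 4) = 0" by (simp add: vertex_simps)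
    show "re_vec F (cis t) = (1 - coord 2 t) *\<^sub>R vector [a, 0, 0] + coord 2 t *\<^sub>R vector [1 - a, 1, 0]" if "t \<in> {\<theta> 3..\<theta> 4}" for t
      using bottom_coords[of t] that unfolding vec_eq_iff forall_3 re_vec_coord by (simp add: vector_3 algebra_simps)
  qed (use mark_order coord_continuous in simp_all)
  then show ?thesis by (simp add: edge_arc_def image_image)
qed

text \<open>Along a wall edge the radial derivative of the surface points along the axis of the wall: the
  conjugate coordinates in the two other directions are constant there, so these components of the
  radial derivative vanish.  It does not vanish itself, since the data are null and the height has nonzero
  differential; and the normal is orthogonal to it.\<close>

lemma wall_normal:
  assumes j: "j = 0 \<or> j = 2 \<or> j = 4" and t: "\<theta> j < t" "t < \<theta> (Suc j)"
  shows "unit_normal (re_vec F) (cis t) \<bullet> axis (wall_axis i0 j) 1 = 0"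
proof -
  define m where "m = wall_axis i0 j"
  define v where "v i = \<Phi> i (cis t) * cis t" for i
  have U: "cis t \<in> slit_plane \<theta>" by (rule arc_in_slit_plane) (use j t in auto)
  have vv: "vel i t = \<i> * v i" for i by (simp add: velocity v_def)
  have m0: "Im (v m) = 0" using walls(1)[OF j t] unfolding vv m_def by simp
  have other: "Re (v i) = 0" if "i \<noteq> m" for i using walls(2)[OF j t, of i] that unfolding vv m_def by simp
  have m3: "m \<noteq> 3" using kind by (auto simp: m_def wall_axis_def)
  have "(v 1)\<^sup>2 + (v 2)\<^sup>2 + (v 3)\<^sup>2 = ((\<Phi> 1 (cis t))\<^sup>2 + (\<Phi> 2 (cis t))\<^sup>2 + (\<Phi> 3 (cis t))\<^sup>2) * (cis t)\<^sup>2"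
    by (simp add: v_def power_mult_distrib algebra_simps)
  then have sum: "Re ((v 1)\<^sup>2) + Re ((v 2)\<^sup>2) + Re ((v 3)\<^sup>2) = 0" unfolding null[OF U] by (metis mult_zero_left plus_complex.sel(1) zero_complex.sel(1))
  have "v 3 \<noteq> 0" using regular[OF U] by (simp add: v_def)
  then have "Im (v 3) \<noteq> 0" using other[of 3] m3 by (simp add: complex_eq_iff)
  have vm: "Re (v m) \<noteq> 0"
  proof
    assume "Re (v m) = 0"
    then have "Re (v i) = 0" for i using other[of i] by (cases "i = m") auto
    then have "(Im (v 1))\<^sup>2 + (Im (v 2))\<^sup>2 + (Im (v 3))\<^sup>2 = 0" using sum by (simp add: power2_eq_square)
    then show False using \<open>Im (v 3) \<noteq> 0\<close> by (simp add: add_nonneg_eq_0_iff)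
  qed
  have "re_vec (\<lambda>i w. \<Phi> i w * cis t) (cis t) = Re (v m) *\<^sub>R axis m 1"
  proof (unfold vec_eq_iff, rule allI)
    fix i show "re_vec (\<lambda>i w. \<Phi> i w * cis t) (cis t) $ i = (Re (v m) *\<^sub>R axis m 1) $ i"
      unfolding re_vec_nth v_def[symmetric] using other[of i] by (cases "i = m") (simp_all add: axis_def)
  qed
  then have "Re (v m) * (unit_normal (re_vec F) (cis t) \<bullet> axis m 1) = 0"
    using normal_orthogonal[OF U, of "cis t"] by simp
  then show ?thesis using vm unfolding m_def by simp
qed

lemma edge_arc_interior:
  assumes "z \<in> edge_arc \<theta> k - marks \<theta>" "k < 5"
  obtains t where "\<theta> k < t" "t < \<theta> (Suc k)" "z = cis t"
proof -
  obtain t where t: "\<theta> k \<le> t" "t \<le> \<theta> (Suc k)" "z = cis t" using assms(1) by (auto simp: edge_arc_def)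
  have "cis (\<theta> i) \<in> marks \<theta>" if "i \<le> 5" for i
  proof (cases "i = 5")
    case True
    then show ?thesis unfolding True cis_last marks_def by simp
  next
    case False
    then show ?thesis unfolding marks_def using that by simp
  qed
  then have "t \<noteq> \<theta> k" "t \<noteq> \<theta> (Suc k)" using assms t(3) by auto
  then have "\<theta> k < t" "t < \<theta> (Suc k)" using t by linarith+
  then show thesis using that t(3) by blast
qed

theorem minimal_pentagon: "minimal_pentagon (re_vec F) \<theta>"
  unfolding minimal_pentagon_def
proof (intro conjI)
  show "\<exists>U. open U \<and> cball 0 1 - marks \<theta> \<subseteq> U \<and> C2_surface_on U (re_vec F)"
    using open_U cball_minus_marks_subset_slit_plane C2_surface by blast
  show "\<forall>z\<in>cball 0 1 - marks \<theta>. regular_at (re_vec F) z \<and> mean_curvature (re_vec F) z = 0"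
    using regular_at mean_curvature_zero cball_minus_marks_subset_slit_plane by blast
qed (rule fm re_vec_continuous boundary_embedded)+

theorem pentagon_in_box:
  "pentagon_in_box h (re_vec F) \<theta> (vector [1, 1, h]) (vector [0, 0, h]) (vector [a, 0, 0]) (vector [1 - a, 1, 0])"
  unfolding pentagon_in_box_def
proof (intro conjI)
  show "h > 0" using c_pos c_less_h by simp
  show "minimal_pentagon (re_vec F) \<theta>" by (rule minimal_pentagon)
  show "re_vec F ` cball 0 1 \<subseteq> unit_base_box h" using in_box by blast
  show "re_vec F ` marks \<theta> \<subseteq> box_edge_points h"
  proof
    fix x assume "x \<in> re_vec F ` marks \<theta>"
    then obtain k where k: "k < 5" "x = re_vec F (cis (\<theta> k))" by (auto simp: marks_def)
    have "x \<in> unit_base_box h" unfolding k(2) by (rule in_box) simp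
    moreover have "x $ 1 \<in> {0, 1} \<and> x $ 2 \<in> {0, 1}"
      unfolding k(2) re_vec_coord using k(1) a_01 unfolding less_5_cases by (elim disjE) (simp_all add: vertex_simps)
    then have "x $ 1 \<in> {0, box_corner h $ 1} \<and> x $ 2 \<in> {0, box_corner h $ 2}" by (simp add: box_corner_def vector_3)
    moreover have "(1::3) \<noteq> 2" by simp
    ultimately show "x \<in> box_edge_points h" unfolding box_edge_points_def by blast
  qed
  show "diagonal_ends h (vector [1, 1, h]) (vector [0, 0, h])" "diagonal_ends 0 (vector [a, 0, 0]) (vector [1 - a, 1, 0])"
    using a_01 by (auto simp: diagonal_ends_def vector_3)
  have wall: "\<exists>i\<in>{1, 2}. \<exists>c\<in>{0, 1}. re_vec F ` edge_arc \<theta> k \<subseteq> vertical_face h i c \<and> (\<forall>z\<in>edge_arc \<theta> k - marks \<theta>. unit_normal (re_vec F) z \<bullet> axis i 1 = 0)"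
    if k: "k < 5" "k \<noteq> 1" "k \<noteq> 3" for k
  proof (rule bexI[of _ "wall_axis i0 k"], rule bexI[of _ "if k = 2 then 0 else 1"], rule conjI)
    have j: "k = 0 \<or> k = 2 \<or> k = 4" using k by linarith
    show "re_vec F ` edge_arc \<theta> k \<subseteq> vertical_face h (wall_axis i0 k) (if k = 2 then 0 else 1)"
    proof
      fix x assume "x \<in> re_vec F ` edge_arc \<theta> k"
      then obtain t where t: "\<theta> k \<le> t" "t \<le> \<theta> (Suc k)" "x = re_vec F (cis t)" unfolding edge_arc_def by auto
      have "x \<in> unit_base_box h" unfolding t(3) by (rule in_box) simp
      moreover have "x $ wall_axis i0 k = (if k = 2 then 0 else 1)" unfolding t(3) re_vec_coord by (rule wall_coord[OF j t(1,2)])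
      ultimately show "x \<in> vertical_face h (wall_axis i0 k) (if k = 2 then 0 else 1)" unfolding vertical_face_def by blast
    qed
    show "\<forall>z\<in>edge_arc \<theta> k - marks \<theta>. unit_normal (re_vec F) z \<bullet> axis (wall_axis i0 k) 1 = 0"
    proof
      fix z assume "z \<in> edge_arc \<theta> k - marks \<theta>"
      then obtain t where "\<theta> k < t" "t < \<theta> (Suc k)" "z = cis t" using k(1) by (rule edge_arc_interior)
      then show "unit_normal (re_vec F) z \<bullet> axis (wall_axis i0 k) 1 = 0" using wall_normal[OF j] by simp
    qed
    show "(if k = 2 then 0 else 1) \<in> {0::real, 1}" by simp
    show "wall_axis i0 k \<in> {1, 2}" using kind by (auto simp: wall_axis_def)
  qed
  show "\<exists>m<5. \<exists>n<5. m \<noteq> n \<and> re_vec F ` edge_arc \<theta> m = closed_segment (vector [1, 1, h]) (vector [0, 0, h]) \<and>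
      re_vec F ` edge_arc \<theta> n = closed_segment (vector [a, 0, 0]) (vector [1 - a, 1, 0]) \<and>
      (\<forall>k<5. k \<noteq> m \<and> k \<noteq> n \<longrightarrow> (\<exists>i\<in>{1, 2}. \<exists>c\<in>{0, 1}. re_vec F ` edge_arc \<theta> k \<subseteq> vertical_face h i c \<and>
        (\<forall>z\<in>edge_arc \<theta> k - marks \<theta>. unit_normal (re_vec F) z \<bullet> axis i 1 = 0)))"
    by (rule exI[of _ 1], rule conjI, simp, rule exI[of _ 3]) (use wall top_image bottom_image in simp)
qed

text \<open>By the strict maximum principle the surface touches the wall \<open>x\<^sub>1 = 1\<close> in no interior point and in no free arc.
  Thus the edge \<open>0\<close> can be recovered from the surface as a set.\<close>

lemma front_wall:
  "re_vec F ` cball 0 1 \<inter> {x. x $ 1 = 1 \<and> x $ 3 > 0} = (\<lambda>t. re_vec F (cis t)) ` {\<theta> 0..\<theta> 1}"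
proof
  show "(\<lambda>t. re_vec F (cis t)) ` {\<theta> 0..\<theta> 1} \<subseteq> re_vec F ` cball 0 1 \<inter> {x. x $ 1 = 1 \<and> x $ 3 > 0}"
  proof (rule image_subsetI)
    fix t assume "t \<in> {\<theta> 0..\<theta> 1}"
    then have "coord 1 t = 1" "coord 3 t > 0" using wall_B[of t] height_B[of t] c_pos by simp_all
    then show "re_vec F (cis t) \<in> re_vec F ` cball 0 1 \<inter> {x. x $ 1 = 1 \<and> x $ 3 > 0}" by (simp add: coord_def)
  qed
  show "re_vec F ` cball 0 1 \<inter> {x. x $ 1 = 1 \<and> x $ 3 > 0} \<subseteq> (\<lambda>t. re_vec F (cis t)) ` {\<theta> 0..\<theta> 1}"
  proof
    fix x assume "x \<in> re_vec F ` cball 0 1 \<inter> {x. x $ 1 = 1 \<and> x $ 3 > 0}"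
    then obtain z where z: "z \<in> cball 0 1" "x = re_vec F z" "Re (F 1 z) = 1" "Re (F 3 z) > 0" by auto
    have "z \<notin> ball 0 1" using horizontal_upper(2)[of 1 z] z(3) by auto
    then have "z \<in> sphere 0 1" using z(1) by auto
    then obtain j t where j: "j < 5" "\<theta> j \<le> t" "t < \<theta> (Suc j)" "z = cis t" by (rule sphere_arcs[OF fm])
    have v: "coord 1 t = 1" "coord 3 t > 0" using z(3,4) by (simp_all add: coord_def j(4))
    have "\<exists>s\<in>{\<theta> 0..\<theta> 1}. z = cis s"
    proof (rule arc_cases[OF j(1-3)])
      assume "\<theta> 0 \<le> t" "t < \<theta> 1" then show ?thesis using j(4) by auto
    next
      assume t: "\<theta> 1 \<le> t" "t < \<theta> 2"
      have "\<theta> 1 < t \<Longrightarrow> coord 1 t < 1" using top_decreasing[of "\<theta> 1" t] top_coords(2)[of t] t by (simp add: vertex_simps)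
      then have "t = \<theta> 1" using t v by force
      then show ?thesis using j(4) mark_order by auto
    next
      assume t: "\<theta> 2 \<le> t" "t < \<theta> 3"
      have "i0 \<noteq> 1" using wall_A[of t] t v by auto
      then have "i0 = 2" using kind by blast
      then have "t = \<theta> 2" using free_arc_A[of t] t v by (cases "t = \<theta> 2") auto
      then show ?thesis using v by (simp add: vertex_simps)
    next
      assume "\<theta> 3 \<le> t" "t < \<theta> 4" then show ?thesis using bottom_coords(1)[of t] v by simp
    next
      assume t: "\<theta> 4 \<le> t" "t < \<theta> 5"
      then show ?thesis using free_arc_C[of t] v by (cases "t = \<theta> 4") (simp_all add: vertex_simps)
    qed
    then show "x \<in> (\<lambda>t. re_vec F (cis t)) ` {\<theta> 0..\<theta> 1}" using z(2) by blast
  qed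
qed

end

section \<open>The null curve of a solved period problem\<close>

text \<open>The weight between the two horizontal forms that makes both ends of the edge \<open>0\<close> lie on the same vertical line.\<close>

definition spread :: "(nat \<Rightarrow> real) \<Rightarrow> (nat \<Rightarrow> real) \<Rightarrow> real \<Rightarrow> real \<Rightarrow> real" where
  "spread e e' p q = sqrt (edge_len e' 0 p q / edge_len e 0 p q)"

text \<open>The scale for which the top diagonal spans the unit square.\<close>

definition dilation :: "(nat \<Rightarrow> real) \<Rightarrow> (nat \<Rightarrow> real) \<Rightarrow> real \<Rightarrow> real \<Rightarrow> real" where
  "dilation e e' p q = 2 * sqrt 2 / (spread e e' p q * edge_len e 1 p q + edge_len e' 1 p q / spread e e' p q)"

definition box_height :: "(nat \<Rightarrow> real) \<Rightarrow> (nat \<Rightarrow> real) \<Rightarrow> real \<Rightarrow> real \<Rightarrow> real" where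
  "box_height e e' p q = dilation e e' p q * (edge_len e_height 0 p q + edge_len e_height 4 p q)"

definition shift :: "(nat \<Rightarrow> real) \<Rightarrow> real \<Rightarrow> real \<Rightarrow> complex \<Rightarrow> complex" where
  "shift e p q z = pprim e p q z - pprim e p q (cis (pi / 2))"

text \<open>The Weierstrass representation with \<open>f f' = g\<^sup>2\<close>: the Gauss map is \<open>f / g\<close> up to a constant and \<open>g\<close> is the
  height differential.\<close>

definition vec_of_forms :: "real \<Rightarrow> real \<Rightarrow> complex \<Rightarrow> complex \<Rightarrow> complex \<Rightarrow> 3 \<Rightarrow> complex" where
  "vec_of_forms \<kappa> \<rho> f f' g i = (if i = 1 then complex_of_real (\<kappa> / (2 * \<rho>)) * f' - complex_of_real (\<kappa> * \<rho> / 2) * f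
     else if i = 2 then \<i> * (complex_of_real (\<kappa> * \<rho> / 2) * f + complex_of_real (\<kappa> / (2 * \<rho>)) * f') else complex_of_real \<kappa> * g)"

definition null_curve :: "(nat \<Rightarrow> real) \<Rightarrow> (nat \<Rightarrow> real) \<Rightarrow> real \<Rightarrow> real \<Rightarrow> 3 \<Rightarrow> complex \<Rightarrow> complex" where
  "null_curve e e' p q i z = of_real (vector [1, 1, box_height e e' p q] $ i) +
     vec_of_forms (dilation e e' p q) (spread e e' p q) (shift e p q z) (shift e' p q z) (shift e_height p q z) i"

definition null_deriv :: "(nat \<Rightarrow> real) \<Rightarrow> (nat \<Rightarrow> real) \<Rightarrow> real \<Rightarrow> real \<Rightarrow> 3 \<Rightarrow> complex \<Rightarrow> complex" where
  "null_deriv e e' p q i z = vec_of_forms (dilation e e' p q) (spread e e' p q) (sc_fun (pscale p q) (pmark p q) e z)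
     (sc_fun (pscale p q) (pmark p q) e' z) (sc_fun (pscale p q) (pmark p q) e_height z) i"

lemma vec_of_forms_mult: "c * vec_of_forms \<kappa> \<rho> f f' g i = vec_of_forms \<kappa> \<rho> (c * f) (c * f') (c * g) i"
  by (simp add: vec_of_forms_def algebra_simps del: of_real_divide of_real_mult)

lemma vec_of_forms_diff:
  "vec_of_forms \<kappa> \<rho> f f' g i - vec_of_forms \<kappa> \<rho> k k' l i = vec_of_forms \<kappa> \<rho> (f - k) (f' - k') (g - l) i"
  by (simp add: vec_of_forms_def algebra_simps del: of_real_divide of_real_mult)

lemma vec_of_forms_null:
  assumes "\<rho> \<noteq> 0" "f * f' = g\<^sup>2"
  shows "(vec_of_forms \<kappa> \<rho> f f' g 1)\<^sup>2 + (vec_of_forms \<kappa> \<rho> f f' g 2)\<^sup>2 + (vec_of_forms \<kappa> \<rho> f f' g 3)\<^sup>2 = 0"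
proof -
  define x where "x = complex_of_real (\<kappa> / (2 * \<rho>)) * f'"
  define y where "y = complex_of_real (\<kappa> * \<rho> / 2) * f"
  have v: "vec_of_forms \<kappa> \<rho> f f' g 1 = x - y" "vec_of_forms \<kappa> \<rho> f f' g 2 = \<i> * (y + x)" "vec_of_forms \<kappa> \<rho> f f' g 3 = \<kappa> * g"
    by (simp_all add: vec_of_forms_def x_def y_def)
  have "4 * (x * y) = (of_real \<kappa>)\<^sup>2 * (f * f')"
    using assms(1) by (simp add: x_def y_def power2_eq_square field_simps)
  then have xy: "4 * (x * y) = (of_real \<kappa> * g)\<^sup>2" by (simp add: assms(2) power_mult_distrib)
  have "(x - y)\<^sup>2 + (\<i> * (y + x))\<^sup>2 = - (4 * (x * y))"
    by (simp add: power2_eq_square algebra_simps)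
  then show ?thesis unfolding v xy by simp
qed

lemma distinct_3: "(2::3) \<noteq> 1" "(3::3) \<noteq> 1" "(3::3) \<noteq> 2"
  by simp_all

lemma vec_of_forms_cases:
  assumes "P (\<lambda>z. complex_of_real (\<kappa> / (2 * \<rho>)) * f' z - complex_of_real (\<kappa> * \<rho> / 2) * f z)"
    "P (\<lambda>z. \<i> * (complex_of_real (\<kappa> * \<rho> / 2) * f z + complex_of_real (\<kappa> / (2 * \<rho>)) * f' z))"
    "P (\<lambda>z. complex_of_real \<kappa> * g z)"
  shows "P (\<lambda>z. vec_of_forms \<kappa> \<rho> (f z) (f' z) (g z) i)"
  using exhaust_3_cases[of i] unfolding vec_of_forms_def
  by (elim disjE) (simp_all only: refl distinct_3 if_True if_False not_False_eq_True assms)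

lemma continuous_on_vec_of_forms:
  assumes "continuous_on S f" "continuous_on S f'" "continuous_on S g"
  shows "continuous_on S (\<lambda>z. vec_of_forms \<kappa> \<rho> (f z) (f' z) (g z) i)"
  by (rule vec_of_forms_cases)
     (intro continuous_on_diff continuous_on_add continuous_on_mult continuous_on_const assms)+

lemma vec_of_forms_derivative:
  assumes "(f has_field_derivative D) (at z)" "(f' has_field_derivative D') (at z)" "(g has_field_derivative E) (at z)"
  shows "((\<lambda>z. vec_of_forms \<kappa> \<rho> (f z) (f' z) (g z) i) has_field_derivative vec_of_forms \<kappa> \<rho> D D' E i) (at z)"
proof -
  have "((\<lambda>z. complex_of_real (\<kappa> / (2 * \<rho>)) * f' z - complex_of_real (\<kappa> * \<rho> / 2) * f z)
      has_field_derivative complex_of_real (\<kappa> / (2 * \<rho>)) * D' - complex_of_real (\<kappa> * \<rho> / 2) * D) (at z)"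
    "((\<lambda>z. \<i> * (complex_of_real (\<kappa> * \<rho> / 2) * f z + complex_of_real (\<kappa> / (2 * \<rho>)) * f' z))
      has_field_derivative \<i> * (complex_of_real (\<kappa> * \<rho> / 2) * D + complex_of_real (\<kappa> / (2 * \<rho>)) * D')) (at z)"
    "((\<lambda>z. complex_of_real \<kappa> * g z) has_field_derivative complex_of_real \<kappa> * E) (at z)"
    by (intro DERIV_diff DERIV_add DERIV_cmult assms)+
  note d = this
  show ?thesis
    using exhaust_3_cases[of i] unfolding vec_of_forms_def
    by (elim disjE) (simp_all only: refl distinct_3 if_True if_False not_False_eq_True d)
qed

text \<open>After \<open>spread\<close> and \<open>dilation\<close> have been chosen, one equation between the edge lengths remains.  It says that
  the bottom diagonal joins two corners of the box.\<close>

locale solved_pentagon =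
  fixes e e' :: "nat \<Rightarrow> real" and p q a :: real and i0 :: 3
  assumes pq: "(p, q) \<in> Params"
    and adm: "admissible e" "admissible e'"
    and halves: "\<And>k. k < 5 \<Longrightarrow> e k + e' k = 2 * e_height k"
    and phase: "arc_phase e 0 = - \<i>" "arc_phase e 1 = (1 + \<i>) / sqrt 2" "arc_phase e 4 = 1"
      "arc_phase e' 0 = \<i>" "arc_phase e' 1 = (- 1 + \<i>) / sqrt 2" "arc_phase e' 4 = 1"
    and end_exponents: "e 0 = 1 / 2" "e 1 = - 3 / 4" "e' 0 = - 1 / 2" "e' 1 = - 1 / 4"
    and solved:
      "i0 = 1 \<and> a = 0 \<and> arc_phase e 2 = \<i> \<and> arc_phase e 3 = (- 1 - \<i>) / sqrt 2 \<and> arc_phase e' 2 = - \<i> \<and> arc_phase e' 3 = (1 - \<i>) / sqrt 2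
         \<and> edge_len e 0 p q * edge_len e' 4 p q = edge_len e' 0 p q * edge_len e 4 p q
       \<or> i0 = 2 \<and> a = 1 \<and> arc_phase e 2 = - 1 \<and> arc_phase e 3 = (1 - \<i>) / sqrt 2 \<and> arc_phase e' 2 = - 1 \<and> arc_phase e' 3 = (- 1 - \<i>) / sqrt 2
         \<and> edge_len e 0 p q * (edge_len e' 2 p q + edge_len e' 4 p q) = edge_len e' 0 p q * (edge_len e 2 p q + edge_len e 4 p q)"
begin

abbreviation "\<rho> \<equiv> spread e e' p q"
abbreviation "\<kappa> \<equiv> dilation e e' p q"
abbreviation "ht \<equiv> box_height e e' p q"
abbreviation "\<theta> \<equiv> pmark p q"
abbreviation "\<nu> \<equiv> pscale p q"
abbreviation "L j \<equiv> edge_len e j p q"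
abbreviation "L' j \<equiv> edge_len e' j p q"
abbreviation "L0 j \<equiv> edge_len e_height j p q"

lemma len_pos: "j < 5 \<Longrightarrow> L j > 0" "j < 5 \<Longrightarrow> L' j > 0" "j < 5 \<Longrightarrow> L0 j > 0"
  by (rule edge_len_pos; use adm pq in simp)+

lemma spread_pos: "\<rho> > 0"
  unfolding spread_def using len_pos[of 0] by simp

lemma dilation_pos: "\<kappa> > 0"
  unfolding dilation_def using len_pos[of 1] spread_pos by (intro divide_pos_pos add_pos_pos mult_pos_pos) simp_all

lemma spread_balance: "\<rho> * L 0 = L' 0 / \<rho>"
proof -
  have "\<rho>\<^sup>2 = L' 0 / L 0" unfolding spread_def using len_pos[of 0] by (intro real_sqrt_pow2) simp
  then have "\<rho> * \<rho> * L 0 = L' 0" using len_pos[of 0] by (simp add: power2_eq_square)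
  then show ?thesis using spread_pos by (simp add: field_simps)
qed

lemma dilation_balance: "(\<kappa> * \<rho> / 2 * L 1 + \<kappa> / (2 * \<rho>) * L' 1) / sqrt 2 = 1"
proof -
  define m where "m = \<rho> * L 1 + L' 1 / \<rho>"
  have "m > 0" unfolding m_def using len_pos[of 1] spread_pos by (intro add_pos_pos mult_pos_pos divide_pos_pos) simp_all
  have "\<kappa> * \<rho> / 2 * L 1 + \<kappa> / (2 * \<rho>) * L' 1 = \<kappa> * m / 2"
    using spread_pos by (simp add: m_def field_simps)
  also have "\<dots> = sqrt 2" using \<open>m > 0\<close> by (simp add: dilation_def m_def[symmetric] del: One_nat_def)
  finally show ?thesis by simp
qed

lemma shift_difference:
  assumes "admissible f" "j < 5"
  shows "shift f p q (cis (\<theta> (Suc j))) - shift f p q (cis (\<theta> j)) = of_real (edge_len f j p q) * arc_phase f j"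
proof -
  interpret sc_data \<nu> \<theta> f by (rule sc_data_pmark[OF assms(1) pq])
  show ?thesis using sc_prim_edge[OF assms(2)] by (simp add: shift_def pprim_def edge_len_def)
qed

lemma curve_difference:
  assumes "j < 5"
  shows "null_curve e e' p q i (cis (\<theta> (Suc j))) - null_curve e e' p q i (cis (\<theta> j))
    = vec_of_forms \<kappa> \<rho> (of_real (L j) * arc_phase e j) (of_real (L' j) * arc_phase e' j) (of_real (L0 j) * arc_phase e_height j) i"
proof -
  have "null_curve e e' p q i (cis (\<theta> (Suc j))) - null_curve e e' p q i (cis (\<theta> j))
    = vec_of_forms \<kappa> \<rho> (shift e p q (cis (\<theta> (Suc j)))) (shift e' p q (cis (\<theta> (Suc j)))) (shift e_height p q (cis (\<theta> (Suc j)))) i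
    - vec_of_forms \<kappa> \<rho> (shift e p q (cis (\<theta> j))) (shift e' p q (cis (\<theta> j))) (shift e_height p q (cis (\<theta> j))) i"
    by (simp add: null_curve_def)
  then show ?thesis unfolding vec_of_forms_diff shift_difference[OF adm(1) assms] shift_difference[OF adm(2) assms]
      shift_difference[OF admissible_exponents(1) assms] .
qed

definition "\<alpha> j = \<kappa> * \<rho> / 2 * L j"
definition "\<beta> j = \<kappa> / (2 * \<rho>) * L' j"
definition "\<gamma> j = \<kappa> * L0 j"

lemma forms_re:
  "Re (vec_of_forms \<kappa> \<rho> (of_real s * u) (of_real s' * u') (of_real r * v) 1) = \<kappa> / (2 * \<rho>) * s' * Re u' - \<kappa> * \<rho> / 2 * s * Re u"
  "Re (vec_of_forms \<kappa> \<rho> (of_real s * u) (of_real s' * u') (of_real r * v) 2) = - (\<kappa> * \<rho> / 2 * s * Im u) - \<kappa> / (2 * \<rho>) * s' * Im u'"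
  "Re (vec_of_forms \<kappa> \<rho> (of_real s * u) (of_real s' * u') (of_real r * v) 3) = \<kappa> * r * Re v"
  "Im (vec_of_forms \<kappa> \<rho> (of_real s * u) (of_real s' * u') (of_real r * v) 1) = \<kappa> / (2 * \<rho>) * s' * Im u' - \<kappa> * \<rho> / 2 * s * Im u"
  "Im (vec_of_forms \<kappa> \<rho> (of_real s * u) (of_real s' * u') (of_real r * v) 2) = \<kappa> * \<rho> / 2 * s * Re u + \<kappa> / (2 * \<rho>) * s' * Re u'"
  "Im (vec_of_forms \<kappa> \<rho> (of_real s * u) (of_real s' * u') (of_real r * v) 3) = \<kappa> * r * Im v"
proof -
  have re: "Re (of_real k * w) = k * Re w" "Im (of_real k * w) = k * Im w" "Re (\<i> * w) = - Im w" "Im (\<i> * w) = Re w" for k and w :: complex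
    by simp_all
  have ne: "(2::3) \<noteq> 1" "(3::3) \<noteq> 1" "(3::3) \<noteq> 2" by simp_all
  show "Re (vec_of_forms \<kappa> \<rho> (of_real s * u) (of_real s' * u') (of_real r * v) 1) = \<kappa> / (2 * \<rho>) * s' * Re u' - \<kappa> * \<rho> / 2 * s * Re u"
    unfolding vec_of_forms_def by (simp only: re if_True minus_complex.sel mult.assoc refl)
  show "Im (vec_of_forms \<kappa> \<rho> (of_real s * u) (of_real s' * u') (of_real r * v) 1) = \<kappa> / (2 * \<rho>) * s' * Im u' - \<kappa> * \<rho> / 2 * s * Im u"
    unfolding vec_of_forms_def by (simp only: re if_True minus_complex.sel mult.assoc refl)
  show "Re (vec_of_forms \<kappa> \<rho> (of_real s * u) (of_real s' * u') (of_real r * v) 2) = - (\<kappa> * \<rho> / 2 * s * Im u) - \<kappa> / (2 * \<rho>) * s' * Im u'"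
    unfolding vec_of_forms_def by (simp only: re if_True if_False ne refl plus_complex.sel mult.assoc minus_add_distrib diff_conv_add_uminus)
  show "Im (vec_of_forms \<kappa> \<rho> (of_real s * u) (of_real s' * u') (of_real r * v) 2) = \<kappa> * \<rho> / 2 * s * Re u + \<kappa> / (2 * \<rho>) * s' * Re u'"
    unfolding vec_of_forms_def by (simp only: re if_True if_False ne refl plus_complex.sel mult.assoc)
  show "Re (vec_of_forms \<kappa> \<rho> (of_real s * u) (of_real s' * u') (of_real r * v) 3) = \<kappa> * r * Re v"
    unfolding vec_of_forms_def by (simp only: re if_False ne refl mult.assoc)
  show "Im (vec_of_forms \<kappa> \<rho> (of_real s * u) (of_real s' * u') (of_real r * v) 3) = \<kappa> * r * Im v"
    unfolding vec_of_forms_def by (simp only: re if_False ne refl mult.assoc)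
qed

definition "X i k = Re (null_curve e e' p q i (cis (\<theta> k)))"

lemma vertex_step:
  assumes "j < 5"
  shows "X 1 (Suc j) - X 1 j = \<beta> j * Re (arc_phase e' j) - \<alpha> j * Re (arc_phase e j)"
    "X 2 (Suc j) - X 2 j = - (\<alpha> j * Im (arc_phase e j)) - \<beta> j * Im (arc_phase e' j)"
    "X 3 (Suc j) - X 3 j = \<gamma> j * Re (arc_phase e_height j)"
  unfolding X_def minus_complex.sel(1)[symmetric] curve_difference[OF assms] forms_re \<alpha>_def \<beta>_def \<gamma>_def by (rule refl)+

lemma marks_closed: "X i 5 = X i 0"
  by (simp add: X_def pmark_def)

lemma start: "X 1 1 = 1" "X 2 1 = 1" "X 3 1 = ht"
  by (simp_all add: X_def null_curve_def shift_def pmark_def vec_of_forms_def vector_3)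

lemma balance: "\<alpha> 0 = \<beta> 0" "(\<alpha> 1 + \<beta> 1) / sqrt 2 = 1" "\<gamma> 2 = \<gamma> 0 + \<gamma> 4" "ht = \<gamma> 0 + \<gamma> 4"
proof -
  have "\<alpha> 0 = \<kappa> / 2 * (\<rho> * L 0)" by (simp add: \<alpha>_def)
  then show "\<alpha> 0 = \<beta> 0" unfolding spread_balance by (simp add: \<beta>_def)
  show "(\<alpha> 1 + \<beta> 1) / sqrt 2 = 1" unfolding \<alpha>_def \<beta>_def by (rule dilation_balance)
  have "L0 0 - L0 2 + L0 4 = 0"
    using arg_cong[OF edge_closed[OF admissible_exponents(1) pq, unfolded phases], of Re] by simp
  then have "L0 2 = L0 0 + L0 4" by simp
  then show "\<gamma> 2 = \<gamma> 0 + \<gamma> 4" by (simp add: \<gamma>_def distrib_left)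
  show "ht = \<gamma> 0 + \<gamma> 4" by (simp add: box_height_def \<gamma>_def distrib_left)
qed

lemma balance_solved:
  "i0 = 1 \<Longrightarrow> \<alpha> 4 = \<beta> 4" "i0 = 2 \<Longrightarrow> \<alpha> 2 + \<alpha> 4 = \<beta> 2 + \<beta> 4"
proof -
  have \<rho>: "\<rho> * \<rho> * L 0 = L' 0" using spread_balance spread_pos by (simp add: field_simps)
  have key: "\<rho> * M = M' / \<rho>" if "L 0 * M' = L' 0 * M" for M M'
  proof -
    have "L 0 * M' = L 0 * (\<rho> * \<rho> * M)" using that by (simp add: \<rho>[symmetric] mult_ac)
    then have "M' = \<rho> * \<rho> * M" using len_pos(1)[of 0] by simp
    then show ?thesis using spread_pos by (simp add: field_simps)
  qed
  show "\<alpha> 4 = \<beta> 4" if "i0 = 1"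
  proof -
    have "\<rho> * L 4 = L' 4 / \<rho>" using solved that by (intro key) auto
    then have "\<kappa> / 2 * (\<rho> * L 4) = \<kappa> / 2 * (L' 4 / \<rho>)" by simp
    then show ?thesis by (simp add: \<alpha>_def \<beta>_def)
  qed
  show "\<alpha> 2 + \<alpha> 4 = \<beta> 2 + \<beta> 4" if "i0 = 2"
  proof -
    have "\<rho> * (L 2 + L 4) = (L' 2 + L' 4) / \<rho>" using solved that by (intro key) auto
    then have "\<kappa> / 2 * (\<rho> * (L 2 + L 4)) = \<kappa> / 2 * ((L' 2 + L' 4) / \<rho>)" by simp
    then show ?thesis by (simp add: \<alpha>_def \<beta>_def distrib_left add_divide_distrib)
  qed
qed

text \<open>The coordinates are summed along the edges from the mark \<open>1\<close>, backwards to \<open>0\<close> and \<open>4\<close> and forwards to \<open>2\<close> and \<open>3\<close>.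
  The direction of the bottom diagonal links the marks \<open>3\<close> and \<open>4\<close> and yields the coordinate that is not reached directly.\<close>

lemma vertices:
  "X 1 0 = 1" "X 2 0 = 1" "X 3 0 = \<gamma> 4"
  "X 1 2 = 0" "X 2 2 = 0" "X 3 2 = ht"
  "X 1 3 = a" "X 2 3 = 0" "X 3 3 = 0"
  "X 1 4 = 1 - a" "X 2 4 = 1" "X 3 4 = 0"
proof -
  have S: "Suc 0 = 1" "Suc 1 = 2" "Suc 2 = 3" "Suc 3 = 4" "Suc 4 = 5" by simp_all
  note v0 = vertex_step[of 0, unfolded phase phases S] and v1 = vertex_step[of 1, unfolded phase phases S]
    and v2 = vertex_step[of 2, unfolded phase phases S] and v3 = vertex_step[of 3, unfolded phase phases S]
    and v4 = vertex_step[of 4, unfolded phase phases S marks_closed]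
  have d0: "X 1 1 - X 1 0 = 0" "X 2 1 - X 2 0 = \<alpha> 0 - \<beta> 0" "X 3 1 - X 3 0 = \<gamma> 0"
    using v0 by simp_all
  show x0: "X 1 0 = 1" "X 2 0 = 1" "X 3 0 = \<gamma> 4" using d0 start balance by simp_all
  have m: "- (\<alpha> 1 / sqrt 2) - \<beta> 1 / sqrt 2 = - 1" using balance(2) by (simp add: add_divide_distrib)
  have d1: "X 1 2 - X 1 1 = - (\<alpha> 1 / sqrt 2) - \<beta> 1 / sqrt 2" "X 2 2 - X 2 1 = - (\<alpha> 1 / sqrt 2) - \<beta> 1 / sqrt 2" "X 3 2 - X 3 1 = 0"
    using v1 by simp_all
  show x2: "X 1 2 = 0" "X 2 2 = 0" "X 3 2 = ht" using d1 start unfolding m by simp_all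
  have "X 3 3 - X 3 2 = - \<gamma> 2" using v2(3) by simp
  then show x33: "X 3 3 = 0" using x2 balance by simp
  have "X 3 4 - X 3 3 = 0" using v3(3) by simp
  then show "X 3 4 = 0" using x33 by simp
  have d4: "X 1 0 - X 1 4 = \<beta> 4 - \<alpha> 4" "X 2 0 - X 2 4 = 0" using v4 by simp_all
  show x24: "X 2 4 = 1" using d4 x0 by simp
  have "X 1 3 = a \<and> X 2 3 = 0 \<and> X 1 4 = 1 - a"
    using solved
  proof (elim disjE conjE)
    assume i: "i0 = 1" "a = 0" and ph: "arc_phase e 2 = \<i>" "arc_phase e 3 = (- 1 - \<i>) / sqrt 2" "arc_phase e' 2 = - \<i>" "arc_phase e' 3 = (1 - \<i>) / sqrt 2"
    have "X 1 3 - X 1 2 = 0" using v2(1) unfolding ph by simp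
    moreover have "X 1 4 - X 1 3 = \<beta> 3 / sqrt 2 + \<alpha> 3 / sqrt 2" "X 2 4 - X 2 3 = \<alpha> 3 / sqrt 2 + \<beta> 3 / sqrt 2" using v3(1,2) unfolding ph by simp_all
    ultimately show ?thesis using d4 x0 x2 x24 balance_solved(1)[OF i(1)] i(2) by simp
  next
    assume i: "i0 = 2" "a = 1" and ph: "arc_phase e 2 = - 1" "arc_phase e 3 = (1 - \<i>) / sqrt 2" "arc_phase e' 2 = - 1" "arc_phase e' 3 = (- 1 - \<i>) / sqrt 2"
    have "X 1 3 - X 1 2 = - \<beta> 2 + \<alpha> 2" "X 2 3 - X 2 2 = 0" using v2(1,2) unfolding ph by simp_all
    moreover have "X 1 4 - X 1 3 = - (\<beta> 3 / sqrt 2) - \<alpha> 3 / sqrt 2" "X 2 4 - X 2 3 = \<alpha> 3 / sqrt 2 + \<beta> 3 / sqrt 2" using v3(1,2) unfolding ph by simp_all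
    ultimately show ?thesis using d4 x0 x2 x24 balance_solved(2)[OF i(1)] i(2) by simp
  qed
  then show "X 1 3 = a" "X 2 3 = 0" "X 1 4 = 1 - a" by simp_all
qed

definition "vel i t = \<i> * cis t * null_deriv e e' p q i (cis t)"

lemma vel_arc:
  assumes "j < 5" "\<theta> j < t" "t < \<theta> (Suc j)"
  shows "vel i t = vec_of_forms \<kappa> \<rho> (of_real (parc e p q t) * arc_phase e j) (of_real (parc e' p q t) * arc_phase e' j)
      (of_real (parc e_height p q t) * arc_phase e_height j) i"
proof -
  have s: "\<i> * cis t * sc_fun \<nu> \<theta> f (cis t) = of_real (parc f p q t) * arc_phase f j" if "admissible f" for f
  proof -
    interpret sc_data \<nu> \<theta> f by (rule sc_data_pmark[OF that pq])
    show ?thesis using sc_fun_on_arc'[OF assms] unfolding arc_weight_eq .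
  qed
  show ?thesis unfolding vel_def null_deriv_def vec_of_forms_mult s[OF adm(1)] s[OF adm(2)] s[OF admissible_exponents(1)] ..
qed

lemma fm: "five_marks \<theta>"
  using pq by (intro pmark_five_marks) (auto simp: Params_def)

lemma parc_pos:
  assumes "j < 5" "\<theta> j < t" "t < \<theta> (Suc j)"
  shows "parc f p q t > 0"
proof -
  have "\<nu> k > 0" if "k < 5" for k by (rule pscale_pos[OF that])
  then have "arc_weight \<nu> \<theta> f t > 0" by (rule arc_weight_pos[OF fm _ assms])
  then show ?thesis by (simp only: arc_weight_eq)
qed

definition "A t = \<kappa> * \<rho> / 2 * parc e p q t"
definition "B t = \<kappa> / (2 * \<rho>) * parc e' p q t"
definition "H t = \<kappa> * parc e_height p q t"

lemma ABH_pos: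
  assumes "j < 5" "\<theta> j < t" "t < \<theta> (Suc j)"
  shows "A t > 0" "B t > 0" "H t > 0"
  using parc_pos[OF assms] dilation_pos spread_pos by (simp_all add: A_def B_def H_def)

lemma vel_parts:
  assumes "j < 5" "\<theta> j < t" "t < \<theta> (Suc j)"
  shows "Re (vel 1 t) = B t * Re (arc_phase e' j) - A t * Re (arc_phase e j)"
    "Re (vel 2 t) = - (A t * Im (arc_phase e j)) - B t * Im (arc_phase e' j)"
    "Re (vel 3 t) = H t * Re (arc_phase e_height j)"
    "Im (vel 1 t) = B t * Im (arc_phase e' j) - A t * Im (arc_phase e j)"
    "Im (vel 2 t) = A t * Re (arc_phase e j) + B t * Re (arc_phase e' j)"
    "Im (vel 3 t) = H t * Im (arc_phase e_height j)"
  unfolding vel_arc[OF assms] forms_re A_def B_def H_def by (rule refl)+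

lemma null_curve_continuous: "continuous_on (cball 0 1) (null_curve e e' p q i)"
proof -
  have "continuous_on (cball 0 1) (shift f p q)" if "admissible f" for f
  proof -
    interpret sc_data \<nu> \<theta> f by (rule sc_data_pmark[OF that pq])
    show ?thesis unfolding shift_def [abs_def] pprim_def by (intro continuous_intros sc_prim_continuous_on)
  qed
  note c = this[OF adm(1)] this[OF adm(2)] this[OF admissible_exponents(1)]
  show ?thesis unfolding null_curve_def [abs_def] by (intro continuous_on_add continuous_on_const continuous_on_vec_of_forms c)
qed

sublocale box: box_pentagon \<theta> "null_curve e e' p q" "null_deriv e e' p q" ht "\<gamma> 4" a i0 vel
proof unfold_locales
  show "open (slit_plane \<theta>)" by (rule open_slit_plane)
  show "(null_curve e e' p q i has_field_derivative null_deriv e e' p q i z) (at z)" if z: "z \<in> slit_plane \<theta>" for i z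
  proof -
    have "(shift f p q has_field_derivative sc_fun \<nu> \<theta> f z) (at z)" for f
      unfolding shift_def [abs_def] pprim_def using DERIV_diff[OF sc_prim_derivative[OF z] DERIV_const] by simp
    note d = this[of e] this[of e'] this[of e_height]
    have "((\<lambda>w. of_real (vector [1, 1, ht] $ i) + vec_of_forms \<kappa> \<rho> (shift e p q w) (shift e' p q w) (shift e_height p q w) i)
        has_field_derivative 0 + null_deriv e e' p q i z) (at z)"
      unfolding null_deriv_def by (intro DERIV_add DERIV_const vec_of_forms_derivative d)
    then show ?thesis unfolding null_curve_def [abs_def] by simp
  qed
  show "(null_deriv e e' p q 1 z)\<^sup>2 + (null_deriv e e' p q 2 z)\<^sup>2 + (null_deriv e e' p q 3 z)\<^sup>2 = 0" for z
    unfolding null_deriv_def by (rule vec_of_forms_null, use spread_pos in simp, rule sc_fun_mult, rule halves)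
  show "null_deriv e e' p q 3 z \<noteq> 0" for z
    using dilation_pos by (simp add: null_deriv_def vec_of_forms_def sc_fun_nonzero)
  show "five_marks \<theta>" by (rule fm)
  show "continuous_on (cball 0 1) (null_curve e e' p q i)" for i by (rule null_curve_continuous)
  show "i0 = 1 \<and> a = 0 \<or> i0 = 2 \<and> a = 1" using solved by blast
  show "0 < \<gamma> 4" using dilation_pos len_pos(3)[of 4] by (simp add: \<gamma>_def)
  show "Re (vel (wall_axis i0 j) t) = 0" if j: "j = 0 \<or> j = 2 \<or> j = 4" and t: "\<theta> j < t" "t < \<theta> (Suc j)" for j t
  proof -
    have "j < 5" using j by auto
    note v = vel_parts[OF this t]
    show ?thesis using j
    proof (elim disjE)
      assume j: "j = 2"
      show ?thesis using solved unfolding j by (elim disjE conjE) (use v in \<open>simp_all add: j wall_axis_def\<close>)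
    qed (use v phase in \<open>simp_all add: wall_axis_def\<close>)
  qed
  show "Im (vel i t) = 0" if j: "j = 0 \<or> j = 2 \<or> j = 4" and t: "\<theta> j < t" "t < \<theta> (Suc j)" and i: "i \<noteq> wall_axis i0 j" for j t i
  proof -
    have "j < 5" using j by auto
    note v = vel_parts[OF this t]
    have i3: "i = 1 \<or> i = 2 \<or> i = 3" by (rule exhaust_3_cases)
    show ?thesis using j
    proof (elim disjE)
      assume j: "j = 2"
      show ?thesis using solved unfolding j by (elim disjE conjE; use i3 in \<open>elim disjE\<close>; use v i phases in \<open>simp add: j wall_axis_def\<close>)
    next
      assume j: "j = 0" show ?thesis using i3 by (elim disjE; use v i phase phases in \<open>simp add: j wall_axis_def\<close>)
    next
      assume j: "j = 4" show ?thesis using i3 by (elim disjE; use v i phase phases in \<open>simp add: j wall_axis_def\<close>)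
    qed
  qed
  show "0 < Re (vel 3 t)" if j: "j = 0 \<or> j = 4" and t: "\<theta> j < t" "t < \<theta> (Suc j)" for j t
  proof -
    have "j < 5" using j by auto
    then show ?thesis using j vel_parts(3)[OF _ t] ABH_pos(3)[OF _ t] phases by (elim disjE) simp_all
  qed
  show "Re (vel 3 t) < 0" if t: "\<theta> 2 < t" "t < \<theta> 3" for t
    using vel_parts(3)[of 2 t] ABH_pos(3)[of 2 t] t phases by simp
  show "Re (vel 3 t) = 0" if j: "j = 1 \<or> j = 3" and t: "\<theta> j < t" "t < \<theta> (Suc j)" for j t
  proof -
    have "j < 5" using j by auto
    then show ?thesis using j vel_parts(3)[OF _ t] phases by (elim disjE) simp_all
  qed
  have v1: "Re (vel 1 t) = - (B t / sqrt 2) - A t / sqrt 2 \<and> Re (vel 2 t) = - (A t / sqrt 2) - B t / sqrt 2 \<and> 0 < A t \<and> 0 < B t"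
    if t: "\<theta> 1 < t" "t < \<theta> 2" for t
  proof -
    have t': "\<theta> 1 < t" "t < \<theta> (Suc 1)" using t by (simp_all add: numeral_2_eq_2)
    have "(1::nat) < 5" by simp
    then show ?thesis using vel_parts(1,2)[OF _ t'] ABH_pos(1,2)[OF _ t'] unfolding phase by simp
  qed
  show "Re (vel 1 t) = Re (vel 2 t)" if "\<theta> 1 < t" "t < \<theta> 2" for t using v1[OF that] by simp
  show "Re (vel 2 t) < 0" if "\<theta> 1 < t" "t < \<theta> 2" for t
  proof -
    have "A t / sqrt 2 > 0" "B t / sqrt 2 > 0" using v1[OF that] by simp_all
    then show ?thesis using v1[OF that] by linarith
  qed
  have v3: "Re (vel 1 t) = (1 - 2 * a) * (A t / sqrt 2 + B t / sqrt 2) \<and> Re (vel 2 t) = A t / sqrt 2 + B t / sqrt 2 \<and> 0 < A t / sqrt 2 + B t / sqrt 2"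
    if t: "\<theta> 3 < t" "t < \<theta> 4" for t
  proof -
    have t': "\<theta> 3 < t" "t < \<theta> (Suc 3)" using t by simp_all
    have "A t > 0" "B t > 0" using ABH_pos[OF _ t'] by simp_all
    then have "0 < A t / sqrt 2 + B t / sqrt 2" by (simp add: add_pos_pos)
    moreover have "Re (vel 1 t) = (1 - 2 * a) * (A t / sqrt 2 + B t / sqrt 2) \<and> Re (vel 2 t) = A t / sqrt 2 + B t / sqrt 2"
      using solved by (elim disjE conjE) (use vel_parts(1,2)[OF _ t'] in \<open>simp_all add: algebra_simps\<close>)
    ultimately show ?thesis by simp
  qed
  show "Re (vel 1 t) = (1 - 2 * a) * Re (vel 2 t)" if "\<theta> 3 < t" "t < \<theta> 4" for t using v3[OF that] by simp
  show "0 < Re (vel 2 t)" if "\<theta> 3 < t" "t < \<theta> 4" for t using v3[OF that] by simp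
  show "re_vec (null_curve e e' p q) (cis (\<theta> 0)) = vector [1, 1, \<gamma> 4]" "re_vec (null_curve e e' p q) (cis (\<theta> 1)) = vector [1, 1, ht]"
    "re_vec (null_curve e e' p q) (cis (\<theta> 2)) = vector [0, 0, ht]" "re_vec (null_curve e e' p q) (cis (\<theta> 3)) = vector [a, 0, 0]"
    "re_vec (null_curve e e' p q) (cis (\<theta> 4)) = vector [1 - a, 1, 0]"
    unfolding vec_eq_iff forall_3 re_vec_nth X_def[symmetric] vector_3
    by (intro conjI; rule vertices start)+
qed (rule vel_def)

end

section \<open>Recovering the parameters from the surface\<close>

lemma antiderivative_power_limit:
  fixes f w :: "real \<Rightarrow> real"
  assumes "0 < r" "(f \<longlongrightarrow> 0) (at_right 0)"
    and der: "eventually (\<lambda>u. (f has_real_derivative w u) (at u)) (at_right 0)"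
    and lim: "((\<lambda>u. w u * u powr (1 - r)) \<longlongrightarrow> L) (at_right 0)"
  shows "((\<lambda>u. f u / u powr r) \<longlongrightarrow> L / r) (at_right 0)"
proof (rule lhopital_right_0)
  have pos: "eventually (\<lambda>u::real. 0 < u) (at_right 0)" by (rule eventually_at_right_less)
  show "((\<lambda>u. u powr r) \<longlongrightarrow> 0) (at_right 0)"
  proof -
    have "((\<lambda>u::real. u powr r) \<longlongrightarrow> 0 powr r) (at_right 0)"
      by (rule tendsto_powr') (use assms(1) pos in \<open>auto intro!: tendsto_intros elim: eventually_mono\<close>)
    then show ?thesis by simp
  qed
  show "eventually (\<lambda>u. u powr r \<noteq> 0) (at_right 0)" using pos by (rule eventually_mono) simp
  show "eventually (\<lambda>u. r * u powr (r - 1) \<noteq> 0) (at_right 0)" using pos by (rule eventually_mono) (use assms(1) in simp)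
  show "eventually (\<lambda>u. ((\<lambda>u. u powr r) has_real_derivative r * u powr (r - 1)) (at u)) (at_right 0)"
    using pos by (rule eventually_mono) (rule has_real_derivative_powr)
  have "((\<lambda>u. w u * u powr (1 - r) / r) \<longlongrightarrow> L / r) (at_right 0)"
    by (intro tendsto_divide lim tendsto_const) (use assms(1) in simp)
  moreover have "eventually (\<lambda>u. w u * u powr (1 - r) / r = w u / (r * u powr (r - 1))) (at_right 0)"
    using pos
  proof (rule eventually_mono)
    fix u :: real assume "0 < u"
    have "u powr (1 - r) = inverse (u powr (r - 1))" by (metis minus_diff_eq powr_minus)
    then show "w u * u powr (1 - r) / r = w u / (r * u powr (r - 1))" by (simp add: field_simps)
  qed
  ultimately show "((\<lambda>u. w u / (r * u powr (r - 1))) \<longlongrightarrow> L / r) (at_right 0)" by (rule Lim_transform_eventually)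
qed (use assms in auto)

lemma square_ratio_limit:
  fixes f d :: "real \<Rightarrow> real"
  assumes "((\<lambda>u. f u / u powr r) \<longlongrightarrow> F) (at_right 0)" "((\<lambda>u. d u / u powr (2 * r)) \<longlongrightarrow> D) (at_right 0)" "D \<noteq> 0"
  shows "((\<lambda>u. (f u)\<^sup>2 / d u) \<longlongrightarrow> F\<^sup>2 / D) (at_right 0)"
proof -
  have "((\<lambda>u. (f u / u powr r)\<^sup>2 / (d u / u powr (2 * r))) \<longlongrightarrow> F\<^sup>2 / D) (at_right 0)"
    by (intro tendsto_divide tendsto_power assms)
  moreover have "eventually (\<lambda>u. (f u / u powr r)\<^sup>2 / (d u / u powr (2 * r)) = (f u)\<^sup>2 / d u) (at_right 0)"
    using eventually_at_right_less[of "0::real"]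
  proof (rule eventually_mono)
    fix u :: real assume "0 < u"
    have "u powr (2 * r) = (u powr r)\<^sup>2" by (simp add: power2_eq_square flip: powr_add)
    moreover have "u powr r > 0" using \<open>0 < u\<close> by simp
    ultimately show "(f u / u powr r)\<^sup>2 / (d u / u powr (2 * r)) = (f u)\<^sup>2 / d u" by (simp add: power_divide)
  qed
  ultimately show ?thesis by (rule Lim_transform_eventually)
qed

text \<open>A quotient such as \<open>f\<^sup>2 / d\<close> depends on the point of the curve only.  As \<open>d'\<close> is strictly increasing, points of the
  second curve that approach the end in space also approach it in the parameter.\<close>

lemma end_ratio_unique:
  fixes f d f' d' :: "real \<Rightarrow> real"
  assumes T: "0 < T" and d: "(d \<longlongrightarrow> 0) (at_right 0)" "\<And>t. 0 < t \<Longrightarrow> t \<le> T \<Longrightarrow> 0 < d t"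
    and d': "d' 0 = 0" "\<And>s t. 0 \<le> s \<Longrightarrow> s < t \<Longrightarrow> t \<le> T \<Longrightarrow> d' s < d' t"
    and sub: "\<And>t. 0 \<le> t \<Longrightarrow> t \<le> T \<Longrightarrow> \<exists>s. 0 \<le> s \<and> s \<le> T \<and> f' s = f t \<and> d' s = d t"
    and lim: "((\<lambda>t. (f t)\<^sup>2 / d t) \<longlongrightarrow> k) (at_right 0)" "((\<lambda>t. (f' t)\<^sup>2 / d' t) \<longlongrightarrow> k') (at_right 0)"
  shows "k = k'"
proof -
  obtain \<psi> where \<psi>: "\<And>t. 0 \<le> t \<Longrightarrow> t \<le> T \<Longrightarrow> 0 \<le> \<psi> t \<and> \<psi> t \<le> T \<and> f' (\<psi> t) = f t \<and> d' (\<psi> t) = d t"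
    using sub by metis
  have near: "eventually (\<lambda>t::real. 0 < t \<and> t \<le> T) (at_right 0)"
    by (rule eventually_at_rightI[of 0 T]) (use T in auto)
  have "filterlim \<psi> (at_right 0) (at_right 0)"
    unfolding filterlim_at
  proof (intro conjI)
    show "eventually (\<lambda>t. \<psi> t \<in> {0<..} \<and> \<psi> t \<noteq> 0) (at_right 0)"
      using near
    proof (rule eventually_mono)
      fix t :: real assume t: "0 < t \<and> t \<le> T"
      then have "\<psi> t \<noteq> 0" using \<psi>[of t] d(2)[of t] d'(1) by auto
      then show "\<psi> t \<in> {0<..} \<and> \<psi> t \<noteq> 0" using \<psi>[of t] t by auto
    qed
    show "(\<psi> \<longlongrightarrow> 0) (at_right 0)"
    proof (rule order_tendstoI)
      fix a :: real assume "a < 0"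
      show "eventually (\<lambda>t. a < \<psi> t) (at_right 0)"
        using near
      proof (rule eventually_mono)
        fix t :: real assume "0 < t \<and> t \<le> T"
        then show "a < \<psi> t" using \<psi>[of t] \<open>a < 0\<close> by simp
      qed
    next
      fix a :: real assume "0 < a"
      define b where "b = min a T"
      have b: "0 < b" "b \<le> T" "b \<le> a" using \<open>0 < a\<close> T by (simp_all add: b_def)
      have "0 < d' b" using d'(2)[of 0 b] d'(1) b by simp
      then have "eventually (\<lambda>t. d t < d' b) (at_right 0)" using d(1) by (simp add: order_tendstoD)
      with near show "eventually (\<lambda>t. \<psi> t < a) (at_right 0)"
      proof (eventually_elim)
        case (elim t)
        have "\<not> b \<le> \<psi> t"
        proof
          assume "b \<le> \<psi> t"
          then have "d' b \<le> d' (\<psi> t)" using d'(2)[of b "\<psi> t"] b \<psi>[of t] elim by (cases "b = \<psi> t") auto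
          then show False using \<psi>[of t] elim by simp
        qed
        then show ?case using b by simp
      qed
    qed
  qed
  then have "((\<lambda>t. (f' (\<psi> t))\<^sup>2 / d' (\<psi> t)) \<longlongrightarrow> k') (at_right 0)"
    by (rule filterlim_compose[OF lim(2)])
  moreover have "eventually (\<lambda>t. (f' (\<psi> t))\<^sup>2 / d' (\<psi> t) = (f t)\<^sup>2 / d t) (at_right 0)"
    using near by (rule eventually_mono) (use \<psi> in simp)
  ultimately have "((\<lambda>t. (f t)\<^sup>2 / d t) \<longlongrightarrow> k') (at_right 0)" by (rule Lim_transform_eventually)
  then show ?thesis using lim(1) tendsto_unique trivial_limit_at_right_real by blast
qed

lemma sin_half_ratio: "((\<lambda>u::real. sin (u / 2) / u) \<longlongrightarrow> 1 / 2) (at_right 0)"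
proof -
  have "((\<lambda>u. sin (u / 2)) has_real_derivative 1 / 2) (at (0::real))"
    by (auto intro!: derivative_eq_intros)
  then have "((\<lambda>u::real. sin (u / 2) / u) \<longlongrightarrow> 1 / 2) (at 0)" by (simp add: has_field_derivative_iff)
  then show ?thesis by (rule tendsto_mono[rotated]) (simp add: at_le)
qed

text \<open>The coefficient of the leading power of the speed at the mark \<open>1\<close>.\<close>

definition top_factor :: "(nat \<Rightarrow> real) \<Rightarrow> real \<Rightarrow> real \<Rightarrow> real" where
  "top_factor f p q = (sqrt 2 / 2) powr f 0 * (sqrt 2 / 2) powr f 1 * (sqrt 2 / 2 * (1 - q)) powr f 2
     * (sqrt 2 / 2 * (1 - p)) powr f 3 * sqrt 2 powr f 4"

lemma top_factor_pos: "p < 1 \<Longrightarrow> q < 1 \<Longrightarrow> top_factor f p q > 0"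
  by (simp add: top_factor_def)

lemma lin_quarter: "lin x (pi / 2) = sqrt 2 / 2 * (1 - x)"
  by (simp add: lin_def cos_45 sin_45 algebra_simps)

lemma parc_top:
  assumes "p < 1" "q < 1"
  shows "((\<lambda>u. parc f p q (pi / 2 - u) * u powr (- f 1)) \<longlongrightarrow> top_factor f p q) (at_right 0)"
proof -
  have arg: "((\<lambda>u. pi / 2 - u) \<longlongrightarrow> pi / 2) (at_right 0)" by (auto intro!: tendsto_eq_intros)
  have l: "((\<lambda>u. lin x (pi / 2 - u)) \<longlongrightarrow> sqrt 2 / 2 * (1 - x)) (at_right 0)" for x
  proof -
    have "((\<lambda>u. lin x (pi / 2 - u)) \<longlongrightarrow> lin x (pi / 2)) (at_right 0)"
      unfolding lin_def by (intro tendsto_intros arg) simp_all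
    then show ?thesis by (simp only: lin_quarter)
  qed
  have s: "((\<lambda>u. sin ((pi / 2 - u) / 2)) \<longlongrightarrow> sin (pi / 2 / 2)) (at_right 0)" by (intro tendsto_intros arg) simp
  have "((\<lambda>u. sqrt 2 * (sin (u / 2) / u)) \<longlongrightarrow> sqrt 2 * (1 / 2)) (at_right 0)"
    by (intro tendsto_intros sin_half_ratio)
  then have "((\<lambda>u. \<bar>sqrt 2 * (sin (u / 2) / u)\<bar> powr f 1) \<longlongrightarrow> \<bar>sqrt 2 * (1 / 2)\<bar> powr f 1) (at_right 0)"
    by (intro tendsto_powr tendsto_rabs tendsto_const) simp_all
  then have main: "((\<lambda>u. \<bar>sqrt 2 * (sin (u / 2) / u)\<bar> powr f 1) \<longlongrightarrow> (sqrt 2 / 2) powr f 1) (at_right 0)" by simp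
  have "((\<lambda>u. \<bar>sin ((pi / 2 - u) / 2)\<bar> powr f 0 * \<bar>sqrt 2 * (sin (u / 2) / u)\<bar> powr f 1 * \<bar>lin q (pi / 2 - u)\<bar> powr f 2
      * \<bar>lin p (pi / 2 - u)\<bar> powr f 3 * \<bar>lin (- 1) (pi / 2 - u)\<bar> powr f 4) \<longlongrightarrow>
    \<bar>sin (pi / 2 / 2)\<bar> powr f 0 * (sqrt 2 / 2) powr f 1 * \<bar>sqrt 2 / 2 * (1 - q)\<bar> powr f 2 * \<bar>sqrt 2 / 2 * (1 - p)\<bar> powr f 3
      * \<bar>sqrt 2 / 2 * (1 - - 1)\<bar> powr f 4) (at_right 0)"
    by (intro tendsto_mult main tendsto_powr tendsto_rabs l s tendsto_const) (use assms in \<open>simp_all add: sin_45\<close>)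
  moreover have "\<bar>sin (pi / 2 / 2)\<bar> powr f 0 * (sqrt 2 / 2) powr f 1 * \<bar>sqrt 2 / 2 * (1 - q)\<bar> powr f 2 * \<bar>sqrt 2 / 2 * (1 - p)\<bar> powr f 3
      * \<bar>sqrt 2 / 2 * (1 - - 1)\<bar> powr f 4 = top_factor f p q"
    using assms by (simp add: top_factor_def sin_45 abs_mult)
  moreover have "eventually (\<lambda>u. \<bar>sin ((pi / 2 - u) / 2)\<bar> powr f 0 * \<bar>sqrt 2 * (sin (u / 2) / u)\<bar> powr f 1 * \<bar>lin q (pi / 2 - u)\<bar> powr f 2
      * \<bar>lin p (pi / 2 - u)\<bar> powr f 3 * \<bar>lin (- 1) (pi / 2 - u)\<bar> powr f 4 = parc f p q (pi / 2 - u) * u powr (- f 1)) (at_right 0)"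
    using eventually_at_right_less[of "0::real"]
  proof (rule eventually_mono)
    fix u :: real assume u: "0 < u"
    have half: "(pi / 2 - u) / 2 = pi / 4 - u / 2" by (simp add: diff_divide_distrib)
    have l1: "lin 1 (pi / 2 - u) = sqrt 2 * sin (u / 2)"
      unfolding lin_def half cos_diff sin_diff cos_45 sin_45 by (simp add: algebra_simps)
    have "\<bar>sqrt 2 * (sin (u / 2) / u)\<bar> = \<bar>lin 1 (pi / 2 - u)\<bar> / u" using u by (simp add: l1 abs_mult)
    then have "\<bar>sqrt 2 * (sin (u / 2) / u)\<bar> powr f 1 = \<bar>lin 1 (pi / 2 - u)\<bar> powr f 1 * u powr (- f 1)"
      by (simp only: powr_divide powr_minus) (simp only: divide_inverse)
    then show "\<bar>sin ((pi / 2 - u) / 2)\<bar> powr f 0 * \<bar>sqrt 2 * (sin (u / 2) / u)\<bar> powr f 1 * \<bar>lin q (pi / 2 - u)\<bar> powr f 2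
      * \<bar>lin p (pi / 2 - u)\<bar> powr f 3 * \<bar>lin (- 1) (pi / 2 - u)\<bar> powr f 4 = parc f p q (pi / 2 - u) * u powr (- f 1)"
      by (simp only: parc_def mult_ac)
  qed
  ultimately show ?thesis by (simp only:) (rule Lim_transform_eventually)
qed

lemma parc_bottom: "((\<lambda>t. parc f p q t * t powr (- f 0)) \<longlongrightarrow> (1 / 2) powr f 0) (at_right 0)"
proof -
  have l: "((\<lambda>t. lin x t) \<longlongrightarrow> 1) (at_right 0)" for x
  proof -
    have "((\<lambda>t. lin x t) \<longlongrightarrow> lin x 0) (at_right 0)" unfolding lin_def by (intro tendsto_intros) simp_all
    then show ?thesis by (simp add: lin_def)
  qed
  have main: "((\<lambda>u::real. \<bar>sin (u / 2) / u\<bar> powr f 0) \<longlongrightarrow> \<bar>1 / 2\<bar> powr f 0) (at_right 0)"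
    by (intro tendsto_powr tendsto_rabs tendsto_const sin_half_ratio) simp
  have "((\<lambda>u. \<bar>sin (u / 2) / u\<bar> powr f 0 * \<bar>lin 1 u\<bar> powr f 1 * \<bar>lin q u\<bar> powr f 2 * \<bar>lin p u\<bar> powr f 3 * \<bar>lin (- 1) u\<bar> powr f 4)
    \<longlongrightarrow> \<bar>1 / 2\<bar> powr f 0 * \<bar>1\<bar> powr f 1 * \<bar>1\<bar> powr f 2 * \<bar>1\<bar> powr f 3 * \<bar>1\<bar> powr f 4) (at_right 0)"
    by (intro tendsto_mult main tendsto_powr tendsto_rabs l tendsto_const) simp_all
  then have "((\<lambda>u. \<bar>sin (u / 2) / u\<bar> powr f 0 * \<bar>lin 1 u\<bar> powr f 1 * \<bar>lin q u\<bar> powr f 2 * \<bar>lin p u\<bar> powr f 3 * \<bar>lin (- 1) u\<bar> powr f 4)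
    \<longlongrightarrow> (1 / 2) powr f 0) (at_right 0)" by simp
  moreover have "eventually (\<lambda>u. \<bar>sin (u / 2) / u\<bar> powr f 0 * \<bar>lin 1 u\<bar> powr f 1 * \<bar>lin q u\<bar> powr f 2 * \<bar>lin p u\<bar> powr f 3 * \<bar>lin (- 1) u\<bar> powr f 4
     = parc f p q u * u powr (- f 0)) (at_right 0)"
    using eventually_at_right_less[of "0::real"]
  proof (rule eventually_mono)
    fix u :: real assume u: "0 < u"
    have "\<bar>sin (u / 2) / u\<bar> = \<bar>sin (u / 2)\<bar> / u" using u by simp
    then have "\<bar>sin (u / 2) / u\<bar> powr f 0 = \<bar>sin (u / 2)\<bar> powr f 0 * u powr (- f 0)"
      by (simp only: powr_divide powr_minus) (simp only: divide_inverse)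
    then show "\<bar>sin (u / 2) / u\<bar> powr f 0 * \<bar>lin 1 u\<bar> powr f 1 * \<bar>lin q u\<bar> powr f 2 * \<bar>lin p u\<bar> powr f 3 * \<bar>lin (- 1) u\<bar> powr f 4
     = parc f p q u * u powr (- f 0)"
      by (simp only: parc_def mult_ac)
  qed
  ultimately show ?thesis by (rule Lim_transform_eventually)
qed

lemma vanishing_product:
  fixes g :: "real \<Rightarrow> real"
  assumes "((\<lambda>u. g u * u powr a) \<longlongrightarrow> L) (at_right 0)" "a < b"
  shows "((\<lambda>u. g u * u powr b) \<longlongrightarrow> 0) (at_right 0)"
proof -
  have "((\<lambda>u::real. u powr (b - a)) \<longlongrightarrow> 0 powr (b - a)) (at_right 0)"
    by (rule tendsto_powr') (use assms(2) eventually_at_right_less[of "0::real"] in \<open>auto intro!: tendsto_intros elim: eventually_mono\<close>)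
  then have "((\<lambda>u. g u * u powr a * u powr (b - a)) \<longlongrightarrow> L * 0) (at_right 0)" using assms by (intro tendsto_mult) simp_all
  then show ?thesis by (simp add: mult.assoc flip: powr_add)
qed

context solved_pentagon
begin

lemma params: "- 1 < p" "p < q" "q < 1" "p < 1" "- 1 < q"
  using pq by (auto simp: Params_def)

lemma first_marks: "\<theta> 0 = 0" "\<theta> 1 = pi / 2" "\<theta> (Suc 0) = pi / 2"
  by (simp_all add: pmark_def)

lemma edge_velocity:
  assumes "0 < t" "t < pi / 2"
  shows "(box.coord 2 has_real_derivative A t - B t) (at t)" "(box.coord 3 has_real_derivative H t) (at t)"
proof -
  have t: "\<theta> 0 < t" "t < \<theta> (Suc 0)" using assms by (simp_all add: first_marks)
  have z: "(0::nat) < 5" by simp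
  show "(box.coord 2 has_real_derivative A t - B t) (at t)"
    using box.coord_derivative(1)[OF z t, of 2] unfolding vel_parts[OF z t] phase by simp
  show "(box.coord 3 has_real_derivative H t) (at t)"
    using box.coord_derivative(1)[OF z t, of 3] unfolding vel_parts[OF z t] phases by simp
qed

lemma reflected_derivative:
  assumes "0 < u" "u < pi / 2"
  shows "((\<lambda>u. 1 - box.coord 2 (pi / 2 - u)) has_real_derivative A (pi / 2 - u) - B (pi / 2 - u)) (at u)"
    "((\<lambda>u. ht - box.coord 3 (pi / 2 - u)) has_real_derivative H (pi / 2 - u)) (at u)"
proof -
  have t: "0 < pi / 2 - u" "pi / 2 - u < pi / 2" using assms by simp_all
  have d: "((\<lambda>u. pi / 2 - u) has_real_derivative - 1) (at u)" by (auto intro!: derivative_eq_intros)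
  show "((\<lambda>u. 1 - box.coord 2 (pi / 2 - u)) has_real_derivative A (pi / 2 - u) - B (pi / 2 - u)) (at u)"
    using DERIV_diff[OF DERIV_const DERIV_chain2[OF edge_velocity(1)[OF t] d], of 1] by simp
  show "((\<lambda>u. ht - box.coord 3 (pi / 2 - u)) has_real_derivative H (pi / 2 - u)) (at u)"
    using DERIV_diff[OF DERIV_const DERIV_chain2[OF edge_velocity(2)[OF t] d], of ht] by simp
qed

lemma near_zero: "eventually (\<lambda>u::real. 0 < u \<and> u < pi / 2) (at_right 0)"
  by (rule eventually_at_rightI[of 0 "pi / 2"]) (use pi_gt_zero in auto)

lemma coord_limits:
  "((\<lambda>u. box.coord i (pi / 2 - u)) \<longlongrightarrow> box.coord i (pi / 2)) (at_right 0)"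
  "(box.coord i \<longlongrightarrow> box.coord i 0) (at_right 0)"
proof -
  have c: "isCont (box.coord i) t" for t
    using box.coord_continuous[of UNIV i] by (simp add: continuous_on_eq_continuous_at)
  show "((\<lambda>u. box.coord i (pi / 2 - u)) \<longlongrightarrow> box.coord i (pi / 2)) (at_right 0)"
    by (rule isCont_tendsto_compose[OF c]) (auto intro!: tendsto_eq_intros)
  show "(box.coord i \<longlongrightarrow> box.coord i 0) (at_right 0)"
    by (rule isCont_tendsto_compose[OF c]) (auto intro!: tendsto_eq_intros)
qed

lemma end_coords: "box.coord 2 0 = 1" "box.coord 3 0 = \<gamma> 4" "box.coord 2 (pi / 2) = 1" "box.coord 3 (pi / 2) = ht"
  using box.vertex_coords(2,3,5,6) by (simp_all add: first_marks)

text \<open>At the mark \<open>1\<close> the first horizontal form dominates: \<open>1 - x\<^sub>2\<close> vanishes like \<open>u powr (1 / 4)\<close> and the height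
  difference like \<open>u powr (1 / 2)\<close>.\<close>

lemma top_ratio:
  "((\<lambda>u. (1 - box.coord 2 (pi / 2 - u))\<^sup>2 / (ht - box.coord 3 (pi / 2 - u))) \<longlongrightarrow> 2 * \<kappa> * \<rho>\<^sup>2 * (top_factor e p q)\<^sup>2 / top_factor e_height p q) (at_right 0)"
proof -
  have h1: "e_height 1 = - 1 / 2" by (simp add: e_height_def)
  note tp = parc_top[OF params(4) params(3)]
  have a: "((\<lambda>u. \<kappa> * \<rho> / 2 * (parc e p q (pi / 2 - u) * u powr (3 / 4))) \<longlongrightarrow> \<kappa> * \<rho> / 2 * top_factor e p q) (at_right 0)"
    using tp[of e] unfolding end_exponents by (intro tendsto_mult tendsto_const) simp
  have "((\<lambda>u. parc e' p q (pi / 2 - u) * u powr (1 / 4)) \<longlongrightarrow> top_factor e' p q) (at_right 0)"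
    using tp[of e'] unfolding end_exponents by simp
  then have "((\<lambda>u. parc e' p q (pi / 2 - u) * u powr (3 / 4)) \<longlongrightarrow> 0) (at_right 0)" by (rule vanishing_product) simp
  then have b: "((\<lambda>u. \<kappa> / (2 * \<rho>) * (parc e' p q (pi / 2 - u) * u powr (3 / 4))) \<longlongrightarrow> \<kappa> / (2 * \<rho>) * 0) (at_right 0)"
    by (intro tendsto_mult tendsto_const)
  have ab: "((\<lambda>u. (A (pi / 2 - u) - B (pi / 2 - u)) * u powr (1 - 1 / 4)) \<longlongrightarrow> \<kappa> * \<rho> / 2 * top_factor e p q) (at_right 0)"
    using tendsto_diff[OF a b] by (simp add: A_def B_def left_diff_distrib mult.assoc)
  have "((\<lambda>u. (1 - box.coord 2 (pi / 2 - u)) / u powr (1 / 4)) \<longlongrightarrow> \<kappa> * \<rho> / 2 * top_factor e p q / (1 / 4)) (at_right 0)"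
  proof (rule antiderivative_power_limit[OF _ _ _ ab])
    show "((\<lambda>u. 1 - box.coord 2 (pi / 2 - u)) \<longlongrightarrow> 0) (at_right 0)"
      using tendsto_diff[OF tendsto_const coord_limits(1)[of 2], of 1] by (simp add: end_coords)
    show "\<forall>\<^sub>F u in at_right 0. ((\<lambda>u. 1 - box.coord 2 (pi / 2 - u)) has_real_derivative A (pi / 2 - u) - B (pi / 2 - u)) (at u)"
      using near_zero by (rule eventually_mono) (use reflected_derivative(1) in blast)
  qed simp
  then have f: "((\<lambda>u. (1 - box.coord 2 (pi / 2 - u)) / u powr (1 / 4)) \<longlongrightarrow> 2 * \<kappa> * \<rho> * top_factor e p q) (at_right 0)" by (simp add: mult_ac)
  have "((\<lambda>u. \<kappa> * (parc e_height p q (pi / 2 - u) * u powr (1 - 1 / 2))) \<longlongrightarrow> \<kappa> * top_factor e_height p q) (at_right 0)"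
    using tp[of e_height] unfolding h1 by (intro tendsto_mult tendsto_const) simp
  then have hh: "((\<lambda>u. H (pi / 2 - u) * u powr (1 - 1 / 2)) \<longlongrightarrow> \<kappa> * top_factor e_height p q) (at_right 0)"
    by (simp add: H_def mult.assoc)
  have "((\<lambda>u. (ht - box.coord 3 (pi / 2 - u)) / u powr (1 / 2)) \<longlongrightarrow> \<kappa> * top_factor e_height p q / (1 / 2)) (at_right 0)"
  proof (rule antiderivative_power_limit[OF _ _ _ hh])
    show "((\<lambda>u. ht - box.coord 3 (pi / 2 - u)) \<longlongrightarrow> 0) (at_right 0)"
      using tendsto_diff[OF tendsto_const coord_limits(1)[of 3], of ht] by (simp add: end_coords)
    show "\<forall>\<^sub>F u in at_right 0. ((\<lambda>u. ht - box.coord 3 (pi / 2 - u)) has_real_derivative H (pi / 2 - u)) (at u)"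
      using near_zero by (rule eventually_mono) (use reflected_derivative(2) in blast)
  qed simp
  then have g: "((\<lambda>u. (ht - box.coord 3 (pi / 2 - u)) / u powr (2 * (1 / 4))) \<longlongrightarrow> 2 * \<kappa> * top_factor e_height p q) (at_right 0)" by (simp add: mult_ac)
  have T0: "top_factor e_height p q > 0" by (rule top_factor_pos) (use params in simp_all)
  have "((\<lambda>u. (1 - box.coord 2 (pi / 2 - u))\<^sup>2 / (ht - box.coord 3 (pi / 2 - u))) \<longlongrightarrow>
     (2 * \<kappa> * \<rho> * top_factor e p q)\<^sup>2 / (2 * \<kappa> * top_factor e_height p q)) (at_right 0)"
    by (rule square_ratio_limit[OF f g]) (use T0 dilation_pos in simp)
  also have "(2 * \<kappa> * \<rho> * top_factor e p q)\<^sup>2 / (2 * \<kappa> * top_factor e_height p q) = 2 * \<kappa> * \<rho>\<^sup>2 * (top_factor e p q)\<^sup>2 / top_factor e_height p q"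
    using T0 dilation_pos by (simp add: power2_eq_square field_simps)
  finally show ?thesis .
qed

text \<open>At the mark \<open>0\<close> the second horizontal form dominates.  The spread enters inversely to \<open>top_ratio\<close>, so that it cancels
  from the product of the two limits.\<close>

lemma bottom_ratio:
  "((\<lambda>t. (1 - box.coord 2 t)\<^sup>2 / (box.coord 3 t - \<gamma> 4)) \<longlongrightarrow> 2 * \<kappa> / \<rho>\<^sup>2) (at_right 0)"
proof -
  have h0: "e_height 0 = 0" by (simp add: e_height_def)
  have b: "((\<lambda>u. \<kappa> / (2 * \<rho>) * (parc e' p q u * u powr (1 / 2))) \<longlongrightarrow> \<kappa> / (2 * \<rho>) * (1 / 2) powr (- 1 / 2)) (at_right 0)"
    using parc_bottom[of e' p q] unfolding end_exponents by (intro tendsto_mult tendsto_const) simp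
  have "((\<lambda>u. parc e p q u * u powr (- 1 / 2)) \<longlongrightarrow> (1 / 2) powr (1 / 2)) (at_right 0)"
    using parc_bottom[of e p q] unfolding end_exponents by simp
  then have "((\<lambda>u. parc e p q u * u powr (1 / 2)) \<longlongrightarrow> 0) (at_right 0)" by (rule vanishing_product) simp
  then have a: "((\<lambda>u. \<kappa> * \<rho> / 2 * (parc e p q u * u powr (1 / 2))) \<longlongrightarrow> \<kappa> * \<rho> / 2 * 0) (at_right 0)"
    by (intro tendsto_mult tendsto_const)
  have r: "(1 / 2 :: real) powr (- 1 / 2) = sqrt 2"
  proof -
    have "(1 / 2 :: real) powr (- 1 / 2) = (1 / 2) powr (- (1 / 2))" by simp
    also have "\<dots> = inverse (sqrt (1 / 2))" unfolding powr_minus by (simp add: powr_half_sqrt)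
    also have "\<dots> = sqrt 2" by (simp add: real_sqrt_divide)
    finally show ?thesis .
  qed
  have ab: "((\<lambda>u. (B u - A u) * u powr (1 - 1 / 2)) \<longlongrightarrow> \<kappa> / (2 * \<rho>) * sqrt 2) (at_right 0)"
    using tendsto_diff[OF b a] unfolding r by (simp add: A_def B_def left_diff_distrib mult.assoc)
  have "((\<lambda>u. (1 - box.coord 2 u) / u powr (1 / 2)) \<longlongrightarrow> \<kappa> / (2 * \<rho>) * sqrt 2 / (1 / 2)) (at_right 0)"
  proof (rule antiderivative_power_limit[OF _ _ _ ab])
    show "((\<lambda>u. 1 - box.coord 2 u) \<longlongrightarrow> 0) (at_right 0)"
      using tendsto_diff[OF tendsto_const coord_limits(2)[of 2], of 1] by (simp add: end_coords)
    show "\<forall>\<^sub>F u in at_right 0. ((\<lambda>u. 1 - box.coord 2 u) has_real_derivative B u - A u) (at u)"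
      using near_zero
    proof (rule eventually_mono)
      fix u :: real assume "0 < u \<and> u < pi / 2"
      then show "((\<lambda>u. 1 - box.coord 2 u) has_real_derivative B u - A u) (at u)"
        using DERIV_diff[OF DERIV_const edge_velocity(1)[of u], of 1] by simp
    qed
  qed simp
  then have f: "((\<lambda>u. (1 - box.coord 2 u) / u powr (1 / 2)) \<longlongrightarrow> \<kappa> / \<rho> * sqrt 2) (at_right 0)" by simp
  have "((\<lambda>u. parc e_height p q u * u powr (1 - 1)) \<longlongrightarrow> 1) (at_right 0)"
    using parc_bottom[of e_height p q] unfolding h0 by simp
  from tendsto_mult[OF tendsto_const[of \<kappa>] this]
  have hh: "((\<lambda>u. H u * u powr (1 - 1)) \<longlongrightarrow> \<kappa>) (at_right 0)"
    unfolding H_def mult.assoc mult_1_right .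
  have "((\<lambda>u. (box.coord 3 u - \<gamma> 4) / u powr 1) \<longlongrightarrow> \<kappa> / 1) (at_right 0)"
  proof (rule antiderivative_power_limit[OF _ _ _ hh])
    show "((\<lambda>u. box.coord 3 u - \<gamma> 4) \<longlongrightarrow> 0) (at_right 0)"
      using tendsto_diff[OF coord_limits(2)[of 3] tendsto_const, of "\<gamma> 4"] by (simp add: end_coords)
    show "\<forall>\<^sub>F u in at_right 0. ((\<lambda>u. box.coord 3 u - \<gamma> 4) has_real_derivative H u) (at u)"
      using near_zero
    proof (rule eventually_mono)
      fix u :: real assume "0 < u \<and> u < pi / 2"
      then show "((\<lambda>u. box.coord 3 u - \<gamma> 4) has_real_derivative H u) (at u)"
        using DERIV_diff[OF edge_velocity(2)[of u] DERIV_const, of "\<gamma> 4"] by simp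
    qed
  qed simp
  then have g: "((\<lambda>u. (box.coord 3 u - \<gamma> 4) / u powr (2 * (1 / 2))) \<longlongrightarrow> \<kappa>) (at_right 0)" by simp
  have "((\<lambda>t. (1 - box.coord 2 t)\<^sup>2 / (box.coord 3 t - \<gamma> 4)) \<longlongrightarrow> (\<kappa> / \<rho> * sqrt 2)\<^sup>2 / \<kappa>) (at_right 0)"
    by (rule square_ratio_limit[OF f g]) (use dilation_pos in simp)
  also have "(\<kappa> / \<rho> * sqrt 2)\<^sup>2 / \<kappa> = 2 * \<kappa> / \<rho>\<^sup>2"
    using dilation_pos spread_pos by (simp add: power_mult_distrib power_divide) (simp add: power2_eq_square)
  finally show ?thesis .
qed


lemma front: "re_vec (null_curve e e' p q) ` cball 0 1 \<inter> {x. x $ 1 = 1 \<and> x $ 3 > 0} = (\<lambda>t. re_vec (null_curve e e' p q) (cis t)) ` {0..pi / 2}"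
  using box.front_wall by (simp add: first_marks)

lemma front_rise: "0 \<le> s \<Longrightarrow> s < t \<Longrightarrow> t \<le> pi / 2 \<Longrightarrow> box.coord 3 s < box.coord 3 t"
  using box.rise_B[of s t] by (simp add: first_marks)

end

text \<open>The part of the product of the two end ratios that depends on the marks.\<close>

definition defect :: "(nat \<Rightarrow> real) \<Rightarrow> real \<Rightarrow> real \<Rightarrow> real" where
  "defect e p q = (1 - q) powr (2 * e 2 + 1 / 2) * (1 - p) powr (2 * e 3 + 1 / 2)"

lemma defect_pos: "p < 1 \<Longrightarrow> q < 1 \<Longrightarrow> defect e p q > 0"
  by (simp add: defect_def)

lemma top_factor_defect:
  obtains C where "C > 0" "\<And>p q. p < 1 \<Longrightarrow> q < 1 \<Longrightarrow> (top_factor e p q)\<^sup>2 / top_factor e_height p q = C * defect e p q"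
proof -
  define s where "s = sqrt 2 / 2"
  have s: "s > 0" by (simp add: s_def)
  define C0 where "C0 = (s powr e 0 * s powr e 1 * sqrt 2 powr e 4)\<^sup>2 / (s powr (- 1 / 2) * sqrt 2 powr (- 1 / 2))"
  define C where "C = C0 * s powr (2 * e 2 + 1 / 2) * s powr (2 * e 3 + 1 / 2)"
  have "C > 0" using s by (simp add: C_def C0_def)
  moreover have "(top_factor e p q)\<^sup>2 / top_factor e_height p q = C * defect e p q" if "p < 1" "q < 1" for p q
  proof -
    have sq: "(x powr a)\<^sup>2 / x powr (- 1 / 2) = x powr (2 * a + 1 / 2)" if "x > 0" for x a :: real
      using that by (simp add: power2_eq_square flip: powr_add powr_diff)
    have x: "s * (1 - q) > 0" "s * (1 - p) > 0" using s that by simp_all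
    have e0: "e_height 0 = 0" "e_height 1 = - 1 / 2" "e_height 2 = - 1 / 2" "e_height 3 = - 1 / 2" "e_height 4 = - 1 / 2"
      by (simp_all add: e_height_def)
    have "(top_factor e p q)\<^sup>2 / top_factor e_height p q =
      C0 * (((s * (1 - q)) powr e 2)\<^sup>2 / (s * (1 - q)) powr (- 1 / 2)) * (((s * (1 - p)) powr e 3)\<^sup>2 / (s * (1 - p)) powr (- 1 / 2))"
      unfolding top_factor_def e0 s_def[symmetric] C0_def power_mult_distrib using s by (simp add: mult_ac)
    also have "\<dots> = C0 * (s * (1 - q)) powr (2 * e 2 + 1 / 2) * (s * (1 - p)) powr (2 * e 3 + 1 / 2)"
      unfolding sq[OF x(1)] sq[OF x(2)] ..
    also have "\<dots> = C * defect e p q"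
      unfolding powr_mult C_def defect_def by (simp only: mult_ac)
    finally show ?thesis .
  qed
  ultimately show thesis by (rule that)
qed

text \<open>The ends of the front edge determine the height of the box and the height at the mark \<open>0\<close>, which are the two
  height lengths times the dilation; the product of the two end ratios determines the third quantity.\<close>

lemma congruent_data:
  assumes S: "solved_pentagon e e' p q a i0" "solved_pentagon e e' p2 q2 a i0"
    and eq: "re_vec (null_curve e e' p q) ` cball 0 1 = re_vec (null_curve e e' p2 q2) ` cball 0 1"
  shows "dilation e e' p q * edge_len e_height 0 p q = dilation e e' p2 q2 * edge_len e_height 0 p2 q2"
    "dilation e e' p q * edge_len e_height 4 p q = dilation e e' p2 q2 * edge_len e_height 4 p2 q2"
    "(dilation e e' p q)\<^sup>2 * defect e p q = (dilation e e' p2 q2)\<^sup>2 * defect e p2 q2"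
proof -
  interpret a: solved_pentagon e e' p q a i0 by (rule S(1))
  interpret b: solved_pentagon e e' p2 q2 a i0 by (rule S(2))
  have front: "(\<lambda>t. re_vec (null_curve e e' p q) (cis t)) ` {0..pi / 2} = (\<lambda>t. re_vec (null_curve e e' p2 q2) (cis t)) ` {0..pi / 2}"
    unfolding a.front[symmetric] b.front[symmetric] eq ..
  have ab: "\<exists>s. 0 \<le> s \<and> s \<le> pi / 2 \<and> (\<forall>i. b.box.coord i s = a.box.coord i t)" if t: "0 \<le> t" "t \<le> pi / 2" for t
  proof -
    have "re_vec (null_curve e e' p q) (cis t) \<in> (\<lambda>t. re_vec (null_curve e e' p2 q2) (cis t)) ` {0..pi / 2}"
      unfolding front[symmetric] using t by (intro imageI) simp
    then obtain s where s: "s \<in> {0..pi / 2}" "re_vec (null_curve e e' p q) (cis t) = re_vec (null_curve e e' p2 q2) (cis s)" by blast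
    have "b.box.coord i s = a.box.coord i t" for i
      unfolding a.box.re_vec_coord[symmetric] b.box.re_vec_coord[symmetric] s(2) ..
    then show ?thesis using s(1) by auto
  qed
  have ba: "\<exists>s. 0 \<le> s \<and> s \<le> pi / 2 \<and> (\<forall>i. a.box.coord i s = b.box.coord i t)" if t: "0 \<le> t" "t \<le> pi / 2" for t
  proof -
    have "re_vec (null_curve e e' p2 q2) (cis t) \<in> (\<lambda>t. re_vec (null_curve e e' p q) (cis t)) ` {0..pi / 2}"
      unfolding front using t by (intro imageI) simp
    then obtain s where s: "s \<in> {0..pi / 2}" "re_vec (null_curve e e' p2 q2) (cis t) = re_vec (null_curve e e' p q) (cis s)" by blast
    have "a.box.coord i s = b.box.coord i t" for i
      unfolding a.box.re_vec_coord[symmetric] b.box.re_vec_coord[symmetric] s(2) ..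
    then show ?thesis using s(1) by auto
  qed
  have pi0: "0 \<le> pi / 2" "0 < pi / 2" using pi_gt_zero by simp_all
  have bounds: "a.\<gamma> 4 \<le> a.box.coord 3 t \<and> a.box.coord 3 t \<le> a.ht" "b.\<gamma> 4 \<le> b.box.coord 3 t \<and> b.box.coord 3 t \<le> b.ht"
    if "0 \<le> t" "t \<le> pi / 2" for t
    using a.box.height_B[of t] b.box.height_B[of t] that by (simp_all add: a.first_marks b.first_marks)
  have c: "a.\<gamma> 4 = b.\<gamma> 4"
  proof (rule antisym)
    obtain s where "0 \<le> s" "s \<le> pi / 2" "a.box.coord 3 s = b.box.coord 3 0" using ba[OF order_refl pi0(1)] by blast
    then show "a.\<gamma> 4 \<le> b.\<gamma> 4" using bounds(1)[of s] by (simp add: b.end_coords)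
    obtain s where "0 \<le> s" "s \<le> pi / 2" "b.box.coord 3 s = a.box.coord 3 0" using ab[OF order_refl pi0(1)] by blast
    then show "b.\<gamma> 4 \<le> a.\<gamma> 4" using bounds(2)[of s] by (simp add: a.end_coords)
  qed
  have h: "a.ht = b.ht"
  proof (rule antisym)
    obtain s where "0 \<le> s" "s \<le> pi / 2" "b.box.coord 3 s = a.box.coord 3 (pi / 2)" using ab[OF pi0(1) order_refl] by blast
    then show "a.ht \<le> b.ht" using bounds(2)[of s] by (simp add: a.end_coords)
    obtain s where "0 \<le> s" "s \<le> pi / 2" "a.box.coord 3 s = b.box.coord 3 (pi / 2)" using ba[OF pi0(1) order_refl] by blast
    then show "b.ht \<le> a.ht" using bounds(1)[of s] by (simp add: b.end_coords)
  qed
  show "dilation e e' p q * edge_len e_height 4 p q = dilation e e' p2 q2 * edge_len e_height 4 p2 q2"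
    using c unfolding a.\<gamma>_def b.\<gamma>_def .
  then show "dilation e e' p q * edge_len e_height 0 p q = dilation e e' p2 q2 * edge_len e_height 0 p2 q2"
    using h by (simp add: box_height_def distrib_left)
  have top: "2 * a.\<kappa> * a.\<rho>\<^sup>2 * (top_factor e p q)\<^sup>2 / top_factor e_height p q = 2 * b.\<kappa> * b.\<rho>\<^sup>2 * (top_factor e p2 q2)\<^sup>2 / top_factor e_height p2 q2"
  proof (rule end_ratio_unique[OF pi0(2) _ _ _ _ _ a.top_ratio b.top_ratio])
    show "((\<lambda>u. a.ht - a.box.coord 3 (pi / 2 - u)) \<longlongrightarrow> 0) (at_right 0)"
      using tendsto_diff[OF tendsto_const a.coord_limits(1)[of 3], of a.ht] by (simp add: a.end_coords)
    show "0 < a.ht - a.box.coord 3 (pi / 2 - t)" if "0 < t" "t \<le> pi / 2" for t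
      using a.front_rise[of "pi / 2 - t" "pi / 2"] that by (simp add: a.end_coords)
    show "b.ht - b.box.coord 3 (pi / 2 - 0) = 0" by (simp add: b.end_coords)
    show "b.ht - b.box.coord 3 (pi / 2 - s) < b.ht - b.box.coord 3 (pi / 2 - t)" if "0 \<le> s" "s < t" "t \<le> pi / 2" for s t
      using b.front_rise[of "pi / 2 - t" "pi / 2 - s"] that by simp
    show "\<exists>s. 0 \<le> s \<and> s \<le> pi / 2 \<and> 1 - b.box.coord 2 (pi / 2 - s) = 1 - a.box.coord 2 (pi / 2 - t) \<and> b.ht - b.box.coord 3 (pi / 2 - s) = a.ht - a.box.coord 3 (pi / 2 - t)"
      if t: "0 \<le> t" "t \<le> pi / 2" for t
    proof -
      obtain s where s: "0 \<le> s" "s \<le> pi / 2" "\<forall>i. b.box.coord i s = a.box.coord i (pi / 2 - t)" using ab[of "pi / 2 - t"] t by auto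
      have "pi / 2 - (pi / 2 - s) = s" by simp
      then show ?thesis using s h by (intro exI[of _ "pi / 2 - s"]) simp
    qed
  qed
  have bottom: "2 * a.\<kappa> / a.\<rho>\<^sup>2 = 2 * b.\<kappa> / b.\<rho>\<^sup>2"
  proof (rule end_ratio_unique[OF pi0(2) _ _ _ _ _ a.bottom_ratio b.bottom_ratio])
    show "((\<lambda>u. a.box.coord 3 u - a.\<gamma> 4) \<longlongrightarrow> 0) (at_right 0)"
      using tendsto_diff[OF a.coord_limits(2)[of 3] tendsto_const, of "a.\<gamma> 4"] by (simp add: a.end_coords)
    show "0 < a.box.coord 3 t - a.\<gamma> 4" if "0 < t" "t \<le> pi / 2" for t
      using a.front_rise[of 0 t] that by (simp add: a.end_coords)
    show "b.box.coord 3 0 - b.\<gamma> 4 = 0" by (simp add: b.end_coords)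
    show "b.box.coord 3 s - b.\<gamma> 4 < b.box.coord 3 t - b.\<gamma> 4" if "0 \<le> s" "s < t" "t \<le> pi / 2" for s t
      using b.front_rise[of s t] that by simp
    show "\<exists>s. 0 \<le> s \<and> s \<le> pi / 2 \<and> 1 - b.box.coord 2 s = 1 - a.box.coord 2 t \<and> b.box.coord 3 s - b.\<gamma> 4 = a.box.coord 3 t - a.\<gamma> 4"
      if t: "0 \<le> t" "t \<le> pi / 2" for t
      using ab[OF t] c by auto
  qed
  obtain C where C: "C > 0" "\<And>p q. p < 1 \<Longrightarrow> q < 1 \<Longrightarrow> (top_factor e p q)\<^sup>2 / top_factor e_height p q = C * defect e p q"
    using top_factor_defect by blast
  note Ca = C(2)[OF a.params(4,3)] and Cb = C(2)[OF b.params(4,3)]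
  have "2 * a.\<kappa> * a.\<rho>\<^sup>2 * (C * defect e p q) = 2 * b.\<kappa> * b.\<rho>\<^sup>2 * (C * defect e p2 q2)"
    using top unfolding Ca[symmetric] Cb[symmetric] by simp
  then have t: "a.\<kappa> * a.\<rho>\<^sup>2 * defect e p q = b.\<kappa> * b.\<rho>\<^sup>2 * defect e p2 q2" using C(1) by simp
  have ra: "a.\<rho>\<^sup>2 > 0" "b.\<rho>\<^sup>2 > 0" using a.spread_pos b.spread_pos by simp_all
  have bt: "a.\<kappa> / a.\<rho>\<^sup>2 = b.\<kappa> / b.\<rho>\<^sup>2" using bottom by simp
  have "a.\<kappa>\<^sup>2 * defect e p q = (a.\<kappa> * a.\<rho>\<^sup>2 * defect e p q) * (a.\<kappa> / a.\<rho>\<^sup>2)" using a.spread_pos by (simp add: power2_eq_square)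
  also have "\<dots> = (b.\<kappa> * b.\<rho>\<^sup>2 * defect e p2 q2) * (b.\<kappa> / b.\<rho>\<^sup>2)" by (simp only: t bt)
  also have "\<dots> = b.\<kappa>\<^sup>2 * defect e p2 q2" using b.spread_pos by (simp add: power2_eq_square)
  finally show "(dilation e e' p q)\<^sup>2 * defect e p q = (dilation e e' p2 q2)\<^sup>2 * defect e p2 q2" .
qed

text \<open>In the variable \<open>x = tan (t / 2)\<close> this is, up to a common factor, \<open>D\<close> times the reciprocal square of the factors of the
  height form that depend on \<open>p\<close> and \<open>q\<close>.\<close>

definition quad :: "real \<Rightarrow> real \<Rightarrow> real \<Rightarrow> real \<Rightarrow> real" where
  "quad D p q x = D * ((1 - p * x) * (1 - q * x))"

lemma lin_tan:
  assumes "0 < t" "t < pi / 2"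
  shows "lin x t = cos (t / 2) * (1 - x * tan (t / 2))" "0 < tan (t / 2)" "tan (t / 2) < 1" "0 < cos (t / 2)"
proof -
  note b = half_angle_bounds[OF assms]
  show c: "0 < cos (t / 2)" using b by linarith
  show "lin x t = cos (t / 2) * (1 - x * tan (t / 2))" using c by (simp add: lin_def tan_def algebra_simps)
  show "0 < tan (t / 2)" "tan (t / 2) < 1" using b c by (simp_all add: tan_def)
qed

lemma height_compare:
  assumes pq: "p < 1" "q < 1" "p' < 1" "q' < 1" and D: "0 < D" "0 < D'"
    and less: "\<And>x. 0 < x \<Longrightarrow> x < 1 \<Longrightarrow> quad D' p' q' x < quad D p q x"
  shows "J 0 (- 1 / 2) (- 1 / 2) (- 1 / 2) (- 1 / 2) q p / sqrt D < J 0 (- 1 / 2) (- 1 / 2) (- 1 / 2) (- 1 / 2) q' p' / sqrt D'"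
proof -
  let ?w = "\<lambda>q p. wt 0 (- 1 / 2) (- 1 / 2) (- 1 / 2) (- 1 / 2) q p"
  have "integral {0..pi / 2} (\<lambda>t. ?w q p t / sqrt D) < integral {0..pi / 2} (\<lambda>t. ?w q' p' t / sqrt D')"
  proof (rule integral_open_strict_mono)
    show "(\<lambda>t. ?w q p t / sqrt D) integrable_on {0..pi / 2}" "(\<lambda>t. ?w q' p' t / sqrt D') integrable_on {0..pi / 2}"
      using pq by (intro integrable_on_divide wt_integrable; simp)+
    show "continuous_on {0<..<pi / 2} (\<lambda>t. ?w q p t / sqrt D)" "continuous_on {0<..<pi / 2} (\<lambda>t. ?w q' p' t / sqrt D')"
      using pq D by (intro continuous_on_divide wt_continuous continuous_on_const; simp)+
    fix t assume "t \<in> {0<..<pi / 2}"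
    then have t: "0 < t" "t < pi / 2" by auto
    have l: "lin q t > 0" "lin p t > 0" "lin q' t > 0" "lin p' t > 0" "lin 1 t > 0" "lin (- 1) t > 0" using pq by (simp_all add: lin_pos[OF t])
    have form: "?w q p t / sqrt D = (lin 1 t * lin (- 1) t * (D * (lin q t * lin p t))) powr (- 1 / 2)" if "lin q t > 0" "lin p t > 0" "0 < D" for q p D
    proof -
      have "D powr (- 1 / 2) = D powr (- (1 / 2))" by simp
      also have "\<dots> = inverse (sqrt D)" unfolding powr_minus using that by (simp add: powr_half_sqrt)
      finally have d: "D powr (- 1 / 2) = inverse (sqrt D)" .
      have s0: "sin (t / 2) powr 0 = 1" using half_angle_bounds(1)[OF t] by simp
      show ?thesis unfolding wt_def powr_mult d s0 divide_inverse[of _ "sqrt D"] by (simp only: mult_1_left mult_ac)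
    qed
    have qd: "D * (lin q t * lin p t) = (cos (t / 2))\<^sup>2 * quad D p q (tan (t / 2))" for D p q
      unfolding lin_tan(1)[OF t] quad_def by (simp add: power2_eq_square mult_ac)
    have "D' * (lin q' t * lin p' t) < D * (lin q t * lin p t)"
      unfolding qd using less[OF lin_tan(2,3)[OF t]] lin_tan(4)[OF t] by simp
    then have "lin 1 t * lin (- 1) t * (D' * (lin q' t * lin p' t)) < lin 1 t * lin (- 1) t * (D * (lin q t * lin p t))"
      using l by simp
    then show "?w q p t / sqrt D < ?w q' p' t / sqrt D'"
      unfolding form[OF l(1,2) D(1)] form[OF l(3,4) D(2)] using l D by (intro powr_less_mono2_neg) simp_all
  qed (use pi_gt_zero in simp)
  then show ?thesis unfolding J_def by (simp only: integral_divide)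
qed

text \<open>If one quadratic were larger on all of \<open>(0, 1)\<close>, its height integral would be strictly smaller.\<close>

lemma crossing:
  assumes pq: "p < 1" "q < 1" "p' < 1" "q' < 1" and D: "0 < D" "0 < D'"
    and eq: "J 0 (- 1 / 2) (- 1 / 2) (- 1 / 2) (- 1 / 2) q p / sqrt D = J 0 (- 1 / 2) (- 1 / 2) (- 1 / 2) (- 1 / 2) q' p' / sqrt D'"
  obtains x where "0 < x" "x < 1" "quad D p q x = quad D' p' q' x"
proof -
  define R where "R x = quad D p q x - quad D' p' q' x" for x
  have c: "continuous_on S R" for S unfolding R_def quad_def by (intro continuous_intros)
  obtain x where x: "0 < x" "x < 1" "0 \<le> R x"
  proof (rule ccontr)
    assume "\<not> thesis"
    then have "quad D p q x < quad D' p' q' x" if "0 < x" "x < 1" for x using that \<open>\<And>x. 0 < x \<Longrightarrow> x < 1 \<Longrightarrow> 0 \<le> R x \<Longrightarrow> thesis\<close> by (force simp: R_def)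
    from height_compare[OF pq(3,4,1,2) D(2,1) this] eq show False by simp
  qed
  obtain y where y: "0 < y" "y < 1" "R y \<le> 0"
  proof (rule ccontr)
    assume "\<not> thesis"
    then have "quad D' p' q' x < quad D p q x" if "0 < x" "x < 1" for x using that \<open>\<And>x. 0 < x \<Longrightarrow> x < 1 \<Longrightarrow> R x \<le> 0 \<Longrightarrow> thesis\<close> by (force simp: R_def)
    from height_compare[OF pq D this] eq show False by simp
  qed
  have "\<exists>z. 0 < z \<and> z < 1 \<and> R z = 0"
  proof (cases "x \<le> y")
    case True
    then obtain z where "x \<le> z" "z \<le> y" "R z = 0" using IVT2'[OF y(3) x(3) True c] by blast
    then show ?thesis using x y by (intro exI[of _ z]) simp
  next
    case False
    then have "y \<le> x" by simp
    then obtain z where "y \<le> z" "z \<le> x" "R z = 0" using IVT'[OF y(3) x(3) _ c] by blast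
    then show ?thesis using x y by (intro exI[of _ z]) simp
  qed
  then show thesis using that by (auto simp: R_def)
qed

text \<open>Eliminating the dilation from \<open>congruent_data\<close> leaves two equal normalized height integrals, one for the edge \<open>0\<close> and one
  for the edge \<open>4\<close>.  The latter is the former with negated parameters.\<close>

lemma congruent_crossings:
  assumes S: "solved_pentagon e e' p q a i0" "solved_pentagon e e' p' q' a i0"
    and eq: "re_vec (null_curve e e' p q) ` cball 0 1 = re_vec (null_curve e e' p' q') ` cball 0 1"
  obtains r s where "0 < r" "r < 1" "quad (defect e p q) p q r = quad (defect e p' q') p' q' r"
    "0 < s" "s < 1" "quad (defect e p q) p q (- s) = quad (defect e p' q') p' q' (- s)"
proof -
  interpret a: solved_pentagon e e' p q a i0 by (rule S(1))
  interpret b: solved_pentagon e e' p' q' a i0 by (rule S(2))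
  note pa = a.params and pb = b.params
  let ?D = "defect e p q" let ?D' = "defect e p' q'"
  have D: "?D > 0" "?D' > 0" using pa pb by (simp_all add: defect_pos)
  have "sqrt (a.\<kappa>\<^sup>2 * ?D) = sqrt (b.\<kappa>\<^sup>2 * ?D')" using congruent_data(3)[OF S eq] by simp
  then have k: "a.\<kappa> * sqrt ?D = b.\<kappa> * sqrt ?D'" using a.dilation_pos b.dilation_pos by (simp add: real_sqrt_mult)
  have div: "l / sqrt ?D = l' / sqrt ?D'" if l: "a.\<kappa> * l = b.\<kappa> * l'" for l l'
  proof -
    have "a.\<kappa> * (l * sqrt ?D') * b.\<kappa> = (a.\<kappa> * l) * (b.\<kappa> * sqrt ?D')" by (simp only: mult_ac)
    also have "\<dots> = (b.\<kappa> * l') * (a.\<kappa> * sqrt ?D)" by (simp only: l k)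
    also have "\<dots> = a.\<kappa> * (l' * sqrt ?D) * b.\<kappa>" by (simp only: mult_ac)
    finally have "l * sqrt ?D' = l' * sqrt ?D" using a.dilation_pos b.dilation_pos by simp
    then show ?thesis using D by (simp add: field_simps)
  qed
  have e0: "e_height 0 = 0" "e_height 1 = - 1 / 2" "e_height 2 = - 1 / 2" "e_height 3 = - 1 / 2" "e_height 4 = - 1 / 2"
    by (simp_all add: e_height_def)
  note u = div[OF congruent_data(1)[OF S eq], unfolded edge_len_0[OF pa(4,3)] edge_len_0[OF pb(4,3)] e0]
  note l = div[OF congruent_data(2)[OF S eq], unfolded edge_len_4[OF pa(1,5)] edge_len_4[OF pb(1,5)] e0]
  obtain r where r: "0 < r" "r < 1" "quad ?D p q r = quad ?D' p' q' r"
    by (rule crossing[OF pa(4,3) pb(4,3) D u])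
  have neg: "- p < 1" "- q < 1" "- p' < 1" "- q' < 1" using pa pb by simp_all
  obtain s where s: "0 < s" "s < 1" "quad ?D (- p) (- q) s = quad ?D' (- p') (- q') s"
    by (rule crossing[OF neg D l])
  from s(3) have "quad ?D p q (- s) = quad ?D' p' q' (- s)" by (simp add: quad_def)
  with r s(1,2) show thesis by (rule that)
qed

section \<open>The two families\<close>

lemma solved_pentagon_ss:
  assumes "(p, q) \<in> Params" "edge_len e_ss1 0 p q * edge_len e_ss2 4 p q = edge_len e_ss2 0 p q * edge_len e_ss1 4 p q"
  shows "solved_pentagon e_ss1 e_ss2 p q 0 1"
proof
  show "e_ss1 k + e_ss2 k = 2 * e_height k" if "k < 5" for k
    using that unfolding less_5_cases by (elim disjE) (simp_all add: e_ss1_def e_ss2_def e_height_def)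
  show "e_ss1 0 = 1 / 2" "e_ss1 1 = - 3 / 4" "e_ss2 0 = - 1 / 2" "e_ss2 1 = - 1 / 4"
    by (simp_all add: e_ss1_def e_ss2_def)
  show "1 = (1::3) \<and> 0 = (0::real) \<and> arc_phase e_ss1 2 = \<i> \<and> arc_phase e_ss1 3 = (- 1 - \<i>) / sqrt 2 \<and> arc_phase e_ss2 2 = - \<i> \<and> arc_phase e_ss2 3 = (1 - \<i>) / sqrt 2
         \<and> edge_len e_ss1 0 p q * edge_len e_ss2 4 p q = edge_len e_ss2 0 p q * edge_len e_ss1 4 p q
       \<or> 1 = (2::3) \<and> 0 = (1::real) \<and> arc_phase e_ss1 2 = - 1 \<and> arc_phase e_ss1 3 = (1 - \<i>) / sqrt 2 \<and> arc_phase e_ss2 2 = - 1 \<and> arc_phase e_ss2 3 = (- 1 - \<i>) / sqrt 2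
         \<and> edge_len e_ss1 0 p q * (edge_len e_ss2 2 p q + edge_len e_ss2 4 p q) = edge_len e_ss2 0 p q * (edge_len e_ss1 2 p q + edge_len e_ss1 4 p q)"
    using assms(2) by (intro disjI1 conjI phases refl)
qed (rule assms(1) admissible_exponents phases)+

lemma solved_pentagon_cs:
  assumes "(p, q) \<in> Params"
    "edge_len e_cs1 0 p q * (edge_len e_cs2 2 p q + edge_len e_cs2 4 p q) = edge_len e_cs2 0 p q * (edge_len e_cs1 2 p q + edge_len e_cs1 4 p q)"
  shows "solved_pentagon e_cs1 e_cs2 p q 1 2"
proof
  show "e_cs1 k + e_cs2 k = 2 * e_height k" if "k < 5" for k
    using that unfolding less_5_cases by (elim disjE) (simp_all add: e_cs1_def e_cs2_def e_height_def)
  show "e_cs1 0 = 1 / 2" "e_cs1 1 = - 3 / 4" "e_cs2 0 = - 1 / 2" "e_cs2 1 = - 1 / 4"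
    by (simp_all add: e_cs1_def e_cs2_def)
  show "2 = (1::3) \<and> 1 = (0::real) \<and> arc_phase e_cs1 2 = \<i> \<and> arc_phase e_cs1 3 = (- 1 - \<i>) / sqrt 2 \<and> arc_phase e_cs2 2 = - \<i> \<and> arc_phase e_cs2 3 = (1 - \<i>) / sqrt 2
         \<and> edge_len e_cs1 0 p q * edge_len e_cs2 4 p q = edge_len e_cs2 0 p q * edge_len e_cs1 4 p q
       \<or> 2 = (2::3) \<and> 1 = (1::real) \<and> arc_phase e_cs1 2 = - 1 \<and> arc_phase e_cs1 3 = (1 - \<i>) / sqrt 2 \<and> arc_phase e_cs2 2 = - 1 \<and> arc_phase e_cs2 3 = (- 1 - \<i>) / sqrt 2
         \<and> edge_len e_cs1 0 p q * (edge_len e_cs2 2 p q + edge_len e_cs2 4 p q) = edge_len e_cs2 0 p q * (edge_len e_cs1 2 p q + edge_len e_cs1 4 p q)"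
    using assms(2) by (intro disjI2 conjI phases refl)
qed (rule assms(1) admissible_exponents phases)+

lemma quad_difference:
  "quad D p q x - quad D' p' q' x = (D * (p * q) - D' * (p' * q')) * x\<^sup>2 - (D * (p + q) - D' * (p' + q')) * x + (D - D')"
  by (simp add: quad_def power2_eq_square algebra_simps)

text \<open>Here both quadratics take the value \<open>1\<close> at \<open>1\<close>.  Together with the two crossings they agree at three points, hence
  identically.\<close>

lemma cs_distinct:
  assumes S: "solved_pentagon e_cs1 e_cs2 p q 1 2" "solved_pentagon e_cs1 e_cs2 p' q' 1 2"
    and eq: "re_vec (null_curve e_cs1 e_cs2 p q) ` cball 0 1 = re_vec (null_curve e_cs1 e_cs2 p' q') ` cball 0 1"
  shows "p = p'"
proof -
  note pa = solved_pentagon.params[OF S(1)] and pb = solved_pentagon.params[OF S(2)]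
  define D where "D = defect e_cs1 p q"
  define D' where "D' = defect e_cs1 p' q'"
  have one: "defect e_cs1 p q * ((1 - p) * (1 - q)) = 1" if "p < 1" "q < 1" for p q
    using that by (simp add: defect_def e_cs1_def powr_minus_divide)
  define \<alpha> where "\<alpha> = D * (p * q) - D' * (p' * q')"
  define \<beta> where "\<beta> = D * (p + q) - D' * (p' + q')"
  define \<delta> where "\<delta> = D - D'"
  note qd = quad_difference[of D p q _ D' p' q', folded \<alpha>_def \<beta>_def \<delta>_def]
  obtain r s where r: "0 < r" "quad D p q r = quad D' p' q' r" and s: "0 < s" "quad D p q (- s) = quad D' p' q' (- s)" and rs: "r < 1"
    using congruent_crossings[OF S eq, folded D_def D'_def] by metis
  have q1: "quad D p q 1 = quad D' p' q' 1"
    using one[OF pa(4,3)] one[OF pb(4,3)] by (simp add: quad_def D_def D'_def)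
  have e1: "\<alpha> - \<beta> + \<delta> = 0" using qd[of 1] q1 by simp
  have er: "\<alpha> * r\<^sup>2 - \<beta> * r + \<delta> = 0" using qd[of r] r by simp
  have es: "\<alpha> * s\<^sup>2 + \<beta> * s + \<delta> = 0" using qd[of "- s"] s by simp
  have "(1 - r) * (\<alpha> * (1 + r) - \<beta>) = (\<alpha> - \<beta> + \<delta>) - (\<alpha> * r\<^sup>2 - \<beta> * r + \<delta>)" by (simp add: power2_eq_square algebra_simps)
  then have 1: "\<alpha> * (1 + r) = \<beta>" using e1 er rs by simp
  have "(1 + s) * (\<alpha> * (1 - s) - \<beta>) = (\<alpha> - \<beta> + \<delta>) - (\<alpha> * s\<^sup>2 + \<beta> * s + \<delta>)" by (simp add: power2_eq_square algebra_simps)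
  then have 2: "\<alpha> * (1 - s) = \<beta>" using e1 es s(1) by simp
  have "\<alpha> * (r + s) = 0" using 1 2 by (simp add: algebra_simps)
  then have \<alpha>: "\<alpha> = 0" using r(1) s(1) by simp
  have \<beta>: "\<beta> = 0" using 1 \<alpha> by simp
  have \<delta>: "D = D'" using e1 \<alpha> \<beta> by (simp add: \<delta>_def)
  have "D > 0" unfolding D_def using pa by (simp add: defect_pos)
  then have pq: "p * q = p' * q'" "p + q = p' + q'" using \<alpha> \<beta> \<delta> by (simp_all add: \<alpha>_def \<beta>_def flip: right_diff_distrib)
  have "(p - p') * (p - q') = p * p - p * (p' + q') + p' * q'" by (simp add: algebra_simps)
  also have "\<dots> = 0" unfolding pq[symmetric] by (simp add: algebra_simps)
  finally have "p = p' \<or> p = q'" by simp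
  then show ?thesis using pq(2) pa(2) pb(2) by auto
qed

text \<open>The difference of the quadratics has one root in \<open>(0, 1)\<close> and one in \<open>(- 1, 0)\<close>, so its values at \<open>0\<close> and \<open>1\<close> have opposite
  signs.  As they are \<open>1 / (1 - p) - 1 / (1 - p')\<close> and \<open>q' - q\<close>, both parameters move in the same direction.  Then one height
  length increases and the other decreases, although their quotient is fixed.\<close>

lemma ss_not_congruent:
  assumes S: "solved_pentagon e_ss1 e_ss2 p q 0 1" "solved_pentagon e_ss1 e_ss2 p' q' 0 1"
    and eq: "re_vec (null_curve e_ss1 e_ss2 p q) ` cball 0 1 = re_vec (null_curve e_ss1 e_ss2 p' q') ` cball 0 1"
  shows "\<not> q < q'"
proof
  assume qq: "q < q'"
  interpret a: solved_pentagon e_ss1 e_ss2 p q 0 1 by (rule S(1))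
  interpret b: solved_pentagon e_ss1 e_ss2 p' q' 0 1 by (rule S(2))
  note pa = a.params and pb = b.params
  define D where "D = defect e_ss1 p q"
  define D' where "D' = defect e_ss1 p' q'"
  have one: "defect e_ss1 p q = 1 / (1 - p)" if "p < 1" "q < 1" for p q
    using that by (simp add: defect_def e_ss1_def powr_minus_divide)
  define \<alpha> where "\<alpha> = D * (p * q) - D' * (p' * q')"
  define \<beta> where "\<beta> = D * (p + q) - D' * (p' + q')"
  define \<delta> where "\<delta> = D - D'"
  note qd = quad_difference[of D p q _ D' p' q', folded \<alpha>_def \<beta>_def \<delta>_def]
  obtain r s where r: "0 < r" "quad D p q r = quad D' p' q' r" and s: "0 < s" "quad D p q (- s) = quad D' p' q' (- s)" and rs: "r < 1"
    using congruent_crossings[OF S eq, folded D_def D'_def] by metis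
  have "quad D p q 1 = 1 - q" "quad D' p' q' 1 = 1 - q'"
    using one[OF pa(4,3)] one[OF pb(4,3)] pa pb by (simp_all add: quad_def D_def D'_def)
  then have e1: "\<alpha> - \<beta> + \<delta> > 0" using qd[of 1] qq by simp
  have er: "\<alpha> * r\<^sup>2 - \<beta> * r + \<delta> = 0" using qd[of r] r by simp
  have es: "\<alpha> * s\<^sup>2 + \<beta> * s + \<delta> = 0" using qd[of "- s"] s by simp
  have "(r + s) * (\<alpha> * (r - s) - \<beta>) = (\<alpha> * r\<^sup>2 - \<beta> * r + \<delta>) - (\<alpha> * s\<^sup>2 + \<beta> * s + \<delta>)" by (simp add: power2_eq_square algebra_simps)
  then have \<beta>: "\<beta> = \<alpha> * (r - s)" using er es r(1) s(1) by simp
  have \<delta>: "\<delta> = - (\<alpha> * (r * s))" using er unfolding \<beta> by (simp add: power2_eq_square algebra_simps)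
  have "\<alpha> - \<beta> + \<delta> = \<alpha> * ((1 - r) * (1 + s))" unfolding \<beta> \<delta> by (simp add: algebra_simps)
  then have "\<alpha> * ((1 - r) * (1 + s)) > 0" using e1 by simp
  moreover have "(1 - r) * (1 + s) > 0" using rs s(1) by simp
  ultimately have "\<alpha> > 0" by (simp add: zero_less_mult_iff)
  then have "\<delta> < 0" unfolding \<delta> using r(1) s(1) by simp
  then have "1 / (1 - p) < 1 / (1 - p')" using one[OF pa(4,3)] one[OF pb(4,3)] by (simp add: \<delta>_def D_def D'_def)
  then have pp: "p < p'" using pa pb by (simp add: divide_simps split: if_splits)
  have e0: "e_height 0 = 0" "e_height 1 = - 1 / 2" "e_height 2 = - 1 / 2" "e_height 3 = - 1 / 2" "e_height 4 = - 1 / 2"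
    by (simp_all add: e_height_def)
  have mono: "quad 1 u' v' x < quad 1 u v x" if "u < u'" "v < v'" "u' < 1" "v' < 1" "0 < x" "x < 1" for u v u' v' x
  proof -
    have "u' * x < 1 * x" "v' * x < 1 * x" using that by (intro mult_strict_right_mono; simp)+
    then have "u' * x < 1" "v' * x < 1" using that(6) by linarith+
    moreover have "u * x < u' * x" "v * x < v' * x" using that by simp_all
    ultimately have "(1 - u' * x) * (1 - v' * x) < (1 - u * x) * (1 - v * x)" by (intro mult_strict_mono') simp_all
    then show ?thesis by (simp add: quad_def)
  qed
  \<comment> \<open>growing parameters decrease both factors of the height form under the exponent \<open>- 1 / 2\<close>\<close>
  have up: "edge_len e_height 0 p q < edge_len e_height 0 p' q'"
    unfolding edge_len_0[OF pa(4,3)] edge_len_0[OF pb(4,3)] e0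
    using height_compare[of p q p' q' 1 1] mono[OF pp qq pb(4,3)] pa pb by simp
  have down: "edge_len e_height 4 p' q' < edge_len e_height 4 p q"
    unfolding edge_len_4[OF pa(1,5)] edge_len_4[OF pb(1,5)] e0
    using height_compare[of "- p'" "- q'" "- p" "- q" 1 1] mono[of "- p'" "- p" "- q'" "- q"] pp qq pa pb by simp
  have "b.\<kappa> < a.\<kappa>"
  proof (rule ccontr)
    assume "\<not> b.\<kappa> < a.\<kappa>"
    then have "a.\<kappa> * edge_len e_height 0 p q \<le> b.\<kappa> * edge_len e_height 0 p q" using a.len_pos(3)[of 0] by (intro mult_right_mono) simp_all
    also have "\<dots> < b.\<kappa> * edge_len e_height 0 p' q'" using up b.dilation_pos by simp
    finally show False using congruent_data(1)[OF S eq] by simp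
  qed
  then have "b.\<kappa> * edge_len e_height 4 p' q' < a.\<kappa> * edge_len e_height 4 p' q'" using b.len_pos(3)[of 4] by simp
  also have "\<dots> < a.\<kappa> * edge_len e_height 4 p q" using down a.dilation_pos by simp
  finally show False using congruent_data(2)[OF S eq] by simp
qed

section \<open>Continuity\<close>

lemma edge_len_nonzero: "admissible e \<Longrightarrow> j < 5 \<Longrightarrow> x \<in> Params \<Longrightarrow> edge_len e j (fst x) (snd x) > 0"
  by (rule edge_len_pos) simp_all

lemma spread_positive: "admissible e \<Longrightarrow> admissible e' \<Longrightarrow> x \<in> Params \<Longrightarrow> spread e e' (fst x) (snd x) > 0"
  using edge_len_nonzero[of e 0 x] edge_len_nonzero[of e' 0 x] by (simp add: spread_def)

lemma spread_continuous:
  assumes "admissible e" "admissible e'"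
  shows "continuous_on Params (\<lambda>x. spread e e' (fst x) (snd x))"
  unfolding spread_def
proof (intro continuous_intros edge_len_continuous assms ballI)
  show "edge_len e 0 (fst x) (snd x) \<noteq> 0" if "x \<in> Params" for x using edge_len_nonzero[OF assms(1) _ that, of 0] by simp
qed simp_all

lemma dilation_continuous:
  assumes "admissible e" "admissible e'"
  shows "continuous_on Params (\<lambda>x. dilation e e' (fst x) (snd x))"
  unfolding dilation_def
proof (intro continuous_intros edge_len_continuous spread_continuous assms ballI)
  fix x assume x: "x \<in> Params"
  have s: "spread e e' (fst x) (snd x) > 0" by (rule spread_positive[OF assms x])
  then show "spread e e' (fst x) (snd x) \<noteq> 0" by simp
  have "spread e e' (fst x) (snd x) * edge_len e 1 (fst x) (snd x) + edge_len e' 1 (fst x) (snd x) / spread e e' (fst x) (snd x) > 0"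
    using s edge_len_nonzero[OF assms(1) _ x, of 1] edge_len_nonzero[OF assms(2) _ x, of 1]
    by (intro add_pos_pos mult_pos_pos divide_pos_pos) simp_all
  then show "spread e e' (fst x) (snd x) * edge_len e 1 (fst x) (snd x) + edge_len e' 1 (fst x) (snd x) / spread e e' (fst x) (snd x) \<noteq> 0" by simp
qed simp_all

lemma box_height_continuous:
  assumes "admissible e" "admissible e'"
  shows "continuous_on Params (\<lambda>x. box_height e e' (fst x) (snd x))"
  unfolding box_height_def by (intro continuous_intros dilation_continuous edge_len_continuous assms admissible_exponents) simp_all

lemma shift_continuous:
  assumes "admissible f"
  shows "continuous_on (Params \<times> cball 0 1) (\<lambda>y. shift f (fst (fst y)) (snd (fst y)) (snd y))"
proof -
  have c: "continuous_on (Params \<times> cball 0 1) (\<lambda>y. pprim f (fst (fst y)) (snd (fst y)) (g y))"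
    if g: "continuous_on (Params \<times> cball 0 1) g" "\<And>y. y \<in> Params \<times> cball 0 1 \<Longrightarrow> g y \<in> cball 0 1" for g :: "(real \<times> real) \<times> complex \<Rightarrow> complex"
  proof -
    have "continuous_on (Params \<times> cball 0 1) (\<lambda>y. (\<lambda>((p, q), z). pprim f p q z) (fst y, g y))"
    proof (rule continuous_on_compose2[OF pprim_continuous[OF assms]])
      show "continuous_on (Params \<times> cball 0 1) (\<lambda>y. (fst y, g y))" by (intro continuous_intros g(1))
      show "(\<lambda>y. (fst y, g y)) ` (Params \<times> cball 0 1) \<subseteq> Params \<times> cball 0 1" using g(2) by auto
    qed
    then show ?thesis by (simp add: case_prod_beta)
  qed
  have "continuous_on (Params \<times> cball 0 1) (\<lambda>y. pprim f (fst (fst y)) (snd (fst y)) (snd y))"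
    by (rule c) (auto intro: continuous_intros)
  moreover have "continuous_on (Params \<times> cball (0::complex) 1) (\<lambda>y. pprim f (fst (fst y)) (snd (fst y)) (cis (pi / 2)))"
    by (rule c[of "\<lambda>_. cis (pi / 2)"]) (auto intro: continuous_intros)
  ultimately show ?thesis unfolding shift_def by (rule continuous_on_diff)
qed

lemma null_curve_jointly_continuous:
  assumes "admissible e" "admissible e'"
  shows "continuous_on (Params \<times> cball 0 1) (\<lambda>y. null_curve e e' (fst (fst y)) (snd (fst y)) i (snd y))"
proof -
  have lift: "continuous_on (Params \<times> cball (0::complex) 1) (\<lambda>y. g (fst y))" if "continuous_on Params g" for g :: "real \<times> real \<Rightarrow> real"
    by (rule continuous_on_compose2[OF that]) (auto intro: continuous_intros)
  define \<kappa> where "\<kappa> y = dilation e e' (fst (fst y)) (snd (fst y))" for y :: "(real \<times> real) \<times> complex"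
  define \<rho> where "\<rho> y = spread e e' (fst (fst y)) (snd (fst y))" for y :: "(real \<times> real) \<times> complex"
  define h where "h y = box_height e e' (fst (fst y)) (snd (fst y))" for y :: "(real \<times> real) \<times> complex"
  define f where "f y = shift e (fst (fst y)) (snd (fst y)) (snd y)" for y
  define f' where "f' y = shift e' (fst (fst y)) (snd (fst y)) (snd y)" for y
  define g where "g y = shift e_height (fst (fst y)) (snd (fst y)) (snd y)" for y
  let ?S = "Params \<times> cball (0::complex) 1"
  have k: "continuous_on ?S \<kappa>" unfolding \<kappa>_def by (rule lift[OF dilation_continuous[OF assms]])
  have r: "continuous_on ?S \<rho>" unfolding \<rho>_def by (rule lift[OF spread_continuous[OF assms]])
  have h: "continuous_on ?S h" unfolding h_def by (rule lift[OF box_height_continuous[OF assms]])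
  have f: "continuous_on ?S f" "continuous_on ?S f'" "continuous_on ?S g"
    unfolding f_def f'_def g_def by (intro shift_continuous assms admissible_exponents)+
  have r0: "\<forall>y\<in>?S. 2 * \<rho> y \<noteq> 0"
  proof
    fix y assume "y \<in> ?S"
    then have "\<rho> y > 0" unfolding \<rho>_def by (intro spread_positive assms) auto
    then show "2 * \<rho> y \<noteq> 0" by simp
  qed
  have c: "continuous_on ?S (\<lambda>y. complex_of_real (\<kappa> y / (2 * \<rho> y)))" "continuous_on ?S (\<lambda>y. complex_of_real (\<kappa> y * \<rho> y / 2))"
    "continuous_on ?S (\<lambda>y. complex_of_real (\<kappa> y))"
    using r0 by (intro continuous_on_of_real continuous_on_divide continuous_on_mult continuous_on_const k r; simp)+
  have "continuous_on ?S (\<lambda>y. vec_of_forms (\<kappa> y) (\<rho> y) (f y) (f' y) (g y) i)"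
  proof -
    have "continuous_on ?S (\<lambda>y. complex_of_real (\<kappa> y / (2 * \<rho> y)) * f' y - complex_of_real (\<kappa> y * \<rho> y / 2) * f y)"
      "continuous_on ?S (\<lambda>y. \<i> * (complex_of_real (\<kappa> y * \<rho> y / 2) * f y + complex_of_real (\<kappa> y / (2 * \<rho> y)) * f' y))"
      "continuous_on ?S (\<lambda>y. complex_of_real (\<kappa> y) * g y)"
      by (intro continuous_on_diff continuous_on_add continuous_on_mult continuous_on_const c f)+
    note d = this
    show ?thesis
      using exhaust_3_cases[of i] unfolding vec_of_forms_def
      by (elim disjE) (simp_all only: refl distinct_3 if_True if_False not_False_eq_True d)
  qed
  moreover have "continuous_on ?S (\<lambda>y. complex_of_real (vector [1, 1, h y] $ i))"
  proof -
    have v: "vector [1, 1, a] $ i = (if i = 3 then a else 1)" for a :: real using exhaust_3_cases[of i] by (auto simp: vector_3)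
    show ?thesis unfolding v by (cases "i = 3") (simp_all add: continuous_on_of_real h)
  qed
  ultimately show ?thesis
    unfolding null_curve_def \<kappa>_def \<rho>_def h_def f_def f'_def g_def by (rule continuous_on_add[rotated])
qed

text \<open>Everything in the construction is an explicit continuous function of the marks, so a curve of
  solved period problems is a continuous family of pentagons.\<close>

lemma solved_family:
  fixes p q :: "real \<Rightarrow> real" and lo hi :: real
  assumes I: "lo < hi" and c: "continuous_on {lo<..<hi} p" "continuous_on {lo<..<hi} q"
    and S: "\<And>t. t \<in> {lo<..<hi} \<Longrightarrow> solved_pentagon e e' (p t) (q t) a i0"
    and type: "\<And>h X \<theta>. pentagon_in_box h X \<theta> (vector [1, 1, h]) (vector [0, 0, h]) (vector [a, 0, 0]) (vector [1 - a, 1, 0]) \<Longrightarrow> T h X \<theta>"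
    and distinct: "\<And>t t'. t \<in> {lo<..<hi} \<Longrightarrow> t' \<in> {lo<..<hi} \<Longrightarrow>
       re_vec (null_curve e e' (p t) (q t)) ` cball 0 1 = re_vec (null_curve e e' (p t') (q t')) ` cball 0 1 \<Longrightarrow> t = t'"
  shows "one_parameter_family T"
  unfolding one_parameter_family_def
proof (intro exI conjI)
  let ?I = "{lo<..<hi}"
  have "(lo + hi) / 2 \<in> ?I" using I by simp
  from S[OF this] have adm: "admissible e" "admissible e'" by (rule solved_pentagon.adm)+
  have par: "(\<lambda>t. (p t, q t)) ` ?I \<subseteq> Params" using solved_pentagon.pq[OF S] by blast
  have cpq: "continuous_on ?I (\<lambda>t. (p t, q t))" by (intro continuous_intros c)
  show "is_interval ?I" "open ?I" by (simp_all add: is_interval_oo)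
  show "?I \<noteq> {}" using I by simp
  show "\<forall>t\<in>?I. T (box_height e e' (p t) (q t)) (re_vec (null_curve e e' (p t) (q t))) (pmark (p t) (q t))"
  proof
    fix t assume t: "t \<in> ?I"
    interpret solved_pentagon e e' "p t" "q t" a i0 by (rule S[OF t])
    show "T (box_height e e' (p t) (q t)) (re_vec (null_curve e e' (p t) (q t))) (pmark (p t) (q t))"
      by (rule type[OF box.pentagon_in_box])
  qed
  show "continuous_on ?I (\<lambda>t. box_height e e' (p t) (q t))"
    using continuous_on_compose2[OF box_height_continuous[OF adm] cpq par] by simp
  show "\<forall>k<5. continuous_on ?I (\<lambda>t. pmark (p t) (q t) k)"
    using continuous_on_compose2[OF pmark_continuous[of UNIV] cpq subset_UNIV] by simp
  show "continuous_on (?I \<times> cball 0 1) (\<lambda>(t, z). re_vec (null_curve e e' (p t) (q t)) z)"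
  proof -
    have "continuous_on (?I \<times> cball 0 1) (\<lambda>y. null_curve e e' (p (fst y)) (q (fst y)) i (snd y))" for i
    proof -
      have pr: "continuous_on (?I \<times> cball (0::complex) 1) (\<lambda>y. ((p (fst y), q (fst y)), snd y))"
        by (intro continuous_intros continuous_on_compose2[OF c(1)] continuous_on_compose2[OF c(2)]) auto
      have sub: "(\<lambda>y. ((p (fst y), q (fst y)), snd y)) ` (?I \<times> cball 0 1) \<subseteq> Params \<times> cball 0 1" using par by auto
      show ?thesis using continuous_on_compose2[OF null_curve_jointly_continuous[OF adm] pr sub] by simp
    qed
    then show ?thesis unfolding re_vec_def case_prod_beta by (intro continuous_on_vec_lambda continuous_on_Re)
  qed
  show "inj_on (\<lambda>t. re_vec (null_curve e e' (p t) (q t)) ` cball 0 1) ?I"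
    using distinct by (intro inj_onI)
qed

theorem theorem1p2:
  shows "one_parameter_family pentagon_SS \<and> one_parameter_family pentagon_CS"
proof
  obtain P where P: "continuous_on {0<..<1} P" "\<And>q. q \<in> {0<..<1} \<Longrightarrow> (P q, q) \<in> Params"
    "\<And>q. q \<in> {0<..<1} \<Longrightarrow> edge_len e_ss1 0 (P q) q * edge_len e_ss2 4 (P q) q = edge_len e_ss2 0 (P q) q * edge_len e_ss1 4 (P q) q"
    using ss_solution by blast
  show "one_parameter_family pentagon_SS"
  proof (rule solved_family[OF _ P(1) continuous_on_id])
    show S: "solved_pentagon e_ss1 e_ss2 (P t) t 0 1" if "t \<in> {0<..<1}" for t
      by (rule solved_pentagon_ss[OF P(2,3)[OF that]])
    show "pentagon_SS h X \<theta>" if "pentagon_in_box h X \<theta> (vector [1, 1, h]) (vector [0, 0, h]) (vector [0, 0, 0]) (vector [1 - 0, 1, 0])" for h X \<theta>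
      unfolding pentagon_SS_def
    proof (intro exI conjI)
      show "vector [0, 0, h] - vector [1, 1, h] = (- 1) *\<^sub>R (vector [1 - 0, 1, 0] - vector [0, 0, 0] :: real^3)"
        by (simp add: vec_eq_iff forall_3 vector_3)
    qed (rule that)
    show "t = t'" if t: "t \<in> {0<..<1}" "t' \<in> {0<..<1}"
      and eq: "re_vec (null_curve e_ss1 e_ss2 (P t) t) ` cball 0 1 = re_vec (null_curve e_ss1 e_ss2 (P t') t') ` cball 0 1" for t t'
      using ss_not_congruent[OF S[OF t(1)] S[OF t(2)] eq] ss_not_congruent[OF S[OF t(2)] S[OF t(1)] eq[symmetric]] by simp
  qed simp
  obtain Q where Q: "continuous_on {1 / 2<..<1} Q" "\<And>p. p \<in> {1 / 2<..<1} \<Longrightarrow> (p, Q p) \<in> Params"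
    "\<And>p. p \<in> {1 / 2<..<1} \<Longrightarrow> edge_len e_cs1 0 p (Q p) * (edge_len e_cs2 2 p (Q p) + edge_len e_cs2 4 p (Q p))
      = edge_len e_cs2 0 p (Q p) * (edge_len e_cs1 2 p (Q p) + edge_len e_cs1 4 p (Q p))"
    using cs_solution by blast
  show "one_parameter_family pentagon_CS"
  proof (rule solved_family[OF _ continuous_on_id Q(1)])
    show S: "solved_pentagon e_cs1 e_cs2 t (Q t) 1 2" if "t \<in> {1 / 2<..<1}" for t
      by (rule solved_pentagon_cs[OF Q(2,3)[OF that]])
    show "pentagon_CS h X \<theta>" if "pentagon_in_box h X \<theta> (vector [1, 1, h]) (vector [0, 0, h]) (vector [1, 0, 0]) (vector [1 - 1, 1, 0])" for h X \<theta>
      unfolding pentagon_CS_def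
    proof (intro exI conjI)
      show "orthogonal (vector [0, 0, h] - vector [1, 1, h]) (vector [1 - 1, 1, 0] - vector [1, 0, 0] :: real^3)"
        by (simp add: orthogonal_def inner_vec_def sum_3 vector_3)
    qed (rule that)
    show "t = t'" if t: "t \<in> {1 / 2<..<1}" "t' \<in> {1 / 2<..<1}"
      and eq: "re_vec (null_curve e_cs1 e_cs2 t (Q t)) ` cball 0 1 = re_vec (null_curve e_cs1 e_cs2 t' (Q t')) ` cball 0 1" for t t'
      by (rule cs_distinct[OF S[OF t(1)] S[OF t(2)] eq])
  qed simp
qed

end
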